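(* Let $f=R_jh$, $h\in L^p(\mathbb R^n)$. If $1\le p<n/(j+k)$, then $$f=c^{-1}R_j\,\mathbb D_n^{j+k}R_k^*\,\mathcal R_{j,k}f,\qquad c=\frac{2^{j+k}\pi^{(j+k)/2}\,\Gamma(n/2)}{\Gamma((n-j-k)/2)}.$$ More generally, if $0<\alpha<n-j-k$ and $1\le p<n/(j+k+\alpha)$, then $$f=c^{-1}R_j\,\mathbb D_n^{j+k+\alpha}R_k^*\,I_{n-k}^\alpha\,\mathcal R_{j,k}f=c^{-1}R_j\,\mathbb D_n^{j+k+\alpha}R_k^*\,\mathcal R_{j,k}\,I_{n-j}^\alpha f$$ with the same constant $c$.
   Context: Throughout, $n,j,k$ are integers with $j>0$, $k>0$, $j+k<n$. $G_{n,j}$ is the Grassmannian of $j$-dimensional linear subspaces of $\mathbb R^n$; $G(n,j)$ is the manifold of $j$-dimensional unoriented affine planes in $\mathbb R^n$. Every $\tau\in G(n,j)$ is written uniquely as $\tau=\xi+u$, $\xi\in G_{n,j}$, $u\in\xi^\perp$, and $f(\tau)=f(\xi,u)$; similarly $\zeta=\eta+v\in G(n,k)$, $\eta\in G_{n,k}$, $v\in\eta^\perp$. The $j$-plane transform is $(R_jh)(\tau)=\int_\tau h(x)\,d_\tau x$, $\tau\in G(n,j)$ (Euclidean measure on $\tau$). The dual $k$-plane transform of $\varphi$ on $G(n,k)$ is $(R_k^*\varphi)(x)=\int_{O(n)}\varphi(\gamma\eta_0+x)\,d\gamma$, with $\eta_0\in G_{n,k}$ fixed and $d\gamma$ the invariant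 probability measure on $O(n)$. The mixed Radon transform is $$(\mathcal R_{j,k}f)(\eta+v)=\int_{G_j(\eta^\perp)}d\xi\int_\eta f(\xi+u+v)\,du,$$ where $G_j(\eta^\perp)$ is the Grassmannian of $j$-dimensional linear subspaces of $\eta^\perp$ with its invariant probability measure and $du$ is Lebesgue measure on $\eta$. Riesz potentials: $(I_m^\alpha h)(x)=\frac1{\gamma_m(\alpha)}\int_{\mathbb R^m}\frac{h(y)\,dy}{|x-y|^{m-\alpha}}$, $\gamma_m(\alpha)=\frac{2^\alpha\pi^{m/2}\Gamma(\alpha/2)}{\Gamma((m-\alpha)/2)}$. $I_n^\alpha$ acts on functions on $\mathbb R^n$; $I_{n-j}^\alpha$ and $I_{n-k}^\alpha$ act on functions on $G(n,j)$ and $G(n,k)$ in the fiber variable $u\in\xi^\perp\cong\mathbb R^{n-j}$, respectively $v\in\eta^\perp\cong\mathbb R^{n-k}$, with $\xi$, respectively $\eta$, fixed. The Riesz fractional derivative $\mathbb D_n^\alpha$ is the left inverse of $I_n^\alpha$: if $\varphi=I_n^\alpha h$ with $h\in L^p(\mathbb R^n)$, $1\le p<n/\alpha$, then $\mathbb D_n^\alpha\varphi=h$. It can be represented, with the limit in the $L^p$-norm and almost everywhere, as the hypersingular integral $(\mathbb D_n^\alpha\varphi)(x)=\lim_{\varepsilon\to0}\frac1{d_{n,\ell}(\alpha)}\int_{|y|>\varepsilon}\frac{(\Delta_y^\ell\varphi)(x)}{|y|^{n+\alpha}}\,dy$, $(\Delta_y^\ell\varphi)(x)=\sum_{i=0}^\ell(-1)^i\binom{\ell}{i}\varphi(x-iy)$,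 where $\ell=\alpha$ if $\alpha$ is an odd integer and $\ell>2[\alpha/2]$ is arbitrary otherwise, and, with $B_\ell(\alpha)=\sum_{i=0}^\ell(-1)^i\binom{\ell}{i}i^\alpha$, $d_{n,\ell}(\alpha)=\frac{\pi^{n/2}}{2^\alpha\Gamma((n+\alpha)/2)}\Gamma(-\alpha/2)B_\ell(\alpha)$ if $\alpha\ne2,4,\dots$, and $d_{n,\ell}(\alpha)=\frac{\pi^{n/2}}{2^\alpha\Gamma((n+\alpha)/2)}\frac{2(-1)^{\alpha/2-1}}{(\alpha/2)!}\frac{d}{d\alpha}B_\ell(\alpha)$ if $\alpha=2,4,\dots$. *)

theory Defs
  imports "HOL-Probability.Probability"
begin

text \<open>
  Real n-space is \<^typ>\<open>real^'n\<close> with n = \<^term>\<open>CARD('n)\<close>.  A plane is represented by its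
  point set, so that \<open>f (\<xi> + u)\<close> is \<open>f ((+) u ` \<xi>)\<close>.  Functions are real-valued.
  All measures below are completed: the functions involved are determined only up to null sets,
  and a Lebesgue measurable function restricted to almost every plane is measurable only with
  respect to the completed measure of the plane.
\<close>

section \<open>Planes and their Euclidean measure\<close>

text \<open>For a plane \<open>\<tau> = \<xi> + u\<close> with \<open>u \<in> \<xi>\<^sup>\<bottom>\<close>, \<open>direction \<tau>\<close> is \<open>\<xi>\<close> and \<open>foot \<tau>\<close> is \<open>u\<close>.\<close>

definition direction :: "(real^'n) set \<Rightarrow> (real^'n) set" where
  "direction \<tau> = {x - y | x y. x \<in> \<tau> \<and> y \<in> \<tau>}"

definition foot :: "(real^'n) set \<Rightarrow> real^'n" where
  "foot \<tau> = closest_point \<tau> 0"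

text \<open>Image of Lebesgue measure in orthonormal coordinates; independent of the chosen basis.\<close>

definition plane_measure :: "(real^'n) set \<Rightarrow> (real^'n) measure" where
  "plane_measure \<tau> = completion
     (let B = (SOME B. pairwise orthogonal B \<and> (\<forall>b\<in>B. norm b = 1) \<and> span B = direction \<tau>)
      in distr (\<Pi>\<^sub>M b\<in>B. lborel) borel (\<lambda>t. foot \<tau> + (\<Sum>b\<in>B. t b *\<^sub>R b)))"

section \<open>Grassmannians and invariant measures\<close>

definition grassmannian :: "(real^'n) set \<Rightarrow> nat \<Rightarrow> (real^'n) set set" where
  "grassmannian V j = {\<xi>. subspace \<xi> \<and> \<xi> \<subseteq> V \<and> dim \<xi> = j}"

definition affine_grassmannian :: "nat \<Rightarrow> (real^'n) set set" where
  "affine_grassmannian j = {\<tau>. affine \<tau> \<and> aff_dim \<tau> = int j}"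

text \<open>
  The topology on Grassmannians is the one induced by identifying a subspace with the matrix of
  the orthogonal projection onto it (which is \<^term>\<open>closest_point \<xi>\<close> for a subspace \<open>\<xi>\<close>), and a
  plane with the projection onto its direction together with its foot.
\<close>

definition grassmannian_borel :: "(real^'n) set \<Rightarrow> nat \<Rightarrow> (real^'n) set measure" where
  "grassmannian_borel V j =
     vimage_algebra (grassmannian V j) (\<lambda>\<xi>. matrix (closest_point \<xi>)) borel"

definition affine_grassmannian_borel :: "nat \<Rightarrow> (real^'n) set measure" where
  "affine_grassmannian_borel j =
     vimage_algebra (affine_grassmannian j)
       (\<lambda>\<tau>. (matrix (closest_point (direction \<tau>)), foot \<tau>)) borel"

definition invariant_grassmannian_prob ::
    "(real^'n) set \<Rightarrow> nat \<Rightarrow> (real^'n) set measure \<Rightarrow> bool" where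
  "invariant_grassmannian_prob V j M \<longleftrightarrow>
     prob_space M \<and> sets M = sets (grassmannian_borel V j) \<and>
     (\<forall>g. orthogonal_transformation g \<and> g ` V = V \<longrightarrow> distr M M (image g) = M)"

definition grassmannian_measure :: "(real^'n) set \<Rightarrow> nat \<Rightarrow> (real^'n) set measure" where
  "grassmannian_measure V j = completion (THE M. invariant_grassmannian_prob V j M)"

text \<open>The group O(n) is compact, so left invariance determines the two-sided Haar measure.\<close>

definition invariant_orthogonal_prob :: "(real^'n^'n) measure \<Rightarrow> bool" where
  "invariant_orthogonal_prob M \<longleftrightarrow>
     prob_space M \<and> sets M = sets (restrict_space borel {Q. orthogonal_matrix Q}) \<and>
     (\<forall>A. orthogonal_matrix A \<longrightarrow> distr M M (\<lambda>Q. A ** Q) = M)"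

definition orthogonal_haar :: "(real^'n^'n) measure" where
  "orthogonal_haar = completion (THE M. invariant_orthogonal_prob M)"

text \<open>The measure \<open>d\<tau> = d\<xi> du\<close> on the manifold of affine j-planes.\<close>

definition affine_grassmannian_measure :: "nat \<Rightarrow> (real^'n) set measure" where
  "affine_grassmannian_measure j = completion
     (measure_of (affine_grassmannian j) (sets (affine_grassmannian_borel j))
       (\<lambda>A. \<integral>\<^sup>+\<xi>. (\<integral>\<^sup>+u. indicator A ((+) u ` \<xi>) \<partial>plane_measure (\<xi>\<^sup>\<bottom>))
              \<partial>grassmannian_measure UNIV j))"

section \<open>Radon transforms\<close>

definition plane_transform :: "(real^'n \<Rightarrow> real) \<Rightarrow> (real^'n) set \<Rightarrow> real" where
  "plane_transform h \<tau> = (\<integral>x. h x \<partial>plane_measure \<tau>)"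

definition dual_plane_transform ::
    "(real^'n) set \<Rightarrow> ((real^'n) set \<Rightarrow> real) \<Rightarrow> real^'n \<Rightarrow> real" where
  "dual_plane_transform \<eta>\<^sub>0 \<phi> x =
     (\<integral>Q. \<phi> ((+) x ` ((\<lambda>y. Q *v y) ` \<eta>\<^sub>0)) \<partial>orthogonal_haar)"

definition mixed_radon ::
    "nat \<Rightarrow> ((real^'n) set \<Rightarrow> real) \<Rightarrow> (real^'n) set \<Rightarrow> real" where
  "mixed_radon j f \<zeta> =
     (\<integral>\<xi>. (\<integral>u. f ((+) (u + foot \<zeta>) ` \<xi>) \<partial>plane_measure (direction \<zeta>))
        \<partial>grassmannian_measure ((direction \<zeta>)\<^sup>\<bottom>) j)"

section \<open>Riesz potentials and the Riesz fractional derivative\<close>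

definition riesz_gamma :: "nat \<Rightarrow> real \<Rightarrow> real" where
  "riesz_gamma m \<alpha> =
     2 powr \<alpha> * pi powr (real m / 2) * Gamma (\<alpha> / 2) / Gamma ((real m - \<alpha>) / 2)"

definition riesz_potential :: "real \<Rightarrow> (real^'n \<Rightarrow> real) \<Rightarrow> real^'n \<Rightarrow> real" where
  "riesz_potential \<alpha> h x =
     (1 / riesz_gamma CARD('n) \<alpha>) *
     (\<integral>y. h y / norm (x - y) powr (real CARD('n) - \<alpha>) \<partial>lebesgue)"

text \<open>The Riesz potential of order \<open>\<alpha>\<close> in the (n-j)-dimensional fibre variable \<open>u \<in> \<xi>\<^sup>\<bottom>\<close>.\<close>

definition fibre_riesz_potential ::
    "nat \<Rightarrow> real \<Rightarrow> ((real^'n) set \<Rightarrow> real) \<Rightarrow> (real^'n) set \<Rightarrow> real" where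
  "fibre_riesz_potential j \<alpha> f \<tau> =
     (1 / riesz_gamma (CARD('n) - j) \<alpha>) *
     (\<integral>w. f ((+) w ` direction \<tau>) / norm (foot \<tau> - w) powr (real (CARD('n) - j) - \<alpha>)
        \<partial>plane_measure ((direction \<tau>)\<^sup>\<bottom>))"

definition Lp :: "real \<Rightarrow> (real^'n \<Rightarrow> real) set" where
  "Lp p = {h. h \<in> borel_measurable lebesgue \<and> integrable lebesgue (\<lambda>x. \<bar>h x\<bar> powr p)}"

text \<open>
  The Riesz fractional derivative is the left inverse of the Riesz potential on the spaces
  \<open>L\<^sup>p\<close>, \<open>1 \<le> p < n/\<alpha>\<close>.  Since the Riesz potential is injective on the union of these spaces
  (modulo null sets), the value is determined up to a null set and does not depend on \<open>p\<close>.
\<close>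

definition riesz_derivative :: "real \<Rightarrow> (real^'n \<Rightarrow> real) \<Rightarrow> real^'n \<Rightarrow> real" where
  "riesz_derivative \<alpha> \<phi> =
     (SOME h. \<exists>p. 1 \<le> p \<and> p < real CARD('n) / \<alpha> \<and> h \<in> Lp p \<and>
        (AE x in lebesgue. \<phi> x = riesz_potential \<alpha> h x))"

end

(* Each of the three transforms x |-> R_k^*(...)(x) of f = R_j h is an average over rotations Q of
   integrals of h (x + Q z) over products of subspace measures and Riesz kernels.  The rotation
   average only sees radial functions, and on these a homogeneous measure is a multiple of the Riesz
   kernel of the same degree; writing powers of the norm as mixtures of Gaussians gives the constant
   c.  So the transforms equal c I^beta h almost everywhere, with beta = j + k or j + k + alpha.

   It remains to see that c h is the Riesz derivative of c I^beta h, that is, that I^beta is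
   injective modulo null sets on the union of the spaces L^p, 1 <= p < n/beta.  I^beta maps an
   inverse quadratic power (c + |x|^2)^(-(n+beta)/2) to a multiple of (c + |y|^2)^(-(n-beta)/2), so
   I^beta g = 0 makes g orthogonal to all translates of the latter.  Differentiation in c raises the
   exponent until these functions form an approximate identity, whence g = 0. *)

theory Submission
  imports Defs
begin

section \<open>Orthogonal projections\<close>

text \<open>The difficulty is that every function is fixed only up to null sets and every measure is
  completed, while the formulas evaluate \<open>f\<close> on particular families of planes. So
  \<open>h\<close> is replaced by a Borel representative, and the planes on which \<open>f\<close>
  differs from its transform are collected in a measurable set \<open>E\<close>; disintegrating the
  measure on affine planes over rotations shows that almost every plane met by each transform avoids
  \<open>E\<close>. This needs measurability jointly in the subspace and the point, for which the
  measure of a subspace is rewritten as an integral over the whole space with a Gaussian weight. The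
  invariant measures are defined by \<open>THE\<close> and the Riesz derivative by
  \<open>SOME\<close>; hence existence and uniqueness of the former, and uniqueness up to null sets
  of the latter, have to be proved. One constant serves for every \<alpha> because the Gamma factors
  containing \<alpha> cancel between the kernel on the fibre and the kernel on the whole
  space.\<close>

lemma closest_point_eqI:
  fixes S :: "'a::euclidean_space set"
  assumes "subspace S" "y \<in> S" "x - y \<in> S\<^sup>\<bottom>"
  shows "closest_point S x = y"
proof (rule closest_point_unique[symmetric])
  show "convex S" "closed S" using assms(1) by (auto simp: subspace_imp_convex closed_subspace)
  show "\<forall>z\<in>S. dist x y \<le> dist x z"
  proof
    fix z assume "z \<in> S"
    then have "orthogonal (y - z) (x - y)"
      using assms by (simp add: orthogonal_comp_def subspace_diff)
    then have "(norm (x - y + (y - z)))\<^sup>2 = (norm (x - y))\<^sup>2 + (norm (y - z))\<^sup>2"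
      by (intro norm_add_Pythagorean) (simp add: orthogonal_commute)
    then have "(norm (x - y))\<^sup>2 \<le> (norm (x - z))\<^sup>2" by simp
    then show "dist x y \<le> dist x z" by (simp add: dist_norm)
  qed
qed (use assms in auto)

lemma closest_point_subspace_in:
  fixes S :: "'a::euclidean_space set"
  shows "subspace S \<Longrightarrow> closest_point S x \<in> S"
  using closest_point_in_set[of S x] subspace_0[of S] by (auto simp: closed_subspace)

lemma diff_closest_point_orthogonal_comp:
  fixes S :: "'a::euclidean_space set"
  assumes "subspace S"
  shows "x - closest_point S x \<in> S\<^sup>\<bottom>"
proof -
  obtain y z where "y \<in> S" "z \<in> S\<^sup>\<bottom>" "x = y + z"
    using subspace_sum_orthogonal_comp[OF assms] by (metis UNIV_I set_plus_elim)
  with closest_point_eqI[OF assms, of y x] show ?thesis by simp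
qed

lemma closest_point_in_subspace [simp]:
  fixes S :: "'a::euclidean_space set"
  shows "subspace S \<Longrightarrow> x \<in> S \<Longrightarrow> closest_point S x = x"
  by (rule closest_point_self)

lemma linear_closest_point:
  fixes S :: "'a::euclidean_space set"
  assumes "subspace S"
  shows "linear (closest_point S)"
proof
  let ?P = "closest_point S"
  fix x y :: 'a and r :: real
  have "x + y - (?P x + ?P y) \<in> S\<^sup>\<bottom>"
    using subspace_add[OF subspace_orthogonal_comp diff_closest_point_orthogonal_comp
        diff_closest_point_orthogonal_comp, OF assms assms, of x y] by (simp add: algebra_simps)
  then show "?P (x + y) = ?P x + ?P y"
    using assms by (intro closest_point_eqI) (auto intro!: subspace_add closest_point_subspace_in)
  have "r *\<^sub>R x - r *\<^sub>R ?P x \<in> S\<^sup>\<bottom>"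
    using subspace_mul[OF subspace_orthogonal_comp diff_closest_point_orthogonal_comp, OF assms, of r x]
    by (simp add: algebra_simps)
  then show "?P (r *\<^sub>R x) = r *\<^sub>R ?P x"
    using assms by (intro closest_point_eqI) (auto intro!: subspace_mul closest_point_subspace_in)
qed

lemma closest_point_orthogonal_comp:
  fixes S :: "'a::euclidean_space set"
  assumes "subspace S"
  shows "closest_point (S\<^sup>\<bottom>) x = x - closest_point S x"
  using assms by (intro closest_point_eqI)
    (auto simp: subspace_orthogonal_comp diff_closest_point_orthogonal_comp orthogonal_comp_self
      closest_point_subspace_in)

lemma inner_orthogonal_comp:
  "x \<in> S \<Longrightarrow> y \<in> S\<^sup>\<bottom> \<Longrightarrow> x \<bullet> y = 0" "x \<in> S \<Longrightarrow> y \<in> S\<^sup>\<bottom> \<Longrightarrow> y \<bullet> x = 0"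
  by (auto simp: orthogonal_comp_def orthogonal_def inner_commute)

lemma norm_closest_point_Pythagorean:
  fixes S :: "'a::euclidean_space set"
  assumes "subspace S"
  shows "(norm (closest_point S x))\<^sup>2 + (norm (x - closest_point S x))\<^sup>2 = (norm x)\<^sup>2"
proof -
  have "orthogonal (closest_point S x) (x - closest_point S x)"
    using closest_point_subspace_in[OF assms] diff_closest_point_orthogonal_comp[OF assms]
    by (simp add: orthogonal_comp_def)
  from norm_add_Pythagorean[OF this] show ?thesis by simp
qed

lemma orthogonal_comp_image:
  fixes g :: "'a::euclidean_space \<Rightarrow> 'a"
  assumes "orthogonal_transformation g"
  shows "g ` (S\<^sup>\<bottom>) = (g ` S)\<^sup>\<bottom>"
proof -
  have s: "surj g" using assms by (rule orthogonal_transformation_surj)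
  have i: "g x \<bullet> g y = x \<bullet> y" for x y using assms by (simp add: orthogonal_transformation_def)
  show ?thesis
  proof (intro equalityI subsetI)
    fix x assume "x \<in> g ` (S\<^sup>\<bottom>)"
    then show "x \<in> (g ` S)\<^sup>\<bottom>"
      by (auto simp: orthogonal_comp_def orthogonal_def i)
  next
    fix x assume x: "x \<in> (g ` S)\<^sup>\<bottom>"
    obtain z where z: "x = g z" using s by (metis surjD)
    have "z \<in> S\<^sup>\<bottom>" using x by (auto simp: z orthogonal_comp_def orthogonal_def i)
    then show "x \<in> g ` (S\<^sup>\<bottom>)" by (simp add: z)
  qed
qed

text \<open>Equivariance of projections. Subspace measures, their weights and the coordinates on
  Grassmannians are all expressed by projections, so their behaviour under rotations reduces to
  this.\<close>

lemma closest_point_orthogonal_image: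
  fixes g :: "'a::euclidean_space \<Rightarrow> 'a"
  assumes "orthogonal_transformation g" "subspace S"
  shows "closest_point (g ` S) (g x) = g (closest_point S x)"
proof (rule closest_point_eqI)
  have l: "linear g" using assms(1) by (rule orthogonal_transformation_linear)
  show "subspace (g ` S)" using l assms(2) by (rule linear_subspace_image)
  show "g (closest_point S x) \<in> g ` S" using assms by (simp add: closest_point_subspace_in)
  show "g x - g (closest_point S x) \<in> (g ` S)\<^sup>\<bottom>"
    using diff_closest_point_orthogonal_comp[OF assms(2), of x]
    by (simp add: orthogonal_comp_image[OF assms(1), symmetric] linear_diff[OF l, symmetric])
qed

lemma closest_point_borel_measurable [measurable]:
  fixes S :: "'a::euclidean_space set"
  assumes "subspace S"
  shows "closest_point S \<in> borel \<rightarrow>\<^sub>M borel"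
  using linear_closest_point[OF assms]
  by (intro borel_measurable_continuous_onI linear_continuous_on) (simp add: linear_conv_bounded_linear)

lemma orthogonal_transformation_borel:
  fixes g :: "'a::euclidean_space \<Rightarrow> 'a"
  assumes "orthogonal_transformation g"
  shows "g \<in> borel \<rightarrow>\<^sub>M borel"
  using orthogonal_transformation_linear[OF assms]
  by (intro borel_measurable_continuous_onI linear_continuous_on) (simp add: linear_conv_bounded_linear)

section \<open>Invariance of Lebesgue measure\<close>

lemma nn_integral_lborel_translate:
  fixes a :: "'a::euclidean_space" and f :: "'a \<Rightarrow> ennreal"
  assumes [measurable]: "f \<in> borel_measurable borel"
  shows "(\<integral>\<^sup>+x. f (a + x) \<partial>lborel) = (\<integral>\<^sup>+x. f x \<partial>lborel)"
proof -
  have "(\<integral>\<^sup>+x. f x \<partial>lborel) = (\<integral>\<^sup>+x. f x \<partial>distr lborel borel (\<lambda>x. a + 1 *\<^sub>R x))"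
    by (subst lborel_affine[of 1 a]) (simp_all add: density_1)
  also have "\<dots> = (\<integral>\<^sup>+x. f (a + x) \<partial>lborel)" by (subst nn_integral_distr) auto
  finally show ?thesis by simp
qed

lemma nn_integral_lborel_scale:
  fixes f :: "'a::euclidean_space \<Rightarrow> ennreal"
  assumes [measurable]: "f \<in> borel_measurable borel" and c: "c \<noteq> 0"
  shows "(\<integral>\<^sup>+x. f x \<partial>lborel) = ennreal (\<bar>c\<bar> ^ DIM('a)) * (\<integral>\<^sup>+x. f (c *\<^sub>R x) \<partial>lborel)"
proof -
  have "(\<integral>\<^sup>+x. f x \<partial>lborel) =
    (\<integral>\<^sup>+x. f x \<partial>density (distr lborel borel (\<lambda>x. 0 + c *\<^sub>R x)) (\<lambda>_. ennreal (\<bar>c\<bar> ^ DIM('a))))"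
    by (subst lborel_affine[of c 0]) (use c in simp_all)
  also have "\<dots> = ennreal (\<bar>c\<bar> ^ DIM('a)) * (\<integral>\<^sup>+x. f (c *\<^sub>R x) \<partial>lborel)"
    by (simp add: nn_integral_density nn_integral_distr nn_integral_cmult)
  finally show ?thesis .
qed

(* The rotated Lebesgue measure is translation invariant, hence proportional to Lebesgue measure;
   the unit ball shows that the factor is 1. *)
lemma nn_integral_lborel_orthogonal:
  fixes f :: "'a::euclidean_space \<Rightarrow> ennreal" and g :: "'a \<Rightarrow> 'a"
  assumes g: "orthogonal_transformation g" and [measurable]: "f \<in> borel_measurable borel"
  shows "(\<integral>\<^sup>+x. f (g x) \<partial>lborel) = (\<integral>\<^sup>+x. f x \<partial>lborel)"
proof -
  have [measurable]: "g \<in> borel \<rightarrow>\<^sub>M borel" by (rule orthogonal_transformation_borel[OF g])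
  have lin: "linear g" using g by (rule orthogonal_transformation_linear)
  have surj: "surj g" using g by (rule orthogonal_transformation_surj)
  define \<phi> :: "'a \<Rightarrow> ennreal" where "\<phi> = indicator (ball (0::'a) 1)"
  have [measurable]: "\<phi> \<in> borel_measurable borel"
    unfolding \<phi>_def by (intro borel_measurable_indicator) simp
  have \<phi>g: "\<phi> (g x) = \<phi> x" for x
    using g by (simp add: \<phi>_def indicator_def orthogonal_transformation_norm)
  define I where "I = (\<integral>\<^sup>+x. \<phi> x \<partial>lborel)"
  have I: "I = emeasure lborel (ball (0::'a) 1)" by (simp add: I_def \<phi>_def)
  have "I \<noteq> \<infinity>"
    using emeasure_bounded_finite[of "ball (0::'a) 1"] unfolding I by (auto simp: less_top)
  have "I \<noteq> 0"
  proof
    assume "I = 0"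
    then have "measure lborel (ball (0::'a) 1) = 0" by (simp add: I measure_def)
    with content_ball_pos[of 1 "0::'a"] show False by simp
  qed
  \<comment> \<open>Uniqueness of the invariant measure by Fubini: the double integral of
    \<open>f (g x) * \<phi> (g x + y)\<close> is evaluated in both orders.\<close>
  have "(\<integral>\<^sup>+x. f (g x) \<partial>lborel) * I = (\<integral>\<^sup>+x. f (g x) * (\<integral>\<^sup>+y. \<phi> (g x + y) \<partial>lborel) \<partial>lborel)"
    by (simp add: nn_integral_lborel_translate I_def nn_integral_multc)
  also have "\<dots> = (\<integral>\<^sup>+x. (\<integral>\<^sup>+y. f (g x) * \<phi> (g x + y) \<partial>lborel) \<partial>lborel)"
    by (simp add: nn_integral_cmult)
  also have "\<dots> = (\<integral>\<^sup>+y. (\<integral>\<^sup>+x. f (g x) * \<phi> (g x + y) \<partial>lborel) \<partial>lborel)"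
    by (intro lborel_pair.Fubini') measurable
  also have "\<dots> = (\<integral>\<^sup>+y. (\<integral>\<^sup>+x. f (g x - y) * \<phi> x \<partial>lborel) \<partial>lborel)"
  proof (rule nn_integral_cong)
    fix y :: 'a
    obtain z where z: "g z = - y" using surj by (metis surjD)
    have "(\<integral>\<^sup>+x. f (g x) * \<phi> (g x + y) \<partial>lborel) = (\<integral>\<^sup>+x. f (g (z + x)) * \<phi> (g (z + x) + y) \<partial>lborel)"
      by (intro nn_integral_lborel_translate[symmetric]) measurable
    then show "(\<integral>\<^sup>+x. f (g x) * \<phi> (g x + y) \<partial>lborel) = (\<integral>\<^sup>+x. f (g x - y) * \<phi> x \<partial>lborel)"
      by (simp add: linear_add[OF lin] z \<phi>g)
  qed
  also have "\<dots> = (\<integral>\<^sup>+x. (\<integral>\<^sup>+y. f (g x - y) * \<phi> x \<partial>lborel) \<partial>lborel)"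
    by (intro lborel_pair.Fubini') measurable
  also have "\<dots> = (\<integral>\<^sup>+x. (\<integral>\<^sup>+y. f y \<partial>lborel) * \<phi> x \<partial>lborel)"
  proof (rule nn_integral_cong)
    fix x :: 'a
    have "(\<integral>\<^sup>+y. f (g x - y) \<partial>lborel) = (\<integral>\<^sup>+y. f y \<partial>lborel)"
      using nn_integral_lborel_scale[of "\<lambda>y. f (g x + y)" "-1"] nn_integral_lborel_translate[of f "g x"]
      by simp
    then show "(\<integral>\<^sup>+y. f (g x - y) * \<phi> x \<partial>lborel) = (\<integral>\<^sup>+y. f y \<partial>lborel) * \<phi> x"
      by (simp add: nn_integral_multc)
  qed
  also have "\<dots> = (\<integral>\<^sup>+y. f y \<partial>lborel) * I"
    by (simp add: nn_integral_cmult I_def)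
  finally show ?thesis
    using \<open>I \<noteq> \<infinity>\<close> \<open>I \<noteq> 0\<close> by (simp add: mult.commute[of _ I] ennreal_mult_cancel_left)
qed

lemma distr_lborel_orthogonal:
  fixes g :: "'a::euclidean_space \<Rightarrow> 'a"
  assumes g: "orthogonal_transformation g"
  shows "distr lborel borel g = lborel"
proof (rule measure_eqI)
  have [measurable]: "g \<in> borel \<rightarrow>\<^sub>M borel" by (rule orthogonal_transformation_borel[OF g])
  fix A assume "A \<in> sets (distr lborel borel g)"
  then have [measurable]: "A \<in> sets borel" by simp
  have "(\<integral>\<^sup>+x. indicator A (g x) \<partial>lborel) = emeasure lborel A"
    by (subst nn_integral_lborel_orthogonal[OF g]) auto
  moreover have "(\<integral>\<^sup>+x. indicator A (g x) \<partial>lborel) = emeasure (distr lborel borel g) A"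
    by (subst nn_integral_indicator[symmetric], simp, subst nn_integral_distr) auto
  ultimately show "emeasure (distr lborel borel g) A = emeasure lborel A" by simp
qed simp

section \<open>Lebesgue measure on subspaces\<close>

text \<open>The measure under the completion in \<open>plane_measure\<close>, before the translation
  by the foot. For orthonormal \<open>B\<close> it depends only on \<open>span B\<close>; the
  comparison with \<open>subspace_measure\<close> shows this.\<close>

definition orthonormal_measure :: "'a::euclidean_space set \<Rightarrow> 'a measure" where
  "orthonormal_measure B = distr (\<Pi>\<^sub>M b\<in>B. lborel) borel (\<lambda>t. \<Sum>b\<in>B. t b *\<^sub>R b)"

lemma product_sigma_finite_lborel: "product_sigma_finite (\<lambda>_. lborel :: real measure)"
  by standard

lemma sets_orthonormal_measure [simp, measurable_cong]:
  "sets (orthonormal_measure B) = sets borel"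
  by (simp add: orthonormal_measure_def)

lemma space_orthonormal_measure [simp]: "space (orthonormal_measure B) = UNIV"
  by (simp add: orthonormal_measure_def)

lemma nn_integral_orthonormal_measure:
  assumes [measurable]: "f \<in> borel_measurable borel"
  shows "(\<integral>\<^sup>+x. f x \<partial>orthonormal_measure B) = (\<integral>\<^sup>+t. f (\<Sum>b\<in>B. t b *\<^sub>R b) \<partial>(\<Pi>\<^sub>M b\<in>B. lborel))"
  unfolding orthonormal_measure_def by (subst nn_integral_distr) auto

lemma nn_integral_orthonormal_measure_cong:
  assumes [measurable]: "f \<in> borel_measurable borel" "g \<in> borel_measurable borel"
    and "\<And>x. x \<in> span B \<Longrightarrow> f x = g x"
  shows "(\<integral>\<^sup>+x. f x \<partial>orthonormal_measure B) = (\<integral>\<^sup>+x. g x \<partial>orthonormal_measure B)"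
  by (auto simp: nn_integral_orthonormal_measure assms(3) span_sum span_scale span_base intro!: nn_integral_cong)

lemma nn_integral_orthonormal_measure_Un:
  fixes B C :: "'a::euclidean_space set"
  assumes [measurable]: "f \<in> borel_measurable borel"
    and BC: "finite B" "finite C" "B \<inter> C = {}"
  shows "(\<integral>\<^sup>+x. f x \<partial>orthonormal_measure (B \<union> C)) =
    (\<integral>\<^sup>+x. (\<integral>\<^sup>+y. f (x + y) \<partial>orthonormal_measure C) \<partial>orthonormal_measure B)"
proof -
  interpret product_sigma_finite "\<lambda>_::'a. lborel :: real measure" by (rule product_sigma_finite_lborel)
  interpret C: sigma_finite_measure "\<Pi>\<^sub>M b\<in>C. (lborel :: real measure)"
    by (rule sigma_finite) (use BC in auto)
  have [measurable]: "(\<lambda>x. \<integral>\<^sup>+y. f (x + y) \<partial>orthonormal_measure C) \<in> borel_measurable borel"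
    by (subst nn_integral_orthonormal_measure) measurable
  have "(\<integral>\<^sup>+x. f x \<partial>orthonormal_measure (B \<union> C)) =
    (\<integral>\<^sup>+s. (\<integral>\<^sup>+t. f (\<Sum>b\<in>B \<union> C. merge B C (s, t) b *\<^sub>R b) \<partial>(\<Pi>\<^sub>M b\<in>C. lborel)) \<partial>(\<Pi>\<^sub>M b\<in>B. lborel))"
    by (subst nn_integral_orthonormal_measure, simp, subst product_nn_integral_fold) (use BC in auto)
  also have "\<dots> = (\<integral>\<^sup>+s. (\<integral>\<^sup>+t. f ((\<Sum>b\<in>B. s b *\<^sub>R b) + (\<Sum>b\<in>C. t b *\<^sub>R b)) \<partial>(\<Pi>\<^sub>M b\<in>C. lborel)) \<partial>(\<Pi>\<^sub>M b\<in>B. lborel))"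
  proof (intro nn_integral_cong arg_cong[where f=f])
    fix s t :: "'a \<Rightarrow> real"
    have "(\<Sum>b\<in>B \<union> C. merge B C (s, t) b *\<^sub>R b) =
      (\<Sum>b\<in>B. merge B C (s, t) b *\<^sub>R b) + (\<Sum>b\<in>C. merge B C (s, t) b *\<^sub>R b)"
      using BC by (intro sum.union_disjoint)
    also have "(\<Sum>b\<in>B. merge B C (s, t) b *\<^sub>R b) = (\<Sum>b\<in>B. s b *\<^sub>R b)"
      by (intro sum.cong) (auto simp: merge_def)
    also have "(\<Sum>b\<in>C. merge B C (s, t) b *\<^sub>R b) = (\<Sum>b\<in>C. t b *\<^sub>R b)"
      using BC by (intro sum.cong) (auto simp: merge_def)
    finally show "(\<Sum>b\<in>B \<union> C. merge B C (s, t) b *\<^sub>R b) = (\<Sum>b\<in>B. s b *\<^sub>R b) + (\<Sum>b\<in>C. t b *\<^sub>R b)" .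
  qed
  also have "\<dots> = (\<integral>\<^sup>+x. (\<integral>\<^sup>+y. f (x + y) \<partial>orthonormal_measure C) \<partial>orthonormal_measure B)"
    by (simp add: nn_integral_orthonormal_measure)
  finally show ?thesis .
qed

lemma nn_integral_gaussian_real:
  assumes "0 < s"
  shows "(\<integral>\<^sup>+x. ennreal (exp (- (s * x\<^sup>2))) \<partial>lborel) = ennreal ((pi / s) powr (1/2))"
proof -
  define \<sigma> where "\<sigma> = 1 / sqrt (2 * s)"
  have \<sigma>: "0 < \<sigma>" "\<sigma>\<^sup>2 = 1 / (2 * s)" using assms by (auto simp: \<sigma>_def power_divide)
  have *: "exp (- (s * x\<^sup>2)) = sqrt (pi / s) * normal_density 0 \<sigma> x" for x
    using assms unfolding normal_density_def by (simp add: \<sigma> real_sqrt_divide field_simps)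
  have "(\<integral>\<^sup>+x. ennreal (exp (- (s * x\<^sup>2))) \<partial>lborel) = ennreal (sqrt (pi / s)) * (\<integral>\<^sup>+x. ennreal (normal_density 0 \<sigma> x) \<partial>lborel)"
    unfolding * using assms by (subst nn_integral_cmult[symmetric]) (auto simp: ennreal_mult)
  also have "(\<integral>\<^sup>+x. ennreal (normal_density 0 \<sigma> x) \<partial>lborel) = 1"
    using \<sigma> by (subst nn_integral_eq_integral) auto
  finally show ?thesis using assms by (simp add: powr_half_sqrt)
qed

lemma norm_sum_orthonormal:
  assumes "finite B" "pairwise orthogonal B" "\<forall>b\<in>B. norm b = 1"
  shows "(norm (\<Sum>b\<in>B. t b *\<^sub>R b))\<^sup>2 = (\<Sum>b\<in>B. (t b)\<^sup>2)"
proof -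
  have "pairwise (\<lambda>i j. orthogonal (t i *\<^sub>R i) (t j *\<^sub>R j)) B"
    using assms(2) by (auto simp: pairwise_def orthogonal_clauses)
  from norm_sum_Pythagorean[OF assms(1) this]
  show ?thesis using assms(3) by (simp add: power_mult_distrib)
qed

lemma nn_integral_gaussian_orthonormal:
  fixes B :: "'a::euclidean_space set"
  assumes B: "finite B" "pairwise orthogonal B" "\<forall>b\<in>B. norm b = 1" and "0 < s"
  shows "(\<integral>\<^sup>+x. ennreal (exp (- (s * (norm x)\<^sup>2))) \<partial>orthonormal_measure B) =
    ennreal ((pi / s) powr (real (card B) / 2))"
proof -
  interpret product_sigma_finite "\<lambda>_::'a. lborel :: real measure" by (rule product_sigma_finite_lborel)
  have "(\<integral>\<^sup>+x. ennreal (exp (- (s * (norm x)\<^sup>2))) \<partial>orthonormal_measure B) =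
    (\<integral>\<^sup>+t. (\<Prod>b\<in>B. ennreal (exp (- (s * (t b)\<^sup>2)))) \<partial>(\<Pi>\<^sub>M b\<in>B. lborel))"
    using B by (simp add: nn_integral_orthonormal_measure norm_sum_orthonormal prod_ennreal
        sum_distrib_left flip: sum_negf exp_sum)
  also have "\<dots> = (\<Prod>b\<in>B. \<integral>\<^sup>+t. ennreal (exp (- (s * t\<^sup>2))) \<partial>lborel)"
    using B by (intro product_nn_integral_prod) auto
  also have "\<dots> = ennreal (((pi / s) powr (1/2)) ^ card B)"
    using assms by (simp add: nn_integral_gaussian_real ennreal_power)
  also have "((pi / s) powr (1/2)) ^ card B = (pi / s) powr (real (card B) / 2)"
    using assms by (simp add: powr_powr flip: powr_realpow)
  finally show ?thesis .
qed

text \<open>An orthonormal basis arises from the standard one by an orthogonal map \<open>U\<close>,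
  and Lebesgue measure is invariant under \<open>U\<close>. The inverse \<open>T\<close> turns
  coordinates with respect to \<open>B\<close> into standard ones, where boxes pull back to products
  of intervals and identify the image measure as \<open>lborel\<close>.\<close>

lemma orthonormal_measure_UNIV:
  fixes B :: "'a::euclidean_space set"
  assumes B: "pairwise orthogonal B" "\<forall>b\<in>B. norm b = 1" "span B = UNIV"
  shows "orthonormal_measure B = lborel"
proof -
  have "0 \<notin> B" using B(2) by auto
  then have ind: "independent B" using B(1) by (rule pairwise_orthogonal_independent[rotated])
  then have fin: "finite B" by (rule independent_imp_finite)
  have "card B = DIM('a)" using indep_card_eq_dim_span[OF ind] B(3) by simp
  then obtain \<phi> where \<phi>: "bij_betw \<phi> (Basis :: 'a set) B"
    using fin by (metis finite_Basis finite_same_card_bij)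
  then have \<phi>B: "\<phi> b \<in> B" if "b \<in> Basis" for b using that by (auto simp: bij_betw_def)
  define \<psi> where "\<psi> = the_inv_into Basis \<phi>"
  have \<psi>: "bij_betw \<psi> B Basis" "\<And>b. b \<in> Basis \<Longrightarrow> \<psi> (\<phi> b) = b" "\<And>c. c \<in> B \<Longrightarrow> \<phi> (\<psi> c) = c"
    using \<phi> by (auto simp: \<psi>_def inj_on_the_inv_into the_inv_into_f_f bij_betw_def f_the_inv_into_f)
  define U where "U x = (\<Sum>b\<in>Basis. (x \<bullet> b) *\<^sub>R \<phi> b)" for x :: 'a
  define T where "T x = (\<Sum>b\<in>Basis. (x \<bullet> \<phi> b) *\<^sub>R b)" for x :: 'a
  have [measurable]: "T \<in> borel \<rightarrow>\<^sub>M borel" "U \<in> borel \<rightarrow>\<^sub>M borel"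
    by (auto simp: T_def[abs_def] U_def[abs_def])
  have \<phi>\<phi>: "\<phi> a \<bullet> \<phi> b = (if a = b then 1 else 0)" if "a \<in> Basis" "b \<in> Basis" for a b
  proof (cases "a = b")
    case True then show ?thesis using bspec[OF B(2) \<phi>B[OF that(1)]] by (simp add: norm_eq_1)
  next
    case False
    then have "\<phi> a \<noteq> \<phi> b" using \<phi> that by (auto simp: bij_betw_def inj_on_def)
    then show ?thesis using B(1) \<phi>B that False by (auto simp: pairwise_def orthogonal_def)
  qed
  have U: "orthogonal_transformation U"
    unfolding orthogonal_transformation_def
  proof (intro conjI allI)
    show "linear U" unfolding U_def
      by (intro linearI) (auto simp: inner_add_left scaleR_add_left sum.distrib scaleR_sum_right)
    fix v w
    have "U v \<bullet> U w = (\<Sum>b\<in>Basis. (w \<bullet> b) * (\<Sum>a\<in>Basis. (v \<bullet> a) * (\<phi> a \<bullet> \<phi> b)))"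
      by (simp add: U_def inner_sum_left inner_sum_right)
    also have "\<dots> = (\<Sum>b\<in>Basis. (v \<bullet> b) * (w \<bullet> b))"
      by (intro sum.cong refl) (simp add: \<phi>\<phi> if_distrib cong: if_cong sum.cong)
    finally show "U v \<bullet> U w = v \<bullet> w" by (simp add: euclidean_inner[of v w])
  qed
  have UT: "U (T x) = x" for x
  proof -
    have "U (T x) = (\<Sum>b\<in>Basis. (x \<bullet> \<phi> b) *\<^sub>R \<phi> b)" by (simp add: U_def T_def)
    also have "\<dots> = (\<Sum>c\<in>B. (x \<bullet> c) *\<^sub>R c)"
      using sum.reindex_bij_betw[OF \<phi>, of "\<lambda>c. (x \<bullet> c) *\<^sub>R c"] .
    also have "\<dots> = x" using B fin by (intro orthonormal_basis_expand) auto
    finally show ?thesis .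
  qed
  have T_sum: "T (\<Sum>c\<in>B. t c *\<^sub>R c) \<bullet> b = t (\<phi> b)" if "b \<in> Basis" for t b
  proof -
    have "T (\<Sum>c\<in>B. t c *\<^sub>R c) \<bullet> b = (\<Sum>c\<in>B. t c *\<^sub>R c) \<bullet> \<phi> b"
      using that by (simp add: T_def)
    also have "\<dots> = (\<Sum>a\<in>Basis. t (\<phi> a) *\<^sub>R \<phi> a) \<bullet> \<phi> b"
      using sum.reindex_bij_betw[OF \<phi>, of "\<lambda>c. t c *\<^sub>R c"] by simp
    also have "\<dots> = (\<Sum>a\<in>Basis. t (\<phi> a) * (if a = b then 1 else 0))"
      using that by (simp add: inner_sum_left \<phi>\<phi>)
    also have "\<dots> = t (\<phi> b)" using that by (simp add: if_distrib cong: if_cong)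
    finally show ?thesis .
  qed
  interpret finite_product_sigma_finite "\<lambda>_::'a. lborel :: real measure" B
    by (intro finite_product_sigma_finite.intro product_sigma_finite_lborel
        finite_product_sigma_finite_axioms.intro fin)
  have "lborel = distr (orthonormal_measure B) borel T"
  proof (rule lborel_eqI)
    fix l u :: 'a assume lu: "\<And>b. b \<in> Basis \<Longrightarrow> l \<bullet> b \<le> u \<bullet> b"
    have "emeasure (distr (orthonormal_measure B) borel T) (box l u) =
      emeasure (\<Pi>\<^sub>M b\<in>B. lborel) ((\<lambda>t. T (\<Sum>c\<in>B. t c *\<^sub>R c)) -` box l u \<inter> space (\<Pi>\<^sub>M b\<in>B. lborel))"
      unfolding orthonormal_measure_def
      by (subst distr_distr) (auto simp: emeasure_distr comp_def)
    also have "(\<lambda>t. T (\<Sum>c\<in>B. t c *\<^sub>R c)) -` box l u \<inter> space (\<Pi>\<^sub>M b\<in>B. lborel) =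
      (\<Pi>\<^sub>E c\<in>B. {l \<bullet> \<psi> c <..< u \<bullet> \<psi> c})"
      using \<psi> \<phi>B by (auto simp: box_def T_sum space_PiM PiE_iff) (metis bij_betwE)+
    also have "emeasure (\<Pi>\<^sub>M b\<in>B. lborel) \<dots> = (\<Prod>c\<in>B. ennreal ((u - l) \<bullet> \<psi> c))"
      using \<psi>(1) lu by (subst measure_times) (auto simp: inner_diff_left bij_betwE intro!: prod.cong)
    also have "\<dots> = (\<Prod>b\<in>Basis. ennreal ((u - l) \<bullet> b))"
      using prod.reindex_bij_betw[OF \<psi>(1), of "\<lambda>b. ennreal ((u - l) \<bullet> b)"] .
    also have "\<dots> = ennreal (\<Prod>b\<in>Basis. (u - l) \<bullet> b)"
      using lu by (intro prod_ennreal) (simp add: inner_diff_left)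
    finally show "emeasure (distr (orthonormal_measure B) borel T) (box l u) = (\<Prod>b\<in>Basis. (u - l) \<bullet> b)" .
  qed simp
  then have "distr lborel borel U = distr (distr (orthonormal_measure B) borel T) borel U"
    by (rule arg_cong)
  also have "\<dots> = distr (orthonormal_measure B) borel (U \<circ> T)"
    by (intro distr_distr) measurable
  also have "U \<circ> T = id" using UT by auto
  also have "distr (orthonormal_measure B) borel id = orthonormal_measure B"
    by (intro measure_eqI) (auto simp: emeasure_distr)
  finally show ?thesis using distr_lborel_orthogonal[OF U] by simp
qed

text \<open>A Gaussian in the directions orthogonal to \<open>S\<close>, normalized to have integral
  1 over \<open>S\<^sup>\<bottom>\<close>. Projecting the weighted Lebesgue measure onto
  \<open>S\<close> integrates these directions out and leaves Lebesgue measure on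
  \<open>S\<close>.\<close>

definition subspace_weight :: "'a::euclidean_space set \<Rightarrow> 'a \<Rightarrow> real" where
  "subspace_weight S x =
     pi powr (- (real DIM('a) - real (dim S)) / 2) * exp (- (norm (x - closest_point S x))\<^sup>2)"

(* A description without a choice of basis, in which the subspace enters only through its
   dimension and the projection; this gives joint measurability in the subspace. *)
definition subspace_measure :: "'a::euclidean_space set \<Rightarrow> 'a measure" where
  "subspace_measure S = distr (density lborel (subspace_weight S)) borel (closest_point S)"

lemma sets_subspace_measure [simp, measurable_cong]: "sets (subspace_measure S) = sets borel"
  by (simp add: subspace_measure_def)

lemma space_subspace_measure [simp]: "space (subspace_measure S) = UNIV"
  by (simp add: subspace_measure_def)

lemma subspace_weight_nonneg [simp]: "0 \<le> subspace_weight S x"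
  by (simp add: subspace_weight_def)

lemma subspace_weight_measurable [measurable]:
  assumes [simp]: "subspace S"
  shows "subspace_weight S \<in> borel_measurable borel"
proof -
  have [measurable]: "closest_point S \<in> borel \<rightarrow>\<^sub>M borel" by simp
  show ?thesis unfolding subspace_weight_def[abs_def] by measurable
qed

lemma nn_integral_subspace_measure:
  assumes S: "subspace S" and [measurable]: "f \<in> borel_measurable borel"
  shows "(\<integral>\<^sup>+x. f x \<partial>subspace_measure S) =
    (\<integral>\<^sup>+x. ennreal (subspace_weight S x) * f (closest_point S x) \<partial>lborel)"
proof -
  have [measurable]: "closest_point S \<in> borel \<rightarrow>\<^sub>M borel" "subspace_weight S \<in> borel_measurable borel"
    using S by simp_all
  show ?thesis
    unfolding subspace_measure_def
    by (subst nn_integral_distr) (auto simp: nn_integral_density)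
qed

text \<open>Extend \<open>B\<close> by an orthonormal basis \<open>C\<close> of the complement.
  Lebesgue measure becomes a product over \<open>B\<close> and \<open>C\<close>, and the weight
  contributes the factor 1 when the \<open>C\<close> part is integrated.\<close>

lemma orthonormal_measure_eq_subspace_measure:
  fixes B :: "'a::euclidean_space set"
  assumes B: "pairwise orthogonal B" "\<forall>b\<in>B. norm b = 1" "span B = S"
  shows "orthonormal_measure B = subspace_measure S"
proof (rule measure_eqI)
  have S: "subspace S" using B(3) by auto
  have "0 \<notin> B" using B(2) by auto
  then have ind: "independent B" using B(1) by (rule pairwise_orthogonal_independent[rotated])
  then have finB: "finite B" by (rule independent_imp_finite)
  obtain C where C: "pairwise orthogonal C" "\<And>b. b \<in> C \<Longrightarrow> norm b = 1" "independent C"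
    "span C = S\<^sup>\<bottom>"
    using orthonormal_basis_subspace[OF subspace_orthogonal_comp, of S] by metis
  have finC: "finite C" using C(3) by (rule independent_imp_finite)
  have BS: "B \<subseteq> S" and CS: "C \<subseteq> S\<^sup>\<bottom>" using B(3) C(4) span_superset by auto
  have disj: "B \<inter> C = {}"
  proof -
    have "B \<inter> C \<subseteq> S \<inter> S\<^sup>\<bottom>" using BS CS by (rule Int_mono)
    then show ?thesis using orthogonal_Int_0[OF S] \<open>0 \<notin> B\<close> by auto
  qed
  have BC: "pairwise orthogonal (B \<union> C)"
  proof -
    have "x \<bullet> y = 0 \<and> y \<bullet> x = 0" if "x \<in> B" "y \<in> C" for x y
      using that BS CS inner_orthogonal_comp[of x S y] by blast
    then show ?thesis using B(1) C(1) unfolding pairwise_def orthogonal_def by blast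
  qed
  have spanBC: "span (B \<union> C) = UNIV"
  proof -
    have "x \<in> span (B \<union> C)" for x
    proof -
      obtain y z where "y \<in> span B" "z \<in> span C" "x = y + z"
        using subspace_sum_orthogonal_comp[OF S] unfolding B(3) C(4) by (metis UNIV_I set_plus_elim)
      then show ?thesis
        using span_mono[of B "B \<union> C"] span_mono[of C "B \<union> C"] by (auto intro!: span_add)
    qed
    then show ?thesis by auto
  qed
  have lb: "orthonormal_measure (B \<union> C) = lborel"
    using BC spanBC B(2) C(2) by (intro orthonormal_measure_UNIV) auto
  have "card B + card C = card (B \<union> C)" using finB finC disj by (simp add: card_Un_disjoint)
  also have "\<dots> = DIM('a)"
  proof -
    have "0 \<notin> B \<union> C" using B(2) C(2) by force
    then show ?thesis
      using indep_card_eq_dim_span[OF pairwise_orthogonal_independent[OF BC]] spanBC by simp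
  qed
  finally have card: "real (card C) = real DIM('a) - real (dim S)"
    using indep_card_eq_dim_span[OF ind] B(3) by simp
  have [measurable]: "closest_point S \<in> borel \<rightarrow>\<^sub>M borel" "subspace_weight S \<in> borel_measurable borel"
    using S by simp_all
  fix A assume "A \<in> sets (orthonormal_measure B)"
  then have [measurable]: "A \<in> sets borel" by simp
  have "emeasure (subspace_measure S) A = (\<integral>\<^sup>+x. indicator A x \<partial>subspace_measure S)" by simp
  also have "\<dots> = (\<integral>\<^sup>+x. ennreal (subspace_weight S x) * indicator A (closest_point S x) \<partial>orthonormal_measure (B \<union> C))"
    unfolding lb by (rule nn_integral_subspace_measure) (use S in auto)
  also have "\<dots> = (\<integral>\<^sup>+x. (\<integral>\<^sup>+y. ennreal (subspace_weight S (x + y)) * indicator A (closest_point S (x + y))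
      \<partial>orthonormal_measure C) \<partial>orthonormal_measure B)"
    by (rule nn_integral_orthonormal_measure_Un) (use finB finC disj in auto)
  also have "\<dots> = (\<integral>\<^sup>+x. indicator A x \<partial>orthonormal_measure B)"
  proof (rule nn_integral_orthonormal_measure_cong)
    interpret product_sigma_finite "\<lambda>_::'a. lborel :: real measure" by (rule product_sigma_finite_lborel)
    interpret C: sigma_finite_measure "\<Pi>\<^sub>M b\<in>C. (lborel :: real measure)"
      by (rule sigma_finite) (use finC in auto)
    show "(\<lambda>x. \<integral>\<^sup>+y. ennreal (subspace_weight S (x + y)) * indicator A (closest_point S (x + y))
      \<partial>orthonormal_measure C) \<in> borel_measurable borel"
      by (subst nn_integral_orthonormal_measure) measurable
    fix x assume "x \<in> span B"
    then have x: "x \<in> S" by (simp add: B)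
    have P: "closest_point S (x + y) = x" if "y \<in> S\<^sup>\<bottom>" for y
      using x that S by (intro closest_point_eqI) auto
    have "(\<integral>\<^sup>+y. ennreal (subspace_weight S (x + y)) * indicator A (closest_point S (x + y)) \<partial>orthonormal_measure C)
      = (\<integral>\<^sup>+y. (ennreal (pi powr (- real (card C) / 2)) * indicator A x) * ennreal (exp (- (1 * (norm y)\<^sup>2))) \<partial>orthonormal_measure C)"
      using C(4) by (intro nn_integral_orthonormal_measure_cong)
         (auto simp: subspace_weight_def P card ennreal_mult mult_ac)
    also have "\<dots> = (ennreal (pi powr (- real (card C) / 2)) * indicator A x) * ennreal ((pi / 1) powr (real (card C) / 2))"
      using finC C by (subst nn_integral_cmult) (auto simp: nn_integral_gaussian_orthonormal[of C 1, simplified])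
    also have "\<dots> = ennreal (pi powr (- real (card C) / 2) * pi powr (real (card C) / 2)) * indicator A x"
      by (simp add: ennreal_mult mult_ac)
    also have "pi powr (- real (card C) / 2) * pi powr (real (card C) / 2) = 1"
      by (simp flip: powr_add)
    finally show "(\<integral>\<^sup>+y. ennreal (subspace_weight S (x + y)) * indicator A (closest_point S (x + y)) \<partial>orthonormal_measure C) = indicator A x"
      by simp
  qed auto
  finally show "emeasure (orthonormal_measure B) A = emeasure (subspace_measure S) A" by simp
qed simp

section \<open>Calculus of subspace measures: Gaussians, orthogonal sums, isometries and
  dilations\<close>

lemma subspace_orthonormal_basis:
  fixes S :: "'a::euclidean_space set"
  assumes "subspace S"
  obtains B where "finite B" "pairwise orthogonal B" "\<forall>b\<in>B. norm b = 1" "span B = S"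
    "card B = dim S" "orthonormal_measure B = subspace_measure S"
proof -
  obtain B where "pairwise orthogonal B" "\<And>x. x \<in> B \<Longrightarrow> norm x = 1" "independent B"
    "card B = dim S" "span B = S"
    using orthonormal_basis_subspace[OF assms] by metis
  then show thesis
    using that[of B] independent_imp_finite orthonormal_measure_eq_subspace_measure by blast
qed

lemma nn_integral_subspace_measure_cong:
  assumes "subspace S" "f \<in> borel_measurable borel" "g \<in> borel_measurable borel"
    and "\<And>x. x \<in> S \<Longrightarrow> f x = g x"
  shows "(\<integral>\<^sup>+x. f x \<partial>subspace_measure S) = (\<integral>\<^sup>+x. g x \<partial>subspace_measure S)"
  using assms by (auto simp: nn_integral_subspace_measure closest_point_subspace_in intro!: nn_integral_cong)

lemma AE_subspace_measure:
  assumes "subspace S"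
  shows "AE x in subspace_measure S. x \<in> S"
proof (rule AE_I)
  have [measurable]: "S \<in> sets borel" using assms by (simp add: closed_subspace)
  show "{x \<in> space (subspace_measure S). x \<notin> S} \<subseteq> - S" "- S \<in> sets (subspace_measure S)" by auto
  have "emeasure (subspace_measure S) (- S) = (\<integral>\<^sup>+x. indicator (- S) x \<partial>subspace_measure S)"
    by (subst nn_integral_indicator) auto
  also have "\<dots> = (\<integral>\<^sup>+x. 0 \<partial>subspace_measure S)"
    using assms by (intro nn_integral_subspace_measure_cong) auto
  finally show "emeasure (subspace_measure S) (- S) = 0" by simp
qed

lemma nn_integral_gaussian_subspace:
  fixes S :: "'a::euclidean_space set"
  assumes "subspace S" "0 < s"
  shows "(\<integral>\<^sup>+x. ennreal (exp (- (s * (norm x)\<^sup>2))) \<partial>subspace_measure S) = ennreal ((pi / s) powr (real (dim S) / 2))"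
proof -
  obtain B where "finite B" "pairwise orthogonal B" "\<forall>b\<in>B. norm b = 1"
    "card B = dim S" "orthonormal_measure B = subspace_measure S"
    using subspace_orthonormal_basis[OF assms(1)] by metis
  with nn_integral_gaussian_orthonormal[of B s] assms(2) show ?thesis by simp
qed

lemma sigma_finite_subspace_measure:
  fixes S :: "'a::euclidean_space set"
  assumes S: "subspace S"
  shows "sigma_finite_measure (subspace_measure S)"
proof
  let ?A = "\<lambda>n::nat. cball (0::'a) (real n)"
  have fin: "emeasure (subspace_measure S) (?A n) \<noteq> \<infinity>" for n
  proof -
    have "emeasure (subspace_measure S) (?A n) =
      (\<integral>\<^sup>+x. indicator (?A n) x \<partial>subspace_measure S)" by simp
    \<comment> \<open>On the ball of radius \<open>n\<close> the Gaussian is at least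
      \<open>exp (- (real n)\<^sup>2)\<close>, and its total integral is finite.\<close>
    also have "\<dots> \<le> (\<integral>\<^sup>+x. ennreal (exp ((real n)\<^sup>2)) * ennreal (exp (- (1 * (norm x)\<^sup>2))) \<partial>subspace_measure S)"
      by (intro nn_integral_mono) (auto simp: indicator_def power_mono simp flip: ennreal_mult exp_add ennreal_1)
    also have "\<dots> < \<infinity>"
      by (subst nn_integral_cmult) (auto simp: nn_integral_gaussian_subspace[OF S, of 1, simplified] ennreal_mult_less_top)
    finally show ?thesis by simp
  qed
  show "\<exists>A. countable A \<and> A \<subseteq> sets (subspace_measure S) \<and> \<Union>A = space (subspace_measure S) \<and>
    (\<forall>a\<in>A. emeasure (subspace_measure S) a \<noteq> \<infinity>)"
  proof (intro exI conjI)
    show "countable (range ?A)" by simp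
    show "\<Union>(range ?A) = space (subspace_measure S)"
      by (auto simp: dist_norm real_arch_simple)
  qed (use fin in auto)
qed

lemma subspace_set_plus: "subspace S \<Longrightarrow> subspace T \<Longrightarrow> subspace (S + T)"
  unfolding set_plus_def using subspace_sums[of S T] by (simp add: Bex_def conj_ac)

text \<open>Orthonormal bases of two orthogonal subspaces unite to one of their sum. This is the
  form in which Fubini is applied to all decompositions into orthogonal pieces, and it yields the
  dimension formula at the same time.\<close>

lemma nn_integral_subspace_measure_plus:
  fixes S T :: "'a::euclidean_space set"
  assumes S: "subspace S" and T: "subspace T" and ST: "T \<subseteq> S\<^sup>\<bottom>"
    and [measurable]: "f \<in> borel_measurable borel"
  shows "(\<integral>\<^sup>+x. f x \<partial>subspace_measure (S + T)) =
    (\<integral>\<^sup>+x. (\<integral>\<^sup>+y. f (x + y) \<partial>subspace_measure T) \<partial>subspace_measure S)"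
    and "dim (S + T) = dim S + dim T"
proof -
  obtain B where B: "finite B" "pairwise orthogonal B" "\<forall>b\<in>B. norm b = 1" "span B = S"
    "card B = dim S" "orthonormal_measure B = subspace_measure S"
    using subspace_orthonormal_basis[OF S] by metis
  obtain C where C: "finite C" "pairwise orthogonal C" "\<forall>b\<in>C. norm b = 1" "span C = T"
    "card C = dim T" "orthonormal_measure C = subspace_measure T"
    using subspace_orthonormal_basis[OF T] by metis
  have 0: "0 \<notin> B \<union> C" using B(3) C(3) by force
  have o: "x \<bullet> y = 0 \<and> y \<bullet> x = 0" if "x \<in> B" "y \<in> C" for x y
  proof -
    have "x \<in> S" "y \<in> S\<^sup>\<bottom>" using that span_base[of x B] span_base[of y C] ST by (auto simp: B C)
    then show ?thesis using inner_orthogonal_comp by blast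
  qed
  have disj: "B \<inter> C = {}" using o 0 by force
  have BC: "pairwise orthogonal (B \<union> C)"
    using B(2) C(2) o unfolding pairwise_def orthogonal_def by blast
  have span: "span (B \<union> C) = S + T"
    unfolding span_Un B(4) C(4) set_plus_def by auto
  have "orthonormal_measure (B \<union> C) = subspace_measure (S + T)"
    using BC span B(3) C(3) by (intro orthonormal_measure_eq_subspace_measure) auto
  then show "(\<integral>\<^sup>+x. f x \<partial>subspace_measure (S + T)) =
    (\<integral>\<^sup>+x. (\<integral>\<^sup>+y. f (x + y) \<partial>subspace_measure T) \<partial>subspace_measure S)"
    using nn_integral_orthonormal_measure_Un[OF assms(4) B(1) C(1) disj] B C by simp
  show "dim (S + T) = dim S + dim T"
    using indep_card_eq_dim_span[OF pairwise_orthogonal_independent[OF BC 0]] span B(1,5) C(1,5) disj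
    by (simp add: card_Un_disjoint)
qed

lemma subspace_measure_UNIV: "subspace_measure UNIV = (lborel :: 'a::euclidean_space measure)"
proof -
  obtain B :: "'a set" where "finite B" "pairwise orthogonal B" "\<forall>b\<in>B. norm b = 1" "span B = UNIV"
    "orthonormal_measure B = subspace_measure UNIV"
    using subspace_orthonormal_basis[OF subspace_UNIV] by metis
  then show ?thesis using orthonormal_measure_UNIV[of B] by simp
qed

lemma nn_integral_lborel_decompose:
  fixes S :: "'a::euclidean_space set"
  assumes S: "subspace S" and [measurable]: "f \<in> borel_measurable borel"
  shows "(\<integral>\<^sup>+x. f x \<partial>lborel) = (\<integral>\<^sup>+x. (\<integral>\<^sup>+y. f (x + y) \<partial>subspace_measure (S\<^sup>\<bottom>)) \<partial>subspace_measure S)"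
  using nn_integral_subspace_measure_plus(1)[OF S subspace_orthogonal_comp[of S], of f]
  by (simp add: subspace_sum_orthogonal_comp[OF S] subspace_measure_UNIV)

lemma dim_orthogonal_comp:
  fixes S :: "'a::euclidean_space set"
  assumes S: "subspace S"
  shows "dim S + dim (S\<^sup>\<bottom>) = DIM('a)"
  using nn_integral_subspace_measure_plus(2)[OF S subspace_orthogonal_comp[of S] order_refl, of "\<lambda>_. 0"]
  by (simp add: subspace_sum_orthogonal_comp[OF S])

lemma nn_integral_subspace_translate:
  fixes S :: "'a::euclidean_space set"
  assumes S: "subspace S" and a: "a \<in> S" and [measurable]: "f \<in> borel_measurable borel"
  shows "(\<integral>\<^sup>+x. f (a + x) \<partial>subspace_measure S) = (\<integral>\<^sup>+x. f x \<partial>subspace_measure S)"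
proof -
  have [measurable]: "closest_point S \<in> borel \<rightarrow>\<^sub>M borel" "subspace_weight S \<in> borel_measurable borel"
    using S by simp_all
  have P: "closest_point S (a + x) = a + closest_point S x" for x
    using linear_add[OF linear_closest_point[OF S], of a x] a S by simp
  have "(\<integral>\<^sup>+x. f x \<partial>subspace_measure S) =
     (\<integral>\<^sup>+x. ennreal (subspace_weight S x) * f (closest_point S x) \<partial>lborel)"
    by (rule nn_integral_subspace_measure) (use S in auto)
  also have "\<dots> = (\<integral>\<^sup>+x. ennreal (subspace_weight S (a + x)) * f (closest_point S (a + x)) \<partial>lborel)"
    by (rule nn_integral_lborel_translate[symmetric]) measurable
  also have "\<dots> = (\<integral>\<^sup>+x. ennreal (subspace_weight S x) * f (a + closest_point S x) \<partial>lborel)"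
    by (simp add: P subspace_weight_def)
  also have "\<dots> = (\<integral>\<^sup>+x. f (a + x) \<partial>subspace_measure S)"
    by (rule nn_integral_subspace_measure[symmetric]) (use S in auto)
  finally show ?thesis by simp
qed

lemma dim_orthogonal_image:
  fixes g :: "'a::euclidean_space \<Rightarrow> 'a"
  assumes "orthogonal_transformation g"
  shows "dim (g ` S) = dim S"
  by (rule dim_image_eq[OF orthogonal_transformation_linear[OF assms]
        inj_on_subset[OF orthogonal_transformation_inj[OF assms] subset_UNIV]])

lemma subspace_measure_orthogonal_image:
  fixes g :: "'a::euclidean_space \<Rightarrow> 'a"
  assumes g: "orthogonal_transformation g" and S: "subspace S"
  shows "subspace_measure (g ` S) = distr (subspace_measure S) borel g"
proof (rule measure_eqI)
  have [measurable]: "g \<in> borel \<rightarrow>\<^sub>M borel" by (rule orthogonal_transformation_borel[OF g])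
  have lin: "linear g" using g by (rule orthogonal_transformation_linear)
  have gS: "subspace (g ` S)" using lin S by (rule linear_subspace_image)
  have w: "subspace_weight (g ` S) (g x) = subspace_weight S x" for x
    unfolding subspace_weight_def closest_point_orthogonal_image[OF g S] dim_orthogonal_image[OF g]
    by (simp add: linear_diff[OF lin, symmetric] orthogonal_transformation_norm[OF g])
  have [measurable]: "closest_point S \<in> borel \<rightarrow>\<^sub>M borel" "subspace_weight S \<in> borel_measurable borel"
    "closest_point (g ` S) \<in> borel \<rightarrow>\<^sub>M borel" "subspace_weight (g ` S) \<in> borel_measurable borel"
    using S gS by simp_all
  fix A assume "A \<in> sets (subspace_measure (g ` S))"
  then have [measurable]: "A \<in> sets borel" by simp
  have "emeasure (subspace_measure (g ` S)) A = (\<integral>\<^sup>+x. indicator A x \<partial>subspace_measure (g ` S))"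
    by simp
  also have "\<dots> = (\<integral>\<^sup>+x. ennreal (subspace_weight (g ` S) x) * indicator A (closest_point (g ` S) x) \<partial>lborel)"
    by (rule nn_integral_subspace_measure) (use gS in auto)
  also have "\<dots> = (\<integral>\<^sup>+x. ennreal (subspace_weight (g ` S) (g x)) * indicator A (closest_point (g ` S) (g x)) \<partial>lborel)"
    by (rule nn_integral_lborel_orthogonal[OF g, symmetric]) measurable
  also have "\<dots> = (\<integral>\<^sup>+x. ennreal (subspace_weight S x) * indicator A (g (closest_point S x)) \<partial>lborel)"
    by (simp add: w closest_point_orthogonal_image[OF g S])
  also have "\<dots> = (\<integral>\<^sup>+x. indicator A (g x) \<partial>subspace_measure S)"
    by (rule nn_integral_subspace_measure[symmetric]) (use S in auto)
  also have "\<dots> = (\<integral>\<^sup>+x. indicator A x \<partial>distr (subspace_measure S) borel g)"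
    by (subst nn_integral_distr) auto
  also have "\<dots> = emeasure (distr (subspace_measure S) borel g) A" by simp
  finally show "emeasure (subspace_measure (g ` S)) A = emeasure (distr (subspace_measure S) borel g) A" .
qed simp

text \<open>Reduced to the dilation of Lebesgue measure on the whole space: \<open>f\<close> on
  \<open>S\<close> is multiplied by a Gaussian on \<open>S\<^sup>\<bottom>\<close>, the product is
  dilated, and the power of \<open>c\<close> that belongs to the Gaussian is cancelled.\<close>

lemma nn_integral_subspace_scale:
  fixes S :: "'a::euclidean_space set"
  assumes S: "subspace S" and c: "0 < c" and [measurable]: "f \<in> borel_measurable borel"
  shows "(\<integral>\<^sup>+x. f x \<partial>subspace_measure S) = ennreal (c powr real (dim S)) * (\<integral>\<^sup>+x. f (c *\<^sub>R x) \<partial>subspace_measure S)"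
proof -
  have [measurable]: "closest_point S \<in> borel \<rightarrow>\<^sub>M borel" "subspace_weight S \<in> borel_measurable borel"
    using S by simp_all
  interpret C: sigma_finite_measure "subspace_measure (S\<^sup>\<bottom>)"
    by (rule sigma_finite_subspace_measure[OF subspace_orthogonal_comp])
  define q where "q = real (dim (S\<^sup>\<bottom>)) / 2"
  have P: "closest_point S (c *\<^sub>R x) = c *\<^sub>R closest_point S x" for x
    using linear_scale[OF linear_closest_point[OF S]] .
  have Pxy: "closest_point S (x + y) = x" if "x \<in> S" "y \<in> S\<^sup>\<bottom>" for x y
    using that S by (intro closest_point_eqI) auto
  \<comment> \<open>The width \<open>s\<close> is kept as a parameter because the dilation by
    \<open>c\<close> changes a Gaussian of parameter 1 into one of parameter
    \<open>c\<^sup>2\<close>.\<close>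
  have dec: "(\<integral>\<^sup>+z. f (r *\<^sub>R closest_point S z) * ennreal (exp (- (s * (norm (z - closest_point S z))\<^sup>2))) \<partial>lborel)
    = (\<integral>\<^sup>+x. f (r *\<^sub>R x) \<partial>subspace_measure S) * ennreal ((pi / s) powr q)" if "0 < s" for r s
  proof -
    have "(\<integral>\<^sup>+z. f (r *\<^sub>R closest_point S z) * ennreal (exp (- (s * (norm (z - closest_point S z))\<^sup>2))) \<partial>lborel)
      = (\<integral>\<^sup>+x. (\<integral>\<^sup>+y. f (r *\<^sub>R closest_point S (x + y)) * ennreal (exp (- (s * (norm (x + y - closest_point S (x + y)))\<^sup>2)))
         \<partial>subspace_measure (S\<^sup>\<bottom>)) \<partial>subspace_measure S)"
      by (rule nn_integral_lborel_decompose[OF S]) measurable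
    also have "\<dots> = (\<integral>\<^sup>+x. f (r *\<^sub>R x) * ennreal ((pi / s) powr q) \<partial>subspace_measure S)"
    proof (rule nn_integral_subspace_measure_cong[OF S])
      fix x assume x: "x \<in> S"
      have "(\<integral>\<^sup>+y. f (r *\<^sub>R closest_point S (x + y)) * ennreal (exp (- (s * (norm (x + y - closest_point S (x + y)))\<^sup>2)))
         \<partial>subspace_measure (S\<^sup>\<bottom>)) = (\<integral>\<^sup>+y. f (r *\<^sub>R x) * ennreal (exp (- (s * (norm y)\<^sup>2))) \<partial>subspace_measure (S\<^sup>\<bottom>))"
        by (rule nn_integral_subspace_measure_cong[OF subspace_orthogonal_comp]) (auto simp: Pxy x)
      also have "\<dots> = f (r *\<^sub>R x) * ennreal ((pi / s) powr q)"
        using that by (simp add: nn_integral_cmult nn_integral_gaussian_subspace[OF subspace_orthogonal_comp] q_def)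
      finally show "(\<integral>\<^sup>+y. f (r *\<^sub>R closest_point S (x + y)) * ennreal (exp (- (s * (norm (x + y - closest_point S (x + y)))\<^sup>2)))
         \<partial>subspace_measure (S\<^sup>\<bottom>)) = f (r *\<^sub>R x) * ennreal ((pi / s) powr q)" .
    qed measurable
    also have "\<dots> = (\<integral>\<^sup>+x. f (r *\<^sub>R x) \<partial>subspace_measure S) * ennreal ((pi / s) powr q)"
      by (simp add: nn_integral_multc)
    finally show ?thesis .
  qed
  have "(\<integral>\<^sup>+x. f x \<partial>subspace_measure S) * ennreal (pi powr q) =
    (\<integral>\<^sup>+z. f (closest_point S z) * ennreal (exp (- ((norm (z - closest_point S z))\<^sup>2))) \<partial>lborel)"
    using dec[of 1 1] by simp
  also have "\<dots> = ennreal (\<bar>c\<bar> ^ DIM('a)) *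
     (\<integral>\<^sup>+z. f (c *\<^sub>R closest_point S z) * ennreal (exp (- (c\<^sup>2 * (norm (z - closest_point S z))\<^sup>2))) \<partial>lborel)"
    using c by (subst nn_integral_lborel_scale[of _ c])
      (auto simp: P power_mult_distrib simp flip: scaleR_diff_right)
  also have "\<dots> = ennreal (\<bar>c\<bar> ^ DIM('a)) * ((\<integral>\<^sup>+x. f (c *\<^sub>R x) \<partial>subspace_measure S) * ennreal ((pi / c\<^sup>2) powr q))"
    using c by (subst dec) auto
  also have "(pi / c\<^sup>2) powr q = pi powr q * c powr (- real (dim (S\<^sup>\<bottom>)))"
  proof -
    have "c\<^sup>2 = c powr 2" using c by simp
    then have "(c\<^sup>2) powr q = c powr real (dim (S\<^sup>\<bottom>))" by (simp add: powr_powr q_def)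
    then show ?thesis using c by (simp add: powr_divide powr_minus field_simps)
  qed
  also have "\<bar>c\<bar> ^ DIM('a) = c powr real (dim S) * c powr real (dim (S\<^sup>\<bottom>))"
    using c dim_orthogonal_comp[OF S] by (simp add: powr_realpow power_add[symmetric])
  also have "ennreal (c powr real (dim S) * c powr real (dim (S\<^sup>\<bottom>))) *
      ((\<integral>\<^sup>+x. f (c *\<^sub>R x) \<partial>subspace_measure S) * ennreal (pi powr q * c powr (- real (dim (S\<^sup>\<bottom>))))) =
    (ennreal (c powr real (dim S)) * (\<integral>\<^sup>+x. f (c *\<^sub>R x) \<partial>subspace_measure S)) * ennreal (pi powr q) *
      ennreal (c powr real (dim (S\<^sup>\<bottom>)) * c powr (- real (dim (S\<^sup>\<bottom>))))"
    by (simp add: ennreal_mult mult_ac)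
  also have "c powr real (dim (S\<^sup>\<bottom>)) * c powr (- real (dim (S\<^sup>\<bottom>))) = 1"
    using c by (simp flip: powr_add)
  finally have "(\<integral>\<^sup>+x. f x \<partial>subspace_measure S) * ennreal (pi powr q) =
    (ennreal (c powr real (dim S)) * (\<integral>\<^sup>+x. f (c *\<^sub>R x) \<partial>subspace_measure S)) * ennreal (pi powr q)"
    by simp
  then show ?thesis
    by (subst (asm) mult_right_ennreal_cancel) auto
qed

section \<open>Euclidean measure on planes\<close>

lemma direction_translate:
  assumes "subspace S"
  shows "direction ((+) w ` S) = S"
  unfolding direction_def
proof (intro equalityI subsetI)
  fix x assume "x \<in> S"
  then have "x = (w + x) - (w + 0)" "w + x \<in> (+) w ` S" "w + 0 \<in> (+) w ` S"
    using subspace_0[OF assms] by auto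
  then show "x \<in> {x - y |x y. x \<in> (+) w ` S \<and> y \<in> (+) w ` S}" by blast
qed (auto intro: subspace_diff[OF assms])

lemma foot_translate:
  fixes S :: "(real^'n) set"
  assumes S: "subspace S"
  shows "foot ((+) w ` S) = w - closest_point S w"
  unfolding foot_def
proof (rule closest_point_unique[symmetric])
  have "(+) w ` S = (+) (w - closest_point S w) ` S"
  proof (intro equalityI image_subsetI)
    fix x assume x: "x \<in> S"
    have P: "closest_point S w \<in> S" using S by (rule closest_point_subspace_in)
    show "w + x \<in> (+) (w - closest_point S w) ` S"
      by (rule image_eqI[where x="closest_point S w + x"]) (use x P S in \<open>auto intro: subspace_add\<close>)
    show "w - closest_point S w + x \<in> (+) w ` S"
      by (rule image_eqI[where x="x - closest_point S w"]) (use x P S in \<open>auto intro: subspace_diff\<close>)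
  qed
  note eq = this
  show "convex ((+) w ` S)" "closed ((+) w ` S)"
    using S by (auto intro: convex_translation closed_translation subspace_imp_convex closed_subspace)
  show "w - closest_point S w \<in> (+) w ` S"
    unfolding eq using subspace_0[OF S] by force
  show "\<forall>z\<in>(+) w ` S. dist 0 (w - closest_point S w) \<le> dist 0 z"
    unfolding eq
  proof (intro ballI)
    fix z assume "z \<in> (+) (w - closest_point S w) ` S"
    then obtain x where x: "x \<in> S" "z = w - closest_point S w + x" by auto
    have "orthogonal (w - closest_point S w) x"
      using diff_closest_point_orthogonal_comp[OF S, of w] x(1)
      by (auto simp: orthogonal_comp_def orthogonal_commute)
    from norm_add_Pythagorean[OF this]
    have "(norm (w - closest_point S w))\<^sup>2 \<le> (norm z)\<^sup>2" by (simp add: x)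
    then show "dist 0 (w - closest_point S w) \<le> dist 0 z" by simp
  qed
qed

text \<open>The basis picked by \<open>SOME\<close> disappears here, since every orthonormal basis
  of \<open>S\<close> gives \<open>subspace_measure S\<close>.\<close>

lemma plane_measure_translate:
  fixes S :: "(real^'n) set"
  assumes S: "subspace S"
  shows "plane_measure ((+) w ` S) =
    completion (distr (subspace_measure S) borel ((+) (w - closest_point S w)))"
proof -
  let ?Q = "\<lambda>B. pairwise orthogonal B \<and> (\<forall>b\<in>B. norm b = 1) \<and> span B = S"
  define B where "B = (SOME B. ?Q B)"
  have "\<exists>B. ?Q B" using subspace_orthonormal_basis[OF S] by metis
  then have "?Q B" unfolding B_def by (rule someI_ex)
  then have B: "pairwise orthogonal B" "\<forall>b\<in>B. norm b = 1" "span B = S" by auto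
  have "distr (subspace_measure S) borel ((+) (w - closest_point S w)) =
    distr (\<Pi>\<^sub>M b\<in>B. lborel) borel (\<lambda>t. (w - closest_point S w) + (\<Sum>b\<in>B. t b *\<^sub>R b))"
    unfolding orthonormal_measure_eq_subspace_measure[OF B, symmetric] orthonormal_measure_def
    by (subst distr_distr) (auto simp: comp_def)
  then show ?thesis
    unfolding plane_measure_def direction_translate[OF S] foot_translate[OF S] Let_def B_def by simp
qed

lemma plane_measure_subspace:
  fixes S :: "(real^'n) set"
  assumes S: "subspace S"
  shows "plane_measure S = completion (subspace_measure S)"
proof -
  have "plane_measure ((+) 0 ` S) = completion (distr (subspace_measure S) borel (\<lambda>x. x))"
    unfolding plane_measure_translate[OF S] using S subspace_0[OF S] by (simp cong: distr_cong)
  also have "distr (subspace_measure S) borel (\<lambda>x. x) = subspace_measure S"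
    by (intro measure_eqI) (auto simp: emeasure_distr)
  finally show ?thesis by simp
qed

section \<open>Orthonormal frames\<close>

text \<open>Indexed by the numbers below \<open>CARD('n)\<close> instead of the coordinate type, so
  that initial segments of a frame span a flag of subspaces.\<close>

definition orthonormal_frame :: "(nat \<Rightarrow> real^'n) \<Rightarrow> bool" where
  "orthonormal_frame b \<longleftrightarrow> (\<forall>i<CARD('n). \<forall>l<CARD('n). b i \<bullet> b l = (if i = l then 1 else 0))"

lemma orthonormal_frame_expand:
  fixes b :: "nat \<Rightarrow> real^'n"
  assumes b: "orthonormal_frame b"
  shows "(\<Sum>i<CARD('n). (b i \<bullet> x) *\<^sub>R b i) = x"
proof -
  let ?B = "b ` {..<CARD('n)}"
  have bb: "b i \<bullet> b l = (if i = l then 1 else 0)" if "i < CARD('n)" "l < CARD('n)" for i l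
    using b that by (auto simp: orthonormal_frame_def)
  have inj: "inj_on b {..<CARD('n)}"
  proof (rule inj_onI)
    fix i l assume "i \<in> {..<CARD('n)}" "l \<in> {..<CARD('n)}" "b i = b l"
    then show "i = l" using bb[of i l] bb[of l l] by (auto split: if_splits)
  qed
  have orth: "pairwise orthogonal ?B" by (auto simp: pairwise_def orthogonal_def bb)
  have 1: "norm y = 1" if "y \<in> ?B" for y using that by (auto simp: norm_eq_1 bb)
  have "0 \<notin> ?B" using 1 by force
  then have ind: "independent ?B" using orth by (simp add: pairwise_orthogonal_independent)
  have "card ?B = dim (UNIV :: (real^'n) set)" by (simp add: card_image[OF inj])
  then have "UNIV \<subseteq> span ?B" by (intro card_ge_dim_independent) (use ind in auto)
  then have "(\<Sum>y\<in>?B. (x \<bullet> y) *\<^sub>R y) = x"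
    by (intro orthonormal_basis_expand) (use orth 1 in auto)
  then show ?thesis by (simp add: sum.reindex[OF inj] inner_commute)
qed

text \<open>Bases of \<xi>, of its complement \<open>W\<close> inside \<open>V\<close>, and of
  \<open>V\<^sup>\<bottom>\<close> are concatenated. With frames adapted to such flags a single
  matrix can move \<xi> while it preserves \<open>V\<close>.\<close>

lemma orthonormal_flag_exists:
  fixes V \<xi> :: "(real^'n) set"
  assumes V: "subspace V" and \<xi>: "subspace \<xi>" "\<xi> \<subseteq> V"
  obtains b where "orthonormal_frame b" "span (b ` {..<dim \<xi>}) = \<xi>" "span (b ` {..<dim V}) = V"
    "\<And>i. dim V \<le> i \<Longrightarrow> i < CARD('n) \<Longrightarrow> b i \<in> V\<^sup>\<bottom>"
proof -
  have ex: "\<exists>xs. distinct xs \<and> length xs = dim S \<and> span (set xs) = S \<and> pairwise orthogonal (set xs) \<and> (\<forall>x\<in>set xs. norm x = 1)"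
    if S: "subspace S" for S :: "(real^'n) set"
  proof -
    obtain B where B: "finite B" "pairwise orthogonal B" "\<forall>b\<in>B. norm b = 1" "span B = S" "card B = dim S"
      using subspace_orthonormal_basis[OF S] by metis
    obtain xs where "set xs = B" "distinct xs" using finite_distinct_list[OF B(1)] by blast
    with B show ?thesis by (intro exI[of _ xs]) (auto simp: distinct_card)
  qed
  define W where "W = V \<inter> \<xi>\<^sup>\<bottom>"
  have W: "subspace W" unfolding W_def using subspace_inter[OF V subspace_orthogonal_comp] .
  obtain xs where xs: "distinct xs" "length xs = dim \<xi>" "span (set xs) = \<xi>" "pairwise orthogonal (set xs)" "\<forall>x\<in>set xs. norm x = 1"
    using ex[OF \<xi>(1)] by blast
  obtain ys where ys: "distinct ys" "length ys = dim W" "span (set ys) = W" "pairwise orthogonal (set ys)" "\<forall>x\<in>set ys. norm x = 1"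
    using ex[OF W] by blast
  obtain zs where zs: "distinct zs" "length zs = dim (V\<^sup>\<bottom>)" "span (set zs) = V\<^sup>\<bottom>" "pairwise orthogonal (set zs)" "\<forall>x\<in>set zs. norm x = 1"
    using ex[OF subspace_orthogonal_comp] by blast
  have xsS: "set xs \<subseteq> \<xi>" and ysS: "set ys \<subseteq> W" and zsS: "set zs \<subseteq> V\<^sup>\<bottom>"
    using xs(3) ys(3) zs(3) span_superset by blast+
  have sumV: "\<xi> + W = V"
  proof (intro equalityI subsetI)
    fix v assume v: "v \<in> V"
    have P: "closest_point \<xi> v \<in> \<xi>" using \<xi>(1) by (rule closest_point_subspace_in)
    have "v - closest_point \<xi> v \<in> W"
      unfolding W_def using diff_closest_point_orthogonal_comp[OF \<xi>(1)] subspace_diff[OF V v, of "closest_point \<xi> v"] P \<xi>(2)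
      by blast
    with P show "v \<in> \<xi> + W" using set_plus_intro[of "closest_point \<xi> v" \<xi> "v - closest_point \<xi> v" W] by simp
  next
    fix v assume "v \<in> \<xi> + W"
    then show "v \<in> V" using subspace_add[OF V] \<xi>(2) by (auto simp: W_def elim!: set_plus_elim)
  qed
  have dimV: "dim V = dim \<xi> + dim W"
    using nn_integral_subspace_measure_plus(2)[OF \<xi>(1) W, of "\<lambda>_. 0"] sumV by (simp add: W_def)
  define L where "L = xs @ ys @ zs"
  have len: "length L = CARD('n)"
    using dim_orthogonal_comp[OF V] by (simp add: L_def xs ys zs dimV)
  have o1: "x \<bullet> y = 0 \<and> y \<bullet> x = 0" if "x \<in> set xs" "y \<in> set ys" for x y
    using that xsS ysS inner_orthogonal_comp[of x \<xi> y] unfolding W_def by blast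
  have o2: "x \<bullet> y = 0 \<and> y \<bullet> x = 0" if "x \<in> set xs \<union> set ys" "y \<in> set zs" for x y
    using that xsS ysS zsS \<xi>(2) inner_orthogonal_comp[of x V y] unfolding W_def by blast
  have orth: "pairwise orthogonal (set L)"
    using xs(4) ys(4) zs(4) o1 o2 unfolding L_def pairwise_def orthogonal_def by (simp, blast)
  have norm1: "norm x = 1" if "x \<in> set L" for x
    using that xs(5) ys(5) zs(5) by (auto simp: L_def)
  have nz: "x \<bullet> x \<noteq> 0" if "x \<in> set L" for x using norm1[OF that] by (metis inner_eq_zero_iff norm_zero zero_neq_one)
  have dis: "distinct L"
    using xs(1) ys(1) zs(1) o1 o2 nz unfolding L_def distinct_append set_append by blast
  have "orthonormal_frame ((!) L)"
    unfolding orthonormal_frame_def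
  proof (intro allI impI)
    fix i l assume il: "i < CARD('n)" "l < CARD('n)"
    show "L ! i \<bullet> L ! l = (if i = l then 1 else 0)"
    proof (cases "i = l")
      case True then show ?thesis using norm1[of "L ! i"] il len by (simp add: norm_eq_1)
    next
      case False
      then have "L ! i \<noteq> L ! l" using dis il len by (simp add: nth_eq_iff_index_eq)
      then show ?thesis using orth il len False unfolding pairwise_def orthogonal_def by simp
    qed
  qed
  moreover have "span ((!) L ` {..<dim \<xi>}) = \<xi>"
    using nth_image[of "dim \<xi>" L] by (simp add: L_def xs lessThan_atLeast0 flip: xs(2))
  moreover have "span ((!) L ` {..<dim V}) = V"
  proof -
    have "(!) L ` {..<dim V} = set xs \<union> set ys"
      using nth_image[of "dim V" L] by (simp add: L_def dimV lessThan_atLeast0 flip: xs(2) ys(2))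
    then show ?thesis using sumV by (simp add: span_Un xs(3) ys(3) set_plus_def) blast
  qed
  moreover have "L ! i \<in> V\<^sup>\<bottom>" if "dim V \<le> i" "i < CARD('n)" for i
  proof -
    have "L ! i \<in> set zs"
      using that len by (auto simp: L_def nth_append xs ys zs dimV)
    then show ?thesis using zsS by blast
  qed
  ultimately show thesis using that by blast
qed

text \<open>The sum of the rank one matrices \<open>c i\<close> times the transpose of
  \<open>b i\<close>. For an orthonormal frame \<open>b\<close> it is the linear map that sends each
  \<open>b i\<close> to \<open>c i\<close>.\<close>

definition frame_matrix :: "(nat \<Rightarrow> real^'n) \<Rightarrow> (nat \<Rightarrow> real^'n) \<Rightarrow> real^'n^'n" where
  "frame_matrix b c = (\<chi> r s. \<Sum>i<CARD('n). c i $ r * b i $ s)"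

lemma frame_matrix_mult:
  fixes b c :: "nat \<Rightarrow> real^'n"
  shows "frame_matrix b c *v x = (\<Sum>i<CARD('n). (b i \<bullet> x) *\<^sub>R c i)"
proof -
  have "(frame_matrix b c *v x) $ r = (\<Sum>i<CARD('n). (b i \<bullet> x) *\<^sub>R c i) $ r" for r
  proof -
    have "(frame_matrix b c *v x) $ r = (\<Sum>s\<in>UNIV. \<Sum>i<CARD('n). c i $ r * b i $ s * x $ s)"
      by (simp add: frame_matrix_def matrix_vector_mult_def sum_distrib_right)
    also have "\<dots> = (\<Sum>i<CARD('n). \<Sum>s\<in>UNIV. c i $ r * b i $ s * x $ s)" by (rule sum.swap)
    also have "\<dots> = (\<Sum>i<CARD('n). (b i \<bullet> x) * c i $ r)"
      by (simp add: inner_vec_def sum_distrib_left mult_ac)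
    finally show ?thesis by simp
  qed
  then show ?thesis by (simp add: vec_eq_iff)
qed

lemma frame_matrix_frame:
  fixes b c :: "nat \<Rightarrow> real^'n"
  assumes "orthonormal_frame b" "l < CARD('n)"
  shows "frame_matrix b c *v b l = c l"
proof -
  have "frame_matrix b c *v b l = (\<Sum>i<CARD('n). (if i = l then 1 else 0) *\<^sub>R c i)"
    using assms unfolding frame_matrix_mult orthonormal_frame_def by (intro sum.cong) auto
  also have "\<dots> = (\<Sum>i<CARD('n). if i = l then c i else 0)"
    by (intro sum.cong) auto
  finally show ?thesis using assms(2) by simp
qed

lemma orthogonal_matrix_frame:
  fixes b c :: "nat \<Rightarrow> real^'n"
  assumes b: "orthonormal_frame b" and c: "orthonormal_frame c"
  shows "orthogonal_matrix (frame_matrix b c)"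
proof -
  let ?f = "(*v) (frame_matrix b c)"
  have "norm (?f x) = norm x" for x
  proof -
    have *: "(\<Sum>i<CARD('n). t i *\<^sub>R d i) \<bullet> (\<Sum>i<CARD('n). t i *\<^sub>R d i) = (\<Sum>i<CARD('n). t i * t i)"
      if "orthonormal_frame d" for d :: "nat \<Rightarrow> real^'n" and t
    proof -
      have "(\<Sum>i<CARD('n). t i *\<^sub>R d i) \<bullet> (\<Sum>i<CARD('n). t i *\<^sub>R d i) =
        (\<Sum>i<CARD('n). \<Sum>l<CARD('n). t i * t l * (d l \<bullet> d i))"
        by (simp add: inner_sum_left inner_sum_right sum_distrib_left mult_ac)
      also have "\<dots> = (\<Sum>i<CARD('n). \<Sum>l<CARD('n). if l = i then t i * t l else 0)"
        using that by (intro sum.cong) (auto simp: orthonormal_frame_def)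
      finally show ?thesis by simp
    qed
    have "?f x \<bullet> ?f x = (\<Sum>i<CARD('n). (b i \<bullet> x) * (b i \<bullet> x))"
      unfolding frame_matrix_mult by (rule *[OF c])
    also have "\<dots> = x \<bullet> x" using *[OF b, of "\<lambda>i. b i \<bullet> x"] by (simp add: orthonormal_frame_expand[OF b])
    finally show ?thesis by (simp add: norm_eq)
  qed
  then have "orthogonal_transformation ?f" by (simp add: orthogonal_transformation)
  then show ?thesis by (simp add: orthogonal_transformation_matrix)
qed

lemma frame_matrix_image_span:
  fixes b c :: "nat \<Rightarrow> real^'n"
  assumes "orthonormal_frame b" "I \<subseteq> {..<CARD('n)}"
  shows "(*v) (frame_matrix b c) ` span (b ` I) = span (c ` I)"
proof -
  have "(*v) (frame_matrix b c) ` span (b ` I) = span ((*v) (frame_matrix b c) ` b ` I)"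
    by (rule linear_span_image[symmetric]) simp
  also have "(*v) (frame_matrix b c) ` b ` I = c ` I"
    using assms by (auto simp: image_image frame_matrix_frame subset_iff intro!: image_cong)
  finally show ?thesis .
qed

section \<open>Stabilizers of a subspace and their action on its Grassmannian\<close>

lemma orthogonal_matrix_transformation:
  "orthogonal_matrix (A :: real^'n^'n) \<Longrightarrow> orthogonal_transformation ((*v) A)"
  by (simp add: orthogonal_transformation_matrix)

definition stabilizer :: "(real^'n) set \<Rightarrow> (real^'n^'n) set" where
  "stabilizer V = {Q. orthogonal_matrix Q \<and> (*v) Q ` V = V}"

text \<open>The matrix carries a frame adapted to the flag of \<xi> and \<open>V\<close> to one
  adapted to the flag of \<zeta> and \<open>V\<close>. Transitivity is what forces invariant
  probability measures on the Grassmannian to be unique.\<close>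

lemma stabilizer_transitive:
  fixes V :: "(real^'n) set"
  assumes "subspace V" "\<xi> \<in> grassmannian V j" "\<zeta> \<in> grassmannian V j"
  obtains Q where "Q \<in> stabilizer V" "(*v) Q ` \<xi> = \<zeta>"
proof -
  have \<xi>: "subspace \<xi>" "\<xi> \<subseteq> V" "dim \<xi> = j" and \<zeta>: "subspace \<zeta>" "\<zeta> \<subseteq> V" "dim \<zeta> = j"
    using assms by (auto simp: grassmannian_def)
  obtain b where b: "orthonormal_frame b" "span (b ` {..<j}) = \<xi>" "span (b ` {..<dim V}) = V"
    using orthonormal_flag_exists[OF assms(1) \<xi>(1,2)] \<xi>(3) by metis
  obtain c where c: "orthonormal_frame c" "span (c ` {..<j}) = \<zeta>" "span (c ` {..<dim V}) = V"
    using orthonormal_flag_exists[OF assms(1) \<zeta>(1,2)] \<zeta>(3) by metis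
  have "dim V \<le> CARD('n)" "j \<le> dim V"
    using dim_subset_UNIV[of V] dim_subset[OF \<xi>(2)] \<xi>(3) by auto
  then have "(*v) (frame_matrix b c) ` V = V" "(*v) (frame_matrix b c) ` \<xi> = \<zeta>"
    using frame_matrix_image_span[OF b(1), of "{..<dim V}" c] frame_matrix_image_span[OF b(1), of "{..<j}" c]
    by (auto simp: b c)
  then show thesis using that[of "frame_matrix b c"] orthogonal_matrix_frame[OF b(1) c(1)]
    by (auto simp: stabilizer_def)
qed

section \<open>Gram--Schmidt orthonormalization\<close>

text \<open>Normalization by \<open>sgn\<close> sends 0 to 0, so dependent input produces zero
  vectors. This makes the procedure total, and Borel measurable without case distinctions.\<close>

function gram_schmidt :: "(nat \<Rightarrow> 'a::euclidean_space) \<Rightarrow> nat \<Rightarrow> 'a" where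
  "gram_schmidt y i = sgn (y i - (\<Sum>l\<in>{..<i}. (y i \<bullet> gram_schmidt y l) *\<^sub>R gram_schmidt y l))"
  by pat_completeness auto
termination by (relation "Wellfounded.measure snd") auto

declare gram_schmidt.simps [simp del]

lemma gram_schmidt_measurable:
  assumes "\<And>l. l \<le> i \<Longrightarrow> (\<lambda>x. Y x l) \<in> borel_measurable M"
  shows "(\<lambda>x. gram_schmidt (Y x) i) \<in> borel_measurable M"
  using assms
proof (induction i rule: less_induct)
  case (less i)
  have [measurable]: "(\<lambda>x. Y x i) \<in> borel_measurable M" using less.prems by simp
  have [measurable]: "(\<lambda>x. gram_schmidt (Y x) l) \<in> borel_measurable M" if "l \<in> {..<i}" for l
    using that less by simp
  show ?case unfolding gram_schmidt.simps[of _ i] sgn_div_norm by measurable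
qed

text \<open>The recursion consists of linear combinations, inner products and norms, all of which an
  orthogonal map respects.\<close>

lemma gram_schmidt_orthogonal_transformation:
  assumes g: "orthogonal_transformation g"
  shows "gram_schmidt (\<lambda>i. g (y i)) i = g (gram_schmidt y i)"
proof (induction i rule: less_induct)
  case (less i)
  have lin: "linear g" using g by (rule orthogonal_transformation_linear)
  have "gram_schmidt (\<lambda>i. g (y i)) i = sgn (g (y i) - (\<Sum>l\<in>{..<i}. (g (y i) \<bullet> g (gram_schmidt y l)) *\<^sub>R g (gram_schmidt y l)))"
    by (subst gram_schmidt.simps) (simp add: less)
  also have "\<dots> = sgn (g (y i - (\<Sum>l\<in>{..<i}. (y i \<bullet> gram_schmidt y l) *\<^sub>R gram_schmidt y l)))"
    using g by (simp add: orthogonal_transformation_def linear_diff[OF lin] linear_sum[OF lin] linear_scale[OF lin])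
  also have "\<dots> = g (sgn (y i - (\<Sum>l\<in>{..<i}. (y i \<bullet> gram_schmidt y l) *\<^sub>R gram_schmidt y l)))"
    using g by (simp add: sgn_div_norm orthogonal_transformation_norm linear_scale[OF lin])
  also have "\<dots> = g (gram_schmidt y i)" by (subst (2) gram_schmidt.simps) simp
  finally show ?case .
qed

lemma gram_schmidt_inner_self:
  assumes "gram_schmidt y i \<noteq> 0"
  shows "gram_schmidt y i \<bullet> gram_schmidt y i = 1"
proof -
  obtain z where z: "gram_schmidt y i = sgn z" by (metis gram_schmidt.simps)
  then show ?thesis using assms by (simp add: norm_sgn sgn_zero_iff flip: norm_eq_1)
qed

lemma gram_schmidt_inner:
  "l < i \<Longrightarrow> gram_schmidt y i \<bullet> gram_schmidt y l = 0"
proof (induction i arbitrary: l rule: less_induct)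
  case (less i)
  define z where "z = y i - (\<Sum>m\<in>{..<i}. (y i \<bullet> gram_schmidt y m) *\<^sub>R gram_schmidt y m)"
  have ml: "gram_schmidt y m \<bullet> gram_schmidt y l = 0" if "m \<noteq> l" "m < i" for m
    using that less.IH[of m l] less.IH[of l m] less.prems by (cases "m < l") (auto simp: inner_commute)
  have "(\<Sum>m\<in>{..<i}. (y i \<bullet> gram_schmidt y m) *\<^sub>R gram_schmidt y m) \<bullet> gram_schmidt y l =
    (\<Sum>m\<in>{..<i}. (y i \<bullet> gram_schmidt y m) * (gram_schmidt y m \<bullet> gram_schmidt y l))"
    by (simp add: inner_sum_left)
  also have "\<dots> = (\<Sum>m\<in>{..<i}. if m = l then (y i \<bullet> gram_schmidt y l) * (gram_schmidt y l \<bullet> gram_schmidt y l) else 0)"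
    by (intro sum.cong) (auto simp: ml)
  \<comment> \<open>Either \<open>gram_schmidt y l\<close> is a unit vector, or it is the default
    value 0 and both sides vanish.\<close>
  also have "\<dots> = y i \<bullet> gram_schmidt y l"
    using less.prems gram_schmidt_inner_self[of y l] by (cases "gram_schmidt y l = 0") auto
  finally have "z \<bullet> gram_schmidt y l = 0" by (simp add: z_def inner_diff_left)
  moreover have "gram_schmidt y i = sgn z" unfolding z_def by (rule gram_schmidt.simps)
  ultimately show ?case by (simp add: sgn_div_norm)
qed

lemma gram_schmidt_in_span: "gram_schmidt y i \<in> span (y ` {..i})"
proof (induction i rule: less_induct)
  case (less i)
  have "gram_schmidt y l \<in> span (y ` {..i})" if "l < i" for l
    using less[OF that] span_mono[OF image_mono[of "{..l}" "{..i}" y]] that by auto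
  then show ?case
    by (subst gram_schmidt.simps, unfold sgn_div_norm)
      (intro span_scale span_diff span_sum, auto intro: span_base)
qed

lemma gram_schmidt_nonzero:
  assumes "y i \<notin> span (y ` {..<i})"
  shows "gram_schmidt y i \<noteq> 0"
proof
  assume "gram_schmidt y i = 0"
  then have "y i = (\<Sum>l\<in>{..<i}. (y i \<bullet> gram_schmidt y l) *\<^sub>R gram_schmidt y l)"
    by (subst (asm) gram_schmidt.simps) (simp add: sgn_zero_iff)
  moreover have "gram_schmidt y l \<in> span (y ` {..<i})" if "l < i" for l
  proof -
    have "{..l} \<subseteq> {..<i}" using that by auto
    then show ?thesis using gram_schmidt_in_span[of y l] span_mono[OF image_mono] by blast
  qed
  then have "(\<Sum>l\<in>{..<i}. (y i \<bullet> gram_schmidt y l) *\<^sub>R gram_schmidt y l) \<in> span (y ` {..<i})"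
    by (intro span_sum span_scale) auto
  ultimately show False using assms by simp
qed

text \<open>Input vectors from \<open>V\<^sup>\<bottom>\<close> have zero coefficients on the
  earlier output in \<open>V\<close>, so the procedure never mixes the two blocks.\<close>

lemma gram_schmidt_subspace:
  assumes V: "subspace V" and y: "\<And>l. l < d \<Longrightarrow> y l \<in> V" "\<And>l. d \<le> l \<Longrightarrow> l \<le> i \<Longrightarrow> y l \<in> V\<^sup>\<bottom>"
  shows "if i < d then gram_schmidt y i \<in> V else gram_schmidt y i \<in> V\<^sup>\<bottom>"
  using y(2)
proof (induction i rule: less_induct)
  case (less i)
  show ?case
  proof (cases "i < d")
    case True
    have "gram_schmidt y i \<in> span (y ` {..i})" by (rule gram_schmidt_in_span)
    also have "\<dots> \<subseteq> V" using True y(1) by (intro span_minimal V) auto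
    finally show ?thesis using True by simp
  next
    case False
    have yi: "y i \<in> V\<^sup>\<bottom>" using False less.prems by simp
    have "(y i \<bullet> gram_schmidt y l) *\<^sub>R gram_schmidt y l \<in> V\<^sup>\<bottom>" if "l < i" for l
    proof (cases "l < d")
      case True
      then have "gram_schmidt y l \<in> V" using less.IH[OF that] less.prems that by simp
      then show ?thesis using inner_orthogonal_comp(2)[OF _ yi] subspace_0[OF subspace_orthogonal_comp] by simp
    next
      case False
      then show ?thesis using less.IH[OF that] less.prems that by (simp add: subspace_scale[OF subspace_orthogonal_comp])
    qed
    then have "gram_schmidt y i \<in> V\<^sup>\<bottom>"
      by (subst gram_schmidt.simps, unfold sgn_div_norm)
        (rule subspace_scale[OF subspace_orthogonal_comp], rule subspace_diff[OF subspace_orthogonal_comp yi],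
         rule subspace_sum[OF subspace_orthogonal_comp], simp)
    then show ?thesis using False by simp
  qed
qed

section \<open>Invariant measures on stabilizers\<close>

lemma borel_measurable_matrix_mult [measurable (raw)]:
  fixes f g :: "'a \<Rightarrow> real^'n^'n"
  assumes "f \<in> borel_measurable M" "g \<in> borel_measurable M"
  shows "(\<lambda>x. f x ** g x) \<in> borel_measurable M"
  using assms
  by (rule borel_measurable_continuous_Pair)
    (unfold matrix_matrix_mult_def, intro continuous_intros)

lemma borel_measurable_matrix_vector_mult [measurable (raw)]:
  fixes f :: "'a \<Rightarrow> real^'n^'n"
  assumes "f \<in> borel_measurable M" "g \<in> borel_measurable M"
  shows "(\<lambda>x. f x *v g x) \<in> borel_measurable M"
  using assms
  by (rule borel_measurable_continuous_Pair)
    (unfold matrix_vector_mult_def, intro continuous_intros)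

lemma borel_measurable_matrixI:
  fixes f :: "'a \<Rightarrow> real^'n^'m"
  assumes "\<And>r s. (\<lambda>x. f x $ r $ s) \<in> borel_measurable M"
  shows "f \<in> borel_measurable M"
  using assms by (subst borel_measurable_euclidean_space) (auto simp: Basis_vec_def inner_axis)

lemma continuous_on_transpose:
  "continuous_on S (transpose :: real^'n^'n \<Rightarrow> real^'n^'n)"
  unfolding transpose_def by (intro continuous_intros)

lemma borel_measurable_transpose [measurable (raw)]:
  fixes f :: "'a \<Rightarrow> real^'n^'n"
  assumes "f \<in> borel_measurable M"
  shows "(\<lambda>x. transpose (f x)) \<in> borel_measurable M"
  by (rule measurable_compose[OF assms borel_measurable_continuous_onI[OF continuous_on_transpose]])

lemma norm_orthogonal_matrix:
  "orthogonal_matrix (Q :: real^'n^'n) \<Longrightarrow> norm (Q *v x) = norm x"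
  by (rule orthogonal_transformation_norm[OF orthogonal_matrix_transformation])

lemma stabilizer_mult:
  assumes "A \<in> stabilizer V" "B \<in> stabilizer V"
  shows "A ** B \<in> stabilizer V"
proof -
  have "(*v) (A ** B) ` V = (*v) A ` (*v) B ` V" by (simp add: image_image matrix_vector_mul_assoc)
  then show ?thesis using assms by (simp add: stabilizer_def orthogonal_matrix_mul)
qed

lemma stabilizer_transpose:
  assumes "A \<in> stabilizer V"
  shows "transpose A \<in> stabilizer V"
proof -
  have A: "orthogonal_matrix A" "(*v) A ` V = V" using assms by (auto simp: stabilizer_def)
  have "(*v) (transpose A) ` V = (*v) (transpose A) ` (*v) A ` V" by (simp add: A)
  also have "\<dots> = V"
    using A(1) unfolding image_image matrix_vector_mul_assoc orthogonal_matrix by simp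
  finally show ?thesis using A by (simp add: stabilizer_def)
qed

lemma orthogonal_matrix_iff_norm:
  "orthogonal_matrix (Q :: real^'n^'n) \<longleftrightarrow> (\<forall>x. norm (Q *v x) = norm x)"
  by (auto simp: norm_orthogonal_matrix)
     (metis matrix_of_matrix_vector_mul matrix_vector_mul_linear orthogonal_transformation orthogonal_transformation_matrix)

lemma dim_orthogonal_matrix_image:
  "orthogonal_matrix (Q :: real^'n^'n) \<Longrightarrow> dim ((*v) Q ` S) = dim S"
  by (rule dim_orthogonal_image[OF orthogonal_matrix_transformation])

text \<open>The inclusion of the image in \<open>V\<close> suffices because an orthogonal matrix
  preserves dimensions. In this form the stabilizer is visibly an intersection of closed
  sets.\<close>

lemma stabilizer_iff:
  fixes V :: "(real^'n) set"
  assumes V: "subspace V"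
  shows "Q \<in> stabilizer V \<longleftrightarrow> (\<forall>x. norm (Q *v x) = norm x) \<and> (\<forall>v\<in>V. Q *v v \<in> V)"
proof -
  have "(*v) Q ` V = V" if Q: "orthogonal_matrix Q" and sub: "\<forall>v\<in>V. Q *v v \<in> V"
  proof (rule subspace_dim_equal)
    show "subspace ((*v) Q ` V)" by (rule linear_subspace_image[OF _ V]) simp
    show "(*v) Q ` V \<subseteq> V" using sub by auto
    show "dim V \<le> dim ((*v) Q ` V)" by (simp add: dim_orthogonal_matrix_image[OF Q])
  qed (rule V)
  then show ?thesis unfolding stabilizer_def orthogonal_matrix_iff_norm[symmetric] by auto
qed

lemma closed_stabilizer:
  fixes V :: "(real^'n) set"
  assumes V: "subspace V"
  shows "closed (stabilizer V)"
proof -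
  have cont: "continuous_on UNIV (\<lambda>Q::real^'n^'n. Q *v x)" for x
    unfolding matrix_vector_mult_def by (intro continuous_intros)
  have "stabilizer V = (\<Inter>x. {Q. norm (Q *v x) = norm x}) \<inter> (\<Inter>v\<in>V. (\<lambda>Q. Q *v v) -` V)"
    by (auto simp: stabilizer_iff[OF V])
  moreover have "closed {Q::real^'n^'n. norm (Q *v x) = norm x}" for x
    by (intro closed_Collect_eq continuous_on_norm cont continuous_on_const)
  moreover have "closed ((\<lambda>Q::real^'n^'n. Q *v v) -` V)" for v
    by (intro closed_vimage cont closed_subspace V)
  ultimately show ?thesis by (simp add: closed_INT closed_Int)
qed

lemma stabilizer_UNIV: "stabilizer UNIV = {Q. orthogonal_matrix (Q :: real^'n^'n)}"
  using orthogonal_transformation_surj[OF orthogonal_matrix_transformation] by (auto simp: stabilizer_def)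

(* Gram--Schmidt commutes with the action of the stabilizer, so it transports the uniform measure on
   an invariant set of matrices to an invariant measure; the rows are first projected onto V or its
   complement so that the resulting frame is adapted to V. *)
lemma left_invariant_prob_exists:
  fixes V :: "(real^'n) set"
  assumes V: "subspace V"
  obtains M :: "(real^'n^'n) measure" where "prob_space M" "sets M = sets borel"
    "AE Q in M. Q \<in> stabilizer V" "\<And>A. A \<in> stabilizer V \<Longrightarrow> distr M borel ((**) A) = M"
proof -
  define d where "d = dim V"
  have dn: "d \<le> CARD('n)" using dim_subset_UNIV[of V] by (simp add: d_def)
  obtain b where b: "orthonormal_frame b" "span (b ` {..<d}) = V"
    "\<And>i. d \<le> i \<Longrightarrow> i < CARD('n) \<Longrightarrow> b i \<in> V\<^sup>\<bottom>"
    using orthonormal_flag_exists[OF V V order_refl] unfolding d_def by metis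
  have bV: "b i \<in> V" if "i < d" for i using that span_base[of "b i" "b ` {..<d}"] by (simp add: b)
  obtain \<iota> where \<iota>: "bij_betw \<iota> {..<CARD('n)} (UNIV :: 'n set)"
    by (metis bij_betw_from_nat_into_finite finite)
  define W where "W i = (if i < d then V else V\<^sup>\<bottom>)" for i
  have W: "subspace (W i)" for i by (simp add: W_def V subspace_orthogonal_comp)
  have bW: "b i \<in> W i" if "i < CARD('n)" for i using that b(3) bV by (simp add: W_def)
  define Y where "Y X i = closest_point (W i) (X $ \<iota> i)" for X :: "real^'n^'n" and i
  define F where "F X = frame_matrix b (gram_schmidt (Y X))" for X
  \<comment> \<open>The bound on the rows makes the measure of \<open>D\<close> finite; the
    nonvanishing of all Gram-Schmidt vectors makes \<open>F X\<close> orthogonal.\<close>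
  define D where "D = {X :: real^'n^'n. (\<forall>r. norm (X $ r) < 1) \<and> (\<forall>i<CARD('n). gram_schmidt (Y X) i \<noteq> 0)}"
  have row [measurable]: "(\<lambda>X :: real^'n^'n. X $ r) \<in> borel \<rightarrow>\<^sub>M borel" for r
    by (intro borel_measurable_continuous_onI continuous_intros)
  have [measurable]: "(\<lambda>X. gram_schmidt (Y X) i) \<in> borel \<rightarrow>\<^sub>M borel" for i
  proof (rule gram_schmidt_measurable)
    fix l
    show "(\<lambda>X. Y X l) \<in> borel \<rightarrow>\<^sub>M borel"
      unfolding Y_def by (rule measurable_compose[OF row closest_point_borel_measurable[OF W]])
  qed
  have [measurable]: "F \<in> borel \<rightarrow>\<^sub>M borel"
  proof (rule borel_measurable_matrixI)
    fix r s
    have "(\<lambda>X. gram_schmidt (Y X) i $ r) \<in> borel \<rightarrow>\<^sub>M borel" for i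
      by (rule measurable_compose[OF _ borel_measurable_continuous_onI[OF continuous_on_component[OF continuous_on_id]]]) measurable
    then show "(\<lambda>X. F X $ r $ s) \<in> borel \<rightarrow>\<^sub>M borel"
      unfolding F_def frame_matrix_def by simp
  qed
  have Dm [measurable]: "D \<in> sets borel"
  proof -
    have "D = (\<Inter>r\<in>UNIV. {X \<in> space borel. norm (X $ r) < 1}) \<inter>
      (\<Inter>i\<in>{..<CARD('n)}. {X \<in> space borel. gram_schmidt (Y X) i \<noteq> 0})"
      by (auto simp: D_def)
    also have "\<dots> \<in> sets borel"
      by (intro sets.Int sets.finite_INT borel_measurable_neq borel_measurable_less) (auto simp: lessThan_empty_iff)
    finally show ?thesis .
  qed
  \<comment> \<open>The rows of \<open>X0\<close> are half the vectors of the frame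
    \<open>b\<close>: they lie well inside the unit ball and in the correct blocks. A whole ball
    around \<open>X0\<close> belongs to \<open>D\<close>, so \<open>D\<close> has positive
    measure.\<close>
  define X0 :: "real^'n^'n" where "X0 = (\<chi> r. (1/2) *\<^sub>R b (the_inv_into {..<CARD('n)} \<iota> r))"
  \<comment> \<open>Summed over the \<open>CARD('n)\<close> frame vectors an error of this size
    costs a quarter of the norm, against the half contributed by \<open>X0\<close>.\<close>
  define \<epsilon> where "\<epsilon> = 1 / (4 * real CARD('n))"
  have n0: "0 < real CARD('n)" by simp
  have X0: "X0 $ \<iota> i = (1/2) *\<^sub>R b i" if "i < CARD('n)" for i
    using \<iota> that by (simp add: X0_def the_inv_into_f_f bij_betw_def)
  have "ball X0 \<epsilon> \<subseteq> D"
  proof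
    fix X assume "X \<in> ball X0 \<epsilon>"
    then have near: "norm (X $ r - X0 $ r) < \<epsilon>" for r
    proof -
      have "norm ((X - X0) $ r) \<le> norm (X - X0)" by (rule Finite_Cartesian_Product.norm_nth_le)
      with \<open>X \<in> ball X0 \<epsilon>\<close> show ?thesis by (simp add: dist_norm norm_minus_commute)
    qed
    have bnorm: "norm (b i) = 1" if "i < CARD('n)" for i
      using b(1) that by (simp add: orthonormal_frame_def norm_eq_1)
    have "\<epsilon> \<le> 1/4" by (simp add: \<epsilon>_def field_simps)
    have "norm (X $ r) < 1" for r
    proof -
      obtain i where i: "i < CARD('n)" "r = \<iota> i" using \<iota> by (auto simp: bij_betw_def)
      have "norm (X $ r) \<le> norm (X $ r - X0 $ r) + norm (X0 $ r)" using norm_triangle_sub by (simp add: add.commute)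
      also have "\<dots> < 1/4 + 1/2" using near[of r] \<open>\<epsilon> \<le> 1/4\<close> bnorm[OF i(1)] by (simp add: X0[OF i(1)] i(2))
      finally show ?thesis by simp
    qed
    moreover have "gram_schmidt (Y X) i \<noteq> 0" if i: "i < CARD('n)" for i
    proof (rule gram_schmidt_nonzero)
      let ?A = "(*v) (frame_matrix b (Y X))"
      have yn: "norm (Y X i - (1/2) *\<^sub>R b i) \<le> \<epsilon>" if "i < CARD('n)" for i
      proof -
        have "Y X i - (1/2) *\<^sub>R b i = closest_point (W i) (X $ \<iota> i - X0 $ \<iota> i)"
          using linear_diff[OF linear_closest_point[OF W]] bW[OF that] W
          by (simp add: Y_def X0[OF that] subspace_scale)
        also have "norm \<dots> \<le> norm (X $ \<iota> i - X0 $ \<iota> i)"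
        proof (rule power2_le_imp_le)
          show "(norm (closest_point (W i) (X $ \<iota> i - X0 $ \<iota> i)))\<^sup>2 \<le> (norm (X $ \<iota> i - X0 $ \<iota> i))\<^sup>2"
            unfolding norm_closest_point_Pythagorean[OF W, of i "X $ \<iota> i - X0 $ \<iota> i", symmetric] by simp
        qed simp
        finally show ?thesis using near[of "\<iota> i"] by linarith
      qed
      \<comment> \<open>The matrix that takes \<open>b i\<close> to \<open>Y X i\<close> differs
        from half the identity by at most a quarter in operator norm. It is therefore injective, and
        the projected rows are linearly independent.\<close>
      have inj: "x = 0" if "?A x = 0" for x
      proof -
        have "?A x - (1/2) *\<^sub>R x = (\<Sum>i<CARD('n). (b i \<bullet> x) *\<^sub>R (Y X i - (1/2) *\<^sub>R b i))"
          unfolding frame_matrix_mult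
          by (subst (3) orthonormal_frame_expand[OF b(1), symmetric])
            (simp add: scaleR_diff_right sum_subtractf scaleR_sum_right mult.commute)
        also have "norm \<dots> \<le> (\<Sum>i<CARD('n). norm x * \<epsilon>)"
        proof (rule sum_norm_le)
          fix i assume "i \<in> {..<CARD('n)}"
          then have i: "i < CARD('n)" by simp
          have "\<bar>b i \<bullet> x\<bar> \<le> norm x" using Cauchy_Schwarz_ineq2[of "b i" x] bnorm[OF i] by simp
          then show "norm ((b i \<bullet> x) *\<^sub>R (Y X i - (1/2) *\<^sub>R b i)) \<le> norm x * \<epsilon>"
            using yn[OF i] by (simp add: mult_mono)
        qed
        also have "\<dots> = norm x / 4" using n0 by (simp add: \<epsilon>_def)
        finally have "norm x / 2 \<le> norm x / 4" using that by simp
        then show ?thesis by simp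
      qed
      show "Y X i \<notin> span (Y X ` {..<i})"
      proof
        assume "Y X i \<in> span (Y X ` {..<i})"
        also have "Y X ` {..<i} = ?A ` b ` {..<i}"
          using i by (auto simp: image_image frame_matrix_frame[OF b(1)] intro!: image_cong)
        also have "span (?A ` b ` {..<i}) = ?A ` span (b ` {..<i})"
          by (rule linear_span_image) simp
        finally obtain z where z: "z \<in> span (b ` {..<i})" "Y X i = ?A z" by auto
        then have "?A (b i - z) = 0"
          using frame_matrix_frame[OF b(1) i, of "Y X"] by (simp add: matrix_vector_mult_diff_distrib)
        then have "b i = z" using inj by force
        have "orthogonal (b i) z"
          using z(1) by (rule orthogonal_to_span) (use b(1) i in \<open>auto simp: orthonormal_frame_def orthogonal_def\<close>)
        then have "b i \<bullet> b i = 0" by (simp add: \<open>b i = z\<close> orthogonal_def)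
        moreover have "b i \<bullet> b i = 1" using b(1) i unfolding orthonormal_frame_def by metis
        ultimately show False by linarith
      qed
    qed
    ultimately show "X \<in> D" by (simp add: D_def)
  qed
  have "0 < \<epsilon>" by (simp add: \<epsilon>_def)
  have D0: "emeasure lborel D \<noteq> 0"
  proof
    assume "emeasure lborel D = 0"
    then have "emeasure lborel (ball X0 \<epsilon>) \<le> 0"
      using emeasure_mono[OF \<open>ball X0 \<epsilon> \<subseteq> D\<close>, of lborel] by simp
    then have "measure lborel (ball X0 \<epsilon>) = 0" by (simp add: measure_def)
    with content_ball_pos[OF \<open>0 < \<epsilon>\<close>, of X0] show False by simp
  qed
  have Dfin: "emeasure lborel D \<noteq> \<infinity>"
  proof -
    have "norm X \<le> real CARD('n)" if "X \<in> D" for X :: "real^'n^'n"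
    proof -
      have "norm X \<le> (\<Sum>r\<in>UNIV. norm (X $ r))" by (simp add: norm_vec_def L2_set_le_sum)
      also have "\<dots> \<le> (\<Sum>r\<in>(UNIV::'n set). 1)" using that by (intro sum_mono) (auto simp: D_def less_imp_le)
      finally show ?thesis by simp
    qed
    then have "bounded D" by (auto simp: bounded_iff)
    then show ?thesis using emeasure_bounded_finite by (metis less_irrefl infinity_ennreal_def)
  qed
  define U where "U = uniform_measure lborel D"
  have U: "prob_space U" unfolding U_def by (rule prob_space_uniform_measure[OF D0 Dfin])
  have [measurable_cong]: "sets U = sets borel" by (simp add: U_def)
  have FD: "F X \<in> stabilizer V" if "X \<in> D" for X
  proof -
    let ?c = "gram_schmidt (Y X)"
    have nz: "?c i \<noteq> 0" if "i < CARD('n)" for i using \<open>X \<in> D\<close> that by (simp add: D_def)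
    have c: "orthonormal_frame ?c"
      unfolding orthonormal_frame_def
    proof (intro allI impI)
      fix i l assume il: "i < CARD('n)" "l < CARD('n)"
      consider "i = l" | "i < l" | "l < i" by linarith
      then show "?c i \<bullet> ?c l = (if i = l then 1 else 0)"
        by cases (use gram_schmidt_inner_self[OF nz[OF il(1)]] gram_schmidt_inner[of i l "Y X"]
            gram_schmidt_inner[of l i "Y X"] in \<open>auto simp: inner_commute\<close>)
    qed
    have YW: "Y X i \<in> W i" for i unfolding Y_def by (rule closest_point_subspace_in[OF W])
    have cV: "?c i \<in> V" if "i < d" for i
      using gram_schmidt_subspace[OF V, of d "Y X" i] YW that by (auto simp: W_def split: if_splits) (metis)
    have "F X *v v \<in> V" if "v \<in> V" for v
    proof -
      have "F X *v v \<in> (*v) (F X) ` span (b ` {..<d})" using that by (simp add: b)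
      also have "\<dots> = span (?c ` {..<d})"
        unfolding F_def using dn by (intro frame_matrix_image_span[OF b(1)]) auto
      also have "\<dots> \<subseteq> V" using cV by (intro span_minimal V) auto
      finally show ?thesis .
    qed
    then show ?thesis
      using orthogonal_matrix_frame[OF b(1) c] unfolding stabilizer_iff[OF V] orthogonal_matrix_iff_norm[symmetric]
      by (simp add: F_def)
  qed
  have AED: "AE X in U. X \<in> D"
    unfolding U_def by (rule AE_uniform_measureI) auto
  define M where "M = distr U borel F"
  have "prob_space M" unfolding M_def by (rule prob_space.prob_space_distr[OF U]) measurable
  moreover have "sets M = sets borel" by (simp add: M_def)
  moreover have "AE Q in M. Q \<in> stabilizer V"
  proof -
    have "AE X in U. F X \<in> stabilizer V" using AED by eventually_elim (rule FD)
    moreover have "stabilizer V \<in> sets borel" using closed_stabilizer[OF V] by simp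
    ultimately show ?thesis unfolding M_def by (subst AE_distr_iff) auto
  qed
  moreover have "distr M borel ((**) A) = M" if A: "A \<in> stabilizer V" for A
  proof -
    let ?g = "(*v) A"
    have g: "orthogonal_transformation ?g" "?g ` V = V"
      using A by (auto simp: stabilizer_def orthogonal_matrix_transformation)
    have gW: "?g ` W i = W i" for i
      using g by (simp add: W_def orthogonal_comp_image)
    \<comment> \<open>\<open>A\<close> acts on every row at once. This is an isometry of the space
      of matrices, hence preserves Lebesgue measure, and it maps \<open>D\<close> onto
      itself.\<close>
    define G where "G X = (\<chi> r. A *v (X $ r))" for X :: "real^'n^'n"
    have lin: "linear G"
      by (intro linearI) (auto simp: G_def vec_eq_iff matrix_vector_right_distrib matrix_vector_mult_scaleR)
    have G: "orthogonal_transformation G"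
      using g(1) lin by (simp add: orthogonal_transformation_def inner_vec_def[where 'b='n] G_def)
    have [measurable]: "G \<in> borel \<rightarrow>\<^sub>M borel" by (rule orthogonal_transformation_borel[OF G])
    have "Y (G X) i = ?g (Y X i)" for X i
      using closest_point_orthogonal_image[OF g(1) W, of i "X $ \<iota> i"] by (simp add: Y_def G_def gW)
    then have YG: "gram_schmidt (Y (G X)) i = ?g (gram_schmidt (Y X) i)" for X i
      using gram_schmidt_orthogonal_transformation[OF g(1), of "Y X" i] by presburger
    have FG: "F (G X) = A ** F X" for X
    proof -
      have "F (G X) *v x = (A ** F X) *v x" for x
        unfolding F_def matrix_vector_mul_assoc[symmetric] frame_matrix_mult
        by (simp add: YG linear_sum[OF matrix_vector_mul_linear] matrix_vector_mult_scaleR)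
      then show ?thesis by (simp add: matrix_eq)
    qed
    have GD: "G X \<in> D \<longleftrightarrow> X \<in> D" for X
    proof -
      have "norm (G X $ r) = norm (X $ r)" for r
        using orthogonal_transformation_norm[OF g(1)] by (simp add: G_def)
      moreover have "gram_schmidt (Y (G X)) i = 0 \<longleftrightarrow> gram_schmidt (Y X) i = 0" for i
        unfolding YG using orthogonal_transformation_norm[OF g(1), of "gram_schmidt (Y X) i"]
        by (metis norm_eq_zero)
      ultimately show ?thesis by (simp add: D_def)
    qed
    have "distr U borel G = U"
    proof (rule measure_eqI)
      fix E assume "E \<in> sets (distr U borel G)"
      then have [measurable]: "E \<in> sets borel" by simp
      have "emeasure lborel (D \<inter> (G -` E)) = emeasure lborel (G -` (D \<inter> E) \<inter> space lborel)"
        by (rule arg_cong2[where f=emeasure]) (auto simp: GD)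
      also have "\<dots> = emeasure (distr lborel borel G) (D \<inter> E)"
        by (rule emeasure_distr[symmetric]) auto
      finally have eq: "emeasure lborel (D \<inter> (G -` E)) = emeasure lborel (D \<inter> E)"
        by (simp add: distr_lborel_orthogonal[OF G])
      have "emeasure (distr U borel G) E = emeasure U (G -` E)"
        by (subst emeasure_distr) (auto simp: U_def)
      also have "\<dots> = emeasure lborel (D \<inter> (G -` E)) / emeasure lborel D"
        unfolding U_def using measurable_sets[of G borel borel E] by (intro emeasure_uniform_measure) auto
      also have "\<dots> = emeasure U E"
        unfolding eq U_def by (rule emeasure_uniform_measure[symmetric]) auto
      finally show "emeasure (distr U borel G) E = emeasure U E" .
    qed (simp add: U_def)
    then have "distr U borel F = distr (distr U borel G) borel F" by simp
    also have "\<dots> = distr U borel (F \<circ> G)" by (rule distr_distr) measurable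
    also have "F \<circ> G = (**) A \<circ> F" by (auto simp: FG)
    also have "distr U borel ((**) A \<circ> F) = distr M borel ((**) A)"
      unfolding M_def by (rule distr_distr[symmetric]) measurable
    finally show ?thesis unfolding M_def by (rule sym)
  qed
  ultimately show thesis by (rule that)
qed

section \<open>Haar measure and invariant measures on Grassmannians\<close>

abbreviation matrix_measure_space :: "(real^'n^'n) measure" where
  "matrix_measure_space \<equiv> restrict_space borel {Q. orthogonal_matrix Q}"

lemma orthogonal_matrices_borel [measurable]: "{Q :: real^'n^'n. orthogonal_matrix Q} \<in> sets borel"
  using closed_stabilizer[of "UNIV :: (real^'n) set"] by (simp add: stabilizer_UNIV)

text \<open>Transposition is inversion on orthogonal matrices, so it exchanges left and right
  translations.\<close>

lemma right_invariant_prob_exists: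
  fixes V :: "(real^'n) set"
  assumes V: "subspace V"
  obtains M :: "(real^'n^'n) measure" where "prob_space M" "sets M = sets borel"
    "AE Q in M. Q \<in> stabilizer V" "\<forall>A\<in>stabilizer V. distr M borel (\<lambda>Q. Q ** A) = M"
proof -
  obtain M :: "(real^'n^'n) measure" where M: "prob_space M" "sets M = sets borel"
    "AE Q in M. Q \<in> stabilizer V" "\<And>A. A \<in> stabilizer V \<Longrightarrow> distr M borel ((**) A) = M"
    using left_invariant_prob_exists[OF V] by metis
  note [measurable_cong] = M(2)
  define N where "N = distr M borel transpose"
  have [measurable]: "transpose \<in> (borel :: (real^'n^'n) measure) \<rightarrow>\<^sub>M borel" by measurable
  have "prob_space N" unfolding N_def by (rule prob_space.prob_space_distr[OF M(1)]) measurable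
  moreover have "sets N = sets borel" by (simp add: N_def)
  moreover have "AE Q in N. Q \<in> stabilizer V"
  proof -
    have "AE Q in M. transpose Q \<in> stabilizer V" using M(3) by eventually_elim (rule stabilizer_transpose)
    moreover have "stabilizer V \<in> sets borel" using closed_stabilizer[OF V] by simp
    ultimately show ?thesis unfolding N_def by (subst AE_distr_iff) auto
  qed
  moreover have "distr N borel (\<lambda>Q. Q ** A) = N" if "A \<in> stabilizer V" for A
  proof -
    have A: "transpose A \<in> stabilizer V" using that by (rule stabilizer_transpose)
    have "distr N borel (\<lambda>Q. Q ** A) = distr M borel ((\<lambda>Q. Q ** A) \<circ> transpose)"
      unfolding N_def by (rule distr_distr) measurable
    also have "(\<lambda>Q. Q ** A) \<circ> transpose = transpose \<circ> ((**) (transpose A))"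
      by (auto simp: matrix_transpose_mul)
    also have "distr M borel (transpose \<circ> ((**) (transpose A))) = distr (distr M borel ((**) (transpose A))) borel transpose"
      by (rule distr_distr[symmetric]) measurable
    finally show ?thesis by (simp add: M(4)[OF A] N_def)
  qed
  ultimately show thesis using that by blast
qed

lemma nn_integral_distr_matrix_mult:
  fixes A :: "real^'n^'n"
  assumes "sets N = sets borel" and f: "(f :: real^'n^'n \<Rightarrow> ennreal) \<in> borel_measurable borel"
  shows "(\<integral>\<^sup>+B. f (B ** A) \<partial>N) = (\<integral>\<^sup>+B. f B \<partial>distr N borel (\<lambda>B. B ** A))"
proof (rule nn_integral_distr[symmetric])
  have "(\<lambda>B :: real^'n^'n. B ** A) \<in> borel \<rightarrow>\<^sub>M borel"
    by (rule borel_measurable_matrix_mult) auto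
  then show "(\<lambda>B. B ** A) \<in> N \<rightarrow>\<^sub>M borel"
    by (simp add: measurable_cong_sets[OF assms(1) refl])
qed (use f in simp)

text \<open>Draw \<open>B\<close> from \<open>N\<close> and \<open>Q\<close> from \<open>M\<close>.
  The distribution of \<open>B ** Q\<close> is \<open>M\<close> by left invariance of
  \<open>M\<close>, and it is \<open>N\<close> by right invariance of \<open>N\<close>.\<close>

lemma invariant_orthogonal_prob_eq:
  fixes M :: "(real^'n^'n) measure"
  assumes inv: "invariant_orthogonal_prob M"
    and N: "prob_space N" "sets N = sets borel" "AE Q in N. Q \<in> stabilizer UNIV"
      "\<forall>A\<in>stabilizer UNIV. distr N borel (\<lambda>Q. Q ** A) = N"
    and A: "A \<in> sets M"
  shows "emeasure M A = emeasure N A"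
proof -
  interpret M: prob_space M using inv by (simp add: invariant_orthogonal_prob_def)
  interpret N: prob_space N by fact
  interpret pair_sigma_finite M N ..
  have setsM [measurable_cong]: "sets M = sets matrix_measure_space"
    and left: "\<And>B. orthogonal_matrix B \<Longrightarrow> distr M M (\<lambda>Q. B ** Q) = M"
    using inv by (auto simp: invariant_orthogonal_prob_def)
  note [measurable_cong] = N(2)
  have spaceM: "space M = {Q. orthogonal_matrix Q}"
    using sets_eq_imp_space_eq[OF setsM] by (simp add: space_restrict_space)
  have [measurable]: "(\<lambda>x. x) \<in> M \<rightarrow>\<^sub>M borel"
    unfolding measurable_cong_sets[OF setsM refl] by (rule measurable_restrict_space1) simp
  have [measurable]: "A \<in> sets borel"
    using A unfolding setsM by (auto simp: sets_restrict_space)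
  have "emeasure M A = (\<integral>\<^sup>+B. emeasure M A \<partial>N)" by (simp add: N.emeasure_space_1)
  also have "\<dots> = (\<integral>\<^sup>+B. (\<integral>\<^sup>+Q. indicator A (B ** Q) \<partial>M) \<partial>N)"
  proof (rule nn_integral_cong_AE, use N(3) in eventually_elim)
    fix B :: "real^'n^'n" assume "B \<in> stabilizer UNIV"
    then have B: "orthogonal_matrix B" by (simp add: stabilizer_def)
    have BM: "(**) B \<in> M \<rightarrow>\<^sub>M M"
      unfolding measurable_cong_sets[OF refl setsM]
      by (rule measurable_restrict_space2) (auto simp: spaceM orthogonal_matrix_mul B)
    have "emeasure M A = (\<integral>\<^sup>+Q. indicator A Q \<partial>distr M M ((**) B))" using A by (simp add: left[OF B])
    also have "\<dots> = (\<integral>\<^sup>+Q. indicator A (B ** Q) \<partial>M)"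
      by (rule nn_integral_distr[OF BM]) (use A in auto)
    finally show "emeasure M A = (\<integral>\<^sup>+Q. indicator A (B ** Q) \<partial>M)" .
  qed
  also have "\<dots> = (\<integral>\<^sup>+Q. (\<integral>\<^sup>+B. indicator A (B ** Q) \<partial>N) \<partial>M)"
    by (rule Fubini') measurable
  also have "\<dots> = (\<integral>\<^sup>+Q. emeasure N A \<partial>M)"
  proof (rule nn_integral_cong)
    fix Q assume "Q \<in> space M"
    then have Q: "Q \<in> stabilizer UNIV" by (simp add: spaceM stabilizer_UNIV)
    have "(\<integral>\<^sup>+B. indicator A (B ** Q) \<partial>N) = (\<integral>\<^sup>+B. indicator A B \<partial>distr N borel (\<lambda>B. B ** Q))"
      by (rule nn_integral_distr_matrix_mult[OF N(2)]) simp
    also have "\<dots> = emeasure N A" using bspec[OF N(4) Q] by (simp add: N(2))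
    finally show "(\<integral>\<^sup>+B. indicator A (B ** Q) \<partial>N) = emeasure N A" .
  qed
  also have "\<dots> = emeasure N A" by (simp add: M.emeasure_space_1)
  finally show ?thesis .
qed

text \<open>The invariant measures of the definitions live on the group, whereas the measure
  constructed above lives on all matrices. It is concentrated on the closed set
  \<open>stabilizer V\<close>, so restricting it loses no mass.\<close>

lemma stabilizer_prob_exists:
  fixes V :: "(real^'n) set"
  assumes V: "subspace V"
  obtains M :: "(real^'n^'n) measure" where "prob_space M"
    "sets M = sets (restrict_space borel (stabilizer V))"
    "\<forall>A\<in>stabilizer V. distr M M ((**) A) = M"
proof -
  obtain N :: "(real^'n^'n) measure" where N: "prob_space N" "sets N = sets borel"
    "AE Q in N. Q \<in> stabilizer V" "\<And>A. A \<in> stabilizer V \<Longrightarrow> distr N borel ((**) A) = N"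
    using left_invariant_prob_exists[OF V] by metis
  note [measurable_cong] = N(2)
  interpret N: prob_space N by fact
  let ?O = "stabilizer V"
  have Ob: "?O \<in> sets borel" using closed_stabilizer[OF V] by simp
  define M where "M = restrict_space N ?O"
  have spN: "space N = UNIV" using sets_eq_imp_space_eq[OF N(2)] by simp
  have O: "?O \<inter> space N \<in> sets N" using Ob by (simp add: spN N(2))
  have sM: "sets M = sets (restrict_space borel ?O)"
    unfolding M_def by (simp add: sets_restrict_space N(2))
  have spM: "space M = ?O" by (simp add: M_def space_restrict_space spN)
  have eM: "emeasure M A = emeasure N A" if "A \<in> sets M" for A
    unfolding M_def by (rule emeasure_restrict_space[OF O])
      (use that sets.sets_into_space[OF that] in \<open>auto simp: spM\<close>)
  have "emeasure M (space M) = emeasure N ?O" using sets.top[of M] by (simp add: eM spM)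
  also have "\<dots> = 1"
    using N(3) Ob by (intro N.emeasure_eq_1_AE) (auto simp: N(2))
  finally have "prob_space M" by (rule prob_spaceI)
  moreover have "distr M M ((**) A) = M" if A: "A \<in> stabilizer V" for A
  proof (rule measure_eqI)
    have AM [measurable]: "(**) A \<in> M \<rightarrow>\<^sub>M M"
      unfolding measurable_cong_sets[OF sM sM]
      by (intro measurable_restrict_space2 measurable_restrict_space1)
        (auto simp: space_restrict_space stabilizer_mult A)
    fix E assume "E \<in> sets (distr M M ((**) A))"
    then have E: "E \<in> sets M" by simp
    then have EO: "E \<subseteq> ?O" using sets.sets_into_space spM by blast
    have [measurable]: "E \<in> sets borel" using E Ob unfolding sM by (auto simp: sets_restrict_space)
    have iff: "A ** Q \<in> E \<Longrightarrow> Q \<in> ?O" for Q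
    proof -
      assume AQ: "A ** Q \<in> E"
      have "transpose A ** (A ** Q) \<in> ?O"
        by (rule stabilizer_mult[OF stabilizer_transpose[OF A]]) (use EO AQ in auto)
      moreover have "transpose A ** (A ** Q) = Q"
        using A unfolding matrix_mul_assoc stabilizer_def orthogonal_matrix by simp
      ultimately show "Q \<in> ?O" by (simp only:)
    qed
    have "emeasure (distr M M ((**) A)) E = emeasure M ((**) A -` E \<inter> space M)"
      by (rule emeasure_distr[OF AM E])
    also have "\<dots> = emeasure N ((**) A -` E \<inter> space N)"
      unfolding eM[OF measurable_sets[OF AM E]] by (rule arg_cong2[where f=emeasure]) (auto simp: spM spN iff)
    also have "\<dots> = emeasure (distr N borel ((**) A)) E"
      by (rule emeasure_distr[symmetric]) measurable
    also have "\<dots> = emeasure M E"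
      using N(4)[OF A] E by (simp add: eM)
    finally show "emeasure (distr M M ((**) A)) E = emeasure M E" .
  qed simp
  ultimately show thesis using sM by (intro that[of M]) auto
qed

lemma invariant_orthogonal_prob_exists: "\<exists>M. invariant_orthogonal_prob (M :: (real^'n^'n) measure)"
  using stabilizer_prob_exists[of "UNIV :: (real^'n) set"]
  unfolding invariant_orthogonal_prob_def stabilizer_UNIV by (metis mem_Collect_eq subspace_UNIV)

definition haar :: "(real^'n^'n) measure" where
  "haar = (THE M. invariant_orthogonal_prob M)"

lemma orthogonal_haar_eq: "orthogonal_haar = completion haar"
  by (simp add: orthogonal_haar_def haar_def)

text \<open>Every left invariant probability measure agrees with one right invariant measure
  \<open>N\<close>. This gives both the uniqueness that \<open>THE\<close> requires and the right
  invariance of Haar measure.\<close>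

lemma haar_properties:
  shows invariant_haar: "invariant_orthogonal_prob (haar :: (real^'n^'n) measure)"
    and nn_integral_haar_right: "\<And>f A. f \<in> borel_measurable borel \<Longrightarrow> orthogonal_matrix A \<Longrightarrow>
      (\<integral>\<^sup>+Q. f (Q ** A) \<partial>(haar :: (real^'n^'n) measure)) = (\<integral>\<^sup>+Q. f Q \<partial>haar)"
proof -
  obtain N :: "(real^'n^'n) measure" where N: "prob_space N" "sets N = sets borel"
    "AE Q in N. Q \<in> stabilizer UNIV" "\<forall>A\<in>stabilizer UNIV. distr N borel (\<lambda>Q. Q ** A) = N"
    using right_invariant_prob_exists[OF subspace_UNIV] by metis
  interpret N: prob_space N by fact
  note [measurable_cong] = N(2)
  note eq = invariant_orthogonal_prob_eq[OF _ N]
  obtain M :: "(real^'n^'n) measure" where M: "invariant_orthogonal_prob M"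
    using invariant_orthogonal_prob_exists by blast
  have "M' = M" if "invariant_orthogonal_prob M'" for M'
    using that M eq[OF that] eq[OF M] by (intro measure_eqI) (auto simp: invariant_orthogonal_prob_def)
  then have hM: "haar = M" unfolding haar_def using M by blast
  then show inv: "invariant_orthogonal_prob (haar :: (real^'n^'n) measure)" using M by simp
  have sM: "sets haar = sets (matrix_measure_space :: (real^'n^'n) measure)"
    using inv by (simp add: invariant_orthogonal_prob_def)
  have spM: "space haar = {Q :: real^'n^'n. orthogonal_matrix Q}"
    using sets_eq_imp_space_eq[OF sM] by (simp add: space_restrict_space)
  have id: "(\<lambda>x :: real^'n^'n. x) \<in> haar \<rightarrow>\<^sub>M borel"
    unfolding measurable_cong_sets[OF sM refl] by (rule measurable_restrict_space1) simp
  have "distr haar borel (\<lambda>x. x) = N"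
  proof (rule measure_eqI)
    fix E assume "E \<in> sets (distr haar borel (\<lambda>x :: real^'n^'n. x))"
    then have [measurable]: "E \<in> sets borel" by simp
    have E: "E \<inter> {Q. orthogonal_matrix Q} \<in> sets haar"
      unfolding sM by (auto simp: sets_restrict_space)
    have "emeasure (distr haar borel (\<lambda>x. x)) E = emeasure haar (E \<inter> {Q. orthogonal_matrix Q})"
      by (subst emeasure_distr[OF id]) (auto simp: spM)
    also have "\<dots> = emeasure N (E \<inter> {Q. orthogonal_matrix Q})" by (rule eq[OF inv E])
    also have "\<dots> = emeasure N E"
      using N(3) by (intro emeasure_eq_AE) (auto simp: stabilizer_UNIV N(2))
    finally show "emeasure (distr haar borel (\<lambda>x. x)) E = emeasure N E" .
  qed (simp add: N(2))
  then have I: "(\<integral>\<^sup>+Q. f Q \<partial>(haar :: (real^'n^'n) measure)) = (\<integral>\<^sup>+Q. f Q \<partial>N)" if "f \<in> borel_measurable borel" for f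
  proof -
    have "(\<integral>\<^sup>+Q. f Q \<partial>distr haar borel (\<lambda>x :: real^'n^'n. x)) = (\<integral>\<^sup>+Q. f Q \<partial>haar)"
      by (rule nn_integral_distr[OF id]) (use that in simp)
    then show ?thesis by (simp add: \<open>distr haar borel (\<lambda>x. x) = N\<close>)
  qed
  fix f :: "real^'n^'n \<Rightarrow> ennreal" and A :: "real^'n^'n"
  assume f [measurable]: "f \<in> borel_measurable borel" and A: "orthogonal_matrix A"
  have "(\<integral>\<^sup>+Q. f (Q ** A) \<partial>haar) = (\<integral>\<^sup>+Q. f (Q ** A) \<partial>N)" by (rule I) measurable
  also have "\<dots> = (\<integral>\<^sup>+Q. f Q \<partial>distr N borel (\<lambda>Q. Q ** A))"
    by (rule nn_integral_distr_matrix_mult[OF N(2) f])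
  also have "\<dots> = (\<integral>\<^sup>+Q. f Q \<partial>haar)" using N(4) A I[OF f] by (simp add: stabilizer_UNIV)
  finally show "(\<integral>\<^sup>+Q. f (Q ** A) \<partial>haar) = (\<integral>\<^sup>+Q. f Q \<partial>haar)" .
qed

lemma sets_haar [measurable_cong]: "sets haar = sets (matrix_measure_space :: (real^'n^'n) measure)"
  using invariant_haar[where 'n='n] by (simp add: invariant_orthogonal_prob_def)

lemma space_haar: "space haar = {Q :: real^'n^'n. orthogonal_matrix Q}"
  using sets_eq_imp_space_eq[OF sets_haar] by (simp add: space_restrict_space)

lemma prob_space_haar: "prob_space (haar :: (real^'n^'n) measure)"
  using invariant_haar[where 'n='n] by (simp add: invariant_orthogonal_prob_def)

lemma measurable_ident_haar [measurable]: "(\<lambda>x :: real^'n^'n. x) \<in> haar \<rightarrow>\<^sub>M borel"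
  unfolding measurable_cong_sets[OF sets_haar refl] by (rule measurable_restrict_space1) simp

section \<open>The action of orthogonal matrices on Grassmannians\<close>

lemma matrix_closest_point_mult:
  fixes S :: "(real^'n) set"
  shows "subspace S \<Longrightarrow> matrix (closest_point S) *v x = closest_point S x"
  by (simp add: matrix_works linear_closest_point)

text \<open>In the coordinates given by projection matrices a rotation acts by conjugation, which is
  continuous. Measurability of all maps between Grassmannians comes from this formula.\<close>

lemma matrix_closest_point_image:
  fixes S :: "(real^'n) set" and Q :: "real^'n^'n"
  assumes Q: "orthogonal_matrix Q" and S: "subspace S"
  shows "matrix (closest_point ((*v) Q ` S)) = Q ** matrix (closest_point S) ** transpose Q"
proof -
  have QS: "subspace ((*v) Q ` S)" by (rule linear_subspace_image[OF _ S]) simp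
  have "matrix (closest_point ((*v) Q ` S)) *v x = (Q ** matrix (closest_point S) ** transpose Q) *v x" for x
  proof -
    have x: "x = Q *v (transpose Q *v x)"
      using Q by (simp add: matrix_vector_mul_assoc orthogonal_matrix_def del: transpose_matrix_vector)
    have "closest_point ((*v) Q ` S) x = Q *v closest_point S (transpose Q *v x)"
      by (subst x) (rule closest_point_orthogonal_image[OF orthogonal_matrix_transformation[OF Q] S])
    then show ?thesis
      unfolding matrix_closest_point_mult[OF QS] matrix_vector_mul_assoc[symmetric] matrix_closest_point_mult[OF S] .
  qed
  then show ?thesis by (simp add: matrix_eq)
qed

lemma space_grassmannian_borel [simp]: "space (grassmannian_borel V j) = grassmannian V j"
  by (simp add: grassmannian_borel_def)

lemma matrix_closest_point_measurable [measurable]: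
  "(\<lambda>\<xi>. matrix (closest_point \<xi>)) \<in> grassmannian_borel V j \<rightarrow>\<^sub>M (borel :: (real^'n^'n) measure)"
  unfolding grassmannian_borel_def by (rule measurable_vimage_algebra1) auto

lemma sets_grassmannian_borelE:
  fixes V :: "(real^'n) set"
  assumes "A \<in> sets (grassmannian_borel V j)"
  obtains S where "S \<in> sets borel" "A = {\<xi> \<in> grassmannian V j. matrix (closest_point \<xi>) \<in> S}"
proof -
  obtain S where "S \<in> sets borel" "A = (\<lambda>\<xi>. matrix (closest_point \<xi>)) -` S \<inter> grassmannian V j"
    using assms unfolding grassmannian_borel_def by (subst (asm) sets_vimage_algebra2) auto
  then show thesis using that[of S] by blast
qed

lemma measurable_grassmannian_borelI:
  fixes V :: "(real^'n) set"
  assumes "\<And>x. x \<in> space M \<Longrightarrow> f x \<in> grassmannian V j"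
    and "(\<lambda>x. matrix (closest_point (f x))) \<in> M \<rightarrow>\<^sub>M borel"
  shows "f \<in> M \<rightarrow>\<^sub>M grassmannian_borel V j"
  unfolding grassmannian_borel_def by (rule measurable_vimage_algebra2) (use assms in auto)

lemma orthogonal_matrix_image_grassmannian:
  assumes "orthogonal_matrix (Q :: real^'n^'n)" "\<xi> \<in> grassmannian V j"
  shows "(*v) Q ` \<xi> \<in> grassmannian ((*v) Q ` V) j"
  using assms linear_subspace_image[OF matrix_vector_mul_linear]
  by (auto simp: grassmannian_def dim_orthogonal_matrix_image)

lemma orthogonal_matrix_image_measurable:
  fixes V :: "(real^'n) set"
  assumes Q: "orthogonal_matrix Q"
  shows "image ((*v) Q) \<in> grassmannian_borel V j \<rightarrow>\<^sub>M grassmannian_borel ((*v) Q ` V) j"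
proof (rule measurable_grassmannian_borelI)
  have "(\<lambda>\<xi>. Q ** matrix (closest_point \<xi>) ** transpose Q) \<in> grassmannian_borel V j \<rightarrow>\<^sub>M borel"
    by measurable
  also have "?this \<longleftrightarrow> (\<lambda>\<xi>. matrix (closest_point ((*v) Q ` \<xi>))) \<in> grassmannian_borel V j \<rightarrow>\<^sub>M borel"
    by (rule measurable_cong) (simp add: matrix_closest_point_image[OF Q] grassmannian_def)
  finally show "(\<lambda>\<xi>. matrix (closest_point ((*v) Q ` \<xi>))) \<in> grassmannian_borel V j \<rightarrow>\<^sub>M borel" .
qed (simp add: orthogonal_matrix_image_grassmannian[OF Q])

lemma invariant_grassmannian_prob_iff:
  fixes V :: "(real^'n) set"
  shows "invariant_grassmannian_prob V j M \<longleftrightarrow>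
    prob_space M \<and> sets M = sets (grassmannian_borel V j) \<and>
    (\<forall>Q\<in>stabilizer V. distr M M (image ((*v) Q)) = M)"
proof -
  have "(\<forall>g. orthogonal_transformation g \<and> g ` V = V \<longrightarrow> distr M M (image g) = M) \<longleftrightarrow>
    (\<forall>Q\<in>stabilizer V. distr M M (image ((*v) Q)) = M)"
  proof (intro iffI allI impI ballI)
    fix g assume *: "\<forall>Q\<in>stabilizer V. distr M M (image ((*v) Q)) = M"
      and g: "orthogonal_transformation g \<and> g ` V = V"
    then have "(*v) (matrix g) = g" by (auto simp: orthogonal_transformation_linear)
    then show "distr M M (image g) = M"
      using * g unfolding stabilizer_def by (metis (mono_tags) mem_Collect_eq orthogonal_transformation_matrix)
  qed (auto simp: stabilizer_def orthogonal_matrix_transformation)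
  then show ?thesis by (auto simp: invariant_grassmannian_prob_def)
qed

(* Averaging over a right invariant measure on the stabilizer leaves M unchanged by invariance of M,
   and replaces it by a fixed measure by transitivity. *)
lemma invariant_grassmannian_prob_eq:
  fixes V :: "(real^'n) set"
  assumes V: "subspace V" and inv: "invariant_grassmannian_prob V j M"
    and N: "prob_space N" "sets N = sets borel" "AE Q in N. Q \<in> stabilizer V"
      "\<forall>A\<in>stabilizer V. distr N borel (\<lambda>Q. Q ** A) = N"
    and \<xi>0: "\<xi>0 \<in> grassmannian V j" and S [measurable]: "S \<in> sets borel"
  shows "emeasure M {\<xi> \<in> grassmannian V j. matrix (closest_point \<xi>) \<in> S} =
    (\<integral>\<^sup>+B. indicator S (B ** matrix (closest_point \<xi>0) ** transpose B) \<partial>N)"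
proof -
  let ?P = "\<lambda>\<xi>. matrix (closest_point \<xi>)"
  interpret M: prob_space M using inv by (simp add: invariant_grassmannian_prob_def)
  interpret N: prob_space N by fact
  interpret pair_sigma_finite M N ..
  have setsM [measurable_cong]: "sets M = sets (grassmannian_borel V j)"
    and left: "\<And>B. B \<in> stabilizer V \<Longrightarrow> distr M M (image ((*v) B)) = M"
    using inv by (auto simp: invariant_grassmannian_prob_iff)
  note [measurable_cong] = N(2)
  have spaceM: "space M = grassmannian V j" using sets_eq_imp_space_eq[OF setsM] by simp
  have [measurable]: "?P \<in> M \<rightarrow>\<^sub>M borel"
    unfolding measurable_cong_sets[OF setsM refl] by measurable
  let ?A = "{\<xi> \<in> grassmannian V j. ?P \<xi> \<in> S}"
  have A: "?A = ?P -` S \<inter> space M" by (auto simp: spaceM)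
  have [measurable]: "?A \<in> sets M" unfolding A by measurable
  have "emeasure M ?A = (\<integral>\<^sup>+B. emeasure M ?A \<partial>N)" by (simp add: N.emeasure_space_1)
  also have "\<dots> = (\<integral>\<^sup>+B. (\<integral>\<^sup>+\<xi>. indicator S (B ** ?P \<xi> ** transpose B) \<partial>M) \<partial>N)"
  proof (rule nn_integral_cong_AE, use N(3) in eventually_elim)
    fix B :: "real^'n^'n" assume B: "B \<in> stabilizer V"
    then have Bo: "orthogonal_matrix B" and BV: "(*v) B ` V = V" by (auto simp: stabilizer_def)
    have BM: "image ((*v) B) \<in> M \<rightarrow>\<^sub>M M"
      using orthogonal_matrix_image_measurable[OF Bo, of V j] unfolding BV measurable_cong_sets[OF setsM setsM] .
    have "emeasure M ?A = (\<integral>\<^sup>+\<xi>. indicator ?A \<xi> \<partial>distr M M (image ((*v) B)))" by (simp add: left[OF B])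
    also have "\<dots> = (\<integral>\<^sup>+\<xi>. indicator ?A ((*v) B ` \<xi>) \<partial>M)"
      by (rule nn_integral_distr[OF BM]) simp
    also have "\<dots> = (\<integral>\<^sup>+\<xi>. indicator S (B ** ?P \<xi> ** transpose B) \<partial>M)"
    proof (rule nn_integral_cong)
      fix \<xi> assume "\<xi> \<in> space M"
      then have \<xi>: "\<xi> \<in> grassmannian V j" by (simp add: spaceM)
      then have "(*v) B ` \<xi> \<in> grassmannian V j" "subspace \<xi>"
        using orthogonal_matrix_image_grassmannian[OF Bo \<xi>] BV by (auto simp: grassmannian_def)
      then show "indicator ?A ((*v) B ` \<xi>) = (indicator S (B ** ?P \<xi> ** transpose B) :: ennreal)"
        by (simp add: indicator_def matrix_closest_point_image[OF Bo])
    qed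
    finally show "emeasure M ?A = (\<integral>\<^sup>+\<xi>. indicator S (B ** ?P \<xi> ** transpose B) \<partial>M)" .
  qed
  also have "\<dots> = (\<integral>\<^sup>+\<xi>. (\<integral>\<^sup>+B. indicator S (B ** ?P \<xi> ** transpose B) \<partial>N) \<partial>M)"
    by (rule Fubini') measurable
  also have "\<dots> = (\<integral>\<^sup>+\<xi>. (\<integral>\<^sup>+B. indicator S (B ** ?P \<xi>0 ** transpose B) \<partial>N) \<partial>M)"
  proof (rule nn_integral_cong)
    fix \<xi> assume "\<xi> \<in> space M"
    then have "\<xi> \<in> grassmannian V j" by (simp add: spaceM)
    then obtain C where C: "C \<in> stabilizer V" "(*v) C ` \<xi>0 = \<xi>"
      using stabilizer_transitive[OF V \<xi>0] by metis
    then have Co: "orthogonal_matrix C" by (simp add: stabilizer_def)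
    have "subspace \<xi>0" using \<xi>0 by (simp add: grassmannian_def)
    then have P: "?P \<xi> = C ** ?P \<xi>0 ** transpose C"
      using matrix_closest_point_image[OF Co] C(2) by blast
    have "(\<integral>\<^sup>+B. indicator S (B ** ?P \<xi>0 ** transpose B) \<partial>N) =
      (\<integral>\<^sup>+B. indicator S (B ** ?P \<xi>0 ** transpose B) \<partial>distr N borel (\<lambda>Q. Q ** C))"
      using bspec[OF N(4) C(1)] by simp
    also have "\<dots> = (\<integral>\<^sup>+B. indicator S ((B ** C) ** ?P \<xi>0 ** transpose (B ** C)) \<partial>N)"
      by (rule nn_integral_distr_matrix_mult[OF N(2), symmetric]) measurable
    also have "\<dots> = (\<integral>\<^sup>+B. indicator S (B ** ?P \<xi> ** transpose B) \<partial>N)"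
      by (simp add: P matrix_transpose_mul matrix_mul_assoc)
    finally show "(\<integral>\<^sup>+B. indicator S (B ** ?P \<xi> ** transpose B) \<partial>N) = (\<integral>\<^sup>+B. indicator S (B ** ?P \<xi>0 ** transpose B) \<partial>N)"
      by simp
  qed
  also have "\<dots> = (\<integral>\<^sup>+B. indicator S (B ** ?P \<xi>0 ** transpose B) \<partial>N)" by (simp add: M.emeasure_space_1)
  finally show ?thesis .
qed

lemma grassmannian_nonempty:
  fixes V :: "(real^'n) set"
  assumes "subspace V" "j \<le> dim V"
  obtains \<xi> where "\<xi> \<in> grassmannian V j"
proof -
  obtain T where "subspace T" "T \<subseteq> span V" "dim T = j"
    using choose_subspace_of_subspace[OF assms(2)] by metis
  then have "T \<in> grassmannian V j" using assms(1) by (simp add: grassmannian_def span_eq_iff[THEN iffD2])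
  then show thesis by (rule that)
qed

lemma invariant_grassmannian_prob_unique:
  fixes V :: "(real^'n) set"
  assumes V: "subspace V" and M: "invariant_grassmannian_prob V j M" and M': "invariant_grassmannian_prob V j M'"
  shows "M = M'"
proof -
  have "prob_space M" "space M = grassmannian V j"
    using M sets_eq_imp_space_eq[of M] by (auto simp: invariant_grassmannian_prob_def)
  \<comment> \<open>The Grassmannian is nonempty because it carries a probability measure.\<close>
  then obtain \<xi>0 where \<xi>0: "\<xi>0 \<in> grassmannian V j" using prob_space.not_empty by blast
  obtain N :: "(real^'n^'n) measure" where N: "prob_space N" "sets N = sets borel"
    "AE Q in N. Q \<in> stabilizer V" "\<forall>A\<in>stabilizer V. distr N borel (\<lambda>Q. Q ** A) = N"
    using right_invariant_prob_exists[OF V] by metis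
  show ?thesis
  proof (rule measure_eqI)
    show "sets M = sets M'" using M M' by (simp add: invariant_grassmannian_prob_def)
    fix A assume "A \<in> sets M"
    then have "A \<in> sets (grassmannian_borel V j)" using M by (simp add: invariant_grassmannian_prob_def)
    then obtain S where "S \<in> sets borel" "A = {\<xi> \<in> grassmannian V j. matrix (closest_point \<xi>) \<in> S}"
      by (rule sets_grassmannian_borelE)
    then show "emeasure M A = emeasure M' A"
      using invariant_grassmannian_prob_eq[OF V M N \<xi>0] invariant_grassmannian_prob_eq[OF V M' N \<xi>0] by simp
  qed
qed

section \<open>The invariant probability measure on a Grassmannian as an orbit measure\<close>

definition grassmannian_prob :: "(real^'n) set \<Rightarrow> nat \<Rightarrow> (real^'n) set measure" where
  "grassmannian_prob V j = (THE M. invariant_grassmannian_prob V j M)"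

lemma grassmannian_measure_eq: "grassmannian_measure V j = completion (grassmannian_prob V j)"
  by (simp add: grassmannian_measure_def grassmannian_prob_def)

lemma grassmannian_prob_eqI:
  fixes V :: "(real^'n) set"
  assumes "subspace V" "invariant_grassmannian_prob V j M"
  shows "grassmannian_prob V j = M"
  unfolding grassmannian_prob_def
  using assms invariant_grassmannian_prob_unique by (intro the_equality) auto

lemma orbit_measurable:
  fixes V :: "(real^'n) set"
  assumes V: "subspace V" and \<xi>: "\<xi> \<in> grassmannian V j" and M: "sets M = sets (restrict_space borel (stabilizer V))"
  shows "(\<lambda>Q. (*v) Q ` \<xi>) \<in> M \<rightarrow>\<^sub>M grassmannian_borel V j"
proof (rule measurable_grassmannian_borelI)
  have spM: "space M = stabilizer V"
    using sets_eq_imp_space_eq[OF M] by (simp add: space_restrict_space)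
  have sub: "subspace \<xi>" using \<xi> by (simp add: grassmannian_def)
  show "(*v) Q ` \<xi> \<in> grassmannian V j" if "Q \<in> space M" for Q
    using that orthogonal_matrix_image_grassmannian[of Q \<xi> V j] \<xi> by (auto simp: spM stabilizer_def)
  have "(\<lambda>Q :: real^'n^'n. Q ** matrix (closest_point \<xi>) ** transpose Q) \<in> borel \<rightarrow>\<^sub>M borel" by measurable
  then have "(\<lambda>Q. Q ** matrix (closest_point \<xi>) ** transpose Q) \<in> M \<rightarrow>\<^sub>M borel"
    unfolding measurable_cong_sets[OF M refl] by (rule measurable_restrict_space1)
  also have "?this \<longleftrightarrow> (\<lambda>Q. matrix (closest_point ((*v) Q ` \<xi>))) \<in> M \<rightarrow>\<^sub>M borel"
    by (rule measurable_cong) (simp add: spM stabilizer_def matrix_closest_point_image sub)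
  finally show "(\<lambda>Q. matrix (closest_point ((*v) Q ` \<xi>))) \<in> M \<rightarrow>\<^sub>M borel" .
qed

text \<open>The orbit map intertwines left multiplication with the action on subspaces, so it
  carries an invariant measure on the stabilizer to an invariant measure on the
  Grassmannian.\<close>

lemma invariant_orbit_prob:
  fixes V :: "(real^'n) set"
  assumes V: "subspace V" and \<xi>: "\<xi> \<in> grassmannian V j"
    and M: "prob_space M" "sets M = sets (restrict_space borel (stabilizer V))"
      "\<forall>A\<in>stabilizer V. distr M M ((**) A) = M"
  shows "invariant_grassmannian_prob V j (distr M (grassmannian_borel V j) (\<lambda>Q. (*v) Q ` \<xi>))"
  unfolding invariant_grassmannian_prob_iff
proof (intro conjI ballI)
  let ?G = "grassmannian_borel V j" and ?T = "\<lambda>Q. (*v) Q ` \<xi>"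
  let ?D = "distr M ?G ?T"
  have T: "?T \<in> M \<rightarrow>\<^sub>M ?G" by (rule orbit_measurable[OF V \<xi> M(2)])
  show "prob_space ?D" by (rule prob_space.prob_space_distr[OF M(1) T])
  show "sets ?D = sets ?G" by simp
  fix A assume A: "A \<in> stabilizer V"
  then have Ao: "orthogonal_matrix A" "(*v) A ` V = V" by (auto simp: stabilizer_def)
  have AG: "image ((*v) A) \<in> ?G \<rightarrow>\<^sub>M ?G"
    using orthogonal_matrix_image_measurable[OF Ao(1), of V j] unfolding Ao(2) .
  have AM: "(**) A \<in> M \<rightarrow>\<^sub>M M"
    unfolding measurable_cong_sets[OF M(2) M(2)]
    by (intro measurable_restrict_space2 measurable_restrict_space1)
      (auto simp: space_restrict_space stabilizer_mult A)
  have "distr ?D ?D (image ((*v) A)) = distr ?D ?G (image ((*v) A))" by (rule distr_cong) simp_all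
  also have "\<dots> = distr M ?G (image ((*v) A) \<circ> ?T)"
    by (rule distr_distr[OF AG T])
  also have "image ((*v) A) \<circ> ?T = ?T \<circ> (**) A"
    by (auto simp: image_image matrix_vector_mul_assoc fun_eq_iff)
  also have "distr M ?G (?T \<circ> (**) A) = distr (distr M M ((**) A)) ?G ?T"
    by (rule distr_distr[OF T AM, symmetric])
  finally show "distr ?D ?D (image ((*v) A)) = ?D" using M(3) A by simp
qed

lemma invariant_grassmannian_prob:
  fixes V :: "(real^'n) set"
  assumes V: "subspace V" and j: "j \<le> dim V"
  shows "invariant_grassmannian_prob V j (grassmannian_prob V j)"
proof -
  obtain \<xi> where \<xi>: "\<xi> \<in> grassmannian V j" using grassmannian_nonempty[OF V j] by blast
  obtain M :: "(real^'n^'n) measure" where "prob_space M"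
    "sets M = sets (restrict_space borel (stabilizer V))" "\<forall>A\<in>stabilizer V. distr M M ((**) A) = M"
    using stabilizer_prob_exists[OF V] by metis
  then have "invariant_grassmannian_prob V j (distr M (grassmannian_borel V j) (\<lambda>Q. (*v) Q ` \<xi>))"
    by (rule invariant_orbit_prob[OF V \<xi>])
  then show ?thesis using grassmannian_prob_eqI[OF V] by simp
qed

text \<open>Lets statements about almost every subspace be read as statements about almost every
  rotation of one fixed subspace, which is how the dual transform meets planes.\<close>

lemma grassmannian_prob_eq_distr_haar:
  assumes \<xi>: "\<xi> \<in> grassmannian (UNIV :: (real^'n) set) j"
  shows "grassmannian_prob UNIV j = distr haar (grassmannian_borel UNIV j) (\<lambda>Q. (*v) Q ` \<xi>)"
  using invariant_haar[where 'n='n]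
  by (intro grassmannian_prob_eqI invariant_orbit_prob subspace_UNIV \<xi>)
    (auto simp: invariant_orthogonal_prob_def stabilizer_UNIV)

lemma
  fixes V :: "(real^'n) set"
  assumes V: "subspace V" and j: "j \<le> dim V"
  shows prob_space_grassmannian_prob: "prob_space (grassmannian_prob V j)"
    and sets_grassmannian_prob: "sets (grassmannian_prob V j) = sets (grassmannian_borel V j)"
    and space_grassmannian_prob: "space (grassmannian_prob V j) = grassmannian V j"
proof -
  show s: "sets (grassmannian_prob V j) = sets (grassmannian_borel V j)" and "prob_space (grassmannian_prob V j)"
    using invariant_grassmannian_prob[OF assms] by (auto simp: invariant_grassmannian_prob_def)
  show "space (grassmannian_prob V j) = grassmannian V j"
    using sets_eq_imp_space_eq[OF s] by simp
qed

text \<open>The image measure is invariant because conjugation by \<open>Q\<close> identifies the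
  stabilizer of the image of \<open>V\<close> with that of \<open>V\<close>. The mixed transform at
  a rotated plane integrates over the Grassmannian of a rotated complement, which this reduces to a
  fixed one.\<close>

lemma grassmannian_prob_image:
  fixes V :: "(real^'n) set"
  assumes V: "subspace V" and j: "j \<le> dim V" and Q: "orthogonal_matrix Q"
  shows "grassmannian_prob ((*v) Q ` V) j =
    distr (grassmannian_prob V j) (grassmannian_borel ((*v) Q ` V) j) (image ((*v) Q))"
proof (rule grassmannian_prob_eqI)
  let ?M = "grassmannian_prob V j" and ?G = "grassmannian_borel ((*v) Q ` V) j"
  let ?D = "distr ?M ?G (image ((*v) Q))"
  show "subspace ((*v) Q ` V)" by (rule linear_subspace_image[OF _ V]) simp
  note sM = sets_grassmannian_prob[OF V j]
  have QM: "image ((*v) Q) \<in> ?M \<rightarrow>\<^sub>M ?G"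
    using orthogonal_matrix_image_measurable[OF Q, of V j] unfolding measurable_cong_sets[OF sM refl] .
  have Q1: "transpose Q ** Q = mat 1" "Q ** transpose Q = mat 1"
    using Q by (auto simp: orthogonal_matrix_def)
  show "invariant_grassmannian_prob ((*v) Q ` V) j ?D"
    unfolding invariant_grassmannian_prob_iff
  proof (intro conjI ballI)
    show "prob_space ?D" by (rule prob_space.prob_space_distr[OF prob_space_grassmannian_prob[OF V j] QM])
    show "sets ?D = sets ?G" by simp
    fix A assume A: "A \<in> stabilizer ((*v) Q ` V)"
    then have Ao: "orthogonal_matrix A" "(*v) A ` (*v) Q ` V = (*v) Q ` V" by (auto simp: stabilizer_def)
    define B where "B = transpose Q ** (A ** Q)"
    have AQ: "A ** Q = Q ** B" unfolding B_def matrix_mul_assoc Q1(2) by simp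
    have "(*v) B ` V = (*v) (transpose Q) ` (*v) A ` (*v) Q ` V"
      unfolding B_def image_image matrix_vector_mul_assoc matrix_mul_assoc ..
    also have "\<dots> = V" unfolding Ao(2) unfolding image_image matrix_vector_mul_assoc Q1(1) by simp
    finally have B: "B \<in> stabilizer V"
      unfolding stabilizer_def B_def using Ao(1) Q
      by (auto intro!: orthogonal_matrix_mul)
    then have Bo: "orthogonal_matrix B" "(*v) B ` V = V" by (auto simp: stabilizer_def)
    have AG: "image ((*v) A) \<in> ?G \<rightarrow>\<^sub>M ?G"
      using orthogonal_matrix_image_measurable[OF Ao(1), of "(*v) Q ` V" j] unfolding Ao(2) .
    have BM: "image ((*v) B) \<in> ?M \<rightarrow>\<^sub>M ?M"
      using orthogonal_matrix_image_measurable[OF Bo(1), of V j] unfolding Bo(2) measurable_cong_sets[OF sM sM] .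
    have "distr ?D ?D (image ((*v) A)) = distr ?D ?G (image ((*v) A))" by (rule distr_cong) simp_all
    also have "\<dots> = distr ?M ?G (image ((*v) A) \<circ> image ((*v) Q))"
      by (rule distr_distr[OF AG QM])
    also have "image ((*v) A) \<circ> image ((*v) Q) = image ((*v) Q) \<circ> image ((*v) B)"
      unfolding comp_def image_image matrix_vector_mul_assoc AQ ..
    also have "distr ?M ?G (image ((*v) Q) \<circ> image ((*v) B)) = distr (distr ?M ?M (image ((*v) B))) ?G (image ((*v) Q))"
      by (rule distr_distr[OF QM BM, symmetric])
    also have "distr ?M ?M (image ((*v) B)) = ?M"
      using invariant_grassmannian_prob[OF V j] B unfolding invariant_grassmannian_prob_iff by blast
    finally show "distr ?D ?D (image ((*v) A)) = ?D" .
  qed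
qed

section \<open>Joint measurability and the measure on the affine Grassmannian\<close>

text \<open>Multiplication of a matrix and a vector is jointly continuous, and the projection matrix
  is exactly the coordinate that defines the measurable structure of the Grassmannian.\<close>

lemma closest_point_joint_measurable:
  fixes g :: "'a \<Rightarrow> real^'n"
  assumes f: "f \<in> M \<rightarrow>\<^sub>M grassmannian_borel V j" and g: "g \<in> M \<rightarrow>\<^sub>M borel"
  shows "(\<lambda>x. closest_point (f x) (g x)) \<in> M \<rightarrow>\<^sub>M borel"
proof -
  have "(\<lambda>x. matrix (closest_point (f x)) *v g x) \<in> M \<rightarrow>\<^sub>M borel"
    by (rule borel_measurable_matrix_vector_mult[OF measurable_compose[OF f matrix_closest_point_measurable] g])
  also have "?this \<longleftrightarrow> ?thesis"
    using measurable_space[OF f]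
    by (intro measurable_cong matrix_closest_point_mult) (auto simp: grassmannian_def)
  finally show ?thesis .
qed

lemma subspace_weight_joint_measurable:
  fixes g :: "'a \<Rightarrow> real^'n"
  assumes f [measurable]: "f \<in> M \<rightarrow>\<^sub>M grassmannian_borel V j" and g [measurable]: "g \<in> M \<rightarrow>\<^sub>M borel"
  shows "(\<lambda>x. subspace_weight (f x) (g x)) \<in> borel_measurable M"
proof -
  have "(\<lambda>x. pi powr (- (real CARD('n) - real j) / 2) * exp (- (norm (g x - closest_point (f x) (g x)))\<^sup>2)) \<in> borel_measurable M"
    using closest_point_joint_measurable[OF f g] by measurable
  also have "?this \<longleftrightarrow> ?thesis"
    using measurable_space[OF f]
    by (intro measurable_cong) (auto simp: grassmannian_def subspace_weight_def)
  finally show ?thesis .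
qed

lemma subspace_weight_orthogonal_comp:
  fixes S :: "(real^'n) set"
  assumes "subspace S"
  shows "subspace_weight (S\<^sup>\<bottom>) x = pi powr (- real (dim S) / 2) * exp (- (norm (closest_point S x))\<^sup>2)"
proof -
  have "real CARD('n) - real (dim (S\<^sup>\<bottom>)) = real (dim S)"
    using dim_orthogonal_comp[OF assms] by simp
  then show ?thesis by (simp add: subspace_weight_def closest_point_orthogonal_comp[OF assms])
qed

lemma subspace_weight_comp_joint_measurable:
  fixes g :: "'a \<Rightarrow> real^'n"
  assumes f [measurable]: "f \<in> M \<rightarrow>\<^sub>M grassmannian_borel V j" and g [measurable]: "g \<in> M \<rightarrow>\<^sub>M borel"
  shows "(\<lambda>x. subspace_weight ((f x)\<^sup>\<bottom>) (g x)) \<in> borel_measurable M"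
proof -
  have "(\<lambda>x. pi powr (- real j / 2) * exp (- (norm (closest_point (f x) (g x)))\<^sup>2)) \<in> borel_measurable M"
    using closest_point_joint_measurable[OF f g] by measurable
  also have "?this \<longleftrightarrow> ?thesis"
    using measurable_space[OF f]
    by (intro measurable_cong) (auto simp: grassmannian_def subspace_weight_orthogonal_comp)
  finally show ?thesis .
qed

section \<open>Borel structure of affine planes and the product measure on them\<close>

lemma space_affine_grassmannian_borel [simp]:
  "space (affine_grassmannian_borel j) = affine_grassmannian j"
  by (simp add: affine_grassmannian_borel_def)

lemma translate_in_affine_grassmannian:
  fixes \<xi> :: "(real^'n) set"
  assumes "\<xi> \<in> grassmannian V j"
  shows "(+) u ` \<xi> \<in> affine_grassmannian j"
  using assms by (auto simp: affine_grassmannian_def grassmannian_def affine_translation[symmetric]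
      subspace_imp_affine aff_dim_translation_eq aff_dim_subspace)

lemma affine_grassmannianE:
  fixes \<tau> :: "(real^'n) set"
  assumes "\<tau> \<in> affine_grassmannian j"
  obtains \<xi> u where "\<xi> \<in> grassmannian UNIV j" "\<tau> = (+) u ` \<xi>"
proof -
  have \<tau>: "affine \<tau>" "aff_dim \<tau> = int j" using assms by (auto simp: affine_grassmannian_def)
  then have "\<tau> \<noteq> {}" by (auto simp: aff_dim_empty_eq)
  then obtain u where "u \<in> \<tau>" by blast
  define \<xi> where "\<xi> = (\<lambda>x. - u + x) ` \<tau>"
  have u: "subspace \<xi>" "\<tau> = (+) u ` \<xi>"
    unfolding \<xi>_def by (rule affine_diffs_subspace[OF \<tau>(1) \<open>u \<in> \<tau>\<close>]) (simp add: image_image)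
  then have "dim \<xi> = j" using \<tau>(2) by (simp add: aff_dim_translation_eq aff_dim_subspace)
  then show thesis using that[of \<xi> u] u by (simp add: grassmannian_def)
qed

lemma translate_measurable:
  fixes f :: "'a \<Rightarrow> (real^'n) set"
  assumes f [measurable]: "f \<in> M \<rightarrow>\<^sub>M grassmannian_borel V j" and g [measurable]: "g \<in> M \<rightarrow>\<^sub>M borel"
  shows "(\<lambda>x. (+) (g x) ` f x) \<in> M \<rightarrow>\<^sub>M affine_grassmannian_borel j"
  unfolding affine_grassmannian_borel_def
proof (rule measurable_vimage_algebra2)
  show "(\<lambda>x. (+) (g x) ` f x) \<in> space M \<rightarrow> affine_grassmannian j"
    using translate_in_affine_grassmannian measurable_space[OF f] by fastforce
  have "(\<lambda>x. (matrix (closest_point (f x)), g x - closest_point (f x) (g x))) \<in> M \<rightarrow>\<^sub>M borel \<Otimes>\<^sub>M borel"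
    using measurable_compose[OF f matrix_closest_point_measurable] closest_point_joint_measurable[OF f g]
    by measurable
  also have "?this \<longleftrightarrow> (\<lambda>x. (matrix (closest_point (direction ((+) (g x) ` f x))), foot ((+) (g x) ` f x))) \<in> M \<rightarrow>\<^sub>M borel \<Otimes>\<^sub>M borel"
  proof (rule measurable_cong)
    fix x assume "x \<in> space M"
    then have "subspace (f x)" using measurable_space[OF f] by (simp add: grassmannian_def)
    then show "(matrix (closest_point (f x)), g x - closest_point (f x) (g x)) =
      (matrix (closest_point (direction ((+) (g x) ` f x))), foot ((+) (g x) ` f x))"
      by (simp add: direction_translate foot_translate)
  qed
  finally show "(\<lambda>x. (matrix (closest_point (direction ((+) (g x) ` f x))), foot ((+) (g x) ` f x))) \<in> M \<rightarrow>\<^sub>M borel"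
    by (simp add: borel_prod)
qed

lemma direction_measurable [measurable]:
  "direction \<in> affine_grassmannian_borel j \<rightarrow>\<^sub>M (grassmannian_borel UNIV j :: (real^'n) set measure)"
proof (rule measurable_grassmannian_borelI)
  fix \<tau> :: "(real^'n) set" assume "\<tau> \<in> space (affine_grassmannian_borel j)"
  then obtain \<xi> u where "\<xi> \<in> grassmannian UNIV j" "\<tau> = (+) u ` \<xi>"
    using affine_grassmannianE by (metis space_affine_grassmannian_borel)
  then show "direction \<tau> \<in> grassmannian UNIV j" by (simp add: grassmannian_def direction_translate)
next
  have "(\<lambda>\<tau> :: (real^'n) set. (matrix (closest_point (direction \<tau>)), foot \<tau>)) \<in> affine_grassmannian_borel j \<rightarrow>\<^sub>M borel \<Otimes>\<^sub>M borel"
    unfolding affine_grassmannian_borel_def borel_prod by (rule measurable_vimage_algebra1) auto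
  from measurable_compose[OF this measurable_fst]
  show "(\<lambda>\<tau> :: (real^'n) set. matrix (closest_point (direction \<tau>))) \<in> affine_grassmannian_borel j \<rightarrow>\<^sub>M borel"
    by simp
qed

lemma foot_measurable [measurable]:
  "foot \<in> affine_grassmannian_borel j \<rightarrow>\<^sub>M (borel :: (real^'n) measure)"
proof -
  have "(\<lambda>\<tau> :: (real^'n) set. (matrix (closest_point (direction \<tau>)), foot \<tau>)) \<in> affine_grassmannian_borel j \<rightarrow>\<^sub>M borel \<Otimes>\<^sub>M borel"
    unfolding affine_grassmannian_borel_def borel_prod by (rule measurable_vimage_algebra1) auto
  from measurable_compose[OF this measurable_snd] show ?thesis by simp
qed

text \<open>The measure \<open>d\<xi> du\<close> before completion, as the image of one product
  measure. The translation vector runs over the whole space with the weight of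
  \<open>\<xi>\<^sup>\<bottom>\<close>; its component along \<xi>, which is Gaussian, does not
  change the plane.\<close>

definition affine_grassmannian_base :: "nat \<Rightarrow> (real^'n) set measure" where
  "affine_grassmannian_base j =
     distr (density (grassmannian_prob UNIV j \<Otimes>\<^sub>M lborel) (\<lambda>z. subspace_weight ((fst z)\<^sup>\<bottom>) (snd z)))
       (affine_grassmannian_borel j) (\<lambda>z. (+) (snd z) ` fst z)"

lemma affine_grassmannian_measure_eq:
  assumes j: "j \<le> CARD('n)"
  shows "(affine_grassmannian_measure j :: (real^'n) set measure) = completion (affine_grassmannian_base j)"
proof -
  let ?G = "grassmannian_prob (UNIV :: (real^'n) set) j"
  let ?A = "affine_grassmannian_borel j :: (real^'n) set measure"
  have j': "j \<le> dim (UNIV :: (real^'n) set)" using j by simp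
  note sG [measurable_cong] = sets_grassmannian_prob[OF subspace_UNIV j']
  note spG = space_grassmannian_prob[OF subspace_UNIV j']
  interpret G: prob_space ?G by (rule prob_space_grassmannian_prob[OF subspace_UNIV j'])
  have fst: "fst \<in> ?G \<Otimes>\<^sub>M lborel \<rightarrow>\<^sub>M grassmannian_borel UNIV j"
    unfolding measurable_cong_sets[OF refl sG[symmetric]] by (rule measurable_fst)
  have snd: "snd \<in> ?G \<Otimes>\<^sub>M lborel \<rightarrow>\<^sub>M (borel :: (real^'n) measure)" by measurable
  have W [measurable]: "(\<lambda>z. subspace_weight ((fst z)\<^sup>\<bottom>) (snd z)) \<in> borel_measurable (?G \<Otimes>\<^sub>M lborel)"
    by (rule subspace_weight_comp_joint_measurable[OF fst snd])
  have T [measurable]: "(\<lambda>z. (+) (snd z) ` fst z) \<in> ?G \<Otimes>\<^sub>M lborel \<rightarrow>\<^sub>M ?A"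
    by (rule translate_measurable[OF fst snd])
  have "(\<integral>\<^sup>+\<xi>. (\<integral>\<^sup>+u. indicator E ((+) u ` \<xi>) \<partial>plane_measure (\<xi>\<^sup>\<bottom>)) \<partial>grassmannian_measure UNIV j) =
    emeasure (affine_grassmannian_base j) E" if E [measurable]: "E \<in> sets ?A" for E
  proof -
    have "(\<integral>\<^sup>+\<xi>. (\<integral>\<^sup>+u. indicator E ((+) u ` \<xi>) \<partial>plane_measure (\<xi>\<^sup>\<bottom>)) \<partial>grassmannian_measure UNIV j) =
      (\<integral>\<^sup>+\<xi>. (\<integral>\<^sup>+u. indicator E ((+) u ` \<xi>) \<partial>plane_measure (\<xi>\<^sup>\<bottom>)) \<partial>?G)"
      by (simp add: grassmannian_measure_eq nn_integral_completion)
    also have "\<dots> = (\<integral>\<^sup>+\<xi>. (\<integral>\<^sup>+x. ennreal (subspace_weight (\<xi>\<^sup>\<bottom>) x) * indicator E ((+) x ` \<xi>) \<partial>lborel) \<partial>?G)"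
    proof (rule nn_integral_cong)
      fix \<xi> assume "\<xi> \<in> space ?G"
      then have \<xi>: "\<xi> \<in> grassmannian UNIV j" by (simp add: spG)
      then have sub: "subspace \<xi>" by (simp add: grassmannian_def)
      have "(\<lambda>_ :: real^'n. \<xi>) \<in> borel \<rightarrow>\<^sub>M grassmannian_borel UNIV j" using \<xi> by simp
      from translate_measurable[OF this, of "\<lambda>u. u"]
      have [measurable]: "(\<lambda>u. (+) u ` \<xi>) \<in> borel \<rightarrow>\<^sub>M ?A" by simp
      have "(\<integral>\<^sup>+u. indicator E ((+) u ` \<xi>) \<partial>plane_measure (\<xi>\<^sup>\<bottom>)) = (\<integral>\<^sup>+u. indicator E ((+) u ` \<xi>) \<partial>subspace_measure (\<xi>\<^sup>\<bottom>))"
        by (simp add: plane_measure_subspace[OF subspace_orthogonal_comp] nn_integral_completion)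
      also have "\<dots> = (\<integral>\<^sup>+x. ennreal (subspace_weight (\<xi>\<^sup>\<bottom>) x) * indicator E ((+) (closest_point (\<xi>\<^sup>\<bottom>) x) ` \<xi>) \<partial>lborel)"
        by (rule nn_integral_subspace_measure[OF subspace_orthogonal_comp]) measurable
      also have "\<dots> = (\<integral>\<^sup>+x. ennreal (subspace_weight (\<xi>\<^sup>\<bottom>) x) * indicator E ((+) x ` \<xi>) \<partial>lborel)"
      proof (intro nn_integral_cong arg_cong2[where f="(*)"] refl arg_cong[where f="indicator E"])
        fix x :: "real^'n"
        have P: "closest_point \<xi> x \<in> \<xi>" using sub by (rule closest_point_subspace_in)
        show "(+) (closest_point (\<xi>\<^sup>\<bottom>) x) ` \<xi> = (+) x ` \<xi>"
          unfolding closest_point_orthogonal_comp[OF sub]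
        proof (intro equalityI image_subsetI)
          fix y assume y: "y \<in> \<xi>"
          show "x - closest_point \<xi> x + y \<in> (+) x ` \<xi>"
            by (rule image_eqI[where x="y - closest_point \<xi> x"]) (use y P sub in \<open>auto intro: subspace_diff\<close>)
          show "x + y \<in> (+) (x - closest_point \<xi> x) ` \<xi>"
            by (rule image_eqI[where x="closest_point \<xi> x + y"]) (use y P sub in \<open>auto intro: subspace_add\<close>)
        qed
      qed
      finally show "(\<integral>\<^sup>+u. indicator E ((+) u ` \<xi>) \<partial>plane_measure (\<xi>\<^sup>\<bottom>)) =
        (\<integral>\<^sup>+x. ennreal (subspace_weight (\<xi>\<^sup>\<bottom>) x) * indicator E ((+) x ` \<xi>) \<partial>lborel)" .
    qed
    also have "\<dots> = (\<integral>\<^sup>+z. ennreal (subspace_weight ((fst z)\<^sup>\<bottom>) (snd z)) * indicator E ((+) (snd z) ` fst z) \<partial>(?G \<Otimes>\<^sub>M lborel))"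
      by (subst lborel.nn_integral_fst[symmetric]) (simp_all, measurable)
    also have "\<dots> = (\<integral>\<^sup>+z. indicator E ((+) (snd z) ` fst z) \<partial>density (?G \<Otimes>\<^sub>M lborel) (\<lambda>z. subspace_weight ((fst z)\<^sup>\<bottom>) (snd z)))"
      by (subst nn_integral_density) measurable
    also have "\<dots> = (\<integral>\<^sup>+\<tau>. indicator E \<tau> \<partial>affine_grassmannian_base j)"
      unfolding affine_grassmannian_base_def by (subst nn_integral_distr) simp_all
    also have "\<dots> = emeasure (affine_grassmannian_base j) E"
      by (simp add: affine_grassmannian_base_def)
    finally show ?thesis .
  qed
  note eq = this
  \<comment> \<open>The set function inside \<open>measure_of\<close> agrees on all measurable sets
    with a genuine measure, which supplies its countable additivity.\<close>
  have "measure_of (affine_grassmannian j) (sets ?A)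
       (\<lambda>E. \<integral>\<^sup>+\<xi>. (\<integral>\<^sup>+u. indicator E ((+) u ` \<xi>) \<partial>plane_measure (\<xi>\<^sup>\<bottom>)) \<partial>grassmannian_measure UNIV j) =
    measure_of (space (affine_grassmannian_base j)) (sets (affine_grassmannian_base j)) (emeasure (affine_grassmannian_base j :: (real^'n) set measure))"
  proof -
    have sp: "space (affine_grassmannian_base j) = affine_grassmannian j"
      and st: "sets (affine_grassmannian_base j) = sets ?A"
      by (simp_all add: affine_grassmannian_base_def)
    show ?thesis
      unfolding sp st
    proof (rule measure_of_eq)
      show "sets ?A \<subseteq> Pow (affine_grassmannian j)" using sets.space_closed[of ?A] by simp
      show "(\<integral>\<^sup>+\<xi>. (\<integral>\<^sup>+u. indicator E ((+) u ` \<xi>) \<partial>plane_measure (\<xi>\<^sup>\<bottom>)) \<partial>grassmannian_measure UNIV j) =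
        emeasure (affine_grassmannian_base j) E" if "E \<in> sigma_sets (affine_grassmannian j) (sets ?A)" for E
        using that sets.sigma_sets_eq[of ?A] by (intro eq) simp
    qed
  qed
  also have "\<dots> = affine_grassmannian_base j" by (rule measure_of_of_measure)
  finally show ?thesis by (simp add: affine_grassmannian_measure_def)
qed

section \<open>Powers of the norm as mixtures of Gaussians\<close>

lemma nn_integral_gamma:
  fixes a r :: real
  assumes "0 < a" "0 < r"
  shows "(\<integral>\<^sup>+t. ennreal (indicator {0..} t * t powr (a - 1) * exp (- (t * r))) \<partial>lborel) =
    ennreal (Gamma a * r powr (- a))"
proof -
  have *: "indicator {0..} t * t powr (a - 1) / exp t =
      r powr (a - 1) * (indicator {0..} (t / r) * (t / r) powr (a - 1) * exp (- (t / r * r)))" for t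
    using assms by (auto simp: indicator_def powr_divide exp_minus field_simps zero_le_divide_iff)
  have "ennreal (Gamma a) = (\<integral>\<^sup>+t. ennreal (indicator {0..} t * t powr (a - 1) / exp t) \<partial>lborel)"
    by (rule Gamma_conv_nn_integral_real[OF assms(1)])
  also have "\<dots> = ennreal r * (\<integral>\<^sup>+t. ennreal (r powr (a - 1) * (indicator {0..} t * t powr (a - 1) * exp (- (t * r)))) \<partial>lborel)"
    using assms by (subst nn_integral_real_affine[of _ r 0]) (simp_all add: *)
  also have "\<dots> = ennreal r * (ennreal (r powr (a - 1)) * (\<integral>\<^sup>+t. ennreal (indicator {0..} t * t powr (a - 1) * exp (- (t * r))) \<partial>lborel))"
    by (simp add: ennreal_mult nn_integral_cmult)
  also have "\<dots> = ennreal (r powr a) * (\<integral>\<^sup>+t. ennreal (indicator {0..} t * t powr (a - 1) * exp (- (t * r))) \<partial>lborel)"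
    using assms by (simp add: mult.assoc[symmetric] powr_diff flip: ennreal_mult)
  finally have "ennreal (r powr (- a)) * ennreal (Gamma a) = ennreal (r powr (- a)) * (ennreal (r powr a) * (\<integral>\<^sup>+t. ennreal (indicator {0..} t * t powr (a - 1) * exp (- (t * r))) \<partial>lborel))"
    by simp
  also have "\<dots> = (\<integral>\<^sup>+t. ennreal (indicator {0..} t * t powr (a - 1) * exp (- (t * r))) \<partial>lborel)"
    using assms by (simp add: mult.assoc[symmetric] powr_minus flip: ennreal_mult)
  finally show ?thesis using assms by (simp add: mult.commute ennreal_mult Gamma_real_pos less_imp_le)
qed

text \<open>The Gamma integral at \<open>(norm x)\<^sup>2\<close>. Gaussians factor over orthogonal
  decompositions, so after this step integrals of norm powers reduce to Fubini and one-dimensional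
  Gamma integrals.\<close>

lemma norm_powr_gaussian_mixture:
  fixes x :: "'a::real_normed_vector"
  assumes "0 < q" "x \<noteq> 0"
  shows "ennreal (norm x powr (- q)) =
    (\<integral>\<^sup>+t. ennreal (1 / Gamma (q / 2) * (indicator {0..} t * t powr (q / 2 - 1))) * ennreal (exp (- (t * (norm x)\<^sup>2))) \<partial>lborel)"
proof -
  have G: "0 < Gamma (q / 2)" using assms by (simp add: Gamma_real_pos)
  have "((norm x)\<^sup>2) powr (- (q / 2)) = norm x powr (- q)"
    using assms(2) by (simp add: powr_powr flip: powr_numeral)
  then have "ennreal (Gamma (q / 2) * norm x powr (- q)) =
    (\<integral>\<^sup>+t. ennreal (indicator {0..} t * t powr (q / 2 - 1) * exp (- (t * (norm x)\<^sup>2))) \<partial>lborel)"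
    using nn_integral_gamma[of "q / 2" "(norm x)\<^sup>2"] assms by simp
  then have "ennreal (1 / Gamma (q / 2)) * ennreal (Gamma (q / 2) * norm x powr (- q)) =
    (\<integral>\<^sup>+t. ennreal (1 / Gamma (q / 2)) * ennreal (indicator {0..} t * t powr (q / 2 - 1) * exp (- (t * (norm x)\<^sup>2))) \<partial>lborel)"
    by (simp add: nn_integral_cmult)
  moreover have "ennreal (1 / Gamma (q / 2)) * ennreal (Gamma (q / 2) * norm x powr (- q)) = ennreal (norm x powr (- q))"
    using G by (simp flip: ennreal_mult)
  moreover have "ennreal (1 / Gamma (q / 2)) * ennreal (indicator {0..} t * t powr (q / 2 - 1) * exp (- (t * (norm x)\<^sup>2))) =
      ennreal (1 / Gamma (q / 2) * (indicator {0..} t * t powr (q / 2 - 1))) * ennreal (exp (- (t * (norm x)\<^sup>2)))" for t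
    using G by (simp add: mult.assoc flip: ennreal_mult)
  ultimately show ?thesis by simp
qed

text \<open>The mass of the origin is finite and, by dilation with factor 2, equals
  \<open>2 powr dim S\<close> times itself; so it is 0.\<close>

lemma AE_subspace_measure_nonzero:
  fixes S :: "'a::euclidean_space set"
  assumes S: "subspace S" and d: "0 < dim S"
  shows "AE x in subspace_measure S. x \<noteq> 0"
proof -
  let ?e = "emeasure (subspace_measure S) {0}"
  have e: "?e = (\<integral>\<^sup>+x. indicator {0} x \<partial>subspace_measure S)" by simp
  have "?e \<le> (\<integral>\<^sup>+x. ennreal (exp (- (1 * (norm x)\<^sup>2))) \<partial>subspace_measure S)"
    unfolding e by (intro nn_integral_mono) (auto simp: indicator_def)
  also have "\<dots> < \<infinity>" using nn_integral_gaussian_subspace[OF S, of 1] by simp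
  finally have fin: "?e < \<infinity>" .
  have "?e = ennreal (2 powr real (dim S)) * ?e"
  proof -
    have "indicator {0} (2 *\<^sub>R x) = (indicator {0} x :: ennreal)" for x :: 'a by (simp add: indicator_def)
    then show ?thesis
      using nn_integral_subspace_scale[OF S, of 2 "indicator {0}"] unfolding e by simp
  qed
  then have "enn2real ?e = 2 powr real (dim S) * enn2real ?e"
    by (metis enn2real_ennreal enn2real_mult powr_ge_zero)
  moreover have "(1::real) < 2 powr real (dim S)" using d by simp
  moreover have "x = 0" if "x = a * x" "1 < a" for x a :: real
    using that by (metis less_irrefl mult_cancel_right1)
  ultimately have "enn2real ?e = 0" by blast
  then have "?e = 0 \<or> ?e = \<top>" by (simp only: enn2real_eq_0_iff)
  with fin have "?e = 0" by (elim disjE) simp_all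
  then have "{0} \<in> null_sets (subspace_measure S)" by (simp add: null_sets_def)
  from AE_not_in[OF this] show ?thesis by simp
qed

text \<open>Expanding the power as a mixture over \<open>t\<close> and integrating over
  \<open>S\<close> leaves a Beta integral in \<open>t\<close>. Its factor
  \<open>(1 + t) powr (- (d / 2))\<close> is expanded as a Gamma integral over \<open>r\<close>;
  exchanging \<open>t\<close> and \<open>r\<close> then produces only Gamma functions.\<close>

lemma nn_integral_powr_gaussian:
  fixes S :: "'a::euclidean_space set"
  assumes S: "subspace S" and s: "0 < s" "s < real (dim S)"
  shows "(\<integral>\<^sup>+x. ennreal (norm x powr (s - real (dim S))) * ennreal (exp (- (norm x)\<^sup>2)) \<partial>subspace_measure S) =
    ennreal (pi powr (real (dim S) / 2) * Gamma (s / 2) / Gamma (real (dim S) / 2))"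
proof -
  define d where "d = real (dim S)"
  define q where "q = d - s"
  have q: "0 < q" "0 < d" using s by (auto simp: q_def d_def)
  have Gp: "0 < Gamma (q / 2)" "0 < Gamma (s / 2)" "0 < Gamma (d / 2)" using s q by (auto simp: Gamma_real_pos)
  define c where "c t = 1 / Gamma (q / 2) * (indicator {0..} t * t powr (q / 2 - 1))" for t
  have c0: "0 \<le> c t" for t using Gp by (simp add: c_def)
  have [measurable]: "c \<in> borel_measurable borel" unfolding c_def[abs_def] by measurable
  interpret S: sigma_finite_measure "subspace_measure S" by (rule sigma_finite_subspace_measure[OF S])
  interpret P: pair_sigma_finite "subspace_measure S" "lborel :: real measure" ..
  have nz: "AE x in subspace_measure S. x \<noteq> 0"
    using s by (intro AE_subspace_measure_nonzero[OF S]) linarith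
  have "(\<integral>\<^sup>+x. ennreal (norm x powr (s - real (dim S))) * ennreal (exp (- (norm x)\<^sup>2)) \<partial>subspace_measure S) =
    (\<integral>\<^sup>+x. (\<integral>\<^sup>+t. ennreal (c t) * ennreal (exp (- ((1 + t) * (norm x)\<^sup>2))) \<partial>lborel) \<partial>subspace_measure S)"
  proof (rule nn_integral_cong_AE, use nz in eventually_elim)
    fix x :: 'a assume x: "x \<noteq> 0"
    have "ennreal (norm x powr (s - real (dim S))) * ennreal (exp (- (norm x)\<^sup>2)) =
      (\<integral>\<^sup>+t. ennreal (c t) * ennreal (exp (- (t * (norm x)\<^sup>2))) * ennreal (exp (- (norm x)\<^sup>2)) \<partial>lborel)"
      using norm_powr_gaussian_mixture[OF q(1) x] by (simp add: nn_integral_multc q_def d_def c_def)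
    also have "\<dots> = (\<integral>\<^sup>+t. ennreal (c t) * ennreal (exp (- ((1 + t) * (norm x)\<^sup>2))) \<partial>lborel)"
      by (intro nn_integral_cong) (simp add: mult.assoc algebra_simps flip: ennreal_mult exp_add)
    finally show "ennreal (norm x powr (s - real (dim S))) * ennreal (exp (- (norm x)\<^sup>2)) =
      (\<integral>\<^sup>+t. ennreal (c t) * ennreal (exp (- ((1 + t) * (norm x)\<^sup>2))) \<partial>lborel)" .
  qed
  also have "\<dots> = (\<integral>\<^sup>+t. (\<integral>\<^sup>+x. ennreal (c t) * ennreal (exp (- ((1 + t) * (norm x)\<^sup>2))) \<partial>subspace_measure S) \<partial>lborel)"
    by (rule P.Fubini'[symmetric]) measurable
  also have "\<dots> = (\<integral>\<^sup>+t. ennreal (c t * (pi / (1 + t)) powr (d / 2)) \<partial>lborel)"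
  proof (rule nn_integral_cong)
    fix t :: real
    show "(\<integral>\<^sup>+x. ennreal (c t) * ennreal (exp (- ((1 + t) * (norm x)\<^sup>2))) \<partial>subspace_measure S) =
      ennreal (c t * (pi / (1 + t)) powr (d / 2))"
    proof (cases "0 \<le> t")
      case True
      then show ?thesis
        using nn_integral_gaussian_subspace[OF S, of "1 + t"]
        by (simp add: nn_integral_cmult d_def ennreal_mult c0)
    qed (simp add: c_def)
  qed
  also have "\<dots> = (\<integral>\<^sup>+t. (\<integral>\<^sup>+r. ennreal (pi powr (d / 2) / Gamma (d / 2)) * (ennreal (c t) *
      ennreal (indicator {0..} r * r powr (d / 2 - 1) * exp (- (r * (1 + t))))) \<partial>lborel) \<partial>lborel)"
  proof (rule nn_integral_cong)
    fix t :: real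
    show "ennreal (c t * (pi / (1 + t)) powr (d / 2)) =
      (\<integral>\<^sup>+r. ennreal (pi powr (d / 2) / Gamma (d / 2)) * (ennreal (c t) *
        ennreal (indicator {0..} r * r powr (d / 2 - 1) * exp (- (r * (1 + t))))) \<partial>lborel)"
    proof (cases "0 \<le> t")
      case True
      have "(\<integral>\<^sup>+r. ennreal (pi powr (d / 2) / Gamma (d / 2)) * (ennreal (c t) *
        ennreal (indicator {0..} r * r powr (d / 2 - 1) * exp (- (r * (1 + t))))) \<partial>lborel) =
        ennreal (pi powr (d / 2) / Gamma (d / 2)) * (ennreal (c t) * ennreal (Gamma (d / 2) * (1 + t) powr (- (d / 2))))"
        using True q by (simp add: nn_integral_cmult nn_integral_gamma)
      also have "\<dots> = ennreal (c t * (pi / (1 + t)) powr (d / 2))"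
        using Gp c0[of t] True by (simp add: powr_divide powr_minus field_simps flip: ennreal_mult)
      finally show ?thesis by simp
    qed (simp add: c_def)
  qed
  also have "\<dots> = (\<integral>\<^sup>+r. (\<integral>\<^sup>+t. ennreal (pi powr (d / 2) / Gamma (d / 2)) * (ennreal (c t) *
      ennreal (indicator {0..} r * r powr (d / 2 - 1) * exp (- (r * (1 + t))))) \<partial>lborel) \<partial>lborel)"
    by (rule lborel_pair.Fubini') measurable
  also have "\<dots> = (\<integral>\<^sup>+r. ennreal (pi powr (d / 2) / Gamma (d / 2)) *
      ennreal (indicator {0..} r * r powr (s / 2 - 1) * exp (- (r * 1))) \<partial>lborel)"
  proof (rule nn_integral_cong_AE, use AE_lborel_singleton[of "0::real"] in eventually_elim)
    fix r :: real assume "r \<noteq> 0"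
    show "(\<integral>\<^sup>+t. ennreal (pi powr (d / 2) / Gamma (d / 2)) * (ennreal (c t) *
      ennreal (indicator {0..} r * r powr (d / 2 - 1) * exp (- (r * (1 + t))))) \<partial>lborel) =
      ennreal (pi powr (d / 2) / Gamma (d / 2)) * ennreal (indicator {0..} r * r powr (s / 2 - 1) * exp (- (r * 1)))"
    proof (cases "0 < r")
      case True
      have "(\<integral>\<^sup>+t. ennreal (pi powr (d / 2) / Gamma (d / 2)) * (ennreal (c t) *
        ennreal (indicator {0..} r * r powr (d / 2 - 1) * exp (- (r * (1 + t))))) \<partial>lborel) =
        (\<integral>\<^sup>+t. ennreal (pi powr (d / 2) / Gamma (d / 2)) * (ennreal (r powr (d / 2 - 1) * exp (- r) / Gamma (q / 2)) *
          ennreal (indicator {0..} t * t powr (q / 2 - 1) * exp (- (t * r)))) \<partial>lborel)"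
      proof (intro nn_integral_cong arg_cong2[where f="(*)", OF refl])
        fix t :: real
        have "exp (- (r * (1 + t))) = exp (- r) * exp (- (t * r))" by (simp add: algebra_simps flip: exp_add)
        then have "c t * (indicator {0..} r * r powr (d / 2 - 1) * exp (- (r * (1 + t)))) =
          r powr (d / 2 - 1) * exp (- r) / Gamma (q / 2) * (indicator {0..} t * t powr (q / 2 - 1) * exp (- (t * r)))"
          using True by (simp add: c_def)
        then show "ennreal (c t) * ennreal (indicator {0..} r * r powr (d / 2 - 1) * exp (- (r * (1 + t)))) =
          ennreal (r powr (d / 2 - 1) * exp (- r) / Gamma (q / 2)) *
            ennreal (indicator {0..} t * t powr (q / 2 - 1) * exp (- (t * r)))"
          using c0[of t] Gp by (simp flip: ennreal_mult)
      qed
      also have "\<dots> = ennreal (pi powr (d / 2) / Gamma (d / 2)) * (ennreal (r powr (d / 2 - 1) * exp (- r) / Gamma (q / 2)) *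
          ennreal (Gamma (q / 2) * r powr (- (q / 2))))"
        using True q by (simp add: nn_integral_cmult nn_integral_gamma)
      also have "ennreal (r powr (d / 2 - 1) * exp (- r) / Gamma (q / 2)) * ennreal (Gamma (q / 2) * r powr (- (q / 2))) =
        ennreal (r powr (s / 2 - 1) * exp (- r))"
      proof -
        have "d / 2 - 1 + - (q / 2) = s / 2 - 1" by (simp add: q_def field_simps)
        then have "r powr (d / 2 - 1) * r powr (- (q / 2)) = r powr (s / 2 - 1)"
          by (metis powr_add)
        then show ?thesis using Gp by (simp add: field_simps flip: ennreal_mult)
      qed
      finally show ?thesis using True by simp
    qed (use \<open>r \<noteq> 0\<close> in simp)
  qed
  also have "\<dots> = ennreal (pi powr (d / 2) / Gamma (d / 2)) * ennreal (Gamma (s / 2))"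
    using s by (simp add: nn_integral_cmult nn_integral_gamma[of "s / 2" 1, simplified])
  also have "\<dots> = ennreal (pi powr (d / 2) * Gamma (s / 2) / Gamma (d / 2))"
    using Gp by (simp flip: ennreal_mult)
  finally show ?thesis by (simp add: d_def)
qed

text \<open>By Pythagoras each Gaussian of the mixture splits into a factor in \<open>a\<close> and
  a factor in \<open>b\<close>. Integrating over \<open>S\<close> multiplies by
  \<open>(pi / t) powr (dim S / 2)\<close>, which lowers the exponent of the power by
  \<open>dim S\<close>.\<close>

lemma nn_integral_powr_subspace:
  fixes S :: "'a::euclidean_space set"
  assumes S: "subspace S" and b: "b \<in> S\<^sup>\<bottom>" "b \<noteq> 0" and q: "real (dim S) < q"
  shows "(\<integral>\<^sup>+a. ennreal (norm (a + b) powr (- q)) \<partial>subspace_measure S) =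
    ennreal (pi powr (real (dim S) / 2) * Gamma ((q - real (dim S)) / 2) / Gamma (q / 2) * norm b powr (- (q - real (dim S))))"
proof -
  define d where "d = real (dim S)"
  have q: "0 < q" "0 < q - d" using q by (auto simp: d_def)
  have Gp: "0 < Gamma (q / 2)" "0 < Gamma ((q - d) / 2)" using q by (auto simp: Gamma_real_pos)
  define c where "c t = 1 / Gamma (q / 2) * (indicator {0..} t * t powr (q / 2 - 1))" for t
  have c0: "0 \<le> c t" for t using Gp by (simp add: c_def)
  have [measurable]: "c \<in> borel_measurable borel" unfolding c_def[abs_def] by measurable
  interpret S: sigma_finite_measure "subspace_measure S" by (rule sigma_finite_subspace_measure[OF S])
  interpret P: pair_sigma_finite "subspace_measure S" "lborel :: real measure" ..
  have "(\<integral>\<^sup>+a. ennreal (norm (a + b) powr (- q)) \<partial>subspace_measure S) =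
    (\<integral>\<^sup>+a. (\<integral>\<^sup>+t. ennreal (c t * exp (- (t * (norm b)\<^sup>2))) * ennreal (exp (- (t * (norm a)\<^sup>2))) \<partial>lborel) \<partial>subspace_measure S)"
  proof (rule nn_integral_subspace_measure_cong[OF S])
    fix a assume a: "a \<in> S"
    have "orthogonal a b" using inner_orthogonal_comp(1)[OF a b(1)] by (simp add: orthogonal_def)
    then have n: "(norm (a + b))\<^sup>2 = (norm a)\<^sup>2 + (norm b)\<^sup>2" by (rule norm_add_Pythagorean)
    then have "a + b \<noteq> 0" using b(2) by (metis add_nonneg_eq_0_iff norm_eq_zero power_zero_numeral zero_eq_power2 zero_le_power2)
    from norm_powr_gaussian_mixture[OF q(1) this]
    have "ennreal (norm (a + b) powr (- q)) =
      (\<integral>\<^sup>+t. ennreal (c t) * ennreal (exp (- (t * ((norm a)\<^sup>2 + (norm b)\<^sup>2)))) \<partial>lborel)"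
      unfolding c_def n .
    also have "\<dots> = (\<integral>\<^sup>+t. ennreal (c t * exp (- (t * (norm b)\<^sup>2))) * ennreal (exp (- (t * (norm a)\<^sup>2))) \<partial>lborel)"
    proof (rule nn_integral_cong)
      fix t :: real
      have "exp (- (t * ((norm a)\<^sup>2 + (norm b)\<^sup>2))) = exp (- (t * (norm b)\<^sup>2)) * exp (- (t * (norm a)\<^sup>2))"
        by (simp add: algebra_simps flip: exp_add)
      then show "ennreal (c t) * ennreal (exp (- (t * ((norm a)\<^sup>2 + (norm b)\<^sup>2)))) =
        ennreal (c t * exp (- (t * (norm b)\<^sup>2))) * ennreal (exp (- (t * (norm a)\<^sup>2)))"
        by (simp add: ennreal_mult c0 mult.assoc)
    qed
    finally show "ennreal (norm (a + b) powr (- q)) =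
      (\<integral>\<^sup>+t. ennreal (c t * exp (- (t * (norm b)\<^sup>2))) * ennreal (exp (- (t * (norm a)\<^sup>2))) \<partial>lborel)" .
  qed measurable
  also have "\<dots> = (\<integral>\<^sup>+t. (\<integral>\<^sup>+a. ennreal (c t * exp (- (t * (norm b)\<^sup>2))) * ennreal (exp (- (t * (norm a)\<^sup>2))) \<partial>subspace_measure S) \<partial>lborel)"
    by (rule P.Fubini'[symmetric]) measurable
  also have "\<dots> = (\<integral>\<^sup>+t. ennreal (pi powr (d / 2) / Gamma (q / 2)) * ennreal (indicator {0..} t * t powr ((q - d) / 2 - 1) * exp (- (t * (norm b)\<^sup>2))) \<partial>lborel)"
  proof (rule nn_integral_cong_AE, use AE_lborel_singleton[of "0::real"] in eventually_elim)
    fix t :: real assume "t \<noteq> 0"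
    show "(\<integral>\<^sup>+a. ennreal (c t * exp (- (t * (norm b)\<^sup>2))) * ennreal (exp (- (t * (norm a)\<^sup>2))) \<partial>subspace_measure S) =
      ennreal (pi powr (d / 2) / Gamma (q / 2)) * ennreal (indicator {0..} t * t powr ((q - d) / 2 - 1) * exp (- (t * (norm b)\<^sup>2)))"
    proof (cases "0 < t")
      case True
      have "q / 2 - 1 = (q - d) / 2 - 1 + d / 2" by (simp add: field_simps)
      then have "t powr (q / 2 - 1) = t powr ((q - d) / 2 - 1) * t powr (d / 2)"
        by (metis powr_add)
      then have "c t * exp (- (t * (norm b)\<^sup>2)) * (pi / t) powr (d / 2) =
        pi powr (d / 2) / Gamma (q / 2) * (indicator {0..} t * t powr ((q - d) / 2 - 1) * exp (- (t * (norm b)\<^sup>2)))"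
        using True by (simp add: c_def powr_divide)
      moreover have "(\<integral>\<^sup>+a. ennreal (c t * exp (- (t * (norm b)\<^sup>2))) * ennreal (exp (- (t * (norm a)\<^sup>2))) \<partial>subspace_measure S) =
        ennreal (c t * exp (- (t * (norm b)\<^sup>2))) * ennreal ((pi / t) powr (d / 2))"
        using True by (subst nn_integral_cmult) (simp_all add: nn_integral_gaussian_subspace[OF S] d_def)
      ultimately show ?thesis
        using c0[of t] Gp by (simp flip: ennreal_mult)
    qed (use \<open>t \<noteq> 0\<close> in \<open>simp add: c_def\<close>)
  qed
  also have "\<dots> = ennreal (pi powr (d / 2) / Gamma (q / 2)) * ennreal (Gamma ((q - d) / 2) * ((norm b)\<^sup>2) powr (- ((q - d) / 2)))"
    using q b by (simp add: nn_integral_cmult nn_integral_gamma)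
  also have "((norm b)\<^sup>2) powr (- ((q - d) / 2)) = norm b powr (- (q - d))"
  proof -
    have half: "2 * (- (e / 2)) = - e" for e :: real by simp
    have sq: "(norm b)\<^sup>2 = norm b powr 2" using b(2) by simp
    show ?thesis unfolding sq powr_powr half ..
  qed
  also have "ennreal (pi powr (d / 2) / Gamma (q / 2)) * ennreal (Gamma ((q - d) / 2) * norm b powr (- (q - d))) =
    ennreal (pi powr (d / 2) * Gamma ((q - d) / 2) / Gamma (q / 2) * norm b powr (- (q - d)))"
    using Gp by (simp flip: ennreal_mult)
  finally show ?thesis by (simp add: d_def)
qed

section \<open>Homogeneous measures tested on radial functions\<close>

text \<open>The degree is normalized so that Lebesgue measure on a subspace has degree
  \<open>dim S\<close>. Excluding mass at the origin makes it possible to rescale one variable by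
  the norm of another.\<close>

definition homogeneous_measure :: "'a::euclidean_space measure \<Rightarrow> real \<Rightarrow> bool" where
  "homogeneous_measure \<mu> s \<longleftrightarrow> sigma_finite_measure \<mu> \<and> sets \<mu> = sets borel \<and> (AE x in \<mu>. x \<noteq> 0) \<and>
     (\<forall>f\<in>borel_measurable borel. \<forall>c>0. (\<integral>\<^sup>+x. f x \<partial>\<mu>) = ennreal (c powr s) * (\<integral>\<^sup>+x. f (c *\<^sub>R x) \<partial>\<mu>))"

lemma ennreal_powr_mult: "ennreal (x powr a) * ennreal (x powr b) = ennreal (x powr (a + b))"
  by (simp add: powr_add ennreal_mult)

(* A substitute for polar coordinates: the right-hand side does not involve H and the first measure
   jointly, so comparison with the case of equal measures yields the proportionality below. *)
lemma homogeneous_measure_swap: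
  fixes \<mu> \<nu> :: "'a::euclidean_space measure" and H \<phi> :: "real \<Rightarrow> ennreal"
  assumes \<mu>: "homogeneous_measure \<mu> s" and \<nu>: "homogeneous_measure \<nu> s"
    and [measurable]: "H \<in> borel_measurable borel" "\<phi> \<in> borel_measurable borel"
  shows "(\<integral>\<^sup>+x. H (norm x) \<partial>\<mu>) * (\<integral>\<^sup>+y. \<phi> (norm y) \<partial>\<nu>) =
    (\<integral>\<^sup>+x. \<phi> (norm x) \<partial>\<mu>) * (\<integral>\<^sup>+y. ennreal (norm y powr (- 2 * s)) * H (1 / norm y) \<partial>\<nu>)"
proof -
  interpret \<mu>: sigma_finite_measure \<mu> using \<mu> by (simp add: homogeneous_measure_def)
  interpret \<nu>: sigma_finite_measure \<nu> using \<nu> by (simp add: homogeneous_measure_def)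
  interpret pair_sigma_finite \<mu> \<nu> ..
  have [measurable_cong]: "sets \<mu> = sets borel" "sets \<nu> = sets borel"
    and nz\<mu>: "AE x in \<mu>. x \<noteq> 0" and nz\<nu>: "AE x in \<nu>. x \<noteq> 0"
    using \<mu> \<nu> by (auto simp: homogeneous_measure_def)
  have sc\<mu>: "(\<integral>\<^sup>+x. f x \<partial>\<mu>) = ennreal (c powr s) * (\<integral>\<^sup>+x. f (c *\<^sub>R x) \<partial>\<mu>)"
    if "f \<in> borel_measurable borel" "0 < c" for f c using \<mu> that unfolding homogeneous_measure_def by blast
  have sc\<nu>: "(\<integral>\<^sup>+x. f x \<partial>\<nu>) = ennreal (c powr s) * (\<integral>\<^sup>+x. f (c *\<^sub>R x) \<partial>\<nu>)"
    if "f \<in> borel_measurable borel" "0 < c" for f c using \<nu> that unfolding homogeneous_measure_def by blast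
  \<comment> \<open>The integrand after \<open>y\<close> has been rescaled by \<open>norm x\<close>
    and then \<open>x\<close> by \<open>1 / norm y\<close>. A last rescaling of \<open>y\<close> by
    \<open>norm x\<close> separates the variables.\<close>
  define K where "K x y = ennreal (norm x powr s) * \<phi> (norm x) * (ennreal (norm y powr (- 2 * s)) * H (norm x / norm y))" for x y :: 'a
  have [measurable]: "(\<lambda>p. K (fst p) (snd p)) \<in> borel_measurable (borel \<Otimes>\<^sub>M borel)"
    unfolding K_def by measurable
  have "(\<integral>\<^sup>+x. H (norm x) \<partial>\<mu>) * (\<integral>\<^sup>+y. \<phi> (norm y) \<partial>\<nu>) = (\<integral>\<^sup>+x. H (norm x) * (\<integral>\<^sup>+y. \<phi> (norm y) \<partial>\<nu>) \<partial>\<mu>)"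
    by (simp add: nn_integral_multc)
  also have "\<dots> = (\<integral>\<^sup>+x. (\<integral>\<^sup>+y. H (norm x) * (ennreal (norm x powr s) * \<phi> (norm x * norm y)) \<partial>\<nu>) \<partial>\<mu>)"
  proof (rule nn_integral_cong_AE, use nz\<mu> in eventually_elim)
    fix x :: 'a assume "x \<noteq> 0"
    then have "(\<integral>\<^sup>+y. \<phi> (norm y) \<partial>\<nu>) = ennreal (norm x powr s) * (\<integral>\<^sup>+y. \<phi> (norm x * norm y) \<partial>\<nu>)"
      by (subst sc\<nu>[of _ "norm x"]) auto
    then show "H (norm x) * (\<integral>\<^sup>+y. \<phi> (norm y) \<partial>\<nu>) =
      (\<integral>\<^sup>+y. H (norm x) * (ennreal (norm x powr s) * \<phi> (norm x * norm y)) \<partial>\<nu>)"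
      by (simp add: nn_integral_cmult)
  qed
  also have "\<dots> = (\<integral>\<^sup>+y. (\<integral>\<^sup>+x. H (norm x) * (ennreal (norm x powr s) * \<phi> (norm x * norm y)) \<partial>\<mu>) \<partial>\<nu>)"
    by (rule Fubini'[symmetric]) measurable
  also have "\<dots> = (\<integral>\<^sup>+y. (\<integral>\<^sup>+x. K x y \<partial>\<mu>) \<partial>\<nu>)"
  proof (rule nn_integral_cong_AE, use nz\<nu> in eventually_elim)
    fix y :: 'a assume y: "y \<noteq> 0"
    have "(\<integral>\<^sup>+x. H (norm x) * (ennreal (norm x powr s) * \<phi> (norm x * norm y)) \<partial>\<mu>) =
      ennreal ((1 / norm y) powr s) * (\<integral>\<^sup>+x. H (norm x / norm y) * (ennreal ((norm x / norm y) powr s) * \<phi> (norm x)) \<partial>\<mu>)"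
      using y by (subst sc\<mu>[of _ "1 / norm y"]) simp_all
    also have "\<dots> = (\<integral>\<^sup>+x. ennreal ((1 / norm y) powr s) * (H (norm x / norm y) * (ennreal ((norm x / norm y) powr s) * \<phi> (norm x))) \<partial>\<mu>)"
      by (simp add: nn_integral_cmult)
    also have "\<dots> = (\<integral>\<^sup>+x. K x y \<partial>\<mu>)"
    proof (rule nn_integral_cong)
      fix x :: 'a
      have "(1 / norm y) powr s * (norm x / norm y) powr s = norm x powr s * norm y powr (- 2 * s)"
        by (simp add: powr_divide powr_minus_divide flip: powr_add)
      then have eq: "ennreal ((1 / norm y) powr s) * ennreal ((norm x / norm y) powr s) =
        ennreal (norm x powr s) * ennreal (norm y powr (- 2 * s))"
        by (simp flip: ennreal_mult)
      have "ennreal ((1 / norm y) powr s) * (H (norm x / norm y) * (ennreal ((norm x / norm y) powr s) * \<phi> (norm x))) =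
        (ennreal ((1 / norm y) powr s) * ennreal ((norm x / norm y) powr s)) * (H (norm x / norm y) * \<phi> (norm x))"
        by (simp only: mult_ac)
      also have "\<dots> = K x y" unfolding eq K_def by (simp only: mult_ac)
      finally show "ennreal ((1 / norm y) powr s) * (H (norm x / norm y) * (ennreal ((norm x / norm y) powr s) * \<phi> (norm x))) = K x y" .
    qed
    finally show "(\<integral>\<^sup>+x. H (norm x) * (ennreal (norm x powr s) * \<phi> (norm x * norm y)) \<partial>\<mu>) = (\<integral>\<^sup>+x. K x y \<partial>\<mu>)" .
  qed
  also have "\<dots> = (\<integral>\<^sup>+x. (\<integral>\<^sup>+y. K x y \<partial>\<nu>) \<partial>\<mu>)"
    by (rule Fubini') (simp add: case_prod_beta')
  also have "\<dots> = (\<integral>\<^sup>+x. \<phi> (norm x) * (\<integral>\<^sup>+y. ennreal (norm y powr (- 2 * s)) * H (1 / norm y) \<partial>\<nu>) \<partial>\<mu>)"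
  proof (rule nn_integral_cong_AE, use nz\<mu> in eventually_elim)
    fix x :: 'a assume x: "x \<noteq> 0"
    have "(\<integral>\<^sup>+y. K x y \<partial>\<nu>) = ennreal (norm x powr s) * \<phi> (norm x) * (\<integral>\<^sup>+y. ennreal (norm y powr (- 2 * s)) * H (norm x / norm y) \<partial>\<nu>)"
      unfolding K_def by (simp add: nn_integral_cmult)
    also have "(\<integral>\<^sup>+y. ennreal (norm y powr (- 2 * s)) * H (norm x / norm y) \<partial>\<nu>) =
      ennreal (norm x powr s) * (\<integral>\<^sup>+y. ennreal ((norm x * norm y) powr (- 2 * s)) * H (1 / norm y) \<partial>\<nu>)"
      using x by (subst sc\<nu>[of _ "norm x"]) simp_all
    also have "\<dots> = ennreal (norm x powr s) * (ennreal (norm x powr (- 2 * s)) * (\<integral>\<^sup>+y. ennreal (norm y powr (- 2 * s)) * H (1 / norm y) \<partial>\<nu>))"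
      by (simp add: powr_mult ennreal_mult mult.assoc nn_integral_cmult)
    also have "ennreal (norm x powr s) * \<phi> (norm x) * \<dots> = (ennreal (norm x powr s) * ennreal (norm x powr s) * ennreal (norm x powr (- 2 * s))) *
      (\<phi> (norm x) * (\<integral>\<^sup>+y. ennreal (norm y powr (- 2 * s)) * H (1 / norm y) \<partial>\<nu>))"
      by (simp only: mult_ac)
    also have "ennreal (norm x powr s) * ennreal (norm x powr s) * ennreal (norm x powr (- 2 * s)) = 1"
      using x by (simp add: ennreal_powr_mult)
    finally show "(\<integral>\<^sup>+y. K x y \<partial>\<nu>) = \<phi> (norm x) * (\<integral>\<^sup>+y. ennreal (norm y powr (- 2 * s)) * H (1 / norm y) \<partial>\<nu>)" by simp
  qed
  also have "\<dots> = (\<integral>\<^sup>+x. \<phi> (norm x) \<partial>\<mu>) * (\<integral>\<^sup>+y. ennreal (norm y powr (- 2 * s)) * H (1 / norm y) \<partial>\<nu>)"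
    by (rule nn_integral_multc) measurable
  finally show ?thesis .
qed

text \<open>The swap identity is used for the pair \<open>\<mu>\<close>, \<open>\<nu>\<close> and
  for the pair \<open>\<nu>\<close>, \<open>\<nu>\<close>; both contain the same integral
  \<open>C\<close>, which is eliminated. The Gaussian is a test function with finite positive
  integral, so the factor becomes a quotient of Gaussian integrals.\<close>

lemma homogeneous_measure_radial:
  fixes \<mu> \<nu> :: "'a::euclidean_space measure" and H :: "'a \<Rightarrow> ennreal"
  assumes \<mu>: "homogeneous_measure \<mu> s" and \<nu>: "homogeneous_measure \<nu> s"
    and H [measurable]: "H \<in> borel_measurable borel" and rad: "\<And>x y. norm x = norm y \<Longrightarrow> H x = H y"
    and G: "(\<integral>\<^sup>+x. ennreal (exp (- (norm x)\<^sup>2)) \<partial>\<mu>) = ennreal A" "(\<integral>\<^sup>+x. ennreal (exp (- (norm x)\<^sup>2)) \<partial>\<nu>) = ennreal B"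
    and AB: "0 < A" "0 < B"
  shows "(\<integral>\<^sup>+x. H x \<partial>\<mu>) = ennreal (A / B) * (\<integral>\<^sup>+x. H x \<partial>\<nu>)"
proof -
  obtain e :: 'a where e: "norm e = 1" using norm_Basis nonempty_Basis by blast
  define h where "h r = H (r *\<^sub>R e)" for r
  have [measurable]: "h \<in> borel_measurable borel" unfolding h_def by measurable
  have h: "H x = h (norm x)" for x unfolding h_def by (rule rad) (simp add: e)
  define g where "g r = ennreal (exp (- r\<^sup>2))" for r :: real
  have [measurable]: "g \<in> borel_measurable borel" unfolding g_def by measurable
  define C where "C = (\<integral>\<^sup>+y. ennreal (norm y powr (- 2 * s)) * h (1 / norm y) \<partial>\<nu>)"
  have 1: "(\<integral>\<^sup>+x. H x \<partial>\<mu>) * ennreal B = ennreal A * C"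
    using homogeneous_measure_swap[OF \<mu> \<nu>, of h g] G by (simp add: h g_def C_def)
  have "(\<integral>\<^sup>+x. H x \<partial>\<nu>) * ennreal B = ennreal B * C"
    using homogeneous_measure_swap[OF \<nu> \<nu>, of h g] G by (simp add: h g_def C_def)
  then have C: "(\<integral>\<^sup>+x. H x \<partial>\<nu>) = C"
    using AB by (simp add: mult.commute[of _ "ennreal B"] ennreal_mult_cancel_left)
  have "(\<integral>\<^sup>+x. H x \<partial>\<mu>) * ennreal B = ennreal (A / B) * (\<integral>\<^sup>+x. H x \<partial>\<nu>) * ennreal B"
    using 1 AB unfolding C by (simp add: mult.commute[of _ C] mult.assoc flip: ennreal_mult)
  then show ?thesis using AB by (subst (asm) mult_right_ennreal_cancel) auto
qed

lemma sigma_finite_density_powr: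
  fixes g :: "'a::euclidean_space \<Rightarrow> real"
  assumes [measurable]: "g \<in> borel_measurable borel"
  shows "sigma_finite_measure (density lborel (\<lambda>x. ennreal (g x)))"
  by (subst sigma_finite_measure.sigma_finite_iff_density_finite[OF sigma_finite_lborel]) auto

lemma homogeneous_subspace_measure:
  fixes S :: "'a::euclidean_space set"
  assumes "subspace S" "0 < dim S"
  shows "homogeneous_measure (subspace_measure S) (real (dim S))"
  unfolding homogeneous_measure_def
  using assms AE_subspace_measure_nonzero sigma_finite_subspace_measure
  by (intro conjI ballI allI impI nn_integral_subspace_scale) auto

text \<open>Applied with \<open>g\<close> the identity, for the kernel on the whole space, and with
  \<open>g\<close> a projection, for a kernel that sees only the component in a subspace.\<close>

lemma homogeneous_density_powr:
  fixes g :: "'a::euclidean_space \<Rightarrow> 'a"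
  assumes lin: "linear g"
  shows "homogeneous_measure (density lborel (\<lambda>x. ennreal (norm (g x) powr a))) (real DIM('a) + a)"
  unfolding homogeneous_measure_def
proof (intro conjI ballI allI impI)
  have [measurable]: "g \<in> borel \<rightarrow>\<^sub>M borel"
    using lin by (intro borel_measurable_continuous_onI linear_continuous_on) (simp add: linear_conv_bounded_linear)
  show "sigma_finite_measure (density lborel (\<lambda>x. ennreal (norm (g x) powr a)))"
    by (rule sigma_finite_density_powr) measurable
  show "AE x in density lborel (\<lambda>x. ennreal (norm (g x) powr a)). x \<noteq> 0"
    using AE_lborel_singleton[of "0::'a"] by (subst AE_density) auto
  fix f :: "'a \<Rightarrow> ennreal" and c :: real assume [measurable]: "f \<in> borel_measurable borel" and c: "0 < c"
  have "(\<integral>\<^sup>+x. f x \<partial>density lborel (\<lambda>x. ennreal (norm (g x) powr a))) = (\<integral>\<^sup>+x. ennreal (norm (g x) powr a) * f x \<partial>lborel)"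
    by (rule nn_integral_density) measurable
  also have "\<dots> = ennreal (c ^ DIM('a)) * (\<integral>\<^sup>+x. ennreal (norm (g (c *\<^sub>R x)) powr a) * f (c *\<^sub>R x) \<partial>lborel)"
    using c by (subst nn_integral_lborel_scale[of _ c]) simp_all
  also have "\<dots> = ennreal (c ^ DIM('a)) * (ennreal (c powr a) * (\<integral>\<^sup>+x. ennreal (norm (g x) powr a) * f (c *\<^sub>R x) \<partial>lborel))"
    using c by (simp add: linear_scale[OF lin] powr_mult ennreal_mult mult.assoc nn_integral_cmult)
  also have "\<dots> = ennreal (c powr (real DIM('a) + a)) * (\<integral>\<^sup>+x. ennreal (norm (g x) powr a) * f (c *\<^sub>R x) \<partial>lborel)"
    using c by (simp add: powr_add powr_realpow ennreal_mult mult.assoc)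
  also have "(\<integral>\<^sup>+x. ennreal (norm (g x) powr a) * f (c *\<^sub>R x) \<partial>lborel) =
    (\<integral>\<^sup>+x. f (c *\<^sub>R x) \<partial>density lborel (\<lambda>x. ennreal (norm (g x) powr a)))"
    by (rule nn_integral_density[symmetric]) measurable
  finally show "(\<integral>\<^sup>+x. f x \<partial>density lborel (\<lambda>x. ennreal (norm (g x) powr a))) =
    ennreal (c powr (real DIM('a) + a)) * (\<integral>\<^sup>+x. f (c *\<^sub>R x) \<partial>density lborel (\<lambda>x. ennreal (norm (g x) powr a)))" .
qed simp

text \<open>The norm power depends on the component in \<open>S\<close> only, so the component in
  \<open>S\<^sup>\<bottom>\<close> contributes a plain Gaussian integral, a power of
  \<open>pi\<close>.\<close>

lemma nn_integral_gaussian_powr_closest_point: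
  fixes S :: "'a::euclidean_space set"
  assumes S: "subspace S" and s: "0 < s" "s < real (dim S)"
  shows "(\<integral>\<^sup>+x. ennreal (norm (closest_point S x) powr (s - real (dim S))) * ennreal (exp (- (norm x)\<^sup>2)) \<partial>lborel) =
    ennreal (pi powr (real DIM('a) / 2) * Gamma (s / 2) / Gamma (real (dim S) / 2))"
proof -
  have [measurable]: "closest_point S \<in> borel \<rightarrow>\<^sub>M borel" using S by simp
  interpret C: sigma_finite_measure "subspace_measure (S\<^sup>\<bottom>)"
    by (rule sigma_finite_subspace_measure[OF subspace_orthogonal_comp])
  define d where "d = real (dim S)"
  define d' where "d' = real (dim (S\<^sup>\<bottom>))"
  have "(\<integral>\<^sup>+x. ennreal (norm (closest_point S x) powr (s - d)) * ennreal (exp (- (norm x)\<^sup>2)) \<partial>lborel) =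
    (\<integral>\<^sup>+a. (\<integral>\<^sup>+b. ennreal (norm (closest_point S (a + b)) powr (s - d)) * ennreal (exp (- (norm (a + b))\<^sup>2)) \<partial>subspace_measure (S\<^sup>\<bottom>)) \<partial>subspace_measure S)"
    by (rule nn_integral_lborel_decompose[OF S]) measurable
  also have "\<dots> = (\<integral>\<^sup>+a. ennreal (norm a powr (s - d)) * ennreal (exp (- (norm a)\<^sup>2)) * ennreal (pi powr (d' / 2)) \<partial>subspace_measure S)"
  proof (rule nn_integral_subspace_measure_cong[OF S])
    fix a assume a: "a \<in> S"
    have "(\<integral>\<^sup>+b. ennreal (norm (closest_point S (a + b)) powr (s - d)) * ennreal (exp (- (norm (a + b))\<^sup>2)) \<partial>subspace_measure (S\<^sup>\<bottom>)) =
      (\<integral>\<^sup>+b. ennreal (norm a powr (s - d)) * ennreal (exp (- (norm a)\<^sup>2)) * ennreal (exp (- (1 * (norm b)\<^sup>2))) \<partial>subspace_measure (S\<^sup>\<bottom>))"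
    proof (rule nn_integral_subspace_measure_cong[OF subspace_orthogonal_comp])
      fix b assume b: "b \<in> S\<^sup>\<bottom>"
      have "closest_point S (a + b) = a" using a b S by (intro closest_point_eqI) auto
      moreover have "(norm (a + b))\<^sup>2 = (norm a)\<^sup>2 + (norm b)\<^sup>2"
        using inner_orthogonal_comp(1)[OF a b] by (intro norm_add_Pythagorean) (simp add: orthogonal_def)
      ultimately show "ennreal (norm (closest_point S (a + b)) powr (s - d)) * ennreal (exp (- (norm (a + b))\<^sup>2)) =
        ennreal (norm a powr (s - d)) * ennreal (exp (- (norm a)\<^sup>2)) * ennreal (exp (- (1 * (norm b)\<^sup>2)))"
        by (simp add: mult.assoc flip: ennreal_mult exp_add)
    qed measurable
    also have "\<dots> = ennreal (norm a powr (s - d)) * ennreal (exp (- (norm a)\<^sup>2)) * ennreal (pi powr (d' / 2))"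
      using nn_integral_gaussian_subspace[OF subspace_orthogonal_comp, of 1 S] by (subst nn_integral_cmult) (auto simp: d'_def)
    finally show "(\<integral>\<^sup>+b. ennreal (norm (closest_point S (a + b)) powr (s - d)) * ennreal (exp (- (norm (a + b))\<^sup>2)) \<partial>subspace_measure (S\<^sup>\<bottom>)) =
      ennreal (norm a powr (s - d)) * ennreal (exp (- (norm a)\<^sup>2)) * ennreal (pi powr (d' / 2))" .
  qed measurable
  also have "\<dots> = ennreal (pi powr (d / 2) * Gamma (s / 2) / Gamma (d / 2)) * ennreal (pi powr (d' / 2))"
    using nn_integral_powr_gaussian[OF S s] by (simp add: nn_integral_multc d_def)
  also have "\<dots> = ennreal (pi powr (real DIM('a) / 2) * Gamma (s / 2) / Gamma (d / 2))"
  proof -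
    have "real DIM('a) / 2 = d / 2 + d' / 2"
      using dim_orthogonal_comp[OF S] by (simp add: d_def d'_def add_divide_distrib[symmetric] flip: of_nat_add)
    then have "pi powr (real DIM('a) / 2) = pi powr (d / 2) * pi powr (d' / 2)" by (simp only: powr_add)
    moreover have "0 < Gamma (s / 2)" "0 < Gamma (d / 2)" using s by (auto simp: Gamma_real_pos d_def)
    ultimately show ?thesis by (simp flip: ennreal_mult)
  qed
  finally show ?thesis by (simp add: d_def)
qed

section \<open>Riesz kernels\<close>

text \<open>The dimension \<open>N\<close> is a parameter of its own, since the kernels of fibres of
  dimension \<open>n - j\<close> and \<open>n - k\<close> are evaluated at vectors of the ambient
  space. By the convention for \<open>powr\<close> the value at 0 is 0.\<close>

definition riesz_kernel :: "nat \<Rightarrow> real \<Rightarrow> 'a::real_normed_vector \<Rightarrow> real" where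
  "riesz_kernel N \<alpha> x = norm x powr (\<alpha> - real N) / riesz_gamma N \<alpha>"

text \<open>The constant \<open>c\<close> of the inversion formulas, for
  \<open>m = j + k\<close>.\<close>

definition radon_constant :: "nat \<Rightarrow> nat \<Rightarrow> real" where
  "radon_constant n m = 2 ^ m * pi powr (real m / 2) * Gamma (real n / 2) / Gamma ((real n - real m) / 2)"

lemma riesz_gamma_pos: "0 < \<alpha> \<Longrightarrow> \<alpha> < real N \<Longrightarrow> 0 < riesz_gamma N \<alpha>"
  by (simp add: riesz_gamma_def Gamma_real_pos)

lemma radon_constant_pos: "m < n \<Longrightarrow> 0 < radon_constant n m"
  by (simp add: radon_constant_def Gamma_real_pos)

lemma riesz_kernel_nonneg: "0 < \<alpha> \<Longrightarrow> \<alpha> < real N \<Longrightarrow> 0 \<le> riesz_kernel N \<alpha> x"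
  by (simp add: riesz_kernel_def riesz_gamma_pos less_imp_le)

lemma riesz_kernel_norm_cong: "norm x = norm y \<Longrightarrow> riesz_kernel N \<alpha> x = riesz_kernel N \<alpha> y"
  by (simp add: riesz_kernel_def)

lemma riesz_kernel_measurable [measurable (raw)]:
  fixes f :: "'b \<Rightarrow> 'a::{real_normed_vector, second_countable_topology}"
  assumes [measurable]: "f \<in> M \<rightarrow>\<^sub>M borel"
  shows "(\<lambda>x. riesz_kernel N \<alpha> (f x)) \<in> borel_measurable M"
  unfolding riesz_kernel_def by measurable

text \<open>Lebesgue measure on \<open>S\<close> and the density \<open>norm x powr (m - n)\<close>
  are homogeneous of the same degree \<open>m\<close>, hence proportional on radial functions. The
  constant is the quotient \<open>A / B\<close> of their Gaussian integrals times the normalization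
  of the Riesz kernel.\<close>

lemma nn_integral_radial_subspace:
  fixes S :: "'a::euclidean_space set" and H :: "'a \<Rightarrow> ennreal"
  assumes S: "subspace S" "0 < dim S" "dim S < DIM('a)"
    and [measurable]: "H \<in> borel_measurable borel" and rad: "\<And>x y. norm x = norm y \<Longrightarrow> H x = H y"
  shows "(\<integral>\<^sup>+x. H x \<partial>subspace_measure S) =
    ennreal (radon_constant DIM('a) (dim S)) * (\<integral>\<^sup>+x. ennreal (riesz_kernel DIM('a) (real (dim S)) x) * H x \<partial>lborel)"
proof -
  define n m where "n = real DIM('a)" and "m = real (dim S)"
  have nm: "0 < m" "m < n" using S by (auto simp: n_def m_def)
  define A B where "A = pi powr (m / 2)" and "B = pi powr (n / 2) * Gamma (m / 2) / Gamma (n / 2)"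
  have Gp: "0 < Gamma (m / 2)" "0 < Gamma (n / 2)" "0 < Gamma ((n - m) / 2)" using nm by (auto simp: Gamma_real_pos)
  have AB: "0 < A" "0 < B" using Gp by (auto simp: A_def B_def)
  have g: "0 < riesz_gamma DIM('a) m" using nm by (intro riesz_gamma_pos) (auto simp: n_def)
  let ?\<nu> = "density lborel (\<lambda>x::'a. ennreal (norm (id x) powr (m - n)))"
  have hom: "homogeneous_measure ?\<nu> m"
    using homogeneous_density_powr[of "id :: 'a \<Rightarrow> 'a" "m - n", OF linear_id] by (simp add: n_def)
  have G1: "(\<integral>\<^sup>+x. ennreal (exp (- (norm x)\<^sup>2)) \<partial>subspace_measure S) = ennreal A"
    using nn_integral_gaussian_subspace[OF S(1), of 1] by (simp add: A_def m_def)
  have G2: "(\<integral>\<^sup>+x. ennreal (exp (- (norm x)\<^sup>2)) \<partial>?\<nu>) = ennreal B"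
    using nn_integral_powr_gaussian[OF subspace_UNIV, of m] nm
    by (simp add: nn_integral_density subspace_measure_UNIV B_def n_def)
  have "(\<integral>\<^sup>+x. H x \<partial>subspace_measure S) = ennreal (A / B) * (\<integral>\<^sup>+x. H x \<partial>?\<nu>)"
    by (rule homogeneous_measure_radial[OF homogeneous_subspace_measure[OF S(1,2), folded m_def] hom _ rad G1 G2 AB]) auto
  also have "(\<integral>\<^sup>+x. H x \<partial>?\<nu>) = (\<integral>\<^sup>+x. ennreal (norm x powr (m - n)) * H x \<partial>lborel)"
    by (simp add: nn_integral_density)
  also have "\<dots> = (\<integral>\<^sup>+x. ennreal (riesz_gamma DIM('a) m) * (ennreal (riesz_kernel DIM('a) m x) * H x) \<partial>lborel)"
    using g by (simp add: riesz_kernel_def n_def[symmetric] mult.assoc[symmetric] flip: ennreal_mult)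
  also have "\<dots> = ennreal (riesz_gamma DIM('a) m) * (\<integral>\<^sup>+x. ennreal (riesz_kernel DIM('a) m x) * H x \<partial>lborel)"
    by (rule nn_integral_cmult) measurable
  also have "ennreal (A / B) * \<dots> = ennreal (A / B * riesz_gamma DIM('a) m) * (\<integral>\<^sup>+x. ennreal (riesz_kernel DIM('a) m x) * H x \<partial>lborel)"
    using AB g by (subst ennreal_mult) (auto simp: mult.assoc)
  also have "A / B * riesz_gamma DIM('a) m = radon_constant DIM('a) (dim S)"
    using Gp by (simp add: A_def B_def riesz_gamma_def radon_constant_def n_def[symmetric] m_def[symmetric] powr_realpow[symmetric])
  finally show ?thesis by (simp add: m_def)
qed

text \<open>Pulling the kernel of \<open>S\<close> back along the projection adds \<open>m\<close>
  directions in which it is constant, so the degree rises from \<alpha> to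
  \<open>m + \<alpha>\<close>. The constant is again a quotient of Gaussian integrals, and
  normalizing both kernels removes \<alpha> from it.\<close>

lemma nn_integral_radial_projection:
  fixes S :: "'a::euclidean_space set" and H :: "'a \<Rightarrow> ennreal"
  assumes S: "subspace S" and m: "dim S + m = DIM('a)" and \<alpha>: "0 < \<alpha>" "\<alpha> < real (dim S)"
    and [measurable]: "H \<in> borel_measurable borel" and rad: "\<And>x y. norm x = norm y \<Longrightarrow> H x = H y"
  shows "(\<integral>\<^sup>+x. ennreal (riesz_kernel (dim S) \<alpha> (closest_point S x)) * H x \<partial>lborel) =
    ennreal (radon_constant DIM('a) m) * (\<integral>\<^sup>+x. ennreal (riesz_kernel DIM('a) (real m + \<alpha>) x) * H x \<partial>lborel)"
proof -
  define n d \<beta> where "n = real DIM('a)" and "d = real (dim S)" and "\<beta> = real m + \<alpha>"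
  have nd: "n = d + real m" using m by (simp add: n_def d_def flip: of_nat_add)
  have b: "0 < \<beta>" "\<beta> < n" using \<alpha> by (auto simp: \<beta>_def nd d_def)
  have d0: "0 < d" using \<alpha> by (simp add: d_def)
  have [measurable]: "closest_point S \<in> borel \<rightarrow>\<^sub>M borel" using S by simp
  define A B where "A = pi powr (n / 2) * Gamma (\<alpha> / 2) / Gamma (d / 2)" and "B = pi powr (n / 2) * Gamma (\<beta> / 2) / Gamma (n / 2)"
  have Gp: "0 < Gamma (\<alpha> / 2)" "0 < Gamma (n / 2)" "0 < Gamma (d / 2)" "0 < Gamma (\<beta> / 2)" "0 < Gamma ((d - \<alpha>) / 2)"
    using b d0 \<alpha> by (auto simp: Gamma_real_pos d_def)
  have AB: "0 < A" "0 < B" using Gp by (auto simp: A_def B_def)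
  have g: "0 < riesz_gamma DIM('a) \<beta>" "0 < riesz_gamma (dim S) \<alpha>"
    using b \<alpha> by (auto intro!: riesz_gamma_pos simp: n_def)
  let ?\<mu> = "density lborel (\<lambda>x::'a. ennreal (norm (closest_point S x) powr (\<alpha> - d)))"
  let ?\<nu> = "density lborel (\<lambda>x::'a. ennreal (norm (id x) powr (\<beta> - n)))"
  have hom: "homogeneous_measure ?\<mu> \<beta>" "homogeneous_measure ?\<nu> \<beta>"
    using homogeneous_density_powr[OF linear_closest_point[OF S], of "\<alpha> - d"] homogeneous_density_powr[of "id :: 'a \<Rightarrow> 'a" "\<beta> - n", OF linear_id]
    by (simp_all add: n_def[symmetric] nd \<beta>_def)
  have G1: "(\<integral>\<^sup>+x. ennreal (exp (- (norm x)\<^sup>2)) \<partial>?\<mu>) = ennreal A"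
    using nn_integral_gaussian_powr_closest_point[OF S \<alpha>] by (simp add: nn_integral_density A_def n_def d_def)
  have G2: "(\<integral>\<^sup>+x. ennreal (exp (- (norm x)\<^sup>2)) \<partial>?\<nu>) = ennreal B"
    using nn_integral_powr_gaussian[OF subspace_UNIV, of \<beta>] b
    by (simp add: nn_integral_density subspace_measure_UNIV B_def n_def)
  have pull: "(\<integral>\<^sup>+x. H x \<partial>density lborel (\<lambda>x::'a. ennreal (norm (p x) powr (a - real N)))) =
      ennreal (riesz_gamma N a) * (\<integral>\<^sup>+x. ennreal (riesz_kernel N a (p x)) * H x \<partial>lborel)"
    if [measurable]: "p \<in> borel \<rightarrow>\<^sub>M borel" and g: "0 < riesz_gamma N a" for p :: "'a \<Rightarrow> 'a" and a N
  proof -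
    have "(\<integral>\<^sup>+x. H x \<partial>density lborel (\<lambda>x::'a. ennreal (norm (p x) powr (a - real N)))) =
      (\<integral>\<^sup>+x. ennreal (norm (p x) powr (a - real N)) * H x \<partial>lborel)"
      by (rule nn_integral_density) measurable
    also have "\<dots> = (\<integral>\<^sup>+x. ennreal (riesz_gamma N a) * (ennreal (riesz_kernel N a (p x)) * H x) \<partial>lborel)"
      using g by (simp add: riesz_kernel_def mult.assoc[symmetric] flip: ennreal_mult)
    also have "\<dots> = ennreal (riesz_gamma N a) * (\<integral>\<^sup>+x. ennreal (riesz_kernel N a (p x)) * H x \<partial>lborel)"
      by (rule nn_integral_cmult) measurable
    finally show ?thesis .
  qed
  have "(\<integral>\<^sup>+x. H x \<partial>?\<mu>) = ennreal (A / B) * (\<integral>\<^sup>+x. H x \<partial>?\<nu>)"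
    by (rule homogeneous_measure_radial[OF hom _ rad G1 G2 AB]) auto
  then have "ennreal (riesz_gamma (dim S) \<alpha>) * (\<integral>\<^sup>+x. ennreal (riesz_kernel (dim S) \<alpha> (closest_point S x)) * H x \<partial>lborel) =
    ennreal (A / B) * (ennreal (riesz_gamma DIM('a) \<beta>) * (\<integral>\<^sup>+x. ennreal (riesz_kernel DIM('a) \<beta> x) * H x \<partial>lborel))"
    using pull[of "closest_point S" "dim S" \<alpha>] pull[of id "DIM('a)" \<beta>] g by (simp add: d_def n_def)
  also have "\<dots> = ennreal (A / B * riesz_gamma DIM('a) \<beta>) * (\<integral>\<^sup>+x. ennreal (riesz_kernel DIM('a) \<beta> x) * H x \<partial>lborel)"
    using AB g by (subst ennreal_mult) (auto simp: mult.assoc)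
  also have "A / B * riesz_gamma DIM('a) \<beta> = riesz_gamma (dim S) \<alpha> * radon_constant DIM('a) m"
  proof -
    have 1: "2 powr \<beta> = 2 powr \<alpha> * 2 ^ m" by (simp add: \<beta>_def powr_add powr_realpow)
    have "n / 2 = d / 2 + real m / 2" by (simp add: nd add_divide_distrib)
    then have 2: "pi powr (n / 2) = pi powr (d / 2) * pi powr (real m / 2)" by (simp only: powr_add)
    have 3: "n - \<beta> = d - \<alpha>" "n - real m = d" by (simp_all add: nd \<beta>_def)
    show ?thesis
      unfolding A_def B_def riesz_gamma_def radon_constant_def n_def[symmetric] d_def[symmetric] 1 3
      using Gp by (simp add: field_simps 2)
  qed
  also have "ennreal (riesz_gamma (dim S) \<alpha> * radon_constant DIM('a) m) = ennreal (riesz_gamma (dim S) \<alpha>) * ennreal (radon_constant DIM('a) m)"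
  proof (rule ennreal_mult)
    have "m < DIM('a)" using m d0 by (simp add: d_def)
    then show "0 \<le> radon_constant DIM('a) m" by (intro less_imp_le radon_constant_pos)
  qed (use g in simp)
  finally show ?thesis using g
    by (simp add: mult.assoc ennreal_mult_cancel_left \<beta>_def)
qed

text \<open>The normalization of Riesz kernels is consistent under integrating out orthogonal
  directions: the order \<alpha> is kept, only the dimension drops, and no constant appears.\<close>

lemma nn_integral_riesz_kernel_fibre:
  fixes S :: "'a::euclidean_space set"
  assumes S: "subspace S" and b: "b \<in> S\<^sup>\<bottom>" "b \<noteq> 0" and N: "dim S < N" and \<alpha>: "0 < \<alpha>" "\<alpha> < real (N - dim S)"
  shows "(\<integral>\<^sup>+a. ennreal (riesz_kernel N \<alpha> (a + b)) \<partial>subspace_measure S) = ennreal (riesz_kernel (N - dim S) \<alpha> b)"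
proof -
  define d where "d = real (dim S)"
  have NS: "real (N - dim S) = real N - d" using N by (simp add: d_def)
  have q: "d < real N - \<alpha>" using \<alpha> NS by (simp add: d_def)
  have d0: "0 \<le> d" by (simp add: d_def)
  have g: "0 < riesz_gamma N \<alpha>" using \<alpha> NS d0 by (intro riesz_gamma_pos) auto
  have Gp: "0 < Gamma ((real N - \<alpha>) / 2)" "0 < Gamma ((real N - \<alpha> - d) / 2)" "0 < Gamma (\<alpha> / 2)"
    using q d0 \<alpha> by (auto simp: Gamma_real_pos)
  have "(\<integral>\<^sup>+a. ennreal (riesz_kernel N \<alpha> (a + b)) \<partial>subspace_measure S) =
    (\<integral>\<^sup>+a. ennreal (1 / riesz_gamma N \<alpha>) * ennreal (norm (a + b) powr (- (real N - \<alpha>))) \<partial>subspace_measure S)"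
    using g by (simp add: riesz_kernel_def flip: ennreal_mult)
  also have "\<dots> = ennreal (1 / riesz_gamma N \<alpha>) * (\<integral>\<^sup>+a. ennreal (norm (a + b) powr (- (real N - \<alpha>))) \<partial>subspace_measure S)"
    by (rule nn_integral_cmult) measurable
  also have "\<dots> = ennreal (1 / riesz_gamma N \<alpha> * (pi powr (d / 2) * Gamma ((real N - \<alpha> - d) / 2) / Gamma ((real N - \<alpha>) / 2) * norm b powr (- (real N - \<alpha> - d))))"
    using nn_integral_powr_subspace[OF S b, of "real N - \<alpha>"] q Gp g by (simp add: d_def flip: ennreal_mult)
  also have "1 / riesz_gamma N \<alpha> * (pi powr (d / 2) * Gamma ((real N - \<alpha> - d) / 2) / Gamma ((real N - \<alpha>) / 2) * norm b powr (- (real N - \<alpha> - d))) =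
    riesz_kernel (N - dim S) \<alpha> b"
  proof -
    have "real N / 2 = (real N - d) / 2 + d / 2" by (simp add: field_simps)
    then have 1: "pi powr (real N / 2) = pi powr ((real N - d) / 2) * pi powr (d / 2)" by (simp only: powr_add)
    have 2: "real N - d - \<alpha> = real N - \<alpha> - d" "\<alpha> - (real N - d) = - (real N - \<alpha> - d)" by simp_all
    show ?thesis unfolding riesz_kernel_def riesz_gamma_def NS 1 2 using Gp by (simp add: field_simps)
  qed
  finally show ?thesis .
qed

text \<open>Let \<zeta> be the sum of \<xi> and \<eta>, and split \<open>w\<close> in
  \<open>\<eta>\<^sup>\<bottom>\<close> into \<open>a\<close> in \<xi> and \<open>b\<close> in
  \<open>\<zeta>\<^sup>\<bottom>\<close>. The inner integral runs over a translate of \<zeta> and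
  does not see \<open>a\<close>, so only the kernel is integrated over \<xi>; this gives the kernel
  of \<open>\<zeta>\<^sup>\<bottom>\<close>, to which the projection formula applies. Both formulas
  with \<alpha> rest on this, the second with \<xi> and \<eta> exchanged.\<close>

lemma nn_integral_riesz_kernel_planes:
  fixes \<xi> \<eta> :: "'a::euclidean_space set" and H :: "'a \<Rightarrow> ennreal"
  assumes \<xi>: "subspace \<xi>" and \<eta>: "subspace \<eta>" and orth: "\<xi> \<subseteq> \<eta>\<^sup>\<bottom>"
    and dims: "dim \<xi> + dim \<eta> < DIM('a)" and \<alpha>: "0 < \<alpha>" "\<alpha> < real DIM('a) - real (dim \<xi>) - real (dim \<eta>)"
    and H [measurable]: "H \<in> borel_measurable borel" and rad: "\<And>x y. norm x = norm y \<Longrightarrow> H x = H y"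
  shows "(\<integral>\<^sup>+w. ennreal (riesz_kernel (DIM('a) - dim \<eta>) \<alpha> w) *
      (\<integral>\<^sup>+u. (\<integral>\<^sup>+y. H (w + (u + y)) \<partial>subspace_measure \<xi>) \<partial>subspace_measure \<eta>) \<partial>subspace_measure (\<eta>\<^sup>\<bottom>)) =
    ennreal (radon_constant DIM('a) (dim \<xi> + dim \<eta>)) *
      (\<integral>\<^sup>+x. ennreal (riesz_kernel DIM('a) (real (dim \<xi> + dim \<eta>) + \<alpha>) x) * H x \<partial>lborel)"
proof -
  define \<zeta> where "\<zeta> = \<xi> + \<eta>"
  define N where "N = DIM('a) - dim \<eta>"
  have orth': "\<eta> \<subseteq> \<xi>\<^sup>\<bottom>" using orth orthogonal_commute unfolding orthogonal_comp_def by blast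
  have \<zeta>: "subspace \<zeta>" unfolding \<zeta>_def by (rule subspace_set_plus[OF \<xi> \<eta>])
  have dim\<zeta>: "dim \<zeta> = dim \<xi> + dim \<eta>"
    using nn_integral_subspace_measure_plus(2)[OF \<xi> \<eta> orth', of "\<lambda>_. 0"] by (simp add: \<zeta>_def)
  have \<xi>\<zeta>: "\<xi> \<subseteq> \<zeta>" "\<eta> \<subseteq> \<zeta>"
    using subspace_0[OF \<xi>] subspace_0[OF \<eta>] set_plus_intro[of _ \<xi> 0 \<eta>] set_plus_intro[of 0 \<xi> _ \<eta>] by (auto simp: \<zeta>_def)
  have \<zeta>perp: "\<zeta>\<^sup>\<bottom> \<subseteq> \<xi>\<^sup>\<bottom>" "\<zeta>\<^sup>\<bottom> \<subseteq> \<eta>\<^sup>\<bottom>"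
    using \<xi>\<zeta> by (auto intro: orthogonal_comp_anti_mono[THEN subsetD])
  have sum: "\<xi> + \<zeta>\<^sup>\<bottom> = \<eta>\<^sup>\<bottom>"
  proof (intro equalityI subsetI)
    fix w assume "w \<in> \<xi> + \<zeta>\<^sup>\<bottom>"
    then show "w \<in> \<eta>\<^sup>\<bottom>"
      using subspace_add[OF subspace_orthogonal_comp] orth \<zeta>perp(2) by (elim set_plus_elim) blast
  next
    fix w assume w: "w \<in> \<eta>\<^sup>\<bottom>"
    have P: "closest_point \<xi> w \<in> \<xi>" using \<xi> by (rule closest_point_subspace_in)
    have 1: "w - closest_point \<xi> w \<in> \<xi>\<^sup>\<bottom>" using \<xi> by (rule diff_closest_point_orthogonal_comp)
    have 2: "w - closest_point \<xi> w \<in> \<eta>\<^sup>\<bottom>"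
      using subspace_diff[OF subspace_orthogonal_comp w] P orth by blast
    have "w - closest_point \<xi> w \<in> \<zeta>\<^sup>\<bottom>"
      using 1 2 by (auto simp: \<zeta>_def orthogonal_comp_def orthogonal_def inner_add_left elim!: set_plus_elim)
    then show "w \<in> \<xi> + \<zeta>\<^sup>\<bottom>" using set_plus_intro[OF P] by fastforce
  qed
  interpret X: sigma_finite_measure "subspace_measure \<xi>" by (rule sigma_finite_subspace_measure[OF \<xi>])
  interpret E: sigma_finite_measure "subspace_measure \<eta>" by (rule sigma_finite_subspace_measure[OF \<eta>])
  interpret Z: sigma_finite_measure "subspace_measure \<zeta>" by (rule sigma_finite_subspace_measure[OF \<zeta>])
  interpret Zp: sigma_finite_measure "subspace_measure (\<zeta>\<^sup>\<bottom>)" by (rule sigma_finite_subspace_measure[OF subspace_orthogonal_comp])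
  interpret XZ: pair_sigma_finite "subspace_measure \<xi>" "subspace_measure (\<zeta>\<^sup>\<bottom>)" ..
  have [measurable]: "closest_point (\<zeta>\<^sup>\<bottom>) \<in> borel \<rightarrow>\<^sub>M borel" by (simp add: subspace_orthogonal_comp)
  have dim\<zeta>': "dim (\<zeta>\<^sup>\<bottom>) = N - dim \<xi>" using dim_orthogonal_comp[OF \<zeta>] dim\<zeta> by (simp add: N_def)
  have "0 < dim (\<zeta>\<^sup>\<bottom>)" using dim_orthogonal_comp[OF \<zeta>] dim\<zeta> dims by simp
  note nz = AE_subspace_measure_nonzero[OF subspace_orthogonal_comp this]
  have aN: "dim \<xi> < N" "\<alpha> < real (N - dim \<xi>)" using dims \<alpha> by (auto simp: N_def of_nat_diff)
  define J where "J w = (\<integral>\<^sup>+u. (\<integral>\<^sup>+y. H (w + (u + y)) \<partial>subspace_measure \<xi>) \<partial>subspace_measure \<eta>)" for w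
  have [measurable]: "J \<in> borel_measurable borel" unfolding J_def by measurable
  have J: "J w = (\<integral>\<^sup>+z. H (w + z) \<partial>subspace_measure \<zeta>)" for w
    using nn_integral_subspace_measure_plus(1)[OF \<eta> \<xi> orth, of "\<lambda>z. H (w + z)"]
    by (simp add: J_def \<zeta>_def add.commute)
  have J_shift: "J (a + b) = J b" if "a \<in> \<zeta>" for a b
    using nn_integral_subspace_translate[OF \<zeta> that, of "\<lambda>z. H (b + z)"] unfolding J by (simp add: add_ac)
  have "(\<integral>\<^sup>+w. ennreal (riesz_kernel N \<alpha> w) * J w \<partial>subspace_measure (\<eta>\<^sup>\<bottom>)) =
    (\<integral>\<^sup>+a. (\<integral>\<^sup>+b. ennreal (riesz_kernel N \<alpha> (a + b)) * J (a + b) \<partial>subspace_measure (\<zeta>\<^sup>\<bottom>)) \<partial>subspace_measure \<xi>)"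
    unfolding sum[symmetric] by (rule nn_integral_subspace_measure_plus(1)[OF \<xi> subspace_orthogonal_comp \<zeta>perp(1)]) measurable
  also have "\<dots> = (\<integral>\<^sup>+a. (\<integral>\<^sup>+b. ennreal (riesz_kernel N \<alpha> (a + b)) * J b \<partial>subspace_measure (\<zeta>\<^sup>\<bottom>)) \<partial>subspace_measure \<xi>)"
    using \<xi>\<zeta>(1) by (intro nn_integral_subspace_measure_cong[OF \<xi>]) (auto simp: J_shift subset_iff)
  also have "\<dots> = (\<integral>\<^sup>+b. (\<integral>\<^sup>+a. ennreal (riesz_kernel N \<alpha> (a + b)) * J b \<partial>subspace_measure \<xi>) \<partial>subspace_measure (\<zeta>\<^sup>\<bottom>))"
    by (rule XZ.Fubini'[symmetric]) measurable
  also have "\<dots> = (\<integral>\<^sup>+b. ennreal (riesz_kernel (N - dim \<xi>) \<alpha> b) * J b \<partial>subspace_measure (\<zeta>\<^sup>\<bottom>))"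
  proof (rule nn_integral_cong_AE, use AE_subspace_measure[OF subspace_orthogonal_comp] nz in eventually_elim)
    fix b assume b: "b \<in> \<zeta>\<^sup>\<bottom>" "b \<noteq> 0"
    then have "b \<in> \<xi>\<^sup>\<bottom>" using \<zeta>perp by blast
    from nn_integral_riesz_kernel_fibre[OF \<xi> this b(2) aN(1) \<alpha>(1) aN(2)]
    show "(\<integral>\<^sup>+a. ennreal (riesz_kernel N \<alpha> (a + b)) * J b \<partial>subspace_measure \<xi>) = ennreal (riesz_kernel (N - dim \<xi>) \<alpha> b) * J b"
      by (simp add: nn_integral_multc)
  qed
  also have "\<dots> = (\<integral>\<^sup>+b. (\<integral>\<^sup>+z. ennreal (riesz_kernel (dim (\<zeta>\<^sup>\<bottom>)) \<alpha> (closest_point (\<zeta>\<^sup>\<bottom>) (b + z))) * H (b + z) \<partial>subspace_measure \<zeta>) \<partial>subspace_measure (\<zeta>\<^sup>\<bottom>))"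
  proof (rule nn_integral_subspace_measure_cong[OF subspace_orthogonal_comp])
    fix b assume b: "b \<in> \<zeta>\<^sup>\<bottom>"
    have "ennreal (riesz_kernel (N - dim \<xi>) \<alpha> b) * J b = (\<integral>\<^sup>+z. ennreal (riesz_kernel (N - dim \<xi>) \<alpha> b) * H (b + z) \<partial>subspace_measure \<zeta>)"
      unfolding J by (rule nn_integral_cmult[symmetric]) measurable
    also have "\<dots> = (\<integral>\<^sup>+z. ennreal (riesz_kernel (dim (\<zeta>\<^sup>\<bottom>)) \<alpha> (closest_point (\<zeta>\<^sup>\<bottom>) (b + z))) * H (b + z) \<partial>subspace_measure \<zeta>)"
    proof (rule nn_integral_subspace_measure_cong[OF \<zeta>])
      fix z assume z: "z \<in> \<zeta>"
      have "closest_point (\<zeta>\<^sup>\<bottom>) (b + z) = b"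
        using b z by (intro closest_point_eqI) (auto simp: subspace_orthogonal_comp orthogonal_comp_self[OF \<zeta>])
      then show "ennreal (riesz_kernel (N - dim \<xi>) \<alpha> b) * H (b + z) =
        ennreal (riesz_kernel (dim (\<zeta>\<^sup>\<bottom>)) \<alpha> (closest_point (\<zeta>\<^sup>\<bottom>) (b + z))) * H (b + z)"
        by (simp add: dim\<zeta>')
    qed measurable
    finally show "ennreal (riesz_kernel (N - dim \<xi>) \<alpha> b) * J b =
      (\<integral>\<^sup>+z. ennreal (riesz_kernel (dim (\<zeta>\<^sup>\<bottom>)) \<alpha> (closest_point (\<zeta>\<^sup>\<bottom>) (b + z))) * H (b + z) \<partial>subspace_measure \<zeta>)" .
  qed measurable
  also have "\<dots> = (\<integral>\<^sup>+x. ennreal (riesz_kernel (dim (\<zeta>\<^sup>\<bottom>)) \<alpha> (closest_point (\<zeta>\<^sup>\<bottom>) x)) * H x \<partial>lborel)"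
    using nn_integral_lborel_decompose[OF subspace_orthogonal_comp[of \<zeta>], of "\<lambda>x. ennreal (riesz_kernel (dim (\<zeta>\<^sup>\<bottom>)) \<alpha> (closest_point (\<zeta>\<^sup>\<bottom>) x)) * H x"]
    by (simp add: orthogonal_comp_self[OF \<zeta>])
  also have "\<dots> = ennreal (radon_constant DIM('a) (dim \<zeta>)) * (\<integral>\<^sup>+x. ennreal (riesz_kernel DIM('a) (real (dim \<zeta>) + \<alpha>) x) * H x \<partial>lborel)"
    using dim_orthogonal_comp[OF \<zeta>] aN(2) \<alpha>(1) dim\<zeta>'
    by (intro nn_integral_radial_projection subspace_orthogonal_comp H rad) auto
  finally show ?thesis by (simp add: J_def N_def dim\<zeta>)
qed

declare transpose_matrix_vector [simp del]

section \<open>Integration with respect to completed measures\<close>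

lemma borel_measurable_completion_AE:
  fixes f g :: "'a \<Rightarrow> real"
  assumes g: "g \<in> borel_measurable M" and ae: "AE x in M. f x = g x"
  shows "f \<in> borel_measurable (completion M)"
proof (rule measurableI)
  fix A :: "real set" assume A: "A \<in> sets borel"
  show "f -` A \<inter> space (completion M) \<in> sets (completion M)"
  proof (rule completion.in_sets_AE)
    show "AE x in completion M. (x \<in> g -` A \<inter> space M) = (x \<in> f -` A \<inter> space (completion M))"
      using AE_completion[OF ae] by eventually_elim auto
    show "g -` A \<inter> space M \<in> sets (completion M)" using measurable_sets[OF g A] by auto
  qed auto
qed auto

text \<open>Inner integrals of the transforms agree with measurable functions only almost
  everywhere. Over the completed measure this suffices to replace them inside the outer
  integral.\<close>

lemma integral_completion_AE:
  fixes f g :: "'a \<Rightarrow> real"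
  assumes g: "g \<in> borel_measurable M" and ae: "AE x in M. f x = g x"
  shows "(\<integral>x. f x \<partial>completion M) = (\<integral>x. g x \<partial>M)"
proof -
  have "(\<integral>x. f x \<partial>completion M) = (\<integral>x. g x \<partial>completion M)"
    using borel_measurable_completion_AE[OF assms] measurable_completion[OF g] AE_completion[OF ae]
    by (rule integral_cong_AE)
  then show ?thesis using integral_completion[OF g] by simp
qed

text \<open>Here \<open>P\<close> may fail to define a measurable set, so the pull-back criterion
  for image measures does not apply. Invertibility of \<open>T\<close> transports the exceptional
  null set itself.\<close>

lemma AE_distr_inverse:
  assumes T: "T \<in> M \<rightarrow>\<^sub>M N" and T': "T' \<in> N \<rightarrow>\<^sub>M M" and inv: "\<And>x. x \<in> space M \<Longrightarrow> T' (T x) = x"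
    and ae: "AE x in M. P x"
  shows "AE y in distr M N T. P (T' y)"
proof -
  obtain B where B: "{x \<in> space M. \<not> P x} \<subseteq> B" "B \<in> null_sets M" using ae by (auto simp: eventually_ae_filter)
  show ?thesis
  proof (rule AE_I)
    show "{y \<in> space (distr M N T). \<not> P (T' y)} \<subseteq> T' -` B \<inter> space N"
      using B(1) measurable_space[OF T'] by auto
    have BS: "B \<subseteq> space M" using B(2) sets.sets_into_space by blast
    have "T -` (T' -` B \<inter> space N) \<inter> space M = B"
      using measurable_space[OF T] BS by (auto simp: inv inv[OF subsetD[OF BS]])
    then show "emeasure (distr M N T) (T' -` B \<inter> space N) = 0"
      using B(2) measurable_sets[OF T', of B] by (subst emeasure_distr[OF T]) auto
    show "T' -` B \<inter> space N \<in> sets (distr M N T)"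
      using measurable_sets[OF T', of B] B(2) by auto
  qed
qed

lemma distr_subspace_measure_translate:
  fixes S :: "'a::euclidean_space set"
  assumes S: "subspace S" and a: "a \<in> S"
  shows "distr (subspace_measure S) borel ((+) a) = subspace_measure S"
proof (rule measure_eqI)
  fix A assume "A \<in> sets (distr (subspace_measure S) borel ((+) a))"
  then have [measurable]: "A \<in> sets borel" by simp
  have "emeasure (distr (subspace_measure S) borel ((+) a)) A = (\<integral>\<^sup>+x. indicator A x \<partial>distr (subspace_measure S) borel ((+) a))"
    by simp
  also have "\<dots> = (\<integral>\<^sup>+x. indicator A (a + x) \<partial>subspace_measure S)" by (rule nn_integral_distr) auto
  also have "\<dots> = (\<integral>\<^sup>+x. indicator A x \<partial>subspace_measure S)"
    by (rule nn_integral_subspace_translate[OF S a]) simp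
  finally show "emeasure (distr (subspace_measure S) borel ((+) a)) A = emeasure (subspace_measure S) A" by simp
qed simp

lemma integral_subspace_translate:
  fixes S :: "'a::euclidean_space set" and f :: "'a \<Rightarrow> real"
  assumes S: "subspace S" and a: "a \<in> S" and [measurable]: "f \<in> borel_measurable borel"
  shows "(\<integral>x. f (a + x) \<partial>subspace_measure S) = (\<integral>x. f x \<partial>subspace_measure S)"
  by (subst (2) distr_subspace_measure_translate[OF S a, symmetric], subst integral_distr) auto

lemma integral_subspace_orthogonal_image:
  fixes S :: "(real^'n) set" and f :: "real^'n \<Rightarrow> real"
  assumes S: "subspace S" and Q: "orthogonal_matrix Q" and [measurable]: "f \<in> borel_measurable borel"
  shows "(\<integral>x. f x \<partial>subspace_measure ((*v) Q ` S)) = (\<integral>x. f (Q *v x) \<partial>subspace_measure S)"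
  unfolding subspace_measure_orthogonal_image[OF orthogonal_matrix_transformation[OF Q] S]
  by (subst integral_distr) auto

lemma integral_subspace_measure:
  fixes S :: "'a::euclidean_space set" and f :: "'a \<Rightarrow> real"
  assumes S: "subspace S" and [measurable]: "f \<in> borel_measurable borel"
  shows "(\<integral>x. f x \<partial>subspace_measure S) = (\<integral>x. subspace_weight S x * f (closest_point S x) \<partial>lborel)"
proof -
  have [measurable]: "closest_point S \<in> borel \<rightarrow>\<^sub>M borel" "subspace_weight S \<in> borel_measurable borel"
    using S by simp_all
  show ?thesis
    unfolding subspace_measure_def by (subst integral_distr) (simp_all add: integral_density)
qed

lemma plane_transform_borel:
  fixes S :: "(real^'n) set"
  assumes S: "subspace S" and [measurable]: "h \<in> borel_measurable borel"
  shows "plane_transform h ((+) w ` S) = (\<integral>y. h (w + y) \<partial>subspace_measure S)"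
proof -
  have "plane_transform h ((+) w ` S) = (\<integral>y. h y \<partial>distr (subspace_measure S) borel ((+) (w - closest_point S w)))"
    unfolding plane_transform_def plane_measure_translate[OF S] by (rule integral_completion) simp
  also have "\<dots> = (\<integral>y. h (w - closest_point S w + y) \<partial>subspace_measure S)" by (rule integral_distr) auto
  also have "\<dots> = (\<integral>y. h (w - closest_point S w + (closest_point S w + y)) \<partial>subspace_measure S)"
    by (rule integral_subspace_translate[OF S closest_point_subspace_in[OF S], symmetric]) simp
  finally show ?thesis by simp
qed

lemma orthogonal_comp_matrix_image:
  "orthogonal_matrix (Q :: real^'n^'n) \<Longrightarrow> ((*v) Q ` S)\<^sup>\<bottom> = (*v) Q ` (S\<^sup>\<bottom>)"
  using orthogonal_comp_image[OF orthogonal_matrix_transformation, symmetric] .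

lemma orthogonal_matrix_cancel:
  assumes "orthogonal_matrix (Q :: real^'n^'n)"
  shows "transpose Q *v (Q *v x) = x" "Q *v (transpose Q *v x) = x"
  using assms unfolding matrix_vector_mul_assoc orthogonal_matrix_def by simp_all

lemma orthogonal_matrix_image_cancel:
  assumes "orthogonal_matrix (Q :: real^'n^'n)"
  shows "(*v) (transpose Q) ` (*v) Q ` S = S" "(*v) Q ` (*v) (transpose Q) ` S = S"
  unfolding image_image orthogonal_matrix_cancel[OF assms] by simp_all

(* The inner integrals are pulled back to the fixed subspaces, so that a single product measure
   serves for all rotated planes. *)
lemma mixed_radon_rotated:
  fixes f :: "(real^'n) set \<Rightarrow> real" and D :: "(real^'n) set \<Rightarrow> real^'n \<Rightarrow> real"
  assumes \<eta>: "subspace \<eta>" and j: "j \<le> dim (\<eta>\<^sup>\<bottom>)" and Q: "orthogonal_matrix Q"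
    and int: "integrable (grassmannian_prob (\<eta>\<^sup>\<bottom>) j \<Otimes>\<^sub>M subspace_measure \<eta>) (\<lambda>p. D (fst p) (snd p))"
    and ae: "AE \<xi> in grassmannian_prob (\<eta>\<^sup>\<bottom>) j. AE u in subspace_measure \<eta>.
      f ((+) (x + Q *v u) ` (*v) Q ` \<xi>) = D \<xi> u"
  shows "mixed_radon j f ((+) x ` (*v) Q ` \<eta>) =
    (\<integral>p. D (fst p) (snd p) \<partial>(grassmannian_prob (\<eta>\<^sup>\<bottom>) j \<Otimes>\<^sub>M subspace_measure \<eta>))"
proof -
  let ?G = "grassmannian_prob (\<eta>\<^sup>\<bottom>) j"
  let ?Q\<eta> = "(*v) Q ` \<eta>"
  let ?BG = "grassmannian_borel (?Q\<eta>\<^sup>\<bottom>) j"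
  have perp: "?Q\<eta>\<^sup>\<bottom> = (*v) Q ` (\<eta>\<^sup>\<bottom>)" by (rule orthogonal_comp_matrix_image[OF Q])
  have Q': "orthogonal_matrix (transpose Q)" using Q by simp
  have Q\<eta>: "subspace ?Q\<eta>" by (rule linear_subspace_image[OF _ \<eta>]) simp
  note sG [measurable_cong] = sets_grassmannian_prob[OF subspace_orthogonal_comp j]
  interpret G: prob_space ?G by (rule prob_space_grassmannian_prob[OF subspace_orthogonal_comp j])
  interpret E: sigma_finite_measure "subspace_measure \<eta>" by (rule sigma_finite_subspace_measure[OF \<eta>])
  interpret pair_sigma_finite ?G "subspace_measure \<eta>" ..
  have D [measurable]: "(\<lambda>p. D (fst p) (snd p)) \<in> borel_measurable (?G \<Otimes>\<^sub>M borel)"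
    using borel_measurable_integrable[OF int] unfolding measurable_cong_sets[OF sets_pair_measure_cong[OF refl sets_subspace_measure] refl] .
  have D1: "D \<xi> \<in> borel_measurable borel" if "\<xi> \<in> space ?G" for \<xi>
    using measurable_compose[OF measurable_Pair1'[OF that] D] by simp
  \<comment> \<open>The transform measures from the foot, which is \<open>x - Q *v b\<close>.
    Replacing \<open>x\<close> by the foot shifts the variable in \<eta> by \<open>- b\<close>, and
    the measure on \<eta> is invariant under this shift.\<close>
  obtain b where b: "b \<in> \<eta>" "closest_point ?Q\<eta> x = Q *v b"
    using closest_point_subspace_in[OF Q\<eta>, of x] by auto
  have QG: "image ((*v) Q) \<in> ?G \<rightarrow>\<^sub>M ?BG"
    using orthogonal_matrix_image_measurable[OF Q, of "\<eta>\<^sup>\<bottom>" j]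
    unfolding perp measurable_cong_sets[OF sG refl] .
  have Q'G: "image ((*v) (transpose Q)) \<in> ?BG \<rightarrow>\<^sub>M ?G"
    using orthogonal_matrix_image_measurable[OF Q', of "(*v) Q ` (\<eta>\<^sup>\<bottom>)" j]
    unfolding perp measurable_cong_sets[OF refl sG] orthogonal_matrix_image_cancel[OF Q] .
  define inner where "inner \<xi> = (\<integral>u. f ((+) (u + foot ((+) x ` ?Q\<eta>)) ` \<xi>) \<partial>plane_measure ?Q\<eta>)" for \<xi>
  have inner: "inner ((*v) Q ` \<xi>) = (\<integral>u. D \<xi> u \<partial>subspace_measure \<eta>)"
    if \<xi>: "\<xi> \<in> space ?G" and ae\<xi>: "AE u in subspace_measure \<eta>. f ((+) (x + Q *v u) ` (*v) Q ` \<xi>) = D \<xi> u" for \<xi>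
  proof -
    have [measurable]: "D \<xi> \<in> borel_measurable borel" by (rule D1[OF \<xi>])
    have "AE u in subspace_measure \<eta>. f ((+) (x + Q *v ((- b) + u)) ` (*v) Q ` \<xi>) = D \<xi> ((- b) + u)"
    proof -
      have "- b \<in> \<eta>" using subspace_neg[OF \<eta> b(1)] .
      have "AE u in distr (subspace_measure \<eta>) borel ((+) (- b)). f ((+) (x + Q *v u) ` (*v) Q ` \<xi>) = D \<xi> u"
        unfolding distr_subspace_measure_translate[OF \<eta> \<open>- b \<in> \<eta>\<close>] by (rule ae\<xi>)
      from AE_distrD[OF _ this] show ?thesis by simp
    qed
    note ae' = this
    have "(*v) Q \<in> subspace_measure \<eta> \<rightarrow>\<^sub>M borel" "(*v) (transpose Q) \<in> borel \<rightarrow>\<^sub>M subspace_measure \<eta>"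
      by measurable
    then have "AE u in distr (subspace_measure \<eta>) borel ((*v) Q).
      f ((+) (x + Q *v ((- b) + transpose Q *v u)) ` (*v) Q ` \<xi>) = D \<xi> ((- b) + transpose Q *v u)"
      by (rule AE_distr_inverse[OF _ _ _ ae']) (rule orthogonal_matrix_cancel(1)[OF Q])
    moreover have "x + Q *v ((- b) + transpose Q *v u) = u + foot ((+) x ` ?Q\<eta>)" for u
      unfolding foot_translate[OF Q\<eta>] b(2)
      by (simp add: matrix_vector_right_distrib orthogonal_matrix_cancel[OF Q] matrix_vector_mult_diff_distrib)
    ultimately have "inner ((*v) Q ` \<xi>) = (\<integral>u. D \<xi> ((- b) + transpose Q *v u) \<partial>distr (subspace_measure \<eta>) borel ((*v) Q))"
      unfolding inner_def plane_measure_subspace[OF Q\<eta>]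
        subspace_measure_orthogonal_image[OF orthogonal_matrix_transformation[OF Q] \<eta>]
      by (intro integral_completion_AE) (simp_all)
    also have "\<dots> = (\<integral>u. D \<xi> ((- b) + u) \<partial>subspace_measure \<eta>)"
      by (subst integral_distr) (simp_all add: orthogonal_matrix_cancel[OF Q])
    also have "\<dots> = (\<integral>u. D \<xi> u \<partial>subspace_measure \<eta>)"
      using b(1) by (intro integral_subspace_translate[OF \<eta>]) (auto simp: subspace_neg[OF \<eta>])
    finally show ?thesis .
  qed
  define I where "I \<xi> = (\<integral>u. D \<xi> u \<partial>subspace_measure \<eta>)" for \<xi>
  have [measurable]: "I \<in> borel_measurable ?G"
    unfolding I_def by (rule E.borel_measurable_lebesgue_integral) (simp add: case_prod_beta')
  have "AE \<xi> in ?G. inner ((*v) Q ` \<xi>) = I \<xi>"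
    using ae AE_space by eventually_elim (simp add: inner I_def)
  then have "AE \<xi> in distr ?G ?BG (image ((*v) Q)). inner ((*v) Q ` (*v) (transpose Q) ` \<xi>) = I ((*v) (transpose Q) ` \<xi>)"
    by (rule AE_distr_inverse[OF QG Q'G, rotated]) (simp add: orthogonal_matrix_image_cancel[OF Q])
  then have aeI: "AE \<xi> in distr ?G ?BG (image ((*v) Q)). inner \<xi> = I ((*v) (transpose Q) ` \<xi>)"
    by (simp only: orthogonal_matrix_image_cancel[OF Q])
  have meas: "(\<lambda>\<xi>. I ((*v) (transpose Q) ` \<xi>)) \<in> borel_measurable (distr ?G ?BG (image ((*v) Q)))"
    using measurable_compose[OF Q'G, of I] by simp
  have "mixed_radon j f ((+) x ` ?Q\<eta>) = (\<integral>\<xi>. inner \<xi> \<partial>completion (distr ?G ?BG (image ((*v) Q))))"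
    unfolding mixed_radon_def direction_translate[OF Q\<eta>] grassmannian_measure_eq inner_def
    unfolding perp grassmannian_prob_image[OF subspace_orthogonal_comp j Q] ..
  also have "\<dots> = (\<integral>\<xi>. I ((*v) (transpose Q) ` \<xi>) \<partial>distr ?G ?BG (image ((*v) Q)))"
    by (rule integral_completion_AE[OF meas aeI])
  also have "\<dots> = (\<integral>\<xi>. I ((*v) (transpose Q) ` (*v) Q ` \<xi>) \<partial>?G)"
    using meas by (intro integral_distr[OF QG]) simp
  also have "\<dots> = (\<integral>\<xi>. I \<xi> \<partial>?G)" by (simp only: orthogonal_matrix_image_cancel[OF Q])
  also have "\<dots> = (\<integral>p. D (fst p) (snd p) \<partial>(?G \<Otimes>\<^sub>M subspace_measure \<eta>))"
    unfolding I_def using integral_fst[of D] int by (simp add: case_prod_beta')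
  finally show ?thesis .
qed

section \<open>Averaging over rotations\<close>

text \<open>Some orthogonal matrix takes \<open>z'\<close> to \<open>z\<close>; right invariance of
  Haar measure absorbs it.\<close>

lemma nn_integral_haar_radial:
  fixes g :: "real^'n \<Rightarrow> ennreal"
  assumes [measurable]: "g \<in> borel_measurable borel" and n: "norm z = norm z'"
  shows "(\<integral>\<^sup>+Q. g (x + Q *v z) \<partial>haar) = (\<integral>\<^sup>+Q. g (x + Q *v z') \<partial>haar)"
proof -
  obtain f where f: "orthogonal_transformation f" "f z' = z"
    using orthogonal_transformation_exists[of z' z] n by metis
  define A where "A = matrix f"
  have A: "orthogonal_matrix A" "A *v z' = z"
    using f by (auto simp: A_def orthogonal_transformation_matrix matrix_works orthogonal_transformation_linear)
  have "(\<integral>\<^sup>+Q. g (x + (Q ** A) *v z') \<partial>haar) = (\<integral>\<^sup>+Q. g (x + Q *v z') \<partial>haar)"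
    by (rule nn_integral_haar_right[OF _ A(1)]) measurable
  then show ?thesis by (simp add: A(2) flip: matrix_vector_mul_assoc)
qed

text \<open>Common form of the three dual transforms: \<open>\<Omega>\<close>, \<open>W\<close> and
  \<open>L\<close> encode integration over a product of subspaces and kernels, and \<open>R\<close>
  says what this does to radial functions. Averaging over \<open>Q\<close> produces the radial
  function to which \<open>R\<close> applies; afterwards \<open>Q\<close> is removed by the
  invariance of \<open>K\<close> and of Lebesgue measure.\<close>

lemma nn_integral_haar_average:
  fixes W :: "'b \<Rightarrow> real" and L :: "'b \<Rightarrow> real^'n" and K :: "real^'n \<Rightarrow> real" and g :: "real^'n \<Rightarrow> ennreal"
  assumes \<Omega>: "sigma_finite_measure \<Omega>"
    and [measurable]: "W \<in> borel_measurable \<Omega>" "L \<in> \<Omega> \<rightarrow>\<^sub>M borel" "K \<in> borel_measurable borel" "g \<in> borel_measurable borel"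
    and K: "\<And>x y. norm x = norm y \<Longrightarrow> K x = K y"
    and R: "\<And>H :: real^'n \<Rightarrow> ennreal. H \<in> borel_measurable borel \<Longrightarrow> (\<And>x y. norm x = norm y \<Longrightarrow> H x = H y) \<Longrightarrow>
      (\<integral>\<^sup>+p. ennreal (W p) * H (L p) \<partial>\<Omega>) = ennreal C * (\<integral>\<^sup>+y. ennreal (K y) * H y \<partial>lborel)"
  shows "(\<integral>\<^sup>+z. ennreal (W (snd z)) * g (x + fst z *v L (snd z)) \<partial>(haar \<Otimes>\<^sub>M \<Omega>)) =
    ennreal C * (\<integral>\<^sup>+y. ennreal (K y) * g (x + y) \<partial>lborel)"
proof -
  interpret P: sigma_finite_measure \<Omega> by fact
  interpret H: prob_space "haar :: (real^'n^'n) measure" by (rule prob_space_haar)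
  interpret HP: pair_sigma_finite "haar :: (real^'n^'n) measure" \<Omega> ..
  interpret HL: pair_sigma_finite "haar :: (real^'n^'n) measure" "lborel :: (real^'n) measure" ..
  define H where "H z = (\<integral>\<^sup>+Q. g (x + Q *v z) \<partial>haar)" for z
  have [measurable]: "H \<in> borel_measurable borel" unfolding H_def by measurable
  have rad: "H z = H z'" if "norm z = norm z'" for z z'
    unfolding H_def by (rule nn_integral_haar_radial[OF _ that]) simp
  have "(\<integral>\<^sup>+z. ennreal (W (snd z)) * g (x + fst z *v L (snd z)) \<partial>(haar \<Otimes>\<^sub>M \<Omega>)) =
    (\<integral>\<^sup>+p. (\<integral>\<^sup>+Q. ennreal (W p) * g (x + Q *v L p) \<partial>haar) \<partial>\<Omega>)"
    by (subst HP.nn_integral_snd[symmetric]) (auto simp: case_prod_beta')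
  also have "\<dots> = (\<integral>\<^sup>+p. ennreal (W p) * H (L p) \<partial>\<Omega>)"
    unfolding H_def by (intro nn_integral_cong nn_integral_cmult) measurable
  also have "\<dots> = ennreal C * (\<integral>\<^sup>+y. ennreal (K y) * H y \<partial>lborel)" by (rule R[OF _ rad]) auto
  also have "(\<integral>\<^sup>+y. ennreal (K y) * H y \<partial>lborel) = (\<integral>\<^sup>+y. (\<integral>\<^sup>+Q. ennreal (K y) * g (x + Q *v y) \<partial>haar) \<partial>lborel)"
    unfolding H_def by (intro nn_integral_cong nn_integral_cmult[symmetric]) measurable
  also have "\<dots> = (\<integral>\<^sup>+Q. (\<integral>\<^sup>+y. ennreal (K y) * g (x + Q *v y) \<partial>lborel) \<partial>haar)"
    by (rule HL.Fubini') measurable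
  also have "\<dots> = (\<integral>\<^sup>+Q. (\<integral>\<^sup>+y. ennreal (K y) * g (x + y) \<partial>lborel) \<partial>(haar :: (real^'n^'n) measure))"
  proof (rule nn_integral_cong)
    fix Q :: "real^'n^'n" assume "Q \<in> space haar"
    then have Q: "orthogonal_matrix Q" by (simp add: space_haar)
    have "(\<integral>\<^sup>+y. ennreal (K y) * g (x + Q *v y) \<partial>lborel) = (\<integral>\<^sup>+y. ennreal (K (Q *v y)) * g (x + Q *v y) \<partial>lborel)"
      using K[OF norm_orthogonal_matrix[OF Q]] by simp
    also have "\<dots> = (\<integral>\<^sup>+y. ennreal (K y) * g (x + y) \<partial>lborel)"
      by (rule nn_integral_lborel_orthogonal[OF orthogonal_matrix_transformation[OF Q]]) measurable
    finally show "(\<integral>\<^sup>+y. ennreal (K y) * g (x + Q *v y) \<partial>lborel) = (\<integral>\<^sup>+y. ennreal (K y) * g (x + y) \<partial>lborel)" .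
  qed
  also have "\<dots> = (\<integral>\<^sup>+y. ennreal (K y) * g (x + y) \<partial>lborel)" by (simp add: H.emeasure_space_1)
  finally show ?thesis .
qed

text \<open>The positive and negative parts are treated separately. Absolute convergence of the
  potential at the single point \<open>x\<close> gives integrability over the whole product, which
  justifies every later splitting into iterated integrals.\<close>

lemma integral_haar_average:
  fixes W :: "'b \<Rightarrow> real" and L :: "'b \<Rightarrow> real^'n" and K :: "real^'n \<Rightarrow> real" and h :: "real^'n \<Rightarrow> real"
  assumes \<Omega>: "sigma_finite_measure \<Omega>"
    and [measurable]: "W \<in> borel_measurable \<Omega>" "L \<in> \<Omega> \<rightarrow>\<^sub>M borel" "K \<in> borel_measurable borel" "h \<in> borel_measurable borel"
    and pos: "\<And>p. 0 \<le> W p" "\<And>x. 0 \<le> K x" "0 \<le> C"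
    and K: "\<And>x y. norm x = norm y \<Longrightarrow> K x = K y"
    and R: "\<And>H :: real^'n \<Rightarrow> ennreal. H \<in> borel_measurable borel \<Longrightarrow> (\<And>x y. norm x = norm y \<Longrightarrow> H x = H y) \<Longrightarrow>
      (\<integral>\<^sup>+p. ennreal (W p) * H (L p) \<partial>\<Omega>) = ennreal C * (\<integral>\<^sup>+y. ennreal (K y) * H y \<partial>lborel)"
    and fin: "(\<integral>\<^sup>+y. ennreal (K y) * ennreal \<bar>h (x + y)\<bar> \<partial>lborel) < \<infinity>"
  shows "integrable (haar \<Otimes>\<^sub>M \<Omega>) (\<lambda>z. W (snd z) * h (x + fst z *v L (snd z)))"
    and "(\<integral>z. W (snd z) * h (x + fst z *v L (snd z)) \<partial>(haar \<Otimes>\<^sub>M \<Omega>)) = C * (\<integral>y. K y * h (x + y) \<partial>lborel)"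
proof -
  let ?M = "(haar :: (real^'n^'n) measure) \<Otimes>\<^sub>M \<Omega>"
  let ?F = "\<lambda>z. W (snd z) * h (x + fst z *v L (snd z))"
  have nn: "(\<integral>\<^sup>+z. ennreal (W (snd z) * g (x + fst z *v L (snd z))) \<partial>?M) =
      ennreal C * (\<integral>\<^sup>+y. ennreal (K y * g (x + y)) \<partial>lborel)"
    if [measurable]: "g \<in> borel_measurable borel" for g :: "real^'n \<Rightarrow> real"
  proof -
    have "(\<integral>\<^sup>+z. ennreal (W (snd z)) * ennreal (g (x + fst z *v L (snd z))) \<partial>?M) =
      ennreal C * (\<integral>\<^sup>+y. ennreal (K y) * ennreal (g (x + y)) \<partial>lborel)"
    proof (rule nn_integral_haar_average[OF \<Omega>])
      show "K x = K y" if "norm x = norm y" for x y by (rule K[OF that])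
      fix H :: "real^'n \<Rightarrow> ennreal"
      assume H: "H \<in> borel_measurable borel" and rad: "\<And>x y. norm x = norm y \<Longrightarrow> H x = H y"
      show "(\<integral>\<^sup>+p. ennreal (W p) * H (L p) \<partial>\<Omega>) = ennreal C * (\<integral>\<^sup>+y. ennreal (K y) * H y \<partial>lborel)"
        using H rad by (rule R)
    qed measurable
    then show ?thesis by (simp only: ennreal_mult'[OF pos(1)] ennreal_mult'[OF pos(2)])
  qed
  have fin': "(\<integral>\<^sup>+y. ennreal (K y * \<bar>h (x + y)\<bar>) \<partial>lborel) < \<infinity>"
    using fin by (simp only: ennreal_mult'[OF pos(2)])
  have IK: "integrable lborel (\<lambda>y. K y * h (x + y))"
    unfolding integrable_iff_bounded using fin' pos(2) by (simp add: abs_mult)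
  show IF: "integrable ?M ?F"
    unfolding integrable_iff_bounded
  proof
    have "(\<integral>\<^sup>+z. ennreal (norm (?F z)) \<partial>?M) = (\<integral>\<^sup>+z. ennreal (W (snd z) * \<bar>h (x + fst z *v L (snd z))\<bar>) \<partial>?M)"
      using pos(1) by (simp add: abs_mult)
    also have "\<dots> = ennreal C * (\<integral>\<^sup>+y. ennreal (K y * \<bar>h (x + y)\<bar>) \<partial>lborel)"
      by (rule nn) simp
    also have "\<dots> < \<infinity>" using fin' by (simp add: ennreal_mult_less_top)
    finally show "(\<integral>\<^sup>+z. ennreal (norm (?F z)) \<partial>?M) < \<infinity>" .
  qed measurable
  have "(\<integral>z. ?F z \<partial>?M) = enn2real (\<integral>\<^sup>+z. ennreal (?F z) \<partial>?M) - enn2real (\<integral>\<^sup>+z. ennreal (- ?F z) \<partial>?M)"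
    by (rule real_lebesgue_integral_def[OF IF])
  also have "(\<integral>\<^sup>+z. ennreal (?F z) \<partial>?M) = ennreal C * (\<integral>\<^sup>+y. ennreal (K y * h (x + y)) \<partial>lborel)"
    by (rule nn) simp
  also have "(\<integral>\<^sup>+z. ennreal (- ?F z) \<partial>?M) = ennreal C * (\<integral>\<^sup>+y. ennreal (- (K y * h (x + y))) \<partial>lborel)"
    using nn[of "\<lambda>y. - h y"] by simp
  also have "enn2real (ennreal C * (\<integral>\<^sup>+y. ennreal (K y * h (x + y)) \<partial>lborel)) -
      enn2real (ennreal C * (\<integral>\<^sup>+y. ennreal (- (K y * h (x + y))) \<partial>lborel)) = C * (\<integral>y. K y * h (x + y) \<partial>lborel)"
    unfolding real_lebesgue_integral_def[OF IK] using pos(3) by (simp add: enn2real_mult right_diff_distrib)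
  finally show "(\<integral>z. ?F z \<partial>?M) = C * (\<integral>y. K y * h (x + y) \<partial>lborel)" .
qed

section \<open>Null sets of planes\<close>

lemma rotated_grassmannian_measurable:
  fixes f :: "'a \<Rightarrow> real^'n^'n"
  assumes f: "f \<in> M \<rightarrow>\<^sub>M haar" and g: "g \<in> M \<rightarrow>\<^sub>M grassmannian_borel V j"
  shows "(\<lambda>x. (*v) (f x) ` g x) \<in> M \<rightarrow>\<^sub>M grassmannian_borel UNIV j"
proof (rule measurable_grassmannian_borelI)
  have fo: "orthogonal_matrix (f x)" if "x \<in> space M" for x
    using measurable_space[OF f that] by (simp add: space_haar)
  have gs: "g x \<in> grassmannian V j" if "x \<in> space M" for x using measurable_space[OF g that] by simp
  show "(*v) (f x) ` g x \<in> grassmannian UNIV j" if "x \<in> space M" for x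
    using orthogonal_matrix_image_grassmannian[OF fo gs, OF that that] by (auto simp: grassmannian_def)
  have [measurable]: "f \<in> M \<rightarrow>\<^sub>M borel" by (rule measurable_compose[OF f measurable_ident_haar])
  have [measurable]: "(\<lambda>x. matrix (closest_point (g x))) \<in> M \<rightarrow>\<^sub>M borel"
    by (rule measurable_compose[OF g matrix_closest_point_measurable])
  have "(\<lambda>x. f x ** matrix (closest_point (g x)) ** transpose (f x)) \<in> M \<rightarrow>\<^sub>M borel" by measurable
  also have "?this \<longleftrightarrow> (\<lambda>x. matrix (closest_point ((*v) (f x) ` g x))) \<in> M \<rightarrow>\<^sub>M borel"
    using gs by (intro measurable_cong) (auto simp: matrix_closest_point_image[OF fo] grassmannian_def)
  finally show "(\<lambda>x. matrix (closest_point ((*v) (f x) ` g x))) \<in> M \<rightarrow>\<^sub>M borel" .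
qed

text \<open>Converts a statement about almost every plane into a measurable exceptional set
  \<open>E\<close> together with its nullity in the order of quantifiers needed later: a fixed
  direction, almost every rotation of it, almost every translate.\<close>

lemma AE_affine_grassmannianE:
  fixes P :: "(real^'n) set \<Rightarrow> bool"
  assumes j: "j \<le> CARD('n)" and ae: "AE \<tau> in affine_grassmannian_measure j. P \<tau>"
  obtains E where "E \<in> sets (affine_grassmannian_borel j)"
    "\<And>\<tau>. \<tau> \<in> affine_grassmannian j \<Longrightarrow> \<tau> \<notin> E \<Longrightarrow> P \<tau>"
    "\<And>\<xi>. \<xi> \<in> grassmannian UNIV j \<Longrightarrow> AE Q in haar. AE z in lborel. (+) z ` (*v) Q ` \<xi> \<notin> E"
proof -
  let ?G = "grassmannian_prob (UNIV :: (real^'n) set) j"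
  let ?A = "affine_grassmannian_borel j :: (real^'n) set measure"
  have j': "j \<le> dim (UNIV :: (real^'n) set)" using j by simp
  note sG = sets_grassmannian_prob[OF subspace_UNIV j']
  interpret G: prob_space ?G by (rule prob_space_grassmannian_prob[OF subspace_UNIV j'])
  interpret GL: pair_sigma_finite ?G "lborel :: (real^'n) measure" ..
  have fst: "fst \<in> ?G \<Otimes>\<^sub>M lborel \<rightarrow>\<^sub>M grassmannian_borel UNIV j"
    unfolding measurable_cong_sets[OF refl sG[symmetric]] by (rule measurable_fst)
  have snd: "snd \<in> ?G \<Otimes>\<^sub>M lborel \<rightarrow>\<^sub>M (borel :: (real^'n) measure)" by measurable
  have W: "(\<lambda>z. subspace_weight ((fst z)\<^sup>\<bottom>) (snd z)) \<in> borel_measurable (?G \<Otimes>\<^sub>M lborel)"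
    by (rule subspace_weight_comp_joint_measurable[OF fst snd])
  have T: "(\<lambda>z. (+) (snd z) ` fst z) \<in> ?G \<Otimes>\<^sub>M lborel \<rightarrow>\<^sub>M ?A"
    by (rule translate_measurable[OF fst snd])
  have "AE \<tau> in affine_grassmannian_base j. P \<tau>"
    using ae unfolding affine_grassmannian_measure_eq[OF j] AE_completion_iff .
  then obtain E where E: "{\<tau> \<in> space (affine_grassmannian_base j). \<not> P \<tau>} \<subseteq> E"
      "E \<in> null_sets (affine_grassmannian_base j :: (real^'n) set measure)"
    by (auto simp: eventually_ae_filter)
  have EA: "E \<in> sets ?A" using E(2) by (auto simp: affine_grassmannian_base_def)
  have "AE \<tau> in affine_grassmannian_base j. \<tau> \<notin> E" using E(2) by (rule AE_not_in)
  then have "AE z in density (?G \<Otimes>\<^sub>M lborel) (\<lambda>z. subspace_weight ((fst z)\<^sup>\<bottom>) (snd z)). (+) (snd z) ` fst z \<notin> E"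
    unfolding affine_grassmannian_base_def by (rule AE_distrD[rotated]) (use T in simp)
  \<comment> \<open>The weight is strictly positive, so the density and the product measure have the
    same null sets.\<close>
  then have "AE z in ?G \<Otimes>\<^sub>M lborel. (+) (snd z) ` fst z \<notin> E"
    by (subst (asm) AE_density) (use W in \<open>auto simp: subspace_weight_def\<close>)
  then have G0: "AE \<xi> in ?G. AE z in lborel. (+) z ` \<xi> \<notin> E"
    using GL.AE_pair by fastforce
  have "AE Q in haar. AE z in lborel. (+) z ` (*v) Q ` \<xi> \<notin> E" if \<xi>: "\<xi> \<in> grassmannian UNIV j" for \<xi>
  proof -
    have hs: "sets haar = sets (restrict_space borel (stabilizer (UNIV :: (real^'n) set)))"
      by (simp add: sets_haar stabilizer_UNIV)
    show ?thesis
      using G0 unfolding grassmannian_prob_eq_distr_haar[OF \<xi>]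
      by (rule AE_distrD[OF orbit_measurable[OF subspace_UNIV \<xi> hs]])
  qed
  moreover have "P \<tau>" if "\<tau> \<in> affine_grassmannian j" "\<tau> \<notin> E" for \<tau>
    using E(1) that by (auto simp: affine_grassmannian_base_def)
  ultimately show thesis using EA that by blast
qed

lemma AE_lborel_translate:
  fixes a :: "'a::euclidean_space"
  assumes "AE x in lborel. P x"
  shows "AE x in lborel. P (a + x)"
proof -
  have eq: "distr lborel borel ((+) a) = (lborel :: 'a measure)"
    using distr_subspace_measure_translate[OF subspace_UNIV, of a] by (simp add: subspace_measure_UNIV)
  have "AE x in distr lborel borel ((+) a). P x" unfolding eq by (rule assms)
  from AE_distrD[OF _ this] show ?thesis by simp
qed

lemma AE_lborel_orthogonal:
  fixes Q :: "real^'n^'n"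
  assumes Q: "orthogonal_matrix Q" and "AE x in lborel. P x"
  shows "AE x in lborel. P (Q *v x)"
proof -
  have "AE x in distr lborel borel ((*v) Q). P x"
    unfolding distr_lborel_orthogonal[OF orthogonal_matrix_transformation[OF Q]] by (rule assms(2))
  from AE_distrD[OF _ this] show ?thesis by simp
qed

lemma AE_lborel_decompose:
  fixes S :: "'a::euclidean_space set"
  assumes S: "subspace S" and P: "{x. P x} \<in> sets borel" and ae: "AE x in lborel. P x"
  shows "AE a in subspace_measure S. AE b in subspace_measure (S\<^sup>\<bottom>). P (a + b)"
proof -
  interpret C: sigma_finite_measure "subspace_measure (S\<^sup>\<bottom>)"
    by (rule sigma_finite_subspace_measure[OF subspace_orthogonal_comp])
  have [measurable]: "{x. \<not> P x} \<in> sets borel"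
    using sets.compl_sets[OF P] by (simp add: Collect_neg_eq Compl_eq_Diff_UNIV)
  have "(\<integral>\<^sup>+x. indicator {x. \<not> P x} x \<partial>lborel) = 0"
    using ae by (subst nn_integral_0_iff_AE) (auto simp: indicator_def)
  then have "(\<integral>\<^sup>+a. (\<integral>\<^sup>+b. indicator {x. \<not> P x} (a + b) \<partial>subspace_measure (S\<^sup>\<bottom>)) \<partial>subspace_measure S) = 0"
    by (subst (asm) nn_integral_lborel_decompose[OF S]) auto
  then have "AE a in subspace_measure S. (\<integral>\<^sup>+b. indicator {x. \<not> P x} (a + b) \<partial>subspace_measure (S\<^sup>\<bottom>)) = 0"
    by (subst (asm) nn_integral_0_iff_AE) (auto intro!: C.borel_measurable_nn_integral)
  then show ?thesis
  proof eventually_elim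
    fix a assume "(\<integral>\<^sup>+b. indicator {x. \<not> P x} (a + b) \<partial>subspace_measure (S\<^sup>\<bottom>)) = 0"
    then have "AE b in subspace_measure (S\<^sup>\<bottom>). indicator {x. \<not> P x} (a + b) = (0::ennreal)"
      by (subst (asm) nn_integral_0_iff_AE) auto
    then show "AE b in subspace_measure (S\<^sup>\<bottom>). P (a + b)"
      by eventually_elim (auto simp: indicator_def split: if_splits)
  qed
qed

text \<open>Validity for almost every \<open>y\<close> means that an integral over \<open>y\<close>
  vanishes, and that integral is measurable in \<open>x\<close>. This is what permits exchanging
  nested almost-everywhere quantifiers.\<close>

lemma AE_measurable_pred:
  assumes N: "sigma_finite_measure N" and [measurable]: "Measurable.pred (M \<Otimes>\<^sub>M N) (\<lambda>z. P (fst z) (snd z))"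
  shows "Measurable.pred M (\<lambda>x. AE y in N. P x y)"
proof -
  interpret N: sigma_finite_measure N by fact
  let ?f = "\<lambda>x. \<integral>\<^sup>+y. (if P x y then 0 else 1) \<partial>N"
  have f: "?f \<in> borel_measurable M"
    by (rule N.borel_measurable_nn_integral) (simp add: case_prod_beta')
  have "(AE y in N. P x y) \<longleftrightarrow> ?f x = 0" if x: "x \<in> space M" for x
  proof -
    have "Measurable.pred N (P x)"
      using measurable_compose[OF measurable_Pair1'[OF x] assms(2)] by simp
    then have "(\<lambda>y. if P x y then 0 else 1 :: ennreal) \<in> borel_measurable N" by measurable
    then show ?thesis by (subst nn_integral_0_iff_AE) auto
  qed
  then show ?thesis using f by (subst measurable_cong[where g="\<lambda>x. ?f x = 0"]) auto
qed

text \<open>\<open>E\<close> is the exceptional set of planes. The aim is to show that the planes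
  entering the rotated transforms avoid it, with quantifiers nested exactly as the integrals in
  \<open>mixed_radon\<close> and \<open>dual_plane_transform\<close> are.\<close>

locale rotated_planes =
  fixes \<eta> :: "(real^'n) set" and j k :: nat and E :: "(real^'n) set set"
  assumes \<eta>: "\<eta> \<in> grassmannian UNIV k" and jk: "j + k < CARD('n)"
    and E: "E \<in> sets (affine_grassmannian_borel j)"
    and nullE: "\<And>\<xi>. \<xi> \<in> grassmannian UNIV j \<Longrightarrow> AE Q in haar. AE z in lborel. (+) z ` (*v) Q ` \<xi> \<notin> E"
begin

abbreviation "G \<equiv> grassmannian_prob (\<eta>\<^sup>\<bottom>) j"
abbreviation "H \<equiv> haar :: (real^'n^'n) measure"

lemma sub\<eta>: "subspace \<eta>" and dim\<eta>: "dim \<eta> = k" using \<eta> by (auto simp: grassmannian_def)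

lemma dim\<eta>': "dim (\<eta>\<^sup>\<bottom>) = CARD('n) - k" using dim_orthogonal_comp[OF sub\<eta>] dim\<eta> by simp

lemma j_le: "j \<le> dim (\<eta>\<^sup>\<bottom>)" using jk dim\<eta>' by simp

lemmas sets_G = sets_grassmannian_prob[OF subspace_orthogonal_comp j_le]
  and space_G = space_grassmannian_prob[OF subspace_orthogonal_comp j_le]
  and prob_space_G = prob_space_grassmannian_prob[OF subspace_orthogonal_comp j_le]

sublocale G: prob_space G by (rule prob_space_G)
sublocale H: prob_space H by (rule prob_space_haar)
sublocale S: sigma_finite_measure "subspace_measure \<eta>" by (rule sigma_finite_subspace_measure[OF sub\<eta>])
sublocale S': sigma_finite_measure "subspace_measure (\<eta>\<^sup>\<bottom>)" by (rule sigma_finite_subspace_measure[OF subspace_orthogonal_comp])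
sublocale HG: pair_sigma_finite H G ..
sublocale GS: pair_sigma_finite G "subspace_measure \<eta>" ..
sublocale GS': pair_sigma_finite G "subspace_measure (\<eta>\<^sup>\<bottom>)" ..

lemma subG: "\<xi> \<in> space G \<Longrightarrow> \<xi> \<in> grassmannian UNIV j"
  by (auto simp: space_G grassmannian_def)

lemma measurable_G: "f \<in> M \<rightarrow>\<^sub>M G \<longleftrightarrow> f \<in> M \<rightarrow>\<^sub>M grassmannian_borel (\<eta>\<^sup>\<bottom>) j"
  by (simp only: measurable_cong_sets[OF refl sets_G])

lemma pred_E:
  assumes "f \<in> M \<rightarrow>\<^sub>M H" "g \<in> M \<rightarrow>\<^sub>M G" "h \<in> M \<rightarrow>\<^sub>M borel"
  shows "Measurable.pred M (\<lambda>x. (+) (h x) ` (*v) (f x) ` g x \<notin> E)"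
proof -
  have "(\<lambda>x. (+) (h x) ` (*v) (f x) ` g x) \<in> M \<rightarrow>\<^sub>M affine_grassmannian_borel j"
    using assms(2) unfolding measurable_G
    by (intro translate_measurable[OF rotated_grassmannian_measurable] assms)
  then show ?thesis using E by measurable
qed

text \<open>The locale assumption fixes the direction first and then takes almost every rotation;
  Fubini reverses this order.\<close>

lemma AE_rotated: "AE Q in H. AE \<xi> in G. AE z in lborel. (+) z ` (*v) Q ` \<xi> \<notin> E"
proof -
  have m: "Measurable.pred (H \<Otimes>\<^sub>M G) (\<lambda>p. AE z in lborel. (+) z ` (*v) (fst p) ` (snd p) \<notin> E)"
    by (rule AE_measurable_pred[OF sigma_finite_lborel], rule pred_E) measurable
  then have "{x \<in> space (H \<Otimes>\<^sub>M G). AE z in lborel. (+) z ` (*v) (fst x) ` (snd x) \<notin> E} \<in> sets (H \<Otimes>\<^sub>M G)"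
    by (rule predE)
  from HG.AE_commute[OF this] show ?thesis
    using nullE by (auto intro!: AE_I2 simp: subG)
qed

text \<open>For fixed \<open>x\<close> and \<open>Q\<close> the points \<open>x + Q *v u\<close>
  fill only a rotated copy of \<eta>, a null set. With everything else fixed they run over the whole
  space as \<open>x\<close> varies, so the claim holds for almost every \<open>x\<close>.\<close>

lemma AE_rotated_point:
  "AE x in lborel. AE Q in H. AE \<xi> in G. AE u in subspace_measure \<eta>. (+) (x + Q *v u) ` (*v) Q ` \<xi> \<notin> E"
proof -
  let ?N = "H \<Otimes>\<^sub>M (G \<Otimes>\<^sub>M subspace_measure \<eta>)"
  interpret HGS: pair_sigma_finite H "G \<Otimes>\<^sub>M subspace_measure \<eta>" ..
  interpret N: sigma_finite_measure ?N ..
  interpret NL: pair_sigma_finite ?N "lborel :: (real^'n) measure" ..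
  have [measurable]: "(\<lambda>Q. Q) \<in> H \<rightarrow>\<^sub>M borel" by (rule measurable_ident_haar)
  have mP: "Measurable.pred (?N \<Otimes>\<^sub>M lborel) (\<lambda>z. (+) (snd z + fst (fst z) *v snd (snd (fst z))) ` (*v) (fst (fst z)) ` fst (snd (fst z)) \<notin> E)"
    by (rule pred_E) (auto intro!: measurable_compose[OF _ measurable_ident_haar]
        borel_measurable_add borel_measurable_matrix_vector_mult measurable_compose[OF measurable_fst measurable_fst]
        measurable_compose[OF measurable_compose[OF measurable_fst measurable_snd] measurable_fst]
        measurable_compose[OF measurable_compose[OF measurable_fst measurable_snd] measurable_snd] )
  have mQ: "Measurable.pred ?N (\<lambda>p. AE x in lborel. (+) (x + fst p *v snd (snd p)) ` (*v) (fst p) ` fst (snd p) \<notin> E)"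
    by (rule AE_measurable_pred[OF sigma_finite_lborel]) (rule mP)
  have mQ1: "Measurable.pred (G \<Otimes>\<^sub>M subspace_measure \<eta>) (\<lambda>p. AE x in lborel. (+) (x + Q *v snd p) ` (*v) Q ` fst p \<notin> E)" if "Q \<in> space H" for Q
    using measurable_compose[OF measurable_Pair1'[OF that] mQ] by simp
  have "AE Q in H. AE \<xi> in G. AE u in subspace_measure \<eta>. AE x in lborel. (+) (x + Q *v u) ` (*v) Q ` \<xi> \<notin> E"
    using AE_rotated
  proof eventually_elim
    fix Q assume "AE \<xi> in G. AE z in lborel. (+) z ` (*v) Q ` \<xi> \<notin> E"
    then show "AE \<xi> in G. AE u in subspace_measure \<eta>. AE x in lborel. (+) (x + Q *v u) ` (*v) Q ` \<xi> \<notin> E"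
    proof eventually_elim
      fix \<xi> assume ae: "AE z in lborel. (+) z ` (*v) Q ` \<xi> \<notin> E"
      show "AE u in subspace_measure \<eta>. AE x in lborel. (+) (x + Q *v u) ` (*v) Q ` \<xi> \<notin> E"
      proof (rule AE_I2)
        fix u from AE_lborel_translate[OF ae, of "Q *v u"]
        show "AE x in lborel. (+) (x + Q *v u) ` (*v) Q ` \<xi> \<notin> E" by (simp add: add.commute)
      qed
    qed
  qed
  then have "AE Q in H. AE p in G \<Otimes>\<^sub>M subspace_measure \<eta>. AE x in lborel. (+) (x + Q *v snd p) ` (*v) Q ` fst p \<notin> E"
    using AE_space
  proof eventually_elim
    fix Q assume Q: "Q \<in> space H" and ae: "AE \<xi> in G. AE u in subspace_measure \<eta>. AE x in lborel. (+) (x + Q *v u) ` (*v) Q ` \<xi> \<notin> E"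
    show "AE p in G \<Otimes>\<^sub>M subspace_measure \<eta>. AE x in lborel. (+) (x + Q *v snd p) ` (*v) Q ` fst p \<notin> E"
      by (rule GS.AE_pair_measure[OF predE[OF mQ1[OF Q]]]) (use ae in simp)
  qed
  then have "AE p in ?N. AE x in lborel. (+) (x + fst p *v snd (snd p)) ` (*v) (fst p) ` fst (snd p) \<notin> E"
    by (intro HGS.AE_pair_measure[OF predE[OF mQ]]) simp
  then have "AE x in lborel. AE p in ?N. (+) (x + fst p *v snd (snd p)) ` (*v) (fst p) ` fst (snd p) \<notin> E"
    using NL.AE_commute[OF predE[OF mP]] by simp
  then show ?thesis
  proof eventually_elim
    fix x assume "AE p in ?N. (+) (x + fst p *v snd (snd p)) ` (*v) (fst p) ` fst (snd p) \<notin> E"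
    from HGS.AE_pair[OF this]
    have "AE Q in H. AE p in G \<Otimes>\<^sub>M subspace_measure \<eta>. (+) (x + Q *v snd p) ` (*v) Q ` fst p \<notin> E" by simp
    then show "AE Q in H. AE \<xi> in G. AE u in subspace_measure \<eta>. (+) (x + Q *v u) ` (*v) Q ` \<xi> \<notin> E"
      by eventually_elim (use GS.AE_pair in fastforce)
  qed
qed

text \<open>The fibre variable \<open>w\<close> in \<open>\<eta>\<^sup>\<bottom>\<close> and
  \<open>u\<close> in \<eta> together fill the space, so here no \<open>x\<close> has to be
  excluded.\<close>

lemma AE_rotated_fibre:
  "AE Q in H. AE w in subspace_measure (\<eta>\<^sup>\<bottom>). AE \<xi> in G. AE u in subspace_measure \<eta>.
     (+) (x + Q *v w + Q *v u) ` (*v) Q ` \<xi> \<notin> E"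
  using AE_rotated AE_space
proof eventually_elim
  fix Q assume ae: "AE \<xi> in G. AE z in lborel. (+) z ` (*v) Q ` \<xi> \<notin> E" and QH: "Q \<in> space H"
  then have Q: "orthogonal_matrix Q" by (simp add: space_haar)
  have Qm: "(\<lambda>_. Q) \<in> M \<rightarrow>\<^sub>M H" for M :: "'b measure" using QH by simp
  have m3: "Measurable.pred ((G \<Otimes>\<^sub>M subspace_measure (\<eta>\<^sup>\<bottom>)) \<Otimes>\<^sub>M subspace_measure \<eta>)
      (\<lambda>z. (+) (x + Q *v snd (fst z) + Q *v snd z) ` (*v) Q ` fst (fst z) \<notin> E)"
    by (rule pred_E) (use QH in \<open>auto intro!: borel_measurable_add borel_measurable_matrix_vector_mult
        measurable_compose[OF measurable_fst measurable_fst] measurable_compose[OF measurable_fst measurable_snd] measurable_snd\<close>)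
  have m2: "Measurable.pred (G \<Otimes>\<^sub>M subspace_measure (\<eta>\<^sup>\<bottom>))
      (\<lambda>z. AE u in subspace_measure \<eta>. (+) (x + Q *v snd z + Q *v u) ` (*v) Q ` fst z \<notin> E)"
    by (rule AE_measurable_pred[OF S.sigma_finite_measure_axioms]) (rule m3)
  have "AE \<xi> in G. AE w in subspace_measure (\<eta>\<^sup>\<bottom>). AE u in subspace_measure \<eta>.
     (+) (x + Q *v w + Q *v u) ` (*v) Q ` \<xi> \<notin> E"
    using ae AE_space
  proof eventually_elim
    fix \<xi> assume ae\<xi>: "AE z in lborel. (+) z ` (*v) Q ` \<xi> \<notin> E" and \<xi>: "\<xi> \<in> space G"
    have "Measurable.pred borel (\<lambda>z. (+) (x + Q *v z) ` (*v) Q ` \<xi> \<notin> E)"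
      by (rule pred_E) (use QH \<xi> in auto)
    then have "{z. (+) (x + Q *v z) ` (*v) Q ` \<xi> \<notin> E} \<in> sets borel" by (simp add: pred_def)
    from AE_lborel_decompose[OF subspace_orthogonal_comp this AE_lborel_orthogonal[OF Q AE_lborel_translate[OF ae\<xi>]]]
    have "AE w in subspace_measure (\<eta>\<^sup>\<bottom>). AE u in subspace_measure (\<eta>\<^sup>\<bottom>\<^sup>\<bottom>). (+) (x + Q *v (w + u)) ` (*v) Q ` \<xi> \<notin> E" .
    then show "AE w in subspace_measure (\<eta>\<^sup>\<bottom>). AE u in subspace_measure \<eta>. (+) (x + Q *v w + Q *v u) ` (*v) Q ` \<xi> \<notin> E"
      unfolding orthogonal_comp_self[OF sub\<eta>] matrix_vector_right_distrib add.assoc .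
  qed
  then show "AE w in subspace_measure (\<eta>\<^sup>\<bottom>). AE \<xi> in G. AE u in subspace_measure \<eta>.
     (+) (x + Q *v w + Q *v u) ` (*v) Q ` \<xi> \<notin> E"
    using GS'.AE_commute[OF predE[OF m2]] by simp
qed

end

text \<open>A Lebesgue null set meets almost every plane in a null set of that plane: for a fixed
  direction, the measure of the intersection integrates to 0 over all translates. Hence
  \<open>h\<close> and the Riesz derivative may be changed on null sets.\<close>

lemma AE_plane_transform_cong:
  fixes h1 h2 :: "real^'n \<Rightarrow> real"
  assumes j: "j \<le> CARD('n)" and h2 [measurable]: "h2 \<in> borel_measurable borel" and ae: "AE x in lborel. h1 x = h2 x"
  shows "AE \<tau> in affine_grassmannian_measure j. plane_transform h1 \<tau> = plane_transform h2 \<tau>"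
proof -
  let ?G = "grassmannian_prob (UNIV :: (real^'n) set) j"
  let ?A = "affine_grassmannian_borel j :: (real^'n) set measure"
  have j': "j \<le> dim (UNIV :: (real^'n) set)" using j by simp
  note sG = sets_grassmannian_prob[OF subspace_UNIV j'] and spG = space_grassmannian_prob[OF subspace_UNIV j']
  interpret G: prob_space ?G by (rule prob_space_grassmannian_prob[OF subspace_UNIV j'])
  interpret GL: pair_sigma_finite ?G "lborel :: (real^'n) measure" ..
  obtain N where N: "{x. h1 x \<noteq> h2 x} \<subseteq> N" "N \<in> null_sets lborel"
    using ae by (auto simp: eventually_ae_filter)
  have [measurable]: "N \<in> sets borel" using N(2) by auto
  have fst: "fst \<in> ?G \<Otimes>\<^sub>M lborel \<rightarrow>\<^sub>M grassmannian_borel UNIV j"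
    unfolding measurable_cong_sets[OF refl sG[symmetric]] by (rule measurable_fst)
  have snd: "snd \<in> ?G \<Otimes>\<^sub>M lborel \<rightarrow>\<^sub>M (borel :: (real^'n) measure)" by measurable
  have W: "(\<lambda>z. subspace_weight ((fst z)\<^sup>\<bottom>) (snd z)) \<in> borel_measurable (?G \<Otimes>\<^sub>M lborel)"
    by (rule subspace_weight_comp_joint_measurable[OF fst snd])
  have T: "(\<lambda>z. (+) (snd z) ` fst z) \<in> ?G \<Otimes>\<^sub>M lborel \<rightarrow>\<^sub>M ?A"
    by (rule translate_measurable[OF fst snd])
  \<comment> \<open>The measure of the part of \<open>N\<close> on the plane \<tau>, written as an
    integral over the whole space so that it is measurable in \<tau>.\<close>
  define \<beta> where "\<beta> \<tau> = (\<integral>\<^sup>+y. ennreal (subspace_weight (direction \<tau>) y) * indicator N (foot \<tau> + closest_point (direction \<tau>) y) \<partial>lborel)" for \<tau> :: "(real^'n) set"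
  have dirm: "(\<lambda>z. direction (fst z)) \<in> ?A \<Otimes>\<^sub>M lborel \<rightarrow>\<^sub>M (grassmannian_borel UNIV j :: (real^'n) set measure)"
    by (rule measurable_compose[OF measurable_fst direction_measurable])
  have [measurable]: "(\<lambda>z. foot (fst z)) \<in> ?A \<Otimes>\<^sub>M lborel \<rightarrow>\<^sub>M (borel :: (real^'n) measure)"
    by (rule measurable_compose[OF measurable_fst foot_measurable])
  have snd': "snd \<in> ?A \<Otimes>\<^sub>M lborel \<rightarrow>\<^sub>M (borel :: (real^'n) measure)" by measurable
  have [measurable]: "(\<lambda>z. subspace_weight (direction (fst z)) (snd z)) \<in> borel_measurable (?A \<Otimes>\<^sub>M lborel)"
    "(\<lambda>z. closest_point (direction (fst z)) (snd z)) \<in> ?A \<Otimes>\<^sub>M lborel \<rightarrow>\<^sub>M borel"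
    by (rule subspace_weight_joint_measurable[OF dirm snd'], rule closest_point_joint_measurable[OF dirm snd'])
  have \<beta>m [measurable]: "\<beta> \<in> borel_measurable ?A"
    unfolding \<beta>_def by (rule lborel.borel_measurable_nn_integral) (simp add: case_prod_beta')
  have \<beta>: "\<beta> ((+) x ` \<xi>) = (\<integral>\<^sup>+y. indicator N (x + y) \<partial>subspace_measure \<xi>)" if \<xi>: "subspace \<xi>" for x \<xi>
  proof -
    have "\<beta> ((+) x ` \<xi>) = (\<integral>\<^sup>+y. indicator N ((x - closest_point \<xi> x) + y) \<partial>subspace_measure \<xi>)"
      unfolding \<beta>_def direction_translate[OF \<xi>] foot_translate[OF \<xi>]
      by (rule nn_integral_subspace_measure[OF \<xi>, symmetric]) simp
    also have "\<dots> = (\<integral>\<^sup>+y. indicator N ((x - closest_point \<xi> x) + (closest_point \<xi> x + y)) \<partial>subspace_measure \<xi>)"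
      by (rule nn_integral_subspace_translate[OF \<xi> closest_point_subspace_in[OF \<xi>], symmetric]) simp
    finally show ?thesis by simp
  qed
  have "AE \<xi> in ?G. AE x in lborel. \<beta> ((+) x ` \<xi>) = 0"
  proof (rule AE_I2)
    fix \<xi> assume "\<xi> \<in> space ?G"
    then have \<xi>: "subspace \<xi>" by (simp add: spG grassmannian_def)
    interpret S: sigma_finite_measure "subspace_measure \<xi>" by (rule sigma_finite_subspace_measure[OF \<xi>])
    interpret SL: pair_sigma_finite "subspace_measure \<xi>" "lborel :: (real^'n) measure" ..
    have "(\<integral>\<^sup>+x. \<beta> ((+) x ` \<xi>) \<partial>lborel) = (\<integral>\<^sup>+x. (\<integral>\<^sup>+y. indicator N (x + y) \<partial>subspace_measure \<xi>) \<partial>lborel)"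
      by (simp add: \<beta>[OF \<xi>])
    also have "\<dots> = (\<integral>\<^sup>+y. (\<integral>\<^sup>+x. indicator N (x + y) \<partial>lborel) \<partial>subspace_measure \<xi>)"
      by (rule SL.Fubini') measurable
    also have "\<dots> = (\<integral>\<^sup>+y. (\<integral>\<^sup>+x. indicator N x \<partial>lborel) \<partial>subspace_measure \<xi>)"
      using nn_integral_lborel_translate[of "indicator N"] by (simp add: add.commute)
    also have "\<dots> = 0" using N(2) by (simp add: null_setsD1)
    finally have "(\<integral>\<^sup>+x. \<beta> ((+) x ` \<xi>) \<partial>lborel) = 0" .
    moreover have "(\<lambda>x. \<beta> ((+) x ` \<xi>)) \<in> borel_measurable borel"
      unfolding \<beta>[OF \<xi>] by (rule S.borel_measurable_nn_integral) measurable
    ultimately show "AE x in lborel. \<beta> ((+) x ` \<xi>) = 0"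
      by (subst (asm) nn_integral_0_iff_AE) auto
  qed
  moreover have "Measurable.pred (?G \<Otimes>\<^sub>M lborel) (\<lambda>z. \<beta> ((+) (snd z) ` fst z) = 0)"
    using measurable_compose[OF T \<beta>m] by measurable
  ultimately have "AE z in ?G \<Otimes>\<^sub>M lborel. \<beta> ((+) (snd z) ` fst z) = 0"
    by (intro GL.AE_pair_measure predE) auto
  then have "AE z in density (?G \<Otimes>\<^sub>M lborel) (\<lambda>z. subspace_weight ((fst z)\<^sup>\<bottom>) (snd z)). \<beta> ((+) (snd z) ` fst z) = 0"
    using W by (subst AE_density) auto
  moreover have "{\<tau> \<in> space ?A. \<beta> \<tau> = 0} \<in> sets ?A" by measurable
  ultimately have "AE \<tau> in affine_grassmannian_base j. \<beta> \<tau> = 0"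
    unfolding affine_grassmannian_base_def using T by (subst AE_distr_iff) auto
  moreover have "AE \<tau> in affine_grassmannian_base j. \<tau> \<in> affine_grassmannian j"
    by (rule AE_I2) (simp add: affine_grassmannian_base_def)
  ultimately have "AE \<tau> in affine_grassmannian_base j. plane_transform h1 \<tau> = plane_transform h2 \<tau>"
  proof eventually_elim
    fix \<tau> :: "(real^'n) set" assume \<beta>0: "\<beta> \<tau> = 0" and "\<tau> \<in> affine_grassmannian j"
    then obtain \<xi> w where "\<xi> \<in> grassmannian UNIV j" and \<tau>: "\<tau> = (+) w ` \<xi>" by (metis affine_grassmannianE)
    then have \<xi>: "subspace \<xi>" by (simp add: grassmannian_def)
    let ?w = "w - closest_point \<xi> w"
    have "(\<integral>\<^sup>+y. indicator N y \<partial>distr (subspace_measure \<xi>) borel ((+) ?w)) = (\<integral>\<^sup>+y. indicator N (?w + y) \<partial>subspace_measure \<xi>)"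
      by (rule nn_integral_distr) auto
    also have "\<dots> = \<beta> \<tau>"
      unfolding \<beta>_def \<tau> direction_translate[OF \<xi>] foot_translate[OF \<xi>]
      by (rule nn_integral_subspace_measure[OF \<xi>]) simp
    finally have "(\<integral>\<^sup>+y. indicator N y \<partial>distr (subspace_measure \<xi>) borel ((+) ?w)) = 0" using \<beta>0 by simp
    then have "AE y in distr (subspace_measure \<xi>) borel ((+) ?w). indicator N y = (0::ennreal)"
      by (subst (asm) nn_integral_0_iff_AE) auto
    then have aeh: "AE y in distr (subspace_measure \<xi>) borel ((+) ?w). h1 y = h2 y"
      by eventually_elim (use N(1) in \<open>auto simp: indicator_def split: if_splits\<close>)
    have "plane_transform h1 \<tau> = (\<integral>y. h2 y \<partial>distr (subspace_measure \<xi>) borel ((+) ?w))"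
      unfolding plane_transform_def \<tau> plane_measure_translate[OF \<xi>] by (rule integral_completion_AE[OF _ aeh]) simp
    moreover have "plane_transform h2 \<tau> = (\<integral>y. h2 y \<partial>distr (subspace_measure \<xi>) borel ((+) ?w))"
      unfolding plane_transform_def \<tau> plane_measure_translate[OF \<xi>] by (rule integral_completion) simp
    ultimately show "plane_transform h1 \<tau> = plane_transform h2 \<tau>" by simp
  qed
  then show ?thesis unfolding affine_grassmannian_measure_eq[OF j] by (rule AE_completion)
qed

section \<open>Riesz potentials of Lebesgue functions\<close>

lemma nn_integral_two_gaussians:
  fixes y :: "'a::euclidean_space"
  assumes "0 < \<sigma>" "0 < r"
  shows "(\<integral>\<^sup>+x. ennreal (exp (- (\<sigma> * (norm x)\<^sup>2)) * exp (- (r * (norm (x - y))\<^sup>2))) \<partial>lborel) =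
    ennreal ((pi / (\<sigma> + r)) powr (real DIM('a) / 2) * exp (- (\<sigma> * r / (\<sigma> + r) * (norm y)\<^sup>2)))"
proof -
  \<comment> \<open>Completing the square: \<open>z\<close> is the point at which the quadratic
    exponent is smallest.\<close>
  define z where "z = (r / (\<sigma> + r)) *\<^sub>R y"
  have sq: "\<sigma> * (norm (z + x))\<^sup>2 + r * (norm (z + x - y))\<^sup>2 = (\<sigma> + r) * (norm x)\<^sup>2 + \<sigma> * r / (\<sigma> + r) * (norm y)\<^sup>2" for x
  proof -
    define t where "t = r / (\<sigma> + r)"
    have t: "\<sigma> * t = r * (1 - t)" "\<sigma> * r / (\<sigma> + r) = \<sigma> * t" using assms by (auto simp: t_def field_simps)
    have "\<sigma> * (norm (z + x))\<^sup>2 + r * (norm (z + x - y))\<^sup>2 =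
      \<sigma> * (t\<^sup>2 * (y \<bullet> y) + 2 * t * (x \<bullet> y) + x \<bullet> x) + r * ((1 - t)\<^sup>2 * (y \<bullet> y) - 2 * (1 - t) * (x \<bullet> y) + x \<bullet> x)"
    proof -
      have zt: "z + x = t *\<^sub>R y + x" "z + x - y = x - (1 - t) *\<^sub>R y" by (simp_all add: z_def t_def algebra_simps)
      have "(norm (z + x))\<^sup>2 = t\<^sup>2 * (y \<bullet> y) + 2 * t * (x \<bullet> y) + x \<bullet> x"
        unfolding zt power2_norm_eq_inner by (simp add: inner_add_left inner_add_right inner_commute[of y x] power2_eq_square algebra_simps)
      moreover have "(norm (z + x - y))\<^sup>2 = (1 - t)\<^sup>2 * (y \<bullet> y) - 2 * (1 - t) * (x \<bullet> y) + x \<bullet> x"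
        unfolding zt power2_norm_eq_inner by (simp add: inner_diff_left inner_diff_right inner_commute[of y x] power2_eq_square algebra_simps)
      ultimately show ?thesis by simp
    qed
    also have "\<dots> = (\<sigma> + r) * (x \<bullet> x) + (\<sigma> * t * t + r * (1 - t) * (1 - t)) * (y \<bullet> y) + 2 * (\<sigma> * t - r * (1 - t)) * (x \<bullet> y)"
      by (simp add: power2_eq_square algebra_simps)
    also have "\<dots> = (\<sigma> + r) * (x \<bullet> x) + \<sigma> * t * (y \<bullet> y)" unfolding t(1)[symmetric] by (simp add: algebra_simps)
    finally show ?thesis by (simp add: t(2) power2_norm_eq_inner)
  qed
  have "(\<integral>\<^sup>+x. ennreal (exp (- (\<sigma> * (norm x)\<^sup>2)) * exp (- (r * (norm (x - y))\<^sup>2))) \<partial>lborel) =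
    (\<integral>\<^sup>+x. ennreal (exp (- (\<sigma> * (norm (z + x))\<^sup>2)) * exp (- (r * (norm (z + x - y))\<^sup>2))) \<partial>lborel)"
    by (rule nn_integral_lborel_translate[symmetric]) measurable
  also have "\<dots> = (\<integral>\<^sup>+x. ennreal (exp (- (\<sigma> * r / (\<sigma> + r) * (norm y)\<^sup>2))) * ennreal (exp (- ((\<sigma> + r) * (norm x)\<^sup>2))) \<partial>(lborel :: 'a measure))"
  proof (rule nn_integral_cong)
    fix x :: 'a
    have "- (\<sigma> * (norm (z + x))\<^sup>2) + - (r * (norm (z + x - y))\<^sup>2) = - (\<sigma> * r / (\<sigma> + r) * (norm y)\<^sup>2) + - ((\<sigma> + r) * (norm x)\<^sup>2)"
      using sq[of x] by linarith
    then show "ennreal (exp (- (\<sigma> * (norm (z + x))\<^sup>2)) * exp (- (r * (norm (z + x - y))\<^sup>2))) =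
      ennreal (exp (- (\<sigma> * r / (\<sigma> + r) * (norm y)\<^sup>2))) * ennreal (exp (- ((\<sigma> + r) * (norm x)\<^sup>2)))"
      by (simp only: ennreal_mult[symmetric] exp_ge_zero exp_add[symmetric])
  qed
  also have "\<dots> = ennreal (exp (- (\<sigma> * r / (\<sigma> + r) * (norm y)\<^sup>2))) * ennreal ((pi / (\<sigma> + r)) powr (real DIM('a) / 2))"
    using nn_integral_gaussian_subspace[OF subspace_UNIV, of "\<sigma> + r", where 'a='a] assms
    by (simp add: nn_integral_cmult subspace_measure_UNIV)
  finally show ?thesis by (simp add: ennreal_mult[symmetric] mult.commute)
qed

text \<open>Euler's Beta integral on the half line: expand \<open>(1 + t) powr (- (a + b))\<close>
  as a Gamma integral over \<open>s\<close> and integrate over \<open>t\<close> first.\<close>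

lemma nn_integral_beta_halfline:
  fixes a b :: real
  assumes "0 < a" "0 < b"
  shows "(\<integral>\<^sup>+t. ennreal (indicator {0..} t * t powr (a - 1) * (1 + t) powr (- (a + b))) \<partial>lborel) =
    ennreal (Gamma a * Gamma b / Gamma (a + b))"
proof -
  have Gp: "0 < Gamma a" "0 < Gamma b" "0 < Gamma (a + b)" using assms by (auto simp: Gamma_real_pos)
  have "ennreal (Gamma (a + b)) * (\<integral>\<^sup>+t. ennreal (indicator {0..} t * t powr (a - 1) * (1 + t) powr (- (a + b))) \<partial>lborel) =
    (\<integral>\<^sup>+t. ennreal (indicator {0..} t * t powr (a - 1)) * ennreal (Gamma (a + b) * (1 + t) powr (- (a + b))) \<partial>lborel)"
    using Gp by (subst nn_integral_cmult[symmetric]) (auto simp: mult_ac simp flip: ennreal_mult)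
  also have "\<dots> = (\<integral>\<^sup>+t. (\<integral>\<^sup>+s. ennreal (indicator {0..} t * t powr (a - 1)) * ennreal (indicator {0..} s * s powr (a + b - 1) * exp (- (s * (1 + t)))) \<partial>lborel) \<partial>lborel)"
  proof (rule nn_integral_cong)
    fix t :: real
    show "ennreal (indicator {0..} t * t powr (a - 1)) * ennreal (Gamma (a + b) * (1 + t) powr (- (a + b))) =
      (\<integral>\<^sup>+s. ennreal (indicator {0..} t * t powr (a - 1)) * ennreal (indicator {0..} s * s powr (a + b - 1) * exp (- (s * (1 + t)))) \<partial>lborel)"
      using nn_integral_gamma[of "a + b" "1 + t"] assms
      by (cases "0 \<le> t") (simp_all add: nn_integral_cmult)
  qed
  also have "\<dots> = (\<integral>\<^sup>+s. (\<integral>\<^sup>+t. ennreal (indicator {0..} t * t powr (a - 1)) * ennreal (indicator {0..} s * s powr (a + b - 1) * exp (- (s * (1 + t)))) \<partial>lborel) \<partial>lborel)"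
    by (rule lborel_pair.Fubini') measurable
  also have "\<dots> = (\<integral>\<^sup>+s. ennreal (Gamma a) * ennreal (indicator {0..} s * s powr (b - 1) * exp (- (s * 1))) \<partial>lborel)"
  proof (rule nn_integral_cong_AE, use AE_lborel_singleton[of "0::real"] in eventually_elim)
    fix s :: real assume s: "s \<noteq> 0"
    show "(\<integral>\<^sup>+t. ennreal (indicator {0..} t * t powr (a - 1)) * ennreal (indicator {0..} s * s powr (a + b - 1) * exp (- (s * (1 + t)))) \<partial>lborel) =
      ennreal (Gamma a) * ennreal (indicator {0..} s * s powr (b - 1) * exp (- (s * 1)))"
    proof (cases "0 < s")
      case True
      have "(\<integral>\<^sup>+t. ennreal (indicator {0..} t * t powr (a - 1)) * ennreal (indicator {0..} s * s powr (a + b - 1) * exp (- (s * (1 + t)))) \<partial>lborel) =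
        (\<integral>\<^sup>+t. ennreal (s powr (a + b - 1) * exp (- s)) * ennreal (indicator {0..} t * t powr (a - 1) * exp (- (t * s))) \<partial>lborel)"
      proof (rule nn_integral_cong)
        fix t :: real
        have "exp (- (s * (1 + t))) = exp (- s) * exp (- (t * s))" by (simp add: algebra_simps flip: exp_add)
        then show "ennreal (indicator {0..} t * t powr (a - 1)) * ennreal (indicator {0..} s * s powr (a + b - 1) * exp (- (s * (1 + t)))) =
          ennreal (s powr (a + b - 1) * exp (- s)) * ennreal (indicator {0..} t * t powr (a - 1) * exp (- (t * s)))"
          using True by (simp add: mult_ac flip: ennreal_mult)
      qed
      also have "\<dots> = ennreal (s powr (a + b - 1) * exp (- s)) * ennreal (Gamma a * s powr (- a))"
        using True assms by (simp add: nn_integral_cmult nn_integral_gamma)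
      also have "\<dots> = ennreal (Gamma a) * ennreal (s powr (b - 1) * exp (- s))"
      proof -
        have "s powr (a + b - 1) * s powr (- a) = s powr (b - 1)" by (simp flip: powr_add)
        then have "s powr (a + b - 1) * exp (- s) * (Gamma a * s powr (- a)) = Gamma a * (s powr (b - 1) * exp (- s))"
          by (metis (no_types, lifting) mult.assoc mult.commute)
        then show ?thesis using Gp by (simp flip: ennreal_mult)
      qed
      finally show ?thesis using True by simp
    qed (use s in simp)
  qed
  also have "\<dots> = ennreal (Gamma a * Gamma b)"
    using assms Gp nn_integral_gamma[of b 1] by (simp add: nn_integral_cmult ennreal_mult)
  also have "\<dots> = ennreal (Gamma (a + b)) * ennreal (Gamma a * Gamma b / Gamma (a + b))"
    using Gp by (simp flip: ennreal_mult)
  finally show ?thesis using Gp by (simp add: ennreal_mult_cancel_left)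
qed

text \<open>As a Gaussian mixture the integrand is integrable over \<open>x\<close> for each
  \<open>t\<close>; the condition on \<open>p\<close> is convergence of the remaining Gamma integral
  at \<open>t = 0\<close>.\<close>

lemma nn_integral_inverse_quadratic:
  fixes p :: real
  assumes p: "real DIM('a) < 2 * p"
  shows "(\<integral>\<^sup>+x. ennreal ((1 + (norm x)\<^sup>2) powr (- p)) \<partial>(lborel :: 'a::euclidean_space measure)) < \<infinity>"
proof -
  define n where "n = real DIM('a)"
  have n: "0 < n" "0 < p" "0 < p - n / 2" using p by (auto simp: n_def intro: order.strict_trans2[of 0 "real DIM('a)"])
  have Gp: "0 < Gamma p" "0 < Gamma (p - n / 2)" using n by (auto simp: Gamma_real_pos)
  have "ennreal (Gamma p) * (\<integral>\<^sup>+x. ennreal ((1 + (norm x)\<^sup>2) powr (- p)) \<partial>(lborel :: 'a measure)) =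
    (\<integral>\<^sup>+(x::'a). ennreal (Gamma p * (1 + (norm x)\<^sup>2) powr (- p)) \<partial>lborel)"
    using Gp by (subst nn_integral_cmult[symmetric]) (auto simp flip: ennreal_mult)
  also have "\<dots> = (\<integral>\<^sup>+(x::'a). (\<integral>\<^sup>+t. ennreal (indicator {0..} t * t powr (p - 1) * exp (- (t * (1 + (norm x)\<^sup>2)))) \<partial>lborel) \<partial>lborel)"
    using nn_integral_gamma[OF n(2)] by (intro nn_integral_cong) (simp add: add_pos_nonneg)
  also have "\<dots> = (\<integral>\<^sup>+t. (\<integral>\<^sup>+(x::'a). ennreal (indicator {0..} t * t powr (p - 1) * exp (- (t * (1 + (norm x)\<^sup>2)))) \<partial>lborel) \<partial>lborel)"
    by (rule lborel_pair.Fubini') measurable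
  also have "\<dots> = (\<integral>\<^sup>+t. ennreal (pi powr (n / 2)) * ennreal (indicator {0..} t * t powr (p - n / 2 - 1) * exp (- (t * 1))) \<partial>lborel)"
  proof (rule nn_integral_cong_AE, use AE_lborel_singleton[of "0::real"] in eventually_elim)
    fix t :: real assume t: "t \<noteq> 0"
    show "(\<integral>\<^sup>+(x::'a). ennreal (indicator {0..} t * t powr (p - 1) * exp (- (t * (1 + (norm x)\<^sup>2)))) \<partial>lborel) =
      ennreal (pi powr (n / 2)) * ennreal (indicator {0..} t * t powr (p - n / 2 - 1) * exp (- (t * 1)))"
    proof (cases "0 < t")
      case True
      have "(\<integral>\<^sup>+(x::'a). ennreal (indicator {0..} t * t powr (p - 1) * exp (- (t * (1 + (norm x)\<^sup>2)))) \<partial>lborel) =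
        (\<integral>\<^sup>+(x::'a). ennreal (t powr (p - 1) * exp (- t)) * ennreal (exp (- (t * (norm x)\<^sup>2))) \<partial>lborel)"
      proof (rule nn_integral_cong)
        fix x :: 'a
        have "exp (- (t * (1 + (norm x)\<^sup>2))) = exp (- t) * exp (- (t * (norm x)\<^sup>2))" by (simp add: algebra_simps flip: exp_add)
        then show "ennreal (indicator {0..} t * t powr (p - 1) * exp (- (t * (1 + (norm x)\<^sup>2)))) =
          ennreal (t powr (p - 1) * exp (- t)) * ennreal (exp (- (t * (norm x)\<^sup>2)))"
          using True by (simp flip: ennreal_mult)
      qed
      also have "\<dots> = ennreal (t powr (p - 1) * exp (- t)) * ennreal ((pi / t) powr (n / 2))"
        using nn_integral_gaussian_subspace[OF subspace_UNIV True, where 'a='a] True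
        by (simp add: nn_integral_cmult subspace_measure_UNIV n_def)
      also have "\<dots> = ennreal (pi powr (n / 2)) * ennreal (t powr (p - n / 2 - 1) * exp (- t))"
      proof -
        have "t powr (p - 1) = t powr (p - n / 2 - 1) * t powr (n / 2)" by (simp flip: powr_add)
        then have "t powr (p - 1) * exp (- t) * (pi / t) powr (n / 2) = pi powr (n / 2) * (t powr (p - n / 2 - 1) * exp (- t))"
          using True by (simp add: powr_divide)
        then show ?thesis by (simp flip: ennreal_mult)
      qed
      finally show ?thesis using True by simp
    qed (use t in simp)
  qed
  also have "\<dots> = ennreal (pi powr (n / 2)) * ennreal (Gamma (p - n / 2))"
    using nn_integral_gamma[OF n(3), of 1] by (simp add: nn_integral_cmult)
  finally have "ennreal (Gamma p) * (\<integral>\<^sup>+x. ennreal ((1 + (norm x)\<^sup>2) powr (- p)) \<partial>(lborel :: 'a measure)) < \<infinity>"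
    by (simp add: ennreal_mult_less_top)
  then show ?thesis using Gp by (auto simp: ennreal_mult_less_top)
qed

(* A conformal identity; the inverse quadratics serve both as weights for absolute convergence and
   as test functions for injectivity. *)
lemma nn_integral_inverse_quadratic_riesz:
  assumes \<beta>: "0 < \<beta>" "\<beta> < real DIM('a)"
  obtains K where "0 < K" "\<And>c (y :: 'a::euclidean_space). 0 < c \<Longrightarrow>
    (\<integral>\<^sup>+x. ennreal ((c + (norm x)\<^sup>2) powr (- (real DIM('a) + \<beta>) / 2) * norm (x - y) powr (\<beta> - real DIM('a))) \<partial>lborel) =
    ennreal (K * c powr (- \<beta> / 2) * (c + (norm y)\<^sup>2) powr (- (real DIM('a) - \<beta>) / 2))"
proof -
  \<comment> \<open>The exponent \<open>A\<close> is chosen so that, once both factors are Gaussian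
    mixtures and the Gaussians are integrated, the power of \<sigma> left over is
    \<open>n / 2 - 1\<close>. The resulting power \<open>- (n / 2)\<close> then combines with that
    of \<open>1 + \<rho>\<close>, and the answer is a product of pure powers.\<close>
  define n q A where "n = real DIM('a)" and "q = n - \<beta>" and "A = (n + \<beta>) / 2"
  have nq: "0 < n" "0 < q" "0 < A" using \<beta> by (auto simp: n_def q_def A_def)
  have Gp: "0 < Gamma A" "0 < Gamma (q / 2)" "0 < Gamma (n / 2)" "0 < Gamma (\<beta> / 2)" using nq \<beta> by (auto simp: Gamma_real_pos)
  define K where "K = pi powr (n / 2) * Gamma (\<beta> / 2) / Gamma A"
  have K: "0 < K" using Gp by (simp add: K_def)
  have "(\<integral>\<^sup>+x. ennreal ((c + (norm x)\<^sup>2) powr (- A) * norm (x - y) powr (- q)) \<partial>lborel) =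
    ennreal (K * c powr (- \<beta> / 2) * (c + (norm y)\<^sup>2) powr (- (q / 2)))" if c: "0 < c" for c and y :: 'a
  proof -
    define Y where "Y = (norm y)\<^sup>2"
    have Y: "0 \<le> Y" "0 < c + Y" using c by (auto simp: Y_def add_pos_nonneg)
    define i where "i = (indicator {0..} :: real \<Rightarrow> real)"
    have [measurable]: "i \<in> borel_measurable borel" by (simp add: i_def)
    have i0: "0 \<le> i t" for t by (simp add: i_def)
    define a1 where "a1 \<sigma> = i \<sigma> * \<sigma> powr (A - 1) * exp (- (\<sigma> * c))" for \<sigma>
    define a2 where "a2 r = i r * r powr (q / 2 - 1)" for r
    have a0: "0 \<le> a1 t" "0 \<le> a2 t" for t by (auto simp: a1_def a2_def i0)
    have [measurable]: "a1 \<in> borel_measurable borel" "a2 \<in> borel_measurable borel"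
      unfolding a1_def[abs_def] a2_def[abs_def] by measurable
    have "ennreal (Gamma A * Gamma (q / 2)) * (\<integral>\<^sup>+x. ennreal ((c + (norm x)\<^sup>2) powr (- A) * norm (x - y) powr (- q)) \<partial>lborel) =
      (\<integral>\<^sup>+x. ennreal (Gamma A * (c + (norm x)\<^sup>2) powr (- A)) * ennreal (Gamma (q / 2) * norm (x - y) powr (- q)) \<partial>lborel)"
      using Gp by (subst nn_integral_cmult[symmetric]) (auto simp: mult_ac simp flip: ennreal_mult)
    also have "\<dots> = (\<integral>\<^sup>+x. (\<integral>\<^sup>+\<sigma>. (\<integral>\<^sup>+r. ennreal (a1 \<sigma> * a2 r) *
      ennreal (exp (- (\<sigma> * (norm x)\<^sup>2)) * exp (- (r * (norm (x - y))\<^sup>2))) \<partial>lborel) \<partial>lborel) \<partial>lborel)"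
    proof (rule nn_integral_cong_AE, use AE_lborel_singleton[of y] in eventually_elim)
      fix x assume x: "x \<noteq> y"
      have 1: "ennreal (Gamma A * (c + (norm x)\<^sup>2) powr (- A)) = (\<integral>\<^sup>+\<sigma>. ennreal (a1 \<sigma> * exp (- (\<sigma> * (norm x)\<^sup>2))) \<partial>lborel)"
      proof -
        have "a1 \<sigma> * exp (- (\<sigma> * (norm x)\<^sup>2)) = i \<sigma> * \<sigma> powr (A - 1) * exp (- (\<sigma> * (c + (norm x)\<^sup>2)))" for \<sigma>
          by (simp add: a1_def algebra_simps flip: exp_add)
        then show ?thesis using nn_integral_gamma[OF nq(3), of "c + (norm x)\<^sup>2"] c
          by (simp add: i_def add_pos_nonneg)
      qed
      have 2: "ennreal (Gamma (q / 2) * norm (x - y) powr (- q)) = (\<integral>\<^sup>+r. ennreal (a2 r * exp (- (r * (norm (x - y))\<^sup>2))) \<partial>lborel)"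
      proof -
        have sq: "(norm (x - y))\<^sup>2 = norm (x - y) powr 2" using x by simp
        have "2 * (- (q / 2)) = - q" by simp
        then have "((norm (x - y))\<^sup>2) powr (- (q / 2)) = norm (x - y) powr (- q)"
          unfolding sq powr_powr by (simp only:)
        then show ?thesis using nn_integral_gamma[of "q / 2" "(norm (x - y))\<^sup>2"] nq x
          by (simp add: i_def a2_def)
      qed
      have "(\<integral>\<^sup>+\<sigma>. (\<integral>\<^sup>+r. ennreal (a1 \<sigma> * a2 r) * ennreal (exp (- (\<sigma> * (norm x)\<^sup>2)) * exp (- (r * (norm (x - y))\<^sup>2))) \<partial>lborel) \<partial>lborel) =
        (\<integral>\<^sup>+\<sigma>. (\<integral>\<^sup>+r. ennreal (a1 \<sigma> * exp (- (\<sigma> * (norm x)\<^sup>2))) * ennreal (a2 r * exp (- (r * (norm (x - y))\<^sup>2))) \<partial>lborel) \<partial>lborel)"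
        by (intro nn_integral_cong) (simp add: a0 mult_ac flip: ennreal_mult)
      also have "\<dots> = ennreal (Gamma A * (c + (norm x)\<^sup>2) powr (- A)) * ennreal (Gamma (q / 2) * norm (x - y) powr (- q))"
        unfolding 1 2 by (simp add: nn_integral_cmult nn_integral_multc)
      finally show "ennreal (Gamma A * (c + (norm x)\<^sup>2) powr (- A)) * ennreal (Gamma (q / 2) * norm (x - y) powr (- q)) =
        (\<integral>\<^sup>+\<sigma>. (\<integral>\<^sup>+r. ennreal (a1 \<sigma> * a2 r) * ennreal (exp (- (\<sigma> * (norm x)\<^sup>2)) * exp (- (r * (norm (x - y))\<^sup>2))) \<partial>lborel) \<partial>lborel)" by simp
    qed
    also have "\<dots> = (\<integral>\<^sup>+\<sigma>. (\<integral>\<^sup>+x. (\<integral>\<^sup>+r. ennreal (a1 \<sigma> * a2 r) *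
      ennreal (exp (- (\<sigma> * (norm x)\<^sup>2)) * exp (- (r * (norm (x - y))\<^sup>2))) \<partial>lborel) \<partial>lborel) \<partial>lborel)"
      by (rule lborel_pair.Fubini') measurable
    also have "\<dots> = (\<integral>\<^sup>+\<sigma>. (\<integral>\<^sup>+r. (\<integral>\<^sup>+x. ennreal (a1 \<sigma> * a2 r) *
      ennreal (exp (- (\<sigma> * (norm x)\<^sup>2)) * exp (- (r * (norm (x - y))\<^sup>2))) \<partial>lborel) \<partial>lborel) \<partial>lborel)"
      by (intro nn_integral_cong lborel_pair.Fubini') measurable
    also have "\<dots> = (\<integral>\<^sup>+\<sigma>. (\<integral>\<^sup>+\<rho>. ennreal (pi powr (n / 2) * a2 \<rho> * (1 + \<rho>) powr (- (n / 2))) *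
        ennreal (i \<sigma> * \<sigma> powr (n / 2 - 1) * exp (- (\<sigma> * (c + \<rho> / (1 + \<rho>) * Y)))) \<partial>lborel) \<partial>lborel)"
    proof (rule nn_integral_cong_AE, use AE_lborel_singleton[of "0::real"] in eventually_elim)
      fix \<sigma> :: real assume \<sigma>: "\<sigma> \<noteq> 0"
      show "(\<integral>\<^sup>+r. (\<integral>\<^sup>+x. ennreal (a1 \<sigma> * a2 r) * ennreal (exp (- (\<sigma> * (norm x)\<^sup>2)) * exp (- (r * (norm (x - y))\<^sup>2))) \<partial>lborel) \<partial>lborel) =
        (\<integral>\<^sup>+\<rho>. ennreal (pi powr (n / 2) * a2 \<rho> * (1 + \<rho>) powr (- (n / 2))) *
        ennreal (i \<sigma> * \<sigma> powr (n / 2 - 1) * exp (- (\<sigma> * (c + \<rho> / (1 + \<rho>) * Y)))) \<partial>lborel)"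
      proof (cases "0 < \<sigma>")
        case True
        have "(\<integral>\<^sup>+r. (\<integral>\<^sup>+x. ennreal (a1 \<sigma> * a2 r) * ennreal (exp (- (\<sigma> * (norm x)\<^sup>2)) * exp (- (r * (norm (x - y))\<^sup>2))) \<partial>lborel) \<partial>lborel) =
          (\<integral>\<^sup>+r. ennreal (a1 \<sigma> * a2 r) * ennreal ((pi / (\<sigma> + r)) powr (n / 2) * exp (- (\<sigma> * r / (\<sigma> + r) * Y))) \<partial>lborel)"
        proof (rule nn_integral_cong_AE, use AE_lborel_singleton[of "0::real"] in eventually_elim)
          fix r :: real assume r: "r \<noteq> 0"
          show "(\<integral>\<^sup>+x. ennreal (a1 \<sigma> * a2 r) * ennreal (exp (- (\<sigma> * (norm x)\<^sup>2)) * exp (- (r * (norm (x - y))\<^sup>2))) \<partial>lborel) =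
            ennreal (a1 \<sigma> * a2 r) * ennreal ((pi / (\<sigma> + r)) powr (n / 2) * exp (- (\<sigma> * r / (\<sigma> + r) * Y)))"
          proof (cases "0 < r")
            case r: True
            have "(\<integral>\<^sup>+x. ennreal (a1 \<sigma> * a2 r) * ennreal (exp (- (\<sigma> * (norm x)\<^sup>2)) * exp (- (r * (norm (x - y))\<^sup>2))) \<partial>lborel) =
              ennreal (a1 \<sigma> * a2 r) * (\<integral>\<^sup>+x. ennreal (exp (- (\<sigma> * (norm x)\<^sup>2)) * exp (- (r * (norm (x - y))\<^sup>2))) \<partial>lborel)"
              by (rule nn_integral_cmult) measurable
            then show ?thesis unfolding nn_integral_two_gaussians[OF True r] n_def Y_def .
          qed (use r in \<open>simp add: a2_def i_def\<close>)
        qed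
        \<comment> \<open>Substituting \<open>r = \<sigma> * \<rho>\<close> makes the exponent
          linear in \<sigma>, so that the \<sigma> integral becomes a Gamma integral.\<close>
        also have "\<dots> = ennreal \<sigma> * (\<integral>\<^sup>+\<rho>. ennreal (a1 \<sigma> * a2 (\<sigma> * \<rho>)) * ennreal ((pi / (\<sigma> + \<sigma> * \<rho>)) powr (n / 2) * exp (- (\<sigma> * (\<sigma> * \<rho>) / (\<sigma> + \<sigma> * \<rho>) * Y))) \<partial>lborel)"
          using True by (subst nn_integral_real_affine[of _ \<sigma> 0]) simp_all
        also have "\<dots> = (\<integral>\<^sup>+\<rho>. ennreal \<sigma> * (ennreal (a1 \<sigma> * a2 (\<sigma> * \<rho>)) * ennreal ((pi / (\<sigma> + \<sigma> * \<rho>)) powr (n / 2) * exp (- (\<sigma> * (\<sigma> * \<rho>) / (\<sigma> + \<sigma> * \<rho>) * Y)))) \<partial>lborel)"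
          by (rule nn_integral_cmult[symmetric]) measurable
        also have "\<dots> = (\<integral>\<^sup>+\<rho>. ennreal (pi powr (n / 2) * a2 \<rho> * (1 + \<rho>) powr (- (n / 2))) *
          ennreal (i \<sigma> * \<sigma> powr (n / 2 - 1) * exp (- (\<sigma> * (c + \<rho> / (1 + \<rho>) * Y)))) \<partial>lborel)"
        proof (rule nn_integral_cong)
          fix \<rho> :: real
          show "ennreal \<sigma> * (ennreal (a1 \<sigma> * a2 (\<sigma> * \<rho>)) * ennreal ((pi / (\<sigma> + \<sigma> * \<rho>)) powr (n / 2) * exp (- (\<sigma> * (\<sigma> * \<rho>) / (\<sigma> + \<sigma> * \<rho>) * Y)))) =
            ennreal (pi powr (n / 2) * a2 \<rho> * (1 + \<rho>) powr (- (n / 2))) *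
            ennreal (i \<sigma> * \<sigma> powr (n / 2 - 1) * exp (- (\<sigma> * (c + \<rho> / (1 + \<rho>) * Y))))"
          proof (cases "0 \<le> \<rho>")
            case \<rho>: True
            have s1: "\<sigma> + \<sigma> * \<rho> = \<sigma> * (1 + \<rho>)" by (simp add: algebra_simps)
            have s2: "\<sigma> * (\<sigma> * \<rho>) / (\<sigma> + \<sigma> * \<rho>) = \<sigma> * (\<rho> / (1 + \<rho>))" using True \<rho> unfolding s1 by simp
            have s3: "(pi / (\<sigma> + \<sigma> * \<rho>)) powr (n / 2) = pi powr (n / 2) * \<sigma> powr (- (n / 2)) * (1 + \<rho>) powr (- (n / 2))"
              unfolding s1 by (simp only: powr_divide powr_mult powr_minus divide_inverse[of "pi powr (n / 2)"] inverse_mult_distrib mult.assoc)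
            have s4: "a2 (\<sigma> * \<rho>) = \<sigma> powr (q / 2 - 1) * a2 \<rho>"
              using True \<rho> by (simp add: a2_def i_def powr_mult)
            have s5: "exp (- (\<sigma> * c)) * exp (- (\<sigma> * (\<rho> / (1 + \<rho>)) * Y)) = exp (- (\<sigma> * (c + \<rho> / (1 + \<rho>) * Y)))"
              by (simp add: algebra_simps flip: exp_add)
            have s6: "\<sigma> * \<sigma> powr (A - 1) * \<sigma> powr (q / 2 - 1) * \<sigma> powr (- (n / 2)) = \<sigma> powr (n / 2 - 1)"
            proof -
              have "\<sigma> * \<sigma> powr (A - 1) = \<sigma> powr A" using True by (simp add: powr_diff)
              moreover have "A + (q / 2 - 1) + - (n / 2) = n / 2 - 1" by (simp add: A_def q_def field_simps)
              ultimately show ?thesis by (metis powr_add)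
            qed
            have "\<sigma> * (a1 \<sigma> * a2 (\<sigma> * \<rho>) * ((pi / (\<sigma> + \<sigma> * \<rho>)) powr (n / 2) * exp (- (\<sigma> * (\<sigma> * \<rho>) / (\<sigma> + \<sigma> * \<rho>) * Y)))) =
              i \<sigma> * (\<sigma> * \<sigma> powr (A - 1) * \<sigma> powr (q / 2 - 1) * \<sigma> powr (- (n / 2))) * (exp (- (\<sigma> * c)) * exp (- (\<sigma> * (\<rho> / (1 + \<rho>)) * Y))) *
                (pi powr (n / 2) * a2 \<rho> * (1 + \<rho>) powr (- (n / 2)))"
              unfolding s2 s3 s4 a1_def by (simp only: mult_ac)
            also have "\<dots> = (pi powr (n / 2) * a2 \<rho> * (1 + \<rho>) powr (- (n / 2))) * (i \<sigma> * \<sigma> powr (n / 2 - 1) * exp (- (\<sigma> * (c + \<rho> / (1 + \<rho>) * Y))))"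
              unfolding s5 s6 by (simp only: mult_ac)
            finally show ?thesis using True a0 i0 by (simp flip: ennreal_mult)
          qed (use True in \<open>simp add: a2_def i_def zero_le_mult_iff\<close>)
        qed
        finally show ?thesis .
      qed (use \<sigma> in \<open>simp add: a1_def i_def\<close>)
    qed
    also have "\<dots> = (\<integral>\<^sup>+\<rho>. (\<integral>\<^sup>+\<sigma>. ennreal (pi powr (n / 2) * a2 \<rho> * (1 + \<rho>) powr (- (n / 2))) *
        ennreal (i \<sigma> * \<sigma> powr (n / 2 - 1) * exp (- (\<sigma> * (c + \<rho> / (1 + \<rho>) * Y)))) \<partial>lborel) \<partial>lborel)"
      by (rule lborel_pair.Fubini') measurable
    also have "\<dots> = (\<integral>\<^sup>+\<rho>. ennreal (pi powr (n / 2) * Gamma (n / 2)) * ennreal (a2 \<rho> * (c + \<rho> * (c + Y)) powr (- (n / 2))) \<partial>lborel)"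
    proof (rule nn_integral_cong)
      fix \<rho> :: real
      show "(\<integral>\<^sup>+\<sigma>. ennreal (pi powr (n / 2) * a2 \<rho> * (1 + \<rho>) powr (- (n / 2))) *
        ennreal (i \<sigma> * \<sigma> powr (n / 2 - 1) * exp (- (\<sigma> * (c + \<rho> / (1 + \<rho>) * Y)))) \<partial>lborel) =
        ennreal (pi powr (n / 2) * Gamma (n / 2)) * ennreal (a2 \<rho> * (c + \<rho> * (c + Y)) powr (- (n / 2)))"
      proof (cases "0 \<le> \<rho>")
        case True
        have pos: "0 < c + \<rho> / (1 + \<rho>) * Y" using c True Y by (intro add_pos_nonneg) auto
        have "(1 + \<rho>) * (c + \<rho> / (1 + \<rho>) * Y) = c + \<rho> * (c + Y)" using True by (simp add: field_simps)
        then have pw: "(1 + \<rho>) powr (- (n / 2)) * (c + \<rho> / (1 + \<rho>) * Y) powr (- (n / 2)) = (c + \<rho> * (c + Y)) powr (- (n / 2))"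
          using True pos by (simp flip: powr_mult)
        have "(\<integral>\<^sup>+\<sigma>. ennreal (pi powr (n / 2) * a2 \<rho> * (1 + \<rho>) powr (- (n / 2))) *
          ennreal (i \<sigma> * \<sigma> powr (n / 2 - 1) * exp (- (\<sigma> * (c + \<rho> / (1 + \<rho>) * Y)))) \<partial>lborel) =
          ennreal (pi powr (n / 2) * a2 \<rho> * (1 + \<rho>) powr (- (n / 2))) * ennreal (Gamma (n / 2) * (c + \<rho> / (1 + \<rho>) * Y) powr (- (n / 2)))"
          using nn_integral_gamma[of "n / 2", OF _ pos] nq by (subst nn_integral_cmult) (auto simp: i_def)
        also have "\<dots> = ennreal (pi powr (n / 2) * Gamma (n / 2) * (a2 \<rho> * ((1 + \<rho>) powr (- (n / 2)) * (c + \<rho> / (1 + \<rho>) * Y) powr (- (n / 2)))))"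
          using Gp a0 by (simp add: mult_ac flip: ennreal_mult)
        finally show ?thesis unfolding pw using Gp a0 by (simp flip: ennreal_mult)
      qed (simp add: a2_def i_def)
    qed
    also have "\<dots> = ennreal (pi powr (n / 2) * Gamma (n / 2)) * (\<integral>\<^sup>+\<rho>. ennreal (a2 \<rho> * (c + \<rho> * (c + Y)) powr (- (n / 2))) \<partial>lborel)"
      by (rule nn_integral_cmult) measurable
    also have "(\<integral>\<^sup>+\<rho>. ennreal (a2 \<rho> * (c + \<rho> * (c + Y)) powr (- (n / 2))) \<partial>lborel) =
      ennreal (c powr (- \<beta> / 2) * (c + Y) powr (- (q / 2)) * (Gamma (q / 2) * Gamma (\<beta> / 2) / Gamma (n / 2)))"
    proof -
      \<comment> \<open>Substituting \<open>\<rho> = m * \<tau>\<close> turns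
        \<open>c + \<rho> * (c + Y)\<close> into \<open>c * (1 + \<tau>)\<close> and leaves a Beta
        integral.\<close>
      define m where "m = c / (c + Y)"
      have m: "0 < m" using c Y by (simp add: m_def)
      have "(\<integral>\<^sup>+\<rho>. ennreal (a2 \<rho> * (c + \<rho> * (c + Y)) powr (- (n / 2))) \<partial>lborel) =
        ennreal m * (\<integral>\<^sup>+\<tau>. ennreal (a2 (m * \<tau>) * (c + m * \<tau> * (c + Y)) powr (- (n / 2))) \<partial>lborel)"
        using m by (subst nn_integral_real_affine[of _ m 0]) simp_all
      also have "\<dots> = (\<integral>\<^sup>+\<tau>. ennreal m * ennreal (a2 (m * \<tau>) * (c + m * \<tau> * (c + Y)) powr (- (n / 2))) \<partial>lborel)"
        by (rule nn_integral_cmult[symmetric]) measurable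
      also have "\<dots> = (\<integral>\<^sup>+\<tau>. ennreal (c powr (- \<beta> / 2) * (c + Y) powr (- (q / 2))) *
        ennreal (indicator {0..} \<tau> * \<tau> powr (q / 2 - 1) * (1 + \<tau>) powr (- (q / 2 + \<beta> / 2))) \<partial>lborel)"
      proof (rule nn_integral_cong)
        fix \<tau> :: real
        show "ennreal m * ennreal (a2 (m * \<tau>) * (c + m * \<tau> * (c + Y)) powr (- (n / 2))) =
          ennreal (c powr (- \<beta> / 2) * (c + Y) powr (- (q / 2))) *
          ennreal (indicator {0..} \<tau> * \<tau> powr (q / 2 - 1) * (1 + \<tau>) powr (- (q / 2 + \<beta> / 2)))"
        proof (cases "0 \<le> \<tau>")
          case True
          have "c + m * \<tau> * (c + Y) = c * (1 + \<tau>)" using Y by (simp add: m_def field_simps)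
          then have e1: "(c + m * \<tau> * (c + Y)) powr (- (n / 2)) = c powr (- (n / 2)) * (1 + \<tau>) powr (- (n / 2))"
            using True c by (simp add: powr_mult)
          have e2: "m * m powr (q / 2 - 1) = c powr (q / 2) * (c + Y) powr (- (q / 2))"
          proof -
            have "m * m powr (q / 2 - 1) = m powr (q / 2)" using m by (subst powr_mult_base) simp_all
            also have "\<dots> = c powr (q / 2) * (c + Y) powr (- (q / 2))"
              unfolding m_def by (simp only: powr_divide powr_minus divide_inverse[of "c powr (q / 2)"])
            finally show ?thesis .
          qed
          have "q / 2 + - (n / 2) = - \<beta> / 2" by (simp add: q_def field_simps)
          then have e3: "c powr (q / 2) * c powr (- (n / 2)) = c powr (- \<beta> / 2)" by (metis powr_add)
          have e4: "- (q / 2 + \<beta> / 2) = - (n / 2)" by (simp add: q_def field_simps)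
          have "m * (a2 (m * \<tau>) * (c + m * \<tau> * (c + Y)) powr (- (n / 2))) =
            (m * m powr (q / 2 - 1)) * c powr (- (n / 2)) * (\<tau> powr (q / 2 - 1) * (1 + \<tau>) powr (- (n / 2)))"
            unfolding e1 using True m by (simp add: a2_def i_def powr_mult mult_ac)
          also have "\<dots> = (c powr (q / 2) * c powr (- (n / 2))) * (c + Y) powr (- (q / 2)) * (\<tau> powr (q / 2 - 1) * (1 + \<tau>) powr (- (n / 2)))"
            unfolding e2 by (simp only: mult_ac)
          finally show ?thesis unfolding e3 e4 using True m a0 by (simp flip: ennreal_mult)
        qed (use m in \<open>simp add: a2_def i_def zero_le_mult_iff\<close>)
      qed
      also have "\<dots> = ennreal (c powr (- \<beta> / 2) * (c + Y) powr (- (q / 2))) * ennreal (Gamma (q / 2) * Gamma (\<beta> / 2) / Gamma (q / 2 + \<beta> / 2))"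
        using nn_integral_beta_halfline[of "q / 2" "\<beta> / 2"] nq \<beta> by (subst nn_integral_cmult) auto
      also have "q / 2 + \<beta> / 2 = n / 2" by (simp add: q_def field_simps)
      finally show ?thesis using Gp by (simp flip: ennreal_mult)
    qed
    also have "ennreal (pi powr (n / 2) * Gamma (n / 2)) *
        ennreal (c powr (- \<beta> / 2) * (c + Y) powr (- (q / 2)) * (Gamma (q / 2) * Gamma (\<beta> / 2) / Gamma (n / 2))) =
      ennreal (Gamma A * Gamma (q / 2)) * ennreal (K * c powr (- \<beta> / 2) * (c + Y) powr (- (q / 2)))"
      using Gp by (simp add: K_def mult_ac flip: ennreal_mult)
    finally show ?thesis using Gp by (simp add: ennreal_mult_cancel_left Y_def)
  qed
  moreover have "- (real DIM('a) + \<beta>) / 2 = - A" "\<beta> - real DIM('a) = - q" "- (real DIM('a) - \<beta>) / 2 = - (q / 2)"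
    by (simp_all only: A_def q_def n_def)
  ultimately show thesis using that[OF K] by simp
qed

section \<open>Weighted integrability of functions in L^p and injectivity of the Riesz
  potential\<close>

lemma AE_zero_box:
  fixes h :: "'a::euclidean_space \<Rightarrow> real"
  assumes h[measurable]: "h \<in> borel_measurable borel"
    and int: "\<And>a b. integrable lborel (\<lambda>x. indicator (box a b) x * h x)"
    and zero: "\<And>a b. (\<integral>x. indicator (box a b) x * h x \<partial>lborel) = 0"
  shows "AE x in lborel. h x = 0"
proof -
  define P N where "P = density lborel (\<lambda>x. ennreal (h x))" and "N = density lborel (\<lambda>x. ennreal (- h x))"
  have eP: "emeasure P (box a b) = (\<integral>\<^sup>+x. ennreal (indicator (box a b) x * h x) \<partial>lborel)" for a b
    unfolding P_def by (subst emeasure_density) (auto intro!: nn_integral_cong simp: indicator_def)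
  have eN: "emeasure N (box a b) = (\<integral>\<^sup>+x. ennreal (- (indicator (box a b) x * h x)) \<partial>lborel)" for a b
    unfolding N_def by (subst emeasure_density) (auto intro!: nn_integral_cong simp: indicator_def)
  have fin: "(\<integral>\<^sup>+x. ennreal (indicator (box a b) x * h x) \<partial>lborel) \<noteq> \<infinity>"
    "(\<integral>\<^sup>+x. ennreal (- (indicator (box a b) x * h x)) \<partial>lborel) \<noteq> \<infinity>" for a b
    using int[of a b] unfolding real_integrable_def by auto
  \<comment> \<open>The positive and negative parts of \<open>h\<close> are densities of two
    measures that agree on boxes, and boxes form an intersection-stable generator.\<close>
  have "P = N"
  proof (rule measure_eqI_generator_eq)
    let ?E = "range (\<lambda>(a, b). box a b :: 'a set)"
    show "Int_stable ?E" by (auto simp: Int_stable_def box_Int_box)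
    show "?E \<subseteq> Pow UNIV" "sets P = sigma_sets UNIV ?E" "sets N = sigma_sets UNIV ?E"
      by (simp_all add: borel_eq_box P_def N_def)
    let ?A = "\<lambda>n::nat. box (- (real n *\<^sub>R One)) (real n *\<^sub>R One) :: 'a set"
    show "range ?A \<subseteq> ?E" "(\<Union>i. ?A i) = UNIV" unfolding UN_box_eq_UNIV by auto
    show "emeasure P (?A i) \<noteq> \<infinity>" for i unfolding eP by (rule fin)
    fix X assume "X \<in> ?E"
    then obtain ab where "X = (case ab of (a, b) \<Rightarrow> box a b)" by (rule rangeE)
    then obtain a b where X: "X = box a b" by (cases ab) simp
    have 1: "enn2real (emeasure P X) - enn2real (emeasure N X) = 0"
      unfolding X eP eN real_lebesgue_integral_def[OF int[of a b], symmetric] by (rule zero)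
    have "emeasure P X = ennreal (enn2real (emeasure P X))" "emeasure N X = ennreal (enn2real (emeasure N X))"
      using fin[of a b] unfolding X eP eN by (simp_all add: less_top)
    then show "emeasure P X = emeasure N X" using 1 by simp
  qed
  then have "AE x in lborel. ennreal (h x) = ennreal (- h x)"
    unfolding P_def N_def by (intro sigma_finite_measure.density_unique[OF sigma_finite_lborel]) auto
  then show ?thesis
  proof eventually_elim
    fix x assume "ennreal (h x) = ennreal (- h x)"
    then show "h x = 0" by (cases "0 \<le> h x") (auto simp: ennreal_neg ennreal_eq_0_iff not_le dest: sym)
  qed
qed

text \<open>Young's inequality with the conjugate exponent \<open>r = p / (p - 1)\<close>: the
  hypothesis \<open>p * \<beta> < n\<close> is equivalent to \<open>n < q * r\<close>, which is
  integrability of the \<open>r\<close>-th power of the weight. For \<open>p = 1\<close> the weight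
  is simply bounded. The weight does not mention \<open>p\<close>, so functions from different
  spaces become comparable.\<close>

lemma integrable_inverse_quadratic_weight:
  fixes h :: "'a::euclidean_space \<Rightarrow> real"
  assumes h[measurable]: "h \<in> borel_measurable borel" and hp: "integrable lborel (\<lambda>x. \<bar>h x\<bar> powr p)"
    and p: "1 \<le> p" "0 < \<beta>" "p * \<beta> < real DIM('a)"
  shows "integrable lborel (\<lambda>y. h y * (1 + (norm y)\<^sup>2) powr (- (real DIM('a) - \<beta>) / 2))"
proof -
  define n q where "n = real DIM('a)" and "q = n - \<beta>"
  have "\<beta> \<le> p * \<beta>" using p by simp
  then have q: "0 < q" using p unfolding q_def n_def by linarith
  have w1: "(1 + (norm y)\<^sup>2) powr (- q / 2) \<le> 1" for y :: 'a
    using powr_mono[of "- q / 2" 0 "1 + (norm y)\<^sup>2"] q by (auto split: if_splits)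
  show ?thesis
  proof (cases "p = 1")
    case True
    have "integrable lborel (\<lambda>x. \<bar>h x\<bar>)" using hp by (simp add: True)
    then have "integrable lborel h" by (simp add: integrable_abs_iff)
    then show ?thesis
    proof (rule Bochner_Integration.integrable_bound)
      show "AE x in lborel. norm (h x * (1 + (norm x)\<^sup>2) powr (- (real DIM('a) - \<beta>) / 2)) \<le> norm (h x)"
        using w1 by (auto simp: abs_mult q_def n_def intro!: mult_right_le_one_le)
    qed measurable
  next
    case False
    then have p1: "1 < p" using p by simp
    define r where "r = p / (p - 1)"
    have r: "1 < r" "1 / p + 1 / r = 1" using p1 by (auto simp: r_def field_simps)
    have "n * (p - 1) < q * p" using p by (simp add: q_def n_def algebra_simps)
    then have "n < q * r" using p1 by (simp add: r_def pos_less_divide_eq mult.commute)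
    then have "(\<integral>\<^sup>+x. ennreal ((1 + (norm x)\<^sup>2) powr (- (q * r / 2))) \<partial>(lborel :: 'a measure)) < \<infinity>"
      by (intro nn_integral_inverse_quadratic) (simp add: n_def)
    then have w: "integrable (lborel :: 'a measure) (\<lambda>x. (1 + (norm x)\<^sup>2) powr (- (q * r / 2)))"
      by (intro integrableI_nonneg) auto
    show ?thesis
    proof (rule Bochner_Integration.integrable_bound[OF Bochner_Integration.integrable_add[OF hp w]])
      show "AE x in lborel. norm (h x * (1 + (norm x)\<^sup>2) powr (- (real DIM('a) - \<beta>) / 2)) \<le>
        norm (\<bar>h x\<bar> powr p + (1 + (norm x)\<^sup>2) powr (- (q * r / 2)))"
      proof (rule AE_I2)
        fix x :: 'a
        let ?w = "(1 + (norm x)\<^sup>2) powr (- q / 2)"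
        have "\<bar>h x\<bar> * ?w \<le> \<bar>h x\<bar> powr p / p + ?w powr r / r"
          using p1 r by (intro Youngs_inequality) auto
        also have "\<dots> \<le> \<bar>h x\<bar> powr p + ?w powr r"
          using p1 r by (intro add_mono) (auto simp: divide_le_eq mult_left_le intro: order_trans[OF _ mult_left_mono[of 1]])
        also have "?w powr r = (1 + (norm x)\<^sup>2) powr (- (q * r / 2))" by (simp add: powr_powr)
        finally show "norm (h x * (1 + (norm x)\<^sup>2) powr (- (real DIM('a) - \<beta>) / 2)) \<le>
          norm (\<bar>h x\<bar> powr p + (1 + (norm x)\<^sup>2) powr (- (q * r / 2)))"
          by (simp add: abs_mult q_def n_def)
      qed
    qed measurable
  qed
qed

lemma one_plus_norm_shift_le:
  fixes y x0 :: "'a::real_inner"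
  assumes "0 < c"
  shows "1 + (norm y)\<^sup>2 \<le> (2 + (1 + 2 * (norm x0)\<^sup>2) / c) * (c + (norm (y - x0))\<^sup>2)"
proof -
  have "(norm y)\<^sup>2 \<le> (norm (y - x0) + norm x0)\<^sup>2"
    using norm_triangle_ineq[of "y - x0" x0] by (intro power_mono) auto
  also have "\<dots> \<le> 2 * (norm (y - x0))\<^sup>2 + 2 * (norm x0)\<^sup>2"
    using sum_squares_bound[of "norm (y - x0)" "norm x0"] by (simp add: power2_sum)
  finally have 1: "1 + (norm y)\<^sup>2 \<le> 2 * (norm (y - x0))\<^sup>2 + (1 + 2 * (norm x0)\<^sup>2)" by simp
  have "(1 + 2 * (norm x0)\<^sup>2) = (1 + 2 * (norm x0)\<^sup>2) / c * c" using assms by simp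
  also have "\<dots> \<le> (1 + 2 * (norm x0)\<^sup>2) / c * (c + (norm (y - x0))\<^sup>2)"
    using assms by (intro mult_left_mono) auto
  finally show ?thesis using 1 assms by (simp add: distrib_right)
qed

text \<open>A Peetre-type inequality: moving the centre to \<open>x0\<close>, changing 1 to
  \<open>c\<close> and raising the exponent costs only a constant factor. One integrability
  assumption therefore covers all shifted weights.\<close>

lemma inverse_quadratic_shift_le:
  fixes y x0 :: "'a::real_inner"
  assumes c: "0 < c" and t: "0 \<le> t" "t \<le> s"
  shows "(c + (norm (y - x0))\<^sup>2) powr (- s) \<le>
    c powr (t - s) * (2 + (1 + 2 * (norm x0)\<^sup>2) / c) powr t * (1 + (norm y)\<^sup>2) powr (- t)"
proof -
  define X D where "X = c + (norm (y - x0))\<^sup>2" and "D = 2 + (1 + 2 * (norm x0)\<^sup>2) / c"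
  have X: "c \<le> X" "0 < X" using c by (auto simp: X_def add_pos_nonneg)
  have D: "0 < D" using c by (simp add: D_def add_pos_nonneg)
  have "D powr (- t) * X powr (- t) = (D * X) powr (- t)" by (simp add: powr_mult)
  also have "\<dots> \<le> (1 + (norm y)\<^sup>2) powr (- t)"
    using one_plus_norm_shift_le[OF c, of y x0] t
    by (intro powr_mono2') (auto simp: X_def D_def add_pos_nonneg)
  finally have "D powr t * (D powr (- t) * X powr (- t)) \<le> D powr t * (1 + (norm y)\<^sup>2) powr (- t)"
    by (intro mult_left_mono) auto
  then have 1: "X powr (- t) \<le> D powr t * (1 + (norm y)\<^sup>2) powr (- t)"
    using D by (simp add: powr_minus field_simps)
  have 2: "X powr (t - s) \<le> c powr (t - s)" using X c t by (intro powr_mono2') auto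
  have "X powr (- s) = X powr (t - s) * X powr (- t)" by (simp flip: powr_add)
  also have "\<dots> \<le> c powr (t - s) * (D powr t * (1 + (norm y)\<^sup>2) powr (- t))"
    using 1 2 by (intro mult_mono) auto
  finally show ?thesis by (simp add: X_def D_def mult.assoc)
qed

lemma integrable_inverse_quadratic_shift:
  fixes h :: "'a::euclidean_space \<Rightarrow> real"
  assumes h[measurable]: "h \<in> borel_measurable borel"
    and w: "integrable lborel (\<lambda>y. h y * (1 + (norm y)\<^sup>2) powr (- t))" and t: "0 \<le> t" "t \<le> s" "0 < c"
  shows "integrable lborel (\<lambda>y. h y * (c + (norm (y - x0))\<^sup>2) powr (- s))"
proof -
  define C where "C = c powr (t - s) * (2 + (1 + 2 * (norm x0)\<^sup>2) / c) powr t"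
  have C: "0 \<le> C" by (simp add: C_def)
  show ?thesis
  proof (rule Bochner_Integration.integrable_bound[OF integrable_mult_right[OF w, of C]])
    show "AE y in lborel. norm (h y * (c + (norm (y - x0))\<^sup>2) powr (- s)) \<le> norm (C * (h y * (1 + (norm y)\<^sup>2) powr (- t)))"
    proof (rule AE_I2)
      fix y
      have "(c + (norm (y - x0))\<^sup>2) powr (- s) \<le> C * (1 + (norm y)\<^sup>2) powr (- t)"
        unfolding C_def by (rule inverse_quadratic_shift_le) (use t in auto)
      then have "\<bar>h y\<bar> * (c + (norm (y - x0))\<^sup>2) powr (- s) \<le> \<bar>h y\<bar> * (C * (1 + (norm y)\<^sup>2) powr (- t))"
        by (rule mult_left_mono) simp
      then show "norm (h y * (c + (norm (y - x0))\<^sup>2) powr (- s)) \<le> norm (C * (h y * (1 + (norm y)\<^sup>2) powr (- t)))"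
        using C by (simp add: abs_mult mult_ac)
    qed
  qed measurable
qed

lemma nn_integral_inverse_quadratic_riesz_shift:
  assumes \<beta>: "0 < \<beta>" "\<beta> < real DIM('a)"
  obtains K where "0 < K" "\<And>c x0 (y :: 'a::euclidean_space). 0 < c \<Longrightarrow>
    (\<integral>\<^sup>+x. ennreal ((c + (norm (x - x0))\<^sup>2) powr (- (real DIM('a) + \<beta>) / 2) * norm (x - y) powr (\<beta> - real DIM('a))) \<partial>lborel) =
    ennreal (K * c powr (- \<beta> / 2) * (c + (norm (y - x0))\<^sup>2) powr (- (real DIM('a) - \<beta>) / 2))"
proof -
  obtain K where K: "0 < K" "\<And>c (y :: 'a). 0 < c \<Longrightarrow>
    (\<integral>\<^sup>+x. ennreal ((c + (norm x)\<^sup>2) powr (- (real DIM('a) + \<beta>) / 2) * norm (x - y) powr (\<beta> - real DIM('a))) \<partial>lborel) =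
    ennreal (K * c powr (- \<beta> / 2) * (c + (norm y)\<^sup>2) powr (- (real DIM('a) - \<beta>) / 2))"
    using nn_integral_inverse_quadratic_riesz[OF \<beta>] by blast
  show thesis
  proof (rule that[OF K(1)])
    fix c :: real and x0 y :: 'a assume c: "0 < c"
    let ?f = "\<lambda>x. ennreal ((c + (norm (x - x0))\<^sup>2) powr (- (real DIM('a) + \<beta>) / 2) * norm (x - y) powr (\<beta> - real DIM('a)))"
    have "(\<integral>\<^sup>+x. ?f x \<partial>lborel) = (\<integral>\<^sup>+x. ?f (x0 + x) \<partial>lborel)"
      by (rule nn_integral_lborel_translate[symmetric]) measurable
    also have "\<dots> = (\<integral>\<^sup>+x. ennreal ((c + (norm x)\<^sup>2) powr (- (real DIM('a) + \<beta>) / 2) * norm (x - (y - x0)) powr (\<beta> - real DIM('a))) \<partial>lborel)"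
      by (intro nn_integral_cong) (simp add: algebra_simps)
    also have "\<dots> = ennreal (K * c powr (- \<beta> / 2) * (c + (norm (y - x0))\<^sup>2) powr (- (real DIM('a) - \<beta>) / 2))"
      by (rule K(2)[OF c])
    finally show "(\<integral>\<^sup>+x. ?f x \<partial>lborel) = ennreal (K * c powr (- \<beta> / 2) * (c + (norm (y - x0))\<^sup>2) powr (- (real DIM('a) - \<beta>) / 2))" .
  qed
qed

text \<open>After taking absolute values, integrating over \<open>x\<close> first turns the pairing
  into the integral of \<open>\<bar>h\<bar>\<close> against a shifted inverse quadratic, which is
  finite by the weighted integrability of \<open>h\<close>. This licenses the use of Fubini
  below.\<close>

lemma riesz_pair_integrable:
  fixes h :: "'a::euclidean_space \<Rightarrow> real"
  assumes h[measurable]: "h \<in> borel_measurable borel" and \<beta>: "0 < \<beta>" "\<beta> < real DIM('a)" and c: "0 < c"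
    and w: "integrable lborel (\<lambda>y. h y * (1 + (norm y)\<^sup>2) powr (- (real DIM('a) - \<beta>) / 2))"
  shows "integrable (lborel \<Otimes>\<^sub>M lborel)
    (\<lambda>(x, y). (c + (norm (x - x0))\<^sup>2) powr (- (real DIM('a) + \<beta>) / 2) * (h y * norm (x - y) powr (\<beta> - real DIM('a))))"
    (is "integrable _ (\<lambda>(x, y). ?F x y)")
proof -
  obtain K where K: "0 < K" "\<And>c x0 (y :: 'a). 0 < c \<Longrightarrow>
    (\<integral>\<^sup>+x. ennreal ((c + (norm (x - x0))\<^sup>2) powr (- (real DIM('a) + \<beta>) / 2) * norm (x - y) powr (\<beta> - real DIM('a))) \<partial>lborel) =
    ennreal (K * c powr (- \<beta> / 2) * (c + (norm (y - x0))\<^sup>2) powr (- (real DIM('a) - \<beta>) / 2))"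
    using nn_integral_inverse_quadratic_riesz_shift[OF \<beta>] by blast
  have int: "integrable lborel (\<lambda>y. h y * (c + (norm (y - x0))\<^sup>2) powr (- (real DIM('a) - \<beta>) / 2))"
  proof -
    define t where "t = (real DIM('a) - \<beta>) / 2"
    have t: "- (real DIM('a) - \<beta>) / 2 = - t" unfolding t_def by linarith
    have t0: "0 \<le> t" using \<beta> by (simp add: t_def)
    show ?thesis using w unfolding t by (rule integrable_inverse_quadratic_shift[OF h _ t0 order_refl c])
  qed
  show ?thesis
  proof (rule integrableI_bounded)
    have "(\<integral>\<^sup>+z. ennreal (norm (case z of (x, y) \<Rightarrow> ?F x y)) \<partial>(lborel \<Otimes>\<^sub>M lborel)) =
      (\<integral>\<^sup>+x. (\<integral>\<^sup>+y. ennreal (norm (?F x y)) \<partial>lborel) \<partial>lborel)"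
    proof -
      have m: "(\<lambda>z. ennreal (norm (case z of (x, y) \<Rightarrow> ?F x y))) \<in> borel_measurable (lborel \<Otimes>\<^sub>M lborel)" by measurable
      show ?thesis unfolding lborel.nn_integral_fst[OF m, symmetric] by simp
    qed
    also have "\<dots> = (\<integral>\<^sup>+y. (\<integral>\<^sup>+x. ennreal (norm (?F x y)) \<partial>lborel) \<partial>lborel)"
      by (rule lborel_pair.Fubini') measurable
    also have "\<dots> = (\<integral>\<^sup>+y. ennreal (K * c powr (- \<beta> / 2)) * ennreal \<bar>h y * (c + (norm (y - x0))\<^sup>2) powr (- (real DIM('a) - \<beta>) / 2)\<bar> \<partial>lborel)"
    proof (rule nn_integral_cong)
      fix y :: 'a
      have "(\<integral>\<^sup>+x. ennreal (norm (?F x y)) \<partial>lborel) = (\<integral>\<^sup>+x. ennreal \<bar>h y\<bar> *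
        ennreal ((c + (norm (x - x0))\<^sup>2) powr (- (real DIM('a) + \<beta>) / 2) * norm (x - y) powr (\<beta> - real DIM('a))) \<partial>lborel)"
        by (intro nn_integral_cong) (simp add: abs_mult mult_ac flip: ennreal_mult)
      also have "\<dots> = ennreal \<bar>h y\<bar> * ennreal (K * c powr (- \<beta> / 2) * (c + (norm (y - x0))\<^sup>2) powr (- (real DIM('a) - \<beta>) / 2))"
        unfolding K(2)[OF c, symmetric] by (rule nn_integral_cmult) measurable
      also have "\<dots> = ennreal (K * c powr (- \<beta> / 2)) * ennreal \<bar>h y * (c + (norm (y - x0))\<^sup>2) powr (- (real DIM('a) - \<beta>) / 2)\<bar>"
        using K(1) by (simp add: abs_mult mult_ac flip: ennreal_mult)
      finally show "(\<integral>\<^sup>+x. ennreal (norm (?F x y)) \<partial>lborel) =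
        ennreal (K * c powr (- \<beta> / 2)) * ennreal \<bar>h y * (c + (norm (y - x0))\<^sup>2) powr (- (real DIM('a) - \<beta>) / 2)\<bar>" .
    qed
    also have "\<dots> = ennreal (K * c powr (- \<beta> / 2)) * (\<integral>\<^sup>+y. ennreal \<bar>h y * (c + (norm (y - x0))\<^sup>2) powr (- (real DIM('a) - \<beta>) / 2)\<bar> \<partial>lborel)"
      by (rule nn_integral_cmult) measurable
    also have "\<dots> < \<infinity>"
      using int unfolding integrable_iff_bounded by (simp add: ennreal_mult_less_top)
    finally show "(\<integral>\<^sup>+z. ennreal (norm (case z of (x, y) \<Rightarrow> ?F x y)) \<partial>(lborel \<Otimes>\<^sub>M lborel)) < \<infinity>" .
  qed measurable
qed

text \<open>Almost every section of the integrable pairing is integrable, and the factor depending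
  on \<open>x\<close> alone is nonzero.\<close>

lemma AE_integrable_riesz:
  fixes h :: "'a::euclidean_space \<Rightarrow> real"
  assumes h[measurable]: "h \<in> borel_measurable borel" and \<beta>: "0 < \<beta>" "\<beta> < real DIM('a)"
    and w: "integrable lborel (\<lambda>y. h y * (1 + (norm y)\<^sup>2) powr (- (real DIM('a) - \<beta>) / 2))"
  shows "AE x in lborel. integrable lborel (\<lambda>y. h y * norm (x - y) powr (\<beta> - real DIM('a)))"
  using lborel_pair.AE_integrable_fst[OF riesz_pair_integrable[OF h \<beta> zero_less_one w, of 0]]
proof eventually_elim
  fix x :: 'a
  assume i: "integrable lborel (\<lambda>y. (1 + (norm (x - 0))\<^sup>2) powr (- (real DIM('a) + \<beta>) / 2) * (h y * norm (x - y) powr (\<beta> - real DIM('a))))"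
  have "1 + (norm x)\<^sup>2 \<noteq> 0" by (simp add: add_nonneg_eq_0_iff)
  then show "integrable lborel (\<lambda>y. h y * norm (x - y) powr (\<beta> - real DIM('a)))"
    using i by (simp add: integrable_mult_right_iff)
qed

text \<open>The vanishing potential is paired with an inverse quadratic centred at
  \<open>x0\<close>, and Fubini moves the kernel onto the test function.\<close>

lemma riesz_zero_inverse_quadratic:
  fixes h :: "'a::euclidean_space \<Rightarrow> real"
  assumes h[measurable]: "h \<in> borel_measurable borel" and \<beta>: "0 < \<beta>" "\<beta> < real DIM('a)" and c: "0 < c"
    and w: "integrable lborel (\<lambda>y. h y * (1 + (norm y)\<^sup>2) powr (- (real DIM('a) - \<beta>) / 2))"
    and zero: "AE x in lborel. (\<integral>y. h y * norm (x - y) powr (\<beta> - real DIM('a)) \<partial>lborel) = 0"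
  shows "(\<integral>y. h y * (c + (norm (y - x0))\<^sup>2) powr (- (real DIM('a) - \<beta>) / 2) \<partial>lborel) = 0"
proof -
  let ?V = "\<lambda>x. (c + (norm (x - x0))\<^sup>2) powr (- (real DIM('a) + \<beta>) / 2)"
  obtain K where K: "0 < K" "\<And>c x0 (y :: 'a). 0 < c \<Longrightarrow>
    (\<integral>\<^sup>+x. ennreal ((c + (norm (x - x0))\<^sup>2) powr (- (real DIM('a) + \<beta>) / 2) * norm (x - y) powr (\<beta> - real DIM('a))) \<partial>lborel) =
    ennreal (K * c powr (- \<beta> / 2) * (c + (norm (y - x0))\<^sup>2) powr (- (real DIM('a) - \<beta>) / 2))"
    using nn_integral_inverse_quadratic_riesz_shift[OF \<beta>] by blast
  have K': "(\<integral>x. ?V x * norm (x - y) powr (\<beta> - real DIM('a)) \<partial>lborel) =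
    K * c powr (- \<beta> / 2) * (c + (norm (y - x0))\<^sup>2) powr (- (real DIM('a) - \<beta>) / 2)" for y
    using K(2)[OF c, of x0 y] K(1) by (subst integral_eq_nn_integral) auto
  have "(\<integral>y. (\<integral>x. ?V x * (h y * norm (x - y) powr (\<beta> - real DIM('a))) \<partial>lborel) \<partial>lborel) =
    (\<integral>x. (\<integral>y. ?V x * (h y * norm (x - y) powr (\<beta> - real DIM('a))) \<partial>lborel) \<partial>lborel)"
    by (rule lborel_pair.Fubini_integral[OF riesz_pair_integrable[OF h \<beta> c w]])
  also have "\<dots> = 0"
    by (rule integral_eq_zero_AE) (use zero in eventually_elim, simp)
  also have "(\<integral>y. (\<integral>x. ?V x * (h y * norm (x - y) powr (\<beta> - real DIM('a))) \<partial>lborel) \<partial>lborel) =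
    (\<integral>y. K * c powr (- \<beta> / 2) * (h y * (c + (norm (y - x0))\<^sup>2) powr (- (real DIM('a) - \<beta>) / 2)) \<partial>lborel)"
  proof (rule Bochner_Integration.integral_cong[OF refl])
    fix y :: 'a
    have "(\<integral>x. ?V x * (h y * norm (x - y) powr (\<beta> - real DIM('a))) \<partial>lborel) =
      (\<integral>x. h y * (?V x * norm (x - y) powr (\<beta> - real DIM('a))) \<partial>lborel)"
      by (intro Bochner_Integration.integral_cong) (auto simp: mult_ac)
    also have "\<dots> = h y * (K * c powr (- \<beta> / 2) * (c + (norm (y - x0))\<^sup>2) powr (- (real DIM('a) - \<beta>) / 2))"
      unfolding K'[symmetric] by (rule integral_mult_right_zero)
    finally show "(\<integral>x. ?V x * (h y * norm (x - y) powr (\<beta> - real DIM('a))) \<partial>lborel) =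
      K * c powr (- \<beta> / 2) * (h y * (c + (norm (y - x0))\<^sup>2) powr (- (real DIM('a) - \<beta>) / 2))"
      by (simp add: mult_ac)
  qed
  finally show ?thesis using K c by simp
qed

(* Differentiating in the parameter c raises the exponent by one. *)
lemma inverse_quadratic_zero_Suc:
  fixes h :: "'a::euclidean_space \<Rightarrow> real"
  assumes h[measurable]: "h \<in> borel_measurable borel"
    and w: "integrable lborel (\<lambda>y. h y * (1 + (norm y)\<^sup>2) powr (- t))" and t: "0 < t" "t \<le> s"
    and zero: "\<And>c. 0 < c \<Longrightarrow> (\<integral>y. h y * (c + (norm (y - x0))\<^sup>2) powr (- s) \<partial>lborel) = 0" and c: "0 < c"
  shows "(\<integral>y. h y * (c + (norm (y - x0))\<^sup>2) powr (- (s + 1)) \<partial>lborel) = 0"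
proof -
  define X where "X y = c + (norm (y - x0))\<^sup>2" for y
  define d where "d i = inverse (real (Suc i))" for i
  have X: "0 < X y" for y using c by (simp add: X_def add_pos_nonneg)
  have d: "0 < d i" for i by (simp add: d_def)
  have [measurable]: "X \<in> borel_measurable borel" unfolding X_def[abs_def] by measurable
  have deriv: "((\<lambda>u. u powr (- s)) has_real_derivative - s * u powr (- (s + 1))) (at u)" if "0 < u" for u
    using has_real_derivative_powr[OF that, of "- s"] minus_add_distrib[of s 1] by (simp only: diff_conv_add_uminus)
  define g where "g i y = h y * (((X y + d i) powr (- s) - X y powr (- s)) / d i)" for i y
  have int: "integrable lborel (\<lambda>y. h y * (u + (norm (y - x0))\<^sup>2) powr (- r))" if "0 < u" "t \<le> r" for u r
    using integrable_inverse_quadratic_shift[OF h w] that t by simp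
  have "(\<lambda>i. \<integral>y. g i y \<partial>lborel) \<longlonglongrightarrow> (\<integral>y. h y * (- s * X y powr (- (s + 1))) \<partial>lborel)"
  proof (rule integral_dominated_convergence[where w="\<lambda>y. s * \<bar>h y * X y powr (- (s + 1))\<bar>"])
    show "integrable lborel (\<lambda>y. s * \<bar>h y * X y powr (- (s + 1))\<bar>)"
      using int[OF c, of "s + 1"] t unfolding X_def by (intro integrable_mult_right integrable_abs) simp
    show "AE y in lborel. (\<lambda>i. g i y) \<longlonglongrightarrow> h y * (- s * X y powr (- (s + 1)))"
    proof (rule AE_I2)
      fix y
      have "((\<lambda>e. ((X y + e) powr (- s) - X y powr (- s)) / e) \<longlongrightarrow> - s * X y powr (- (s + 1))) (at 0)"
        using deriv[OF X[of y]] by (simp add: DERIV_def)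
      moreover have "filterlim d (at 0) sequentially"
        unfolding d_def[abs_def] filterlim_at using LIMSEQ_inverse_real_of_nat by auto
      ultimately have "(\<lambda>i. ((X y + d i) powr (- s) - X y powr (- s)) / d i) \<longlonglongrightarrow> - s * X y powr (- (s + 1))"
        by (rule filterlim_compose)
      then show "(\<lambda>i. g i y) \<longlonglongrightarrow> h y * (- s * X y powr (- (s + 1)))"
        unfolding g_def by (rule tendsto_mult_left)
    qed
    fix i
    show "AE y in lborel. norm (g i y) \<le> s * \<bar>h y * X y powr (- (s + 1))\<bar>"
    proof (rule AE_I2)
      fix y
      \<comment> \<open>The intermediate point exceeds \<open>X y\<close> and the derivative
        decreases in absolute value, so the absolute value of the limit dominates all difference
        quotients.\<close>
      obtain z where z: "X y < z" "z < X y + d i"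
        "(X y + d i) powr (- s) - X y powr (- s) = (X y + d i - X y) * (- s * z powr (- (s + 1)))"
        using MVT2[of "X y" "X y + d i" "\<lambda>u. u powr (- s)" "\<lambda>u. - s * u powr (- (s + 1))"] deriv X[of y] d[of i] by force
      have "((X y + d i) powr (- s) - X y powr (- s)) / d i = - s * z powr (- (s + 1))"
        using d[of i] unfolding z(3) by simp
      then have "norm (g i y) = s * (\<bar>h y\<bar> * z powr (- (s + 1)))" using t by (simp add: g_def abs_mult)
      also have "\<dots> \<le> s * (\<bar>h y\<bar> * X y powr (- (s + 1)))"
        using t z(1) X[of y] by (intro mult_left_mono powr_mono2') auto
      finally show "norm (g i y) \<le> s * \<bar>h y * X y powr (- (s + 1))\<bar>" by (simp add: abs_mult)
    qed
  qed (auto simp: g_def[abs_def])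
  moreover have "(\<integral>y. g i y \<partial>lborel) = 0" for i
  proof -
    have "g i y = h y * (c + d i + (norm (y - x0))\<^sup>2) powr (- s) / d i - h y * (c + (norm (y - x0))\<^sup>2) powr (- s) / d i" for y
      by (simp add: g_def X_def diff_divide_distrib right_diff_distrib add_ac)
    then have "(\<integral>y. g i y \<partial>lborel) = (\<integral>y. h y * (c + d i + (norm (y - x0))\<^sup>2) powr (- s) / d i \<partial>lborel) -
      (\<integral>y. h y * (c + (norm (y - x0))\<^sup>2) powr (- s) / d i \<partial>lborel)"
      using int[of "c + d i" s] int[of c s] c d[of i] t
      by (simp only:) (intro Bochner_Integration.integral_diff integrable_divide, auto)
    also have "\<dots> = 0" using zero[of "c + d i"] zero[of c] c d[of i] by simp
    finally show ?thesis .
  qed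
  ultimately have "(\<integral>y. h y * (- s * X y powr (- (s + 1))) \<partial>lborel) = 0"
    by (simp add: LIMSEQ_const_iff)
  moreover have "(\<integral>y. h y * (- s * X y powr (- (s + 1))) \<partial>lborel) = - s * (\<integral>y. h y * X y powr (- (s + 1)) \<partial>lborel)"
    by (subst integral_mult_right_zero[symmetric]) (auto intro!: Bochner_Integration.integral_cong simp: mult_ac)
  ultimately show ?thesis using t by (simp add: X_def)
qed

lemma inverse_quadratic_zero_add:
  fixes h :: "'a::euclidean_space \<Rightarrow> real"
  assumes h: "h \<in> borel_measurable borel"
    and w: "integrable lborel (\<lambda>y. h y * (1 + (norm y)\<^sup>2) powr (- t))" and t: "0 < t"
    and zero: "\<And>c. 0 < c \<Longrightarrow> (\<integral>y. h y * (c + (norm (y - x0))\<^sup>2) powr (- t) \<partial>lborel) = 0" and c: "0 < c"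
  shows "(\<integral>y. h y * (c + (norm (y - x0))\<^sup>2) powr (- (t + real M)) \<partial>lborel) = 0"
  using c
proof (induction M arbitrary: c)
  case (Suc M)
  then show ?case
    using inverse_quadratic_zero_Suc[OF h w t, of "t + real M" x0 c] by (simp add: add_ac)
qed (use zero in simp)

(* Rescaled inverse quadratics with an integrable exponent form an approximate identity. *)
lemma inverse_quadratic_zero_AE:
  fixes h :: "'a::euclidean_space \<Rightarrow> real"
  assumes h[measurable]: "h \<in> borel_measurable borel"
    and w: "integrable lborel (\<lambda>y. h y * (1 + (norm y)\<^sup>2) powr (- t))" and t: "0 < t"
    and zero: "\<And>c x. 0 < c \<Longrightarrow> (\<integral>y. h y * (c + (norm (y - x))\<^sup>2) powr (- (t + real DIM('a))) \<partial>lborel) = 0"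
  shows "AE x in lborel. h x = 0"
proof (rule AE_zero_box[OF h])
  \<comment> \<open>The exponent is reached from \<open>t\<close> by integer steps and satisfies
    \<open>2 * p > DIM('a)\<close>, so that \<open>\<phi>\<close> is integrable.\<close>
  define p where "p = t + real DIM('a)"
  have p: "0 < p" "t \<le> p" using t by (simp_all add: p_def)
  define \<phi> where "\<phi> w = (1 + (norm w)\<^sup>2) powr (- p)" for w :: 'a
  have [measurable]: "\<phi> \<in> borel_measurable borel" unfolding \<phi>_def[abs_def] by measurable
  have \<phi>0: "0 < \<phi> w" for w by (auto simp: \<phi>_def add_nonneg_eq_0_iff)
  have int_inv: "integrable lborel (\<lambda>w::'a. (1 + (norm w)\<^sup>2) powr (- s))" if "real DIM('a) < 2 * s" for s
    using nn_integral_inverse_quadratic[OF that] by (intro integrableI_nonneg) auto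
  have int\<phi>: "integrable lborel \<phi>" unfolding \<phi>_def[abs_def] by (rule int_inv) (use t in \<open>simp add: p_def\<close>)
  define A where "A = (\<integral>w. \<phi> w \<partial>lborel)"
  have A: "A \<noteq> 0"
  proof
    assume "A = 0"
    then have "AE w in lborel. \<phi> w = 0"
      using integral_nonneg_eq_0_iff_AE[OF int\<phi>] \<phi>0 unfolding A_def by (simp add: less_imp_le)
    then have "AE w in (lborel :: 'a measure). False" by (rule AE_mp) (use \<phi>0 in \<open>simp add: less_le\<close>)
    then show False by (simp add: eventually_False ae_filter_eq_bot_iff)
  qed
  fix a b :: 'a
  define U where "U = (indicator (box a b) :: 'a \<Rightarrow> real)"
  have [measurable]: "U \<in> borel_measurable borel" by (simp add: U_def)
  have U01: "0 \<le> U x" "U x \<le> 1" for x by (auto simp: U_def indicator_def)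
  obtain R where R: "0 < R" "\<And>x. x \<in> box a b \<Longrightarrow> norm x \<le> R"
    using bounded_box[of a b] by (auto simp: bounded_pos)
  define D where "D = 2 + 2 * R\<^sup>2"
  have D: "0 < D" by (simp add: D_def add_pos_nonneg)
  \<comment> \<open>A bound uniform in \<open>e\<close>. The exponent of \<open>\<phi>\<close> is
    split: the part \<open>t\<close> pays for moving the weight from \<open>w\<close> to
    \<open>y\<close>, and the part \<open>DIM('a)\<close> keeps the bound integrable in
    \<open>w\<close>.\<close>
  have peetre: "U (y + e *\<^sub>R w) * \<phi> w \<le> D powr t * (1 + (norm y)\<^sup>2) powr (- t) * (1 + (norm w)\<^sup>2) powr (- real DIM('a))"
    if e: "0 < e" "e \<le> 1" for y w :: 'a and e
  proof (cases "y + e *\<^sub>R w \<in> box a b")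
    case True
    have "norm y \<le> norm (y + e *\<^sub>R w) + norm (e *\<^sub>R w)" using norm_triangle_ineq4[of "y + e *\<^sub>R w" "e *\<^sub>R w"] by simp
    also have "\<dots> \<le> R + norm w" using R(2)[OF True] e by (intro add_mono) (auto intro: mult_left_le_one_le)
    finally have "(norm y)\<^sup>2 \<le> (R + norm w)\<^sup>2" by (intro power_mono) auto
    also have "\<dots> \<le> 2 * R\<^sup>2 + 2 * (norm w)\<^sup>2"
      using sum_squares_bound[of R "norm w"] by (simp add: power2_sum)
    finally have "(norm y)\<^sup>2 \<le> 2 * R\<^sup>2 + 2 * (norm w)\<^sup>2" .
    moreover have "D * (1 + (norm w)\<^sup>2) = 2 + 2 * R\<^sup>2 + 2 * (norm w)\<^sup>2 + 2 * (R\<^sup>2 * (norm w)\<^sup>2)"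
      by (simp add: D_def algebra_simps)
    moreover have "0 \<le> R\<^sup>2 * (norm w)\<^sup>2" by simp
    ultimately have "1 + (norm y)\<^sup>2 \<le> D * (1 + (norm w)\<^sup>2)" by linarith
    then have "(D * (1 + (norm w)\<^sup>2)) powr (- t) \<le> (1 + (norm y)\<^sup>2) powr (- t)"
      using t by (intro powr_mono2') (auto simp: add_pos_nonneg)
    then have "D powr t * (D powr (- t) * (1 + (norm w)\<^sup>2) powr (- t)) \<le> D powr t * (1 + (norm y)\<^sup>2) powr (- t)"
      unfolding powr_mult by (rule mult_left_mono) simp
    then have "(1 + (norm w)\<^sup>2) powr (- t) \<le> D powr t * (1 + (norm y)\<^sup>2) powr (- t)"
      using D by (simp add: powr_minus field_simps)
    then have "(1 + (norm w)\<^sup>2) powr (- t) * (1 + (norm w)\<^sup>2) powr (- real DIM('a)) \<le>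
      D powr t * (1 + (norm y)\<^sup>2) powr (- t) * (1 + (norm w)\<^sup>2) powr (- real DIM('a))"
      by (rule mult_right_mono) simp
    moreover have "(1 + (norm w)\<^sup>2) powr (- t) * (1 + (norm w)\<^sup>2) powr (- real DIM('a)) = \<phi> w"
      by (simp add: \<phi>_def p_def flip: powr_add)
    ultimately show ?thesis using True by (simp add: U_def)
  qed (simp add: U_def)
  \<comment> \<open>The indicator of the box smoothed at scale \<open>e\<close>, up to the constant
    factor \<open>A\<close>.\<close>
  define k where "k e y = (\<integral>w. U (y + e *\<^sub>R w) * \<phi> w \<partial>lborel)" for e y
  define B where "B = D powr t * (\<integral>(w::'a). (1 + (norm w)\<^sup>2) powr (- real DIM('a)) \<partial>lborel)"
  have B: "0 \<le> B" by (simp add: B_def)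
  have [measurable]: "k e \<in> borel_measurable borel" for e unfolding k_def[abs_def] by measurable
  have intk: "integrable lborel (\<lambda>w. U (y + e *\<^sub>R w) * \<phi> w)" for e y
    by (rule Bochner_Integration.integrable_bound[OF int\<phi>]) (auto simp: U_def indicator_def less_imp_le[OF \<phi>0])
  have k0: "0 \<le> k e y" for e y
    unfolding k_def using U01 by (intro Bochner_Integration.integral_nonneg) (simp add: less_imp_le[OF \<phi>0])
  have k_le: "k e y \<le> B * (1 + (norm y)\<^sup>2) powr (- t)" if "0 < e" "e \<le> 1" for e y
  proof -
    have "k e y \<le> (\<integral>w. D powr t * (1 + (norm y)\<^sup>2) powr (- t) * (1 + (norm w)\<^sup>2) powr (- real DIM('a)) \<partial>(lborel :: 'a measure))"
      unfolding k_def by (intro integral_mono intk peetre[OF that] integrable_mult_right int_inv) simp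
    then show ?thesis by (simp add: B_def mult_ac)
  qed
  \<comment> \<open>The vanishing integrals for \<open>c = e\<^sup>2\<close> are integrated over all
    centres \<open>x\<close> in the box. Exchanging the order and substituting
    \<open>x = y + e *\<^sub>R w\<close> turns the inner integral into a multiple of
    \<open>k e y\<close>.\<close>
  have hk0: "(\<integral>y. h y * k e y \<partial>lborel) = 0" if e: "0 < e" for e
  proof -
    \<comment> \<open>The constant of the shift inequality, made uniform over the centres by the
      bound \<open>R\<close> for the box.\<close>
    define C where "C = (e\<^sup>2) powr (t - p) * (2 + (1 + 2 * R\<^sup>2) / e\<^sup>2) powr t"
    have C: "0 \<le> C" by (simp add: C_def)
    let ?F = "\<lambda>x y. U x * (h y * (e\<^sup>2 + (norm (y - x))\<^sup>2) powr (- p))"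
    have int0: "integrable (lborel \<Otimes>\<^sub>M lborel) (\<lambda>(x, y). U x * (C * (h y * (1 + (norm y)\<^sup>2) powr (- t))))"
    proof (rule lborel_pair.Fubini_integrable)
      have "integrable lborel U" unfolding U_def
        using emeasure_lborel_box_finite[of a b] by (intro integrable_real_indicator) (auto simp: less_top)
      then show "integrable lborel (\<lambda>x. \<integral>y. norm (case (x, y) of (x, y) \<Rightarrow> U x * (C * (h y * (1 + (norm y)\<^sup>2) powr (- t)))) \<partial>lborel)"
        by (simp add: abs_mult)
    qed (use w in auto)
    have "integrable (lborel \<Otimes>\<^sub>M lborel) (\<lambda>(x, y). ?F x y)"
    proof (rule Bochner_Integration.integrable_bound[OF int0], measurable, rule AE_I2, clarsimp)
      fix x y :: 'a
      have "U x * (\<bar>h y\<bar> * (e\<^sup>2 + (norm (y - x))\<^sup>2) powr (- p)) \<le> U x * (\<bar>h y\<bar> * (C * (1 + (norm y)\<^sup>2) powr (- t)))"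
      proof (cases "x \<in> box a b")
        case True
        have "(e\<^sup>2 + (norm (y - x))\<^sup>2) powr (- p) \<le>
          (e\<^sup>2) powr (t - p) * (2 + (1 + 2 * (norm x)\<^sup>2) / e\<^sup>2) powr t * (1 + (norm y)\<^sup>2) powr (- t)"
          by (rule inverse_quadratic_shift_le) (use e t p in auto)
        also have "\<dots> \<le> C * (1 + (norm y)\<^sup>2) powr (- t)"
          unfolding C_def using e t R(2)[OF True]
          by (intro mult_right_mono mult_left_mono powr_mono2 add_mono divide_right_mono power_mono) auto
        finally show ?thesis using U01 by (intro mult_left_mono) auto
      qed (simp add: U_def)
      then show "\<bar>U x * (h y * (e\<^sup>2 + (norm (y - x))\<^sup>2) powr (- p))\<bar> \<le> \<bar>U x * (C * (h y * (1 + (norm y)\<^sup>2) powr (- t)))\<bar>"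
        using U01 C by (simp add: abs_mult mult_ac)
    qed
    then have "(\<integral>y. (\<integral>x. ?F x y \<partial>lborel) \<partial>lborel) = (\<integral>x. (\<integral>y. ?F x y \<partial>lborel) \<partial>lborel)"
      by (rule lborel_pair.Fubini_integral)
    also have "\<dots> = 0" using zero[of "e\<^sup>2"] e by (simp add: p_def)
    finally have F0: "(\<integral>y. (\<integral>x. ?F x y \<partial>lborel) \<partial>lborel) = 0" .
    define E where "E = e ^ DIM('a) * (e\<^sup>2) powr (- p)"
    have E: "0 < E" using e by (simp add: E_def)
    have "(\<integral>x. ?F x y \<partial>lborel) = E * (h y * k e y)" for y
    proof -
      have "(\<integral>\<^sup>+x. ennreal (U x * (e\<^sup>2 + (norm (y - x))\<^sup>2) powr (- p)) \<partial>lborel) =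
        (\<integral>\<^sup>+x. ennreal (U (y + x) * (e\<^sup>2 + (norm (y - (y + x)))\<^sup>2) powr (- p)) \<partial>lborel)"
        by (rule nn_integral_lborel_translate[symmetric]) measurable
      also have "\<dots> = ennreal (\<bar>e\<bar> ^ DIM('a)) *
        (\<integral>\<^sup>+w. ennreal (U (y + e *\<^sub>R w) * (e\<^sup>2 + (norm (y - (y + e *\<^sub>R w)))\<^sup>2) powr (- p)) \<partial>lborel)"
        by (rule nn_integral_lborel_scale) (use e in auto)
      also have "\<dots> = ennreal (\<bar>e\<bar> ^ DIM('a)) * (\<integral>\<^sup>+w. ennreal ((e\<^sup>2) powr (- p)) * ennreal (U (y + e *\<^sub>R w) * \<phi> w) \<partial>lborel)"
      proof (intro arg_cong[where f="\<lambda>x. _ * x"] nn_integral_cong)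
        fix w :: 'a
        have "e\<^sup>2 + (norm (y - (y + e *\<^sub>R w)))\<^sup>2 = e\<^sup>2 * (1 + (norm w)\<^sup>2)"
          by (simp add: power_mult_distrib distrib_left)
        then have "(e\<^sup>2 + (norm (y - (y + e *\<^sub>R w)))\<^sup>2) powr (- p) = (e\<^sup>2) powr (- p) * \<phi> w"
          by (simp only: \<phi>_def powr_mult)
        then show "ennreal (U (y + e *\<^sub>R w) * (e\<^sup>2 + (norm (y - (y + e *\<^sub>R w)))\<^sup>2) powr (- p)) =
          ennreal ((e\<^sup>2) powr (- p)) * ennreal (U (y + e *\<^sub>R w) * \<phi> w)"
          using U01 \<phi>0 by (simp add: mult_ac less_imp_le flip: ennreal_mult)
      qed
      also have "(\<integral>\<^sup>+w. ennreal ((e\<^sup>2) powr (- p)) * ennreal (U (y + e *\<^sub>R w) * \<phi> w) \<partial>lborel) =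
        ennreal ((e\<^sup>2) powr (- p)) * (\<integral>\<^sup>+w. ennreal (U (y + e *\<^sub>R w) * \<phi> w) \<partial>lborel)"
        by (rule nn_integral_cmult) measurable
      also have "(\<integral>\<^sup>+w. ennreal (U (y + e *\<^sub>R w) * \<phi> w) \<partial>lborel) = ennreal (k e y)"
        unfolding k_def by (rule nn_integral_eq_integral[OF intk]) (simp add: U01 less_imp_le[OF \<phi>0])
      also have "ennreal (\<bar>e\<bar> ^ DIM('a)) * (ennreal ((e\<^sup>2) powr (- p)) * ennreal (k e y)) = ennreal (E * k e y)"
        using e k0 by (simp add: E_def mult.assoc flip: ennreal_mult)
      finally have "(\<integral>x. U x * (e\<^sup>2 + (norm (y - x))\<^sup>2) powr (- p) \<partial>lborel) = E * k e y"
        using E k0 U01 by (subst integral_eq_nn_integral) auto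
      moreover have "(\<integral>x. ?F x y \<partial>lborel) = h y * (\<integral>x. U x * (e\<^sup>2 + (norm (y - x))\<^sup>2) powr (- p) \<partial>lborel)"
        by (subst integral_mult_right_zero[symmetric]) (auto intro!: Bochner_Integration.integral_cong simp: mult_ac)
      ultimately show ?thesis by (simp add: mult_ac)
    qed
    then show ?thesis using F0 E by simp
  qed
  define d where "d i = inverse (real (Suc i))" for i
  have d: "0 < d i" "d i \<le> 1" for i by (simp_all add: d_def divide_simps)
  have dlim: "d \<longlonglongrightarrow> 0" unfolding d_def[abs_def] by (rule LIMSEQ_inverse_real_of_nat)
  \<comment> \<open>The smoothed indicators converge to \<open>U y * A\<close> off the boundary of
    the box, and the boundary is a null set.\<close>
  have "cbox a b - box a b \<in> null_sets lebesgue"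
    using negligible_frontier_interval[of a b] by (simp add: negligible_iff_null_sets)
  then have "AE y in lebesgue. y \<notin> cbox a b - box a b" by (rule AE_not_in)
  then have bd: "AE y in lborel. y \<notin> cbox a b - box a b" by (simp add: AE_completion_iff)
  have klim: "(\<lambda>i. k (d i) y) \<longlonglongrightarrow> U y * A" if y: "y \<notin> cbox a b - box a b" for y
  proof -
    have "(\<lambda>i. \<integral>w. U (y + d i *\<^sub>R w) * \<phi> w \<partial>lborel) \<longlonglongrightarrow> (\<integral>w. U y * \<phi> w \<partial>lborel)"
    proof (rule integral_dominated_convergence[OF _ _ int\<phi>])
      show "AE w in lborel. (\<lambda>i. U (y + d i *\<^sub>R w) * \<phi> w) \<longlonglongrightarrow> U y * \<phi> w"
      proof (rule AE_I2)
        fix w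
        have "(\<lambda>i. y + d i *\<^sub>R w) \<longlonglongrightarrow> y + 0 *\<^sub>R w" by (intro tendsto_intros dlim)
        then have l: "(\<lambda>i. y + d i *\<^sub>R w) \<longlonglongrightarrow> y" by simp
        have "eventually (\<lambda>i. U (y + d i *\<^sub>R w) = U y) sequentially"
        proof (cases "y \<in> box a b")
          case True
          then have "eventually (\<lambda>i. y + d i *\<^sub>R w \<in> box a b) sequentially"
            using l by (intro topological_tendstoD) (auto simp: open_box)
          then show ?thesis by eventually_elim (use True in \<open>simp add: U_def\<close>)
        next
          case False
          then have "y \<in> - cbox a b" using y by simp
          then have "eventually (\<lambda>i. y + d i *\<^sub>R w \<in> - cbox a b) sequentially"
            using l by (intro topological_tendstoD) (auto simp: open_Compl closed_cbox)
          then show ?thesis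
            by eventually_elim (use False box_subset_cbox[of a b] in \<open>auto simp: U_def indicator_def\<close>)
        qed
        then have "eventually (\<lambda>i. U (y + d i *\<^sub>R w) * \<phi> w = U y * \<phi> w) sequentially" by eventually_elim simp
        then show "(\<lambda>i. U (y + d i *\<^sub>R w) * \<phi> w) \<longlonglongrightarrow> U y * \<phi> w" by (rule tendsto_eventually)
      qed
    qed (auto simp: U_def indicator_def less_imp_le[OF \<phi>0])
    then show ?thesis by (simp add: k_def A_def)
  qed
  have "(\<lambda>i. \<integral>y. h y * k (d i) y \<partial>lborel) \<longlonglongrightarrow> (\<integral>y. h y * (U y * A) \<partial>lborel)"
  proof (rule integral_dominated_convergence[where w="\<lambda>y. B * \<bar>h y * (1 + (norm y)\<^sup>2) powr (- t)\<bar>"])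
    show "AE y in lborel. (\<lambda>i. h y * k (d i) y) \<longlonglongrightarrow> h y * (U y * A)"
      using bd by eventually_elim (intro tendsto_mult_left klim)
    fix i
    show "AE y in lborel. norm (h y * k (d i) y) \<le> B * \<bar>h y * (1 + (norm y)\<^sup>2) powr (- t)\<bar>"
    proof (rule AE_I2)
      fix y
      have "\<bar>h y\<bar> * k (d i) y \<le> \<bar>h y\<bar> * (B * (1 + (norm y)\<^sup>2) powr (- t))"
        by (intro mult_left_mono k_le d) simp
      then show "norm (h y * k (d i) y) \<le> B * \<bar>h y * (1 + (norm y)\<^sup>2) powr (- t)\<bar>"
        using k0 by (simp add: abs_mult mult_ac)
    qed
  qed (use w in auto)
  then have "(\<integral>y. h y * (U y * A) \<partial>lborel) = 0" by (simp add: hk0 d LIMSEQ_const_iff)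
  also have "(\<lambda>y. h y * (U y * A)) = (\<lambda>y. A * (U y * h y))" by (simp add: mult_ac)
  finally show "(\<integral>x. indicator (box a b) x * h x \<partial>lborel) = 0" using A by (simp add: U_def)
  show "integrable lborel (\<lambda>x. indicator (box a b) x * h x)"
  proof (rule Bochner_Integration.integrable_bound[OF integrable_mult_right[OF w, of "(1 + R\<^sup>2) powr t"]])
    show "AE x in lborel. norm (indicator (box a b) x * h x) \<le> norm ((1 + R\<^sup>2) powr t * (h x * (1 + (norm x)\<^sup>2) powr (- t)))"
    proof (rule AE_I2)
      fix x
      show "norm (indicator (box a b) x * h x) \<le> norm ((1 + R\<^sup>2) powr t * (h x * (1 + (norm x)\<^sup>2) powr (- t)))"
      proof (cases "x \<in> box a b")
        case True
        have pos: "0 < 1 + (norm x)\<^sup>2" by (simp add: add_pos_nonneg)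
        have "(1 + (norm x)\<^sup>2) powr t \<le> (1 + R\<^sup>2) powr t"
          using R(2)[OF True] t by (intro powr_mono2 add_left_mono power_mono) auto
        then have "(1 + (norm x)\<^sup>2) powr t * (1 + (norm x)\<^sup>2) powr (- t) \<le> (1 + R\<^sup>2) powr t * (1 + (norm x)\<^sup>2) powr (- t)"
          by (rule mult_right_mono) simp
        then have "1 \<le> (1 + R\<^sup>2) powr t * (1 + (norm x)\<^sup>2) powr (- t)"
          using pos by (simp flip: powr_add)
        then have "\<bar>h x\<bar> * 1 \<le> \<bar>h x\<bar> * ((1 + R\<^sup>2) powr t * (1 + (norm x)\<^sup>2) powr (- t))"
          by (rule mult_left_mono) simp
        then show ?thesis using True by (simp add: abs_mult mult_ac)
      qed simp
    qed
  qed measurable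
qed

text \<open>The pairing yields the exponent \<open>t = (n - \<beta>) / 2\<close>, which is below the
  integrable range since \<open>2 * t < n\<close>. Raising it \<open>n\<close> times reaches the
  exponent of the approximate identity.\<close>

lemma riesz_potential_zero_AE:
  fixes h :: "'a::euclidean_space \<Rightarrow> real"
  assumes h: "h \<in> borel_measurable borel" and \<beta>: "0 < \<beta>" "\<beta> < real DIM('a)"
    and w: "integrable lborel (\<lambda>y. h y * (1 + (norm y)\<^sup>2) powr (- (real DIM('a) - \<beta>) / 2))"
    and zero: "AE x in lborel. (\<integral>y. h y * norm (x - y) powr (\<beta> - real DIM('a)) \<partial>lborel) = 0"
  shows "AE x in lborel. h x = 0"
proof -
  define t where "t = (real DIM('a) - \<beta>) / 2"
  have t: "0 < t" "- (real DIM('a) - \<beta>) / 2 = - t" using \<beta> unfolding t_def by simp linarith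
  show ?thesis
    using inverse_quadratic_zero_AE[OF h w[unfolded t(2)] t(1)]
      inverse_quadratic_zero_add[OF h w[unfolded t(2)] t(1)]
      riesz_zero_inverse_quadratic[OF h \<beta> _ w zero, unfolded t(2)] by blast
qed

section \<open>The inversion formulas\<close>

lemma translate_subspace_cong:
  fixes S :: "'a::real_vector set"
  assumes "subspace S" "a - b \<in> S"
  shows "(+) a ` S = (+) b ` S"
proof -
  have 1: "a + s \<in> (+) b ` S" if "s \<in> S" for s
    by (rule image_eqI[of _ _ "a - b + s"]) (use subspace_add[OF assms that] in simp_all)
  have 2: "b + s \<in> (+) a ` S" if "s \<in> S" for s
    by (rule image_eqI[of _ _ "s - (a - b)"]) (use subspace_diff[OF assms(1) that assms(2)] in simp_all)
  show ?thesis using 1 2 by blast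
qed

text \<open>Rotating by \<open>Q\<close> and translating by the foot \<open>z'\<close> maps
  \<open>S\<^sup>\<bottom>\<close> isometrically onto the fibre and carries the origin to the foot.
  The kernel centred at the foot becomes the kernel centred at 0, now on a fixed space.\<close>

lemma fibre_riesz_potential_rotated:
  fixes F :: "(real^'n) set \<Rightarrow> real" and S :: "(real^'n) set"
  assumes S: "subspace S" and Q: "orthogonal_matrix Q" and m: "dim S = m"
    and g [measurable]: "g \<in> borel_measurable borel"
    and ae: "AE w in subspace_measure (S\<^sup>\<bottom>). F ((+) (z + Q *v w) ` (*v) Q ` S) = g w"
  shows "fibre_riesz_potential m \<alpha> F ((+) z ` (*v) Q ` S) =
    (\<integral>w. riesz_kernel (CARD('n) - m) \<alpha> w * g w \<partial>subspace_measure (S\<^sup>\<bottom>))"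
proof -
  let ?QS = "(*v) Q ` S"
  have QS: "subspace ?QS" by (rule linear_subspace_image[OF matrix_vector_mul_linear S])
  note perp = subspace_orthogonal_comp
  define z' where "z' = z - closest_point ?QS z"
  have z': "z' \<in> ?QS\<^sup>\<bottom>" unfolding z'_def by (rule diff_closest_point_orthogonal_comp[OF QS])
  have zz: "z - z' \<in> ?QS" by (simp add: z'_def closest_point_subspace_in[OF QS])
  have plane: "(+) (z' + v) ` ?QS = (+) (z + v) ` ?QS" for v
    using translate_subspace_cong[OF QS, of "z + v" "z' + v"] zz by simp
  let ?T = "\<lambda>w. z' + Q *v w" and ?T' = "\<lambda>v. transpose Q *v (v - z')"
  have M: "subspace_measure (?QS\<^sup>\<bottom>) = distr (subspace_measure (S\<^sup>\<bottom>)) borel ?T"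
  proof -
    have "subspace_measure (?QS\<^sup>\<bottom>) = distr (subspace_measure (?QS\<^sup>\<bottom>)) borel ((+) z')"
      by (rule distr_subspace_measure_translate[OF perp z', symmetric])
    also have "\<dots> = distr (distr (subspace_measure (S\<^sup>\<bottom>)) borel ((*v) Q)) borel ((+) z')"
      unfolding orthogonal_comp_matrix_image[OF Q] subspace_measure_orthogonal_image[OF orthogonal_matrix_transformation[OF Q] perp] ..
    also have "\<dots> = distr (subspace_measure (S\<^sup>\<bottom>)) borel ?T"
      by (subst distr_distr) (auto simp: comp_def)
    finally show ?thesis .
  qed
  have [simp]: "?T' (?T w) = w" for w by (simp add: orthogonal_matrix_cancel[OF Q])
  have "AE w in subspace_measure (S\<^sup>\<bottom>). F ((+) (?T w) ` ?QS) = g w"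
    using ae by (simp only: plane)
  then have "AE v in distr (subspace_measure (S\<^sup>\<bottom>)) borel ?T. F ((+) (?T (?T' v)) ` ?QS) = g (?T' v)"
    by (intro AE_distr_inverse[where T'="?T'"]) (auto simp: orthogonal_matrix_cancel[OF Q])
  then have ae': "AE v in subspace_measure (?QS\<^sup>\<bottom>). F ((+) v ` ?QS) / norm (z' - v) powr (real (CARD('n) - m) - \<alpha>) =
      g (?T' v) / norm (z' - v) powr (real (CARD('n) - m) - \<alpha>)"
    unfolding M by eventually_elim (simp add: orthogonal_matrix_cancel[OF Q])
  have "(\<integral>w. F ((+) w ` ?QS) / norm (z' - w) powr (real (CARD('n) - m) - \<alpha>) \<partial>plane_measure (?QS\<^sup>\<bottom>)) =
    (\<integral>v. g (?T' v) / norm (z' - v) powr (real (CARD('n) - m) - \<alpha>) \<partial>subspace_measure (?QS\<^sup>\<bottom>))"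
    unfolding plane_measure_subspace[OF perp] by (rule integral_completion_AE[OF _ ae']) measurable
  also have "\<dots> = (\<integral>w. g (?T' (?T w)) / norm (z' - ?T w) powr (real (CARD('n) - m) - \<alpha>) \<partial>subspace_measure (S\<^sup>\<bottom>))"
    unfolding M by (rule integral_distr) measurable
  also have "\<dots> = (\<integral>w. g w / norm w powr (real (CARD('n) - m) - \<alpha>) \<partial>subspace_measure (S\<^sup>\<bottom>))"
    by (simp add: orthogonal_matrix_cancel[OF Q] norm_orthogonal_matrix[OF Q])
  finally have "fibre_riesz_potential m \<alpha> F ((+) z ` ?QS) =
    (\<integral>w. 1 / riesz_gamma (CARD('n) - m) \<alpha> * (g w / norm w powr (real (CARD('n) - m) - \<alpha>)) \<partial>subspace_measure (S\<^sup>\<bottom>))"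
    by (simp only: integral_mult_right_zero fibre_riesz_potential_def direction_translate[OF QS] foot_translate[OF QS] z'_def)
  also have "\<dots> = (\<integral>w. riesz_kernel (CARD('n) - m) \<alpha> w * g w \<partial>subspace_measure (S\<^sup>\<bottom>))"
  proof (rule Bochner_Integration.integral_cong[OF refl])
    fix w :: "real^'n"
    have "norm w powr (\<alpha> - real (CARD('n) - m)) = inverse (norm w powr (real (CARD('n) - m) - \<alpha>))"
      by (simp flip: powr_minus)
    then show "1 / riesz_gamma (CARD('n) - m) \<alpha> * (g w / norm w powr (real (CARD('n) - m) - \<alpha>)) =
      riesz_kernel (CARD('n) - m) \<alpha> w * g w"
      by (simp add: riesz_kernel_def divide_inverse mult_ac)
  qed
  finally show ?thesis .
qed

lemma riesz_potential_borel:
  fixes h :: "real^'n \<Rightarrow> real"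
  assumes [measurable]: "h \<in> borel_measurable borel"
  shows "riesz_potential \<beta> h x = (\<integral>y. riesz_kernel CARD('n) \<beta> y * h (x + y) \<partial>lborel)"
proof -
  have "riesz_potential \<beta> h x = (\<integral>y. 1 / riesz_gamma CARD('n) \<beta> * (h y / norm (x - y) powr (real CARD('n) - \<beta>)) \<partial>lborel)"
  proof -
    have "(\<integral>y. h y / norm (x - y) powr (real CARD('n) - \<beta>) \<partial>lebesgue) = (\<integral>y. h y / norm (x - y) powr (real CARD('n) - \<beta>) \<partial>lborel)"
      by (rule integral_completion) measurable
    then show ?thesis unfolding riesz_potential_def integral_mult_right_zero by (rule arg_cong)
  qed
  also have "\<dots> = (\<integral>y. riesz_kernel CARD('n) \<beta> (y - x) * h y \<partial>lborel)"
  proof (rule Bochner_Integration.integral_cong[OF refl])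
    fix y :: "real^'n"
    have "norm (y - x) powr (\<beta> - real CARD('n)) = inverse (norm (x - y) powr (real CARD('n) - \<beta>))"
      by (simp add: norm_minus_commute flip: powr_minus)
    then show "1 / riesz_gamma CARD('n) \<beta> * (h y / norm (x - y) powr (real CARD('n) - \<beta>)) = riesz_kernel CARD('n) \<beta> (y - x) * h y"
      by (simp add: riesz_kernel_def divide_inverse mult_ac)
  qed
  also have "\<dots> = (\<integral>y. riesz_kernel CARD('n) \<beta> (x + y - x) * h (x + y) \<partial>lborel)"
    using integral_subspace_translate[OF subspace_UNIV, of x "\<lambda>y. riesz_kernel CARD('n) \<beta> (y - x) * h y"]
    by (simp add: subspace_measure_UNIV)
  finally show ?thesis by simp
qed

lemma riesz_kernel_finite:
  fixes h :: "real^'n \<Rightarrow> real"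
  assumes \<beta>: "0 < \<beta>" "\<beta> < real CARD('n)" and [measurable]: "h \<in> borel_measurable borel"
    and int: "integrable lborel (\<lambda>y. h y * norm (x - y) powr (\<beta> - real CARD('n)))"
  shows "(\<integral>\<^sup>+y. ennreal (riesz_kernel CARD('n) \<beta> y) * ennreal \<bar>h (x + y)\<bar> \<partial>lborel) < \<infinity>"
proof -
  have g: "0 < riesz_gamma CARD('n) \<beta>" using \<beta> by (rule riesz_gamma_pos)
  have "(\<integral>\<^sup>+y. ennreal (riesz_kernel CARD('n) \<beta> y) * ennreal \<bar>h (x + y)\<bar> \<partial>lborel) =
    (\<integral>\<^sup>+y. ennreal (riesz_kernel CARD('n) \<beta> (x + y - x)) * ennreal \<bar>h (x + y)\<bar> \<partial>lborel)" by simp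
  also have "\<dots> = (\<integral>\<^sup>+y. ennreal (riesz_kernel CARD('n) \<beta> (y - x)) * ennreal \<bar>h y\<bar> \<partial>lborel)"
    by (rule nn_integral_lborel_translate) measurable
  also have "\<dots> = (\<integral>\<^sup>+y. ennreal (1 / riesz_gamma CARD('n) \<beta>) * ennreal \<bar>h y * norm (x - y) powr (\<beta> - real CARD('n))\<bar> \<partial>lborel)"
    using g by (intro nn_integral_cong) (simp add: riesz_kernel_def abs_mult norm_minus_commute mult_ac flip: ennreal_mult)
  also have "\<dots> = ennreal (1 / riesz_gamma CARD('n) \<beta>) * (\<integral>\<^sup>+y. ennreal \<bar>h y * norm (x - y) powr (\<beta> - real CARD('n))\<bar> \<partial>lborel)"
    by (rule nn_integral_cmult) measurable
  also have "\<dots> < \<infinity>" using int unfolding integrable_iff_bounded by (simp add: ennreal_mult_less_top)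
  finally show ?thesis .
qed

text \<open>\<open>h\<close> is a Borel representative and \<open>f\<close> equals its transform off
  \<open>E\<close>. On \<open>E\<close> the values of \<open>f\<close> are arbitrary, which is all
  that equality almost everywhere provides.\<close>

locale plane_transform_AE = rotated_planes \<eta> j k E
  for \<eta> :: "(real^'n) set" and j k E +
  fixes h :: "real^'n \<Rightarrow> real" and f :: "(real^'n) set \<Rightarrow> real"
  assumes h [measurable]: "h \<in> borel_measurable borel"
    and fE: "\<And>\<tau>. \<tau> \<in> affine_grassmannian j \<Longrightarrow> \<tau> \<notin> E \<Longrightarrow> f \<tau> = plane_transform h \<tau>"
    and jk0: "0 < j" "0 < k"
begin

lemma G_measurable [measurable (raw)]:
  assumes "a \<in> M \<rightarrow>\<^sub>M G" "b \<in> M \<rightarrow>\<^sub>M (borel :: (real^'n) measure)"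
  shows "(\<lambda>x. subspace_weight (a x) (b x)) \<in> borel_measurable M"
    and "(\<lambda>x. subspace_weight ((a x)\<^sup>\<bottom>) (b x)) \<in> borel_measurable M"
    and "(\<lambda>x. closest_point (a x) (b x)) \<in> M \<rightarrow>\<^sub>M borel"
  using subspace_weight_joint_measurable[OF assms(1)[unfolded measurable_G] assms(2)]
    subspace_weight_comp_joint_measurable[OF assms(1)[unfolded measurable_G] assms(2)]
    closest_point_joint_measurable[OF assms(1)[unfolded measurable_G] assms(2)] by auto

lemma orthogonal_H: "Q \<in> space H \<Longrightarrow> orthogonal_matrix Q"
  by (simp add: space_haar)

lemma space_GD:
  assumes "\<xi> \<in> space G"
  shows "subspace \<xi>" "dim \<xi> = j" "\<xi> \<subseteq> \<eta>\<^sup>\<bottom>" "\<eta> \<subseteq> \<xi>\<^sup>\<bottom>"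
proof -
  show *: "subspace \<xi>" "dim \<xi> = j" "\<xi> \<subseteq> \<eta>\<^sup>\<bottom>" using assms by (auto simp: space_G grassmannian_def)
  show "\<eta> \<subseteq> \<xi>\<^sup>\<bottom>" using *(3) orthogonal_commute unfolding orthogonal_comp_def by blast
qed

text \<open>The integral over the plane is pulled back to \<xi> and then spread over the whole space
  by the weight, so that the domain of \<open>y\<close> is the same for every \<xi>.\<close>

lemma f_rotated:
  assumes Q: "Q \<in> space H" and \<xi>: "\<xi> \<in> space G" and n: "(+) z ` (*v) Q ` \<xi> \<notin> E"
  shows "f ((+) z ` (*v) Q ` \<xi>) = (\<integral>y. subspace_weight \<xi> y * h (z + Q *v closest_point \<xi> y) \<partial>lborel)"
proof -
  note Q' = orthogonal_H[OF Q] and \<xi>' = space_GD(1)[OF \<xi>]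
  have "(*v) Q ` \<xi> \<in> grassmannian ((*v) Q ` UNIV) j"
    by (rule orthogonal_matrix_image_grassmannian[OF Q' subG[OF \<xi>]])
  then have "(+) z ` (*v) Q ` \<xi> \<in> affine_grassmannian j" by (rule translate_in_affine_grassmannian)
  then have "f ((+) z ` (*v) Q ` \<xi>) = plane_transform h ((+) z ` (*v) Q ` \<xi>)" using n by (rule fE)
  also have "\<dots> = (\<integral>y. h (z + y) \<partial>subspace_measure ((*v) Q ` \<xi>))"
    by (rule plane_transform_borel[OF linear_subspace_image[OF matrix_vector_mul_linear \<xi>'] h])
  also have "\<dots> = (\<integral>y. h (z + Q *v y) \<partial>subspace_measure \<xi>)"
    by (rule integral_subspace_orthogonal_image[OF \<xi>' Q']) measurable
  also have "\<dots> = (\<integral>y. subspace_weight \<xi> y * h (z + Q *v closest_point \<xi> y) \<partial>lborel)"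
    by (rule integral_subspace_measure[OF \<xi>']) measurable
  finally show ?thesis .
qed

declare closest_point_borel_measurable [measurable del]

text \<open>A point of \<open>\<Omega>\<close> is \<open>((\<xi>, u), y)\<close>: a direction, a
  point of \<eta>, and an ambient vector whose projection is the point of \<xi>. With the weight
  \<open>W\<close> a product measure stands for the family of spaces \<xi> over the Grassmannian,
  and \<open>L\<close> gives the point of the sum of \<eta> and \<xi>.\<close>

abbreviation "\<Omega> \<equiv> (G \<Otimes>\<^sub>M subspace_measure \<eta>) \<Otimes>\<^sub>M (lborel :: (real^'n) measure)"
abbreviation "W p \<equiv> subspace_weight (fst (fst p)) (snd p)"
abbreviation "L p \<equiv> snd (fst p) + closest_point (fst (fst p)) (snd p)"

sublocale GSL: pair_sigma_finite "G \<Otimes>\<^sub>M subspace_measure \<eta>" "lborel :: (real^'n) measure" ..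
lemma sigma_finite_\<Omega>: "sigma_finite_measure \<Omega>" ..
sublocale H\<Omega>: pair_sigma_finite H \<Omega> ..

text \<open>Joint integrability over \<open>\<Omega>\<close> turns the nested integrals of the
  definition into one integral, to which the averaging over rotations applies.\<close>

lemma mixed_radon_integral:
  assumes Q: "Q \<in> space H" and int: "integrable \<Omega> (\<lambda>p. W p * h (z + Q *v L p))"
    and ae: "AE \<xi> in G. AE u in subspace_measure \<eta>. (+) (z + Q *v u) ` (*v) Q ` \<xi> \<notin> E"
  shows "mixed_radon j f ((+) z ` (*v) Q ` \<eta>) = (\<integral>p. W p * h (z + Q *v L p) \<partial>\<Omega>)"
proof -
  let ?D = "\<lambda>\<xi> u. \<integral>y. subspace_weight \<xi> y * h (z + Q *v (u + closest_point \<xi> y)) \<partial>lborel"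
  have "mixed_radon j f ((+) z ` (*v) Q ` \<eta>) = (\<integral>p. ?D (fst p) (snd p) \<partial>(G \<Otimes>\<^sub>M subspace_measure \<eta>))"
  proof (rule mixed_radon_rotated[OF sub\<eta> j_le orthogonal_H[OF Q]])
    show "integrable (G \<Otimes>\<^sub>M subspace_measure \<eta>) (\<lambda>p. ?D (fst p) (snd p))"
      using GSL.integrable_fst'[OF int] by simp
    show "AE \<xi> in G. AE u in subspace_measure \<eta>. f ((+) (z + Q *v u) ` (*v) Q ` \<xi>) = ?D \<xi> u"
      using ae AE_space
    proof eventually_elim
      fix \<xi> assume \<xi>: "\<xi> \<in> space G" and ae: "AE u in subspace_measure \<eta>. (+) (z + Q *v u) ` (*v) Q ` \<xi> \<notin> E"
      show "AE u in subspace_measure \<eta>. f ((+) (z + Q *v u) ` (*v) Q ` \<xi>) = ?D \<xi> u"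
        using ae by eventually_elim (subst f_rotated[OF Q \<xi>], assumption, simp add: matrix_vector_right_distrib add.assoc)
    qed
  qed
  also have "\<dots> = (\<integral>p. W p * h (z + Q *v L p) \<partial>\<Omega>)"
    using GSL.integral_fst'[OF int] by simp
  finally show ?thesis .
qed

lemma nn_integral_\<Omega>:
  fixes g :: "real^'n \<Rightarrow> ennreal"
  assumes [measurable]: "g \<in> borel_measurable borel"
  shows "(\<integral>\<^sup>+p. ennreal (W p) * g (L p) \<partial>\<Omega>) =
    (\<integral>\<^sup>+\<xi>. (\<integral>\<^sup>+u. (\<integral>\<^sup>+y. g (u + y) \<partial>subspace_measure \<xi>) \<partial>subspace_measure \<eta>) \<partial>G)"
proof -
  have m: "(\<lambda>p. ennreal (W p) * g (L p)) \<in> borel_measurable \<Omega>" by measurable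
  let ?I = "\<lambda>q. \<integral>\<^sup>+y. ennreal (subspace_weight (fst q) y) * g (snd q + closest_point (fst q) y) \<partial>lborel"
  have m': "?I \<in> borel_measurable (G \<Otimes>\<^sub>M subspace_measure \<eta>)" using lborel.borel_measurable_nn_integral_fst[OF m] by simp
  have "(\<integral>\<^sup>+p. ennreal (W p) * g (L p) \<partial>\<Omega>) = (\<integral>\<^sup>+q. ?I q \<partial>(G \<Otimes>\<^sub>M subspace_measure \<eta>))"
    using lborel.nn_integral_fst[OF m] by simp
  also have "\<dots> = (\<integral>\<^sup>+\<xi>. (\<integral>\<^sup>+u. (\<integral>\<^sup>+y. ennreal (subspace_weight \<xi> y) *
      g (u + closest_point \<xi> y) \<partial>lborel) \<partial>subspace_measure \<eta>) \<partial>G)"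
    using S.nn_integral_fst[OF m'] by simp
  also have "\<dots> = (\<integral>\<^sup>+\<xi>. (\<integral>\<^sup>+u. (\<integral>\<^sup>+y. g (u + y) \<partial>subspace_measure \<xi>) \<partial>subspace_measure \<eta>) \<partial>G)"
    by (intro nn_integral_cong nn_integral_subspace_measure[symmetric] space_GD) auto
  finally show ?thesis .
qed

text \<open>For each direction \<xi> the sum of \<eta> and \<xi> is a subspace of dimension
  \<open>j + k\<close>. Its integral of a radial function does not depend on \<xi>, so integrating
  over the probability measure \<open>G\<close> changes nothing.\<close>

lemma dual_mixed_radon:
  assumes x: "AE Q in H. AE \<xi> in G. AE u in subspace_measure \<eta>. (+) (x + Q *v u) ` (*v) Q ` \<xi> \<notin> E"
    and fin: "(\<integral>\<^sup>+y. ennreal (riesz_kernel CARD('n) (real (j + k)) y) * ennreal \<bar>h (x + y)\<bar> \<partial>lborel) < \<infinity>"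
  shows "dual_plane_transform \<eta> (mixed_radon j f) x = radon_constant CARD('n) (j + k) * riesz_potential (real (j + k)) h x"
proof -
  let ?C = "radon_constant CARD('n) (j + k)" and ?K = "riesz_kernel CARD('n) (real (j + k)) :: real^'n \<Rightarrow> real"
  have R: "(\<integral>\<^sup>+p. ennreal (W p) * g (L p) \<partial>\<Omega>) = ennreal ?C * (\<integral>\<^sup>+y. ennreal (?K y) * g y \<partial>lborel)"
    if gm [measurable]: "g \<in> borel_measurable borel" and rad: "\<And>x y. norm x = norm y \<Longrightarrow> g x = g y" for g :: "real^'n \<Rightarrow> ennreal"
  proof -
    have "(\<integral>\<^sup>+u. (\<integral>\<^sup>+y. g (u + y) \<partial>subspace_measure \<xi>) \<partial>subspace_measure \<eta>) =
      ennreal ?C * (\<integral>\<^sup>+y. ennreal (?K y) * g y \<partial>lborel)" if "\<xi> \<in> space G" for \<xi>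
    proof -
      note \<xi> = space_GD[OF that]
      have d: "dim (\<eta> + \<xi>) = j + k"
        using nn_integral_subspace_measure_plus(2)[OF sub\<eta> \<xi>(1,3), of "\<lambda>_. 0"] by (simp add: \<xi>(2) dim\<eta>)
      have "(\<integral>\<^sup>+u. (\<integral>\<^sup>+y. g (u + y) \<partial>subspace_measure \<xi>) \<partial>subspace_measure \<eta>) = (\<integral>\<^sup>+y. g y \<partial>subspace_measure (\<eta> + \<xi>))"
        by (rule nn_integral_subspace_measure_plus(1)[OF sub\<eta> \<xi>(1,3), symmetric]) measurable
      also have "\<dots> = ennreal ?C * (\<integral>\<^sup>+y. ennreal (?K y) * g y \<partial>lborel)"
        using nn_integral_radial_subspace[OF subspace_set_plus[OF sub\<eta> \<xi>(1)] _ _ gm rad] jk jk0 by (simp add: d)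
      finally show ?thesis .
    qed
    then have "(\<integral>\<^sup>+\<xi>. (\<integral>\<^sup>+u. (\<integral>\<^sup>+y. g (u + y) \<partial>subspace_measure \<xi>) \<partial>subspace_measure \<eta>) \<partial>G) =
      (\<integral>\<^sup>+\<xi>. ennreal ?C * (\<integral>\<^sup>+y. ennreal (?K y) * g y \<partial>lborel) \<partial>G)" by (rule nn_integral_cong)
    then show ?thesis by (simp add: nn_integral_\<Omega> G.emeasure_space_1)
  qed
  have pos: "0 < real (j + k)" "real (j + k) < real CARD('n)" using jk jk0 by simp_all
  have C0: "0 \<le> ?C" using radon_constant_pos[OF jk] by simp
  have mW: "(\<lambda>p. W p) \<in> borel_measurable \<Omega>" and mL: "(\<lambda>p. L p) \<in> borel_measurable \<Omega>" and mK: "?K \<in> borel_measurable borel"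
    by measurable
  note avg = integral_haar_average[OF sigma_finite_\<Omega> mW mL mK h subspace_weight_nonneg
      riesz_kernel_nonneg[OF pos] C0 riesz_kernel_norm_cong R fin]
  have int: "integrable (H \<Otimes>\<^sub>M \<Omega>) (\<lambda>z. W (snd z) * h (x + fst z *v L (snd z)))"
    by (rule avg(1))
  have "AE Q in H. mixed_radon j f ((+) x ` (*v) Q ` \<eta>) = (\<integral>p. W p * h (x + Q *v L p) \<partial>\<Omega>)"
    using H\<Omega>.AE_integrable_fst'[OF int] x AE_space
    by eventually_elim (rule mixed_radon_integral, auto)
  then have "dual_plane_transform \<eta> (mixed_radon j f) x = (\<integral>Q. (\<integral>p. W p * h (x + Q *v L p) \<partial>\<Omega>) \<partial>H)"
    unfolding dual_plane_transform_def orthogonal_haar_eq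
    using borel_measurable_integrable[OF H\<Omega>.integrable_fst'[OF int]] by (intro integral_completion_AE) simp_all
  also have "\<dots> = (\<integral>z. W (snd z) * h (x + fst z *v L (snd z)) \<partial>(H \<Otimes>\<^sub>M \<Omega>))"
    using H\<Omega>.integral_fst'[OF int] by simp
  also have "\<dots> = ?C * (\<integral>y. ?K y * h (x + y) \<partial>lborel)" by (rule avg(2))
  finally show ?thesis by (simp add: riesz_potential_borel)
qed

end

context plane_transform_AE
begin

text \<open>The potential adds a variable \<open>w\<close> in the fixed space
  \<open>\<eta>\<^sup>\<bottom>\<close>, so the product measure gains one factor, with the fibre
  kernel in the weight and \<open>w\<close> in the point.\<close>

lemma dual_fibre_mixed_radon:
  assumes \<alpha>: "0 < \<alpha>" "\<alpha> < real CARD('n) - real j - real k"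
    and fin: "(\<integral>\<^sup>+y. ennreal (riesz_kernel CARD('n) (real (j + k) + \<alpha>) y) * ennreal \<bar>h (x + y)\<bar> \<partial>lborel) < \<infinity>"
  shows "dual_plane_transform \<eta> (fibre_riesz_potential k \<alpha> (mixed_radon j f)) x =
    radon_constant CARD('n) (j + k) * riesz_potential (real (j + k) + \<alpha>) h x"
proof -
  let ?C = "radon_constant CARD('n) (j + k)" and ?K = "riesz_kernel CARD('n) (real (j + k) + \<alpha>) :: real^'n \<Rightarrow> real"
  let ?\<kappa> = "riesz_kernel (CARD('n) - k) \<alpha> :: real^'n \<Rightarrow> real"
  let ?S' = "subspace_measure (\<eta>\<^sup>\<bottom>)"
  interpret S\<Omega>: pair_sigma_finite ?S' \<Omega> ..
  have sfS\<Omega>: "sigma_finite_measure (?S' \<Otimes>\<^sub>M \<Omega>)" ..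
  interpret HS\<Omega>: pair_sigma_finite H "?S' \<Otimes>\<^sub>M \<Omega>" ..
  have \<alpha>k: "\<alpha> < real (CARD('n) - k)" using \<alpha> jk by (simp add: of_nat_diff)
  have \<kappa>0: "0 \<le> ?\<kappa> w" for w by (rule riesz_kernel_nonneg[OF \<alpha>(1) \<alpha>k])
  have \<kappa>nz: "?\<kappa> w \<noteq> 0" if "w \<noteq> 0" for w
    using that riesz_gamma_pos[OF \<alpha>(1) \<alpha>k] by (simp add: riesz_kernel_def)
  have pos: "0 < real (j + k) + \<alpha>" "real (j + k) + \<alpha> < real CARD('n)" using \<alpha> by simp_all
  have C0: "0 \<le> ?C" using radon_constant_pos[OF jk] by simp
  define W' where "W' p = ?\<kappa> (fst p) * W (snd p)" for p :: "(real^'n) \<times> ((real^'n) set \<times> (real^'n)) \<times> (real^'n)"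
  define L' where "L' p = fst p + L (snd p)" for p :: "(real^'n) \<times> ((real^'n) set \<times> (real^'n)) \<times> (real^'n)"
  have mW: "W' \<in> borel_measurable (?S' \<Otimes>\<^sub>M \<Omega>)" and mL: "L' \<in> borel_measurable (?S' \<Otimes>\<^sub>M \<Omega>)"
    and mK: "?K \<in> borel_measurable borel" unfolding W'_def[abs_def] L'_def[abs_def] by measurable
  have W0: "0 \<le> W' p" for p by (simp add: W'_def \<kappa>0)
  have R: "(\<integral>\<^sup>+p. ennreal (W' p) * g (L' p) \<partial>(?S' \<Otimes>\<^sub>M \<Omega>)) = ennreal ?C * (\<integral>\<^sup>+y. ennreal (?K y) * g y \<partial>lborel)"
    if gm [measurable]: "g \<in> borel_measurable borel" and rad: "\<And>x y. norm x = norm y \<Longrightarrow> g x = g y" for g :: "real^'n \<Rightarrow> ennreal"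
  proof -
    let ?I = "\<lambda>\<xi> w. \<integral>\<^sup>+u. (\<integral>\<^sup>+y. ennreal (subspace_weight \<xi> y) * g (w + (u + closest_point \<xi> y)) \<partial>lborel) \<partial>subspace_measure \<eta>"
    have I: "?I \<xi> w = (\<integral>\<^sup>+u. (\<integral>\<^sup>+y. g (w + (u + y)) \<partial>subspace_measure \<xi>) \<partial>subspace_measure \<eta>)" if "\<xi> \<in> space G" for \<xi> w
      by (intro nn_integral_cong nn_integral_subspace_measure[symmetric] space_GD(1)[OF that]) measurable
    have mg: "(\<lambda>p. ennreal (W' p) * g (L' p)) \<in> borel_measurable (?S' \<Otimes>\<^sub>M \<Omega>)" using mW mL by measurable
    have mI: "(\<lambda>z. ennreal (?\<kappa> (snd z)) * ?I (fst z) (snd z)) \<in> borel_measurable (G \<Otimes>\<^sub>M ?S')"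
      by measurable
    have "(\<integral>\<^sup>+p. ennreal (W' p) * g (L' p) \<partial>(?S' \<Otimes>\<^sub>M \<Omega>)) =
      (\<integral>\<^sup>+w. (\<integral>\<^sup>+p. ennreal (?\<kappa> w) * (ennreal (W p) * g (w + L p)) \<partial>\<Omega>) \<partial>?S')"
      using sigma_finite_measure.nn_integral_fst[OF sigma_finite_\<Omega> mg] \<kappa>0 by (simp add: W'_def L'_def ennreal_mult mult.assoc)
    also have "\<dots> = (\<integral>\<^sup>+w. ennreal (?\<kappa> w) * (\<integral>\<^sup>+p. ennreal (W p) * g (w + L p) \<partial>\<Omega>) \<partial>?S')"
      by (intro nn_integral_cong nn_integral_cmult) measurable
    also have "\<dots> = (\<integral>\<^sup>+w. ennreal (?\<kappa> w) * (\<integral>\<^sup>+\<xi>. ?I \<xi> w \<partial>G) \<partial>?S')"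
    proof (intro nn_integral_cong arg_cong[where f="\<lambda>x. _ * x"])
      fix w :: "real^'n"
      have "(\<integral>\<^sup>+p. ennreal (W p) * g (w + L p) \<partial>\<Omega>) =
        (\<integral>\<^sup>+\<xi>. (\<integral>\<^sup>+u. (\<integral>\<^sup>+y. g (w + (u + y)) \<partial>subspace_measure \<xi>) \<partial>subspace_measure \<eta>) \<partial>G)"
        by (rule nn_integral_\<Omega>) measurable
      then show "(\<integral>\<^sup>+p. ennreal (W p) * g (w + L p) \<partial>\<Omega>) = (\<integral>\<^sup>+\<xi>. ?I \<xi> w \<partial>G)"
        by (simp add: I cong: nn_integral_cong)
    qed
    also have "\<dots> = (\<integral>\<^sup>+w. (\<integral>\<^sup>+\<xi>. ennreal (?\<kappa> w) * ?I \<xi> w \<partial>G) \<partial>?S')"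
      by (intro nn_integral_cong nn_integral_cmult[symmetric]) measurable
    also have "\<dots> = (\<integral>\<^sup>+\<xi>. (\<integral>\<^sup>+w. ennreal (?\<kappa> w) * ?I \<xi> w \<partial>?S') \<partial>G)"
      by (rule GS'.Fubini') (use mI in \<open>simp add: case_prod_beta'\<close>)
    also have "\<dots> = (\<integral>\<^sup>+\<xi>. ennreal ?C * (\<integral>\<^sup>+y. ennreal (?K y) * g y \<partial>lborel) \<partial>G)"
    proof (rule nn_integral_cong)
      fix \<xi> assume \<xi>: "\<xi> \<in> space G"
      note \<xi>' = space_GD[OF \<xi>]
      show "(\<integral>\<^sup>+w. ennreal (?\<kappa> w) * ?I \<xi> w \<partial>?S') = ennreal ?C * (\<integral>\<^sup>+y. ennreal (?K y) * g y \<partial>lborel)"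
        using nn_integral_riesz_kernel_planes[OF \<xi>'(1) sub\<eta> \<xi>'(3) _ \<alpha>(1) _ gm rad] jk \<alpha>
        by (simp add: I[OF \<xi>] \<xi>'(2) dim\<eta>)
    qed
    finally show ?thesis by (simp add: G.emeasure_space_1)
  qed
  note avg = integral_haar_average[OF sfS\<Omega> mW mL mK h W0 riesz_kernel_nonneg[OF pos] C0 riesz_kernel_norm_cong R fin]
  have int: "integrable (H \<Otimes>\<^sub>M (?S' \<Otimes>\<^sub>M \<Omega>)) (\<lambda>z. W' (snd z) * h (x + fst z *v L' (snd z)))"
    by (rule avg(1))
  have "AE Q in H. fibre_riesz_potential k \<alpha> (mixed_radon j f) ((+) x ` (*v) Q ` \<eta>) =
    (\<integral>p. W' p * h (x + Q *v L' p) \<partial>(?S' \<Otimes>\<^sub>M \<Omega>))"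
    using HS\<Omega>.AE_integrable_fst'[OF int] AE_rotated_fibre[of x] AE_space
  proof eventually_elim
    fix Q
    assume "integrable (?S' \<Otimes>\<^sub>M \<Omega>) (\<lambda>p. W' (snd (Q, p)) * h (x + fst (Q, p) *v L' (snd (Q, p))))" and Q: "Q \<in> space H"
      and ae: "AE w in ?S'. AE \<xi> in G. AE u in subspace_measure \<eta>. (+) (x + Q *v w + Q *v u) ` (*v) Q ` \<xi> \<notin> E"
    then have iQ: "integrable (?S' \<Otimes>\<^sub>M \<Omega>) (\<lambda>p. W' p * h (x + Q *v L' p))" by simp
    define g where "g w = (\<integral>p. W p * h (x + Q *v w + Q *v L p) \<partial>\<Omega>)" for w
    have gm: "g \<in> borel_measurable borel"
      unfolding g_def[abs_def] by (rule sigma_finite_measure.borel_measurable_lebesgue_integral[OF sigma_finite_\<Omega>]) measurable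
    have W'L': "W' (w, p) * h (x + Q *v L' (w, p)) = ?\<kappa> w * (W p * h (x + Q *v w + Q *v L p))" for w p
      by (simp add: W'_def L'_def matrix_vector_right_distrib add.assoc)
    \<comment> \<open>At \<open>w = 0\<close> the kernel has the default value 0, so integrability
      of the weighted integrand says nothing there about the integrand without the kernel.\<close>
    have nz: "AE w in ?S'. w \<noteq> 0"
      by (rule AE_subspace_measure_nonzero[OF subspace_orthogonal_comp]) (use jk dim\<eta>' in simp)
    have "AE w in ?S'. mixed_radon j f ((+) (x + Q *v w) ` (*v) Q ` \<eta>) = g w"
      using S\<Omega>.AE_integrable_fst'[OF iQ] ae nz
    proof (eventually_elim)
      fix w assume "w \<noteq> 0" and i: "integrable \<Omega> (\<lambda>p. W' (w, p) * h (x + Q *v L' (w, p)))"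
        and ae: "AE \<xi> in G. AE u in subspace_measure \<eta>. (+) (x + Q *v w + Q *v u) ` (*v) Q ` \<xi> \<notin> E"
      have "integrable \<Omega> (\<lambda>p. W p * h (x + Q *v w + Q *v L p))"
        using i \<kappa>nz[OF \<open>w \<noteq> 0\<close>] unfolding W'L' by (simp add: integrable_mult_right_iff)
      then show "mixed_radon j f ((+) (x + Q *v w) ` (*v) Q ` \<eta>) = g w"
        unfolding g_def by (rule mixed_radon_integral[OF Q _ ae])
    qed
    then have "fibre_riesz_potential k \<alpha> (mixed_radon j f) ((+) x ` (*v) Q ` \<eta>) = (\<integral>w. ?\<kappa> w * g w \<partial>?S')"
      by (rule fibre_riesz_potential_rotated[OF sub\<eta> orthogonal_H[OF Q] dim\<eta> gm])
    also have "\<dots> = (\<integral>p. W' p * h (x + Q *v L' p) \<partial>(?S' \<Otimes>\<^sub>M \<Omega>))"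
      unfolding S\<Omega>.integral_fst'[OF iQ, symmetric] W'L' g_def integral_mult_right_zero ..
    finally show "fibre_riesz_potential k \<alpha> (mixed_radon j f) ((+) x ` (*v) Q ` \<eta>) =
      (\<integral>p. W' p * h (x + Q *v L' p) \<partial>(?S' \<Otimes>\<^sub>M \<Omega>))" .
  qed
  then have "dual_plane_transform \<eta> (fibre_riesz_potential k \<alpha> (mixed_radon j f)) x =
    (\<integral>Q. (\<integral>p. W' p * h (x + Q *v L' p) \<partial>(?S' \<Otimes>\<^sub>M \<Omega>)) \<partial>H)"
    unfolding dual_plane_transform_def orthogonal_haar_eq
    using borel_measurable_integrable[OF HS\<Omega>.integrable_fst'[OF int]] by (intro integral_completion_AE) simp_all
  also have "\<dots> = (\<integral>z. W' (snd z) * h (x + fst z *v L' (snd z)) \<partial>(H \<Otimes>\<^sub>M (?S' \<Otimes>\<^sub>M \<Omega>)))"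
    using HS\<Omega>.integral_fst'[OF int] by simp
  also have "\<dots> = ?C * (\<integral>y. ?K y * h (x + y) \<partial>lborel)" by (rule avg(2))
  finally show ?thesis by (simp add: riesz_potential_borel)
qed

end

context plane_transform_AE
begin

text \<open>The potential now acts in \<open>\<xi>\<^sup>\<bottom>\<close>, a fibre that varies with
  the integration variable \<xi>. The fibre point is therefore represented by an ambient vector
  \<open>w\<close> through \<open>w - closest_point \<xi> w\<close>, with the Gaussian weight of
  \<open>\<xi>\<^sup>\<bottom>\<close>, which keeps a product measure. Reordering the inner
  integrals leads to the formula for two planes with the roles of \<xi> and \<eta>
  exchanged.\<close>

lemma dual_mixed_radon_fibre:
  assumes \<alpha>: "0 < \<alpha>" "\<alpha> < real CARD('n) - real j - real k"
    and fin: "(\<integral>\<^sup>+y. ennreal (riesz_kernel CARD('n) (real (j + k) + \<alpha>) y) * ennreal \<bar>h (x + y)\<bar> \<partial>lborel) < \<infinity>"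
  shows "dual_plane_transform \<eta> (mixed_radon j (fibre_riesz_potential j \<alpha> f)) x =
    radon_constant CARD('n) (j + k) * riesz_potential (real (j + k) + \<alpha>) h x"
proof -
  let ?C = "radon_constant CARD('n) (j + k)" and ?K = "riesz_kernel CARD('n) (real (j + k) + \<alpha>) :: real^'n \<Rightarrow> real"
  let ?\<kappa> = "riesz_kernel (CARD('n) - j) \<alpha> :: real^'n \<Rightarrow> real"
  let ?GS = "G \<Otimes>\<^sub>M subspace_measure \<eta>" and ?LL = "lborel \<Otimes>\<^sub>M lborel :: ((real^'n) \<times> (real^'n)) measure"
  have sfLL: "sigma_finite_measure ?LL" ..
  interpret GSLL: pair_sigma_finite ?GS ?LL ..
  have sf: "sigma_finite_measure (?GS \<Otimes>\<^sub>M ?LL)" ..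
  interpret HGSLL: pair_sigma_finite H "?GS \<Otimes>\<^sub>M ?LL" ..
  have \<alpha>j: "\<alpha> < real (CARD('n) - j)" using \<alpha> jk by (simp add: of_nat_diff)
  have \<kappa>0: "0 \<le> ?\<kappa> w" for w by (rule riesz_kernel_nonneg[OF \<alpha>(1) \<alpha>j])
  have pos: "0 < real (j + k) + \<alpha>" "real (j + k) + \<alpha> < real CARD('n)" using \<alpha> by simp_all
  have C0: "0 \<le> ?C" using radon_constant_pos[OF jk] by simp
  define W' where "W' p = subspace_weight ((fst (fst p))\<^sup>\<bottom>) (fst (snd p)) * ?\<kappa> (fst (snd p) - closest_point (fst (fst p)) (fst (snd p))) *
    subspace_weight (fst (fst p)) (snd (snd p))" for p :: "((real^'n) set \<times> (real^'n)) \<times> ((real^'n) \<times> (real^'n))"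
  define L' where "L' p = snd (fst p) + ((fst (snd p) - closest_point (fst (fst p)) (fst (snd p))) + closest_point (fst (fst p)) (snd (snd p)))"
    for p :: "((real^'n) set \<times> (real^'n)) \<times> ((real^'n) \<times> (real^'n))"
  have mW: "W' \<in> borel_measurable (?GS \<Otimes>\<^sub>M ?LL)" and mL: "L' \<in> borel_measurable (?GS \<Otimes>\<^sub>M ?LL)"
    and mK: "?K \<in> borel_measurable borel" unfolding W'_def[abs_def] L'_def[abs_def] by measurable
  have W0: "0 \<le> W' p" for p by (simp add: W'_def \<kappa>0)
  have R: "(\<integral>\<^sup>+p. ennreal (W' p) * g (L' p) \<partial>(?GS \<Otimes>\<^sub>M ?LL)) = ennreal ?C * (\<integral>\<^sup>+y. ennreal (?K y) * g y \<partial>lborel)"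
    if gm [measurable]: "g \<in> borel_measurable borel" and rad: "\<And>x y. norm x = norm y \<Longrightarrow> g x = g y" for g :: "real^'n \<Rightarrow> ennreal"
  proof -
    let ?F = "\<lambda>\<xi> u w y. ennreal (subspace_weight (\<xi>\<^sup>\<bottom>) w * ?\<kappa> (w - closest_point \<xi> w) * subspace_weight \<xi> y) *
      g (u + ((w - closest_point \<xi> w) + closest_point \<xi> y))"
    have mg: "(\<lambda>p. ennreal (W' p) * g (L' p)) \<in> borel_measurable (?GS \<Otimes>\<^sub>M ?LL)" using mW mL by measurable
    have mg1: "(\<lambda>q. \<integral>\<^sup>+z. ennreal (W' (q, z)) * g (L' (q, z)) \<partial>?LL) \<in> borel_measurable ?GS"
      by (rule sigma_finite_measure.borel_measurable_nn_integral_fst[OF sfLL mg])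
    have "(\<integral>\<^sup>+p. ennreal (W' p) * g (L' p) \<partial>(?GS \<Otimes>\<^sub>M ?LL)) =
      (\<integral>\<^sup>+\<xi>. (\<integral>\<^sup>+u. (\<integral>\<^sup>+z. ennreal (W' ((\<xi>, u), z)) * g (L' ((\<xi>, u), z)) \<partial>?LL) \<partial>subspace_measure \<eta>) \<partial>G)"
      unfolding sigma_finite_measure.nn_integral_fst[OF sfLL mg, symmetric] S.nn_integral_fst[OF mg1, symmetric] ..
    also have "\<dots> = (\<integral>\<^sup>+\<xi>. ennreal ?C * (\<integral>\<^sup>+y. ennreal (?K y) * g y \<partial>lborel) \<partial>G)"
    proof (rule nn_integral_cong)
      fix \<xi> assume \<xi>: "\<xi> \<in> space G"
      note \<xi>' = space_GD[OF \<xi>] and perp = subspace_orthogonal_comp[of \<xi>]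
      have [measurable]: "closest_point \<xi> \<in> borel \<rightarrow>\<^sub>M borel" by (rule closest_point_borel_measurable[OF \<xi>'(1)])
      have [measurable]: "subspace_weight \<xi> \<in> borel_measurable borel" "subspace_weight (\<xi>\<^sup>\<bottom>) \<in> borel_measurable borel"
        using \<xi>'(1) perp by simp_all
      interpret A: sigma_finite_measure "subspace_measure \<xi>" by (rule sigma_finite_subspace_measure[OF \<xi>'(1)])
      interpret A': sigma_finite_measure "subspace_measure (\<xi>\<^sup>\<bottom>)" by (rule sigma_finite_subspace_measure[OF perp])
      interpret AS: pair_sigma_finite "subspace_measure \<xi>" "subspace_measure \<eta>" ..
      interpret A'S: pair_sigma_finite "subspace_measure (\<xi>\<^sup>\<bottom>)" "subspace_measure \<eta>" ..
      have "(\<integral>\<^sup>+z. ennreal (W' ((\<xi>, u), z)) * g (L' ((\<xi>, u), z)) \<partial>?LL) =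
        (\<integral>\<^sup>+w. ennreal (?\<kappa> w) * (\<integral>\<^sup>+y. g (u + (w + y)) \<partial>subspace_measure \<xi>) \<partial>subspace_measure (\<xi>\<^sup>\<bottom>))" for u
      proof -
        have m: "(\<lambda>z. ennreal (W' ((\<xi>, u), z)) * g (L' ((\<xi>, u), z))) \<in> borel_measurable ?LL"
          unfolding W'_def L'_def by simp
        have "(\<integral>\<^sup>+z. ennreal (W' ((\<xi>, u), z)) * g (L' ((\<xi>, u), z)) \<partial>?LL) =
          (\<integral>\<^sup>+w. (\<integral>\<^sup>+y. ennreal (subspace_weight (\<xi>\<^sup>\<bottom>) w) * (ennreal (?\<kappa> (closest_point (\<xi>\<^sup>\<bottom>) w)) *
            (ennreal (subspace_weight \<xi> y) * g (u + (closest_point (\<xi>\<^sup>\<bottom>) w + closest_point \<xi> y)))) \<partial>lborel) \<partial>lborel)"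
          unfolding lborel.nn_integral_fst[OF m, symmetric]
          by (intro nn_integral_cong) (simp add: W'_def L'_def closest_point_orthogonal_comp[OF \<xi>'(1)] ennreal_mult \<kappa>0 mult.assoc)
        also have "\<dots> = (\<integral>\<^sup>+w. ennreal (subspace_weight (\<xi>\<^sup>\<bottom>) w) * (ennreal (?\<kappa> (closest_point (\<xi>\<^sup>\<bottom>) w)) *
            (\<integral>\<^sup>+y. ennreal (subspace_weight \<xi> y) * g (u + (closest_point (\<xi>\<^sup>\<bottom>) w + closest_point \<xi> y)) \<partial>lborel)) \<partial>lborel)"
          by (simp add: nn_integral_cmult)
        also have "\<dots> = (\<integral>\<^sup>+w. ennreal (subspace_weight (\<xi>\<^sup>\<bottom>) w) * (ennreal (?\<kappa> (closest_point (\<xi>\<^sup>\<bottom>) w)) *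
            (\<integral>\<^sup>+y. g (u + (closest_point (\<xi>\<^sup>\<bottom>) w + y)) \<partial>subspace_measure \<xi>)) \<partial>lborel)"
          by (simp add: nn_integral_subspace_measure[OF \<xi>'(1)])
        also have "\<dots> = (\<integral>\<^sup>+w. ennreal (?\<kappa> w) * (\<integral>\<^sup>+y. g (u + (w + y)) \<partial>subspace_measure \<xi>) \<partial>subspace_measure (\<xi>\<^sup>\<bottom>))"
          by (rule nn_integral_subspace_measure[OF perp, symmetric]) measurable
        finally show ?thesis .
      qed
      then have "(\<integral>\<^sup>+u. (\<integral>\<^sup>+z. ennreal (W' ((\<xi>, u), z)) * g (L' ((\<xi>, u), z)) \<partial>?LL) \<partial>subspace_measure \<eta>) =
        (\<integral>\<^sup>+u. (\<integral>\<^sup>+w. ennreal (?\<kappa> w) * (\<integral>\<^sup>+y. g (u + (w + y)) \<partial>subspace_measure \<xi>) \<partial>subspace_measure (\<xi>\<^sup>\<bottom>)) \<partial>subspace_measure \<eta>)" by simp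
      also have "\<dots> = (\<integral>\<^sup>+w. (\<integral>\<^sup>+u. ennreal (?\<kappa> w) * (\<integral>\<^sup>+y. g (u + (w + y)) \<partial>subspace_measure \<xi>) \<partial>subspace_measure \<eta>) \<partial>subspace_measure (\<xi>\<^sup>\<bottom>))"
        by (rule A'S.Fubini') measurable
      also have "\<dots> = (\<integral>\<^sup>+w. ennreal (?\<kappa> w) * (\<integral>\<^sup>+u. (\<integral>\<^sup>+y. g (u + (w + y)) \<partial>subspace_measure \<xi>) \<partial>subspace_measure \<eta>) \<partial>subspace_measure (\<xi>\<^sup>\<bottom>))"
        by (intro nn_integral_cong nn_integral_cmult) measurable
      also have "\<dots> = (\<integral>\<^sup>+w. ennreal (?\<kappa> w) * (\<integral>\<^sup>+y. (\<integral>\<^sup>+u. g (u + (w + y)) \<partial>subspace_measure \<eta>) \<partial>subspace_measure \<xi>) \<partial>subspace_measure (\<xi>\<^sup>\<bottom>))"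
        by (intro nn_integral_cong arg_cong[where f="\<lambda>x. _ * x"] AS.Fubini') measurable
      also have "\<dots> = (\<integral>\<^sup>+w. ennreal (?\<kappa> w) * (\<integral>\<^sup>+y. (\<integral>\<^sup>+u. g (w + (y + u)) \<partial>subspace_measure \<eta>) \<partial>subspace_measure \<xi>) \<partial>subspace_measure (\<xi>\<^sup>\<bottom>))"
        by (simp add: add_ac)
      also have "\<dots> = ennreal ?C * (\<integral>\<^sup>+y. ennreal (?K y) * g y \<partial>lborel)"
        using nn_integral_riesz_kernel_planes[OF sub\<eta> \<xi>'(1) \<xi>'(4) _ \<alpha>(1) _ gm rad] jk \<alpha>
        by (simp add: \<xi>'(2) dim\<eta> add.commute[of k j] add.commute[of "real k" "real j"])
      finally show "(\<integral>\<^sup>+u. (\<integral>\<^sup>+z. ennreal (W' ((\<xi>, u), z)) * g (L' ((\<xi>, u), z)) \<partial>?LL) \<partial>subspace_measure \<eta>) =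
        ennreal ?C * (\<integral>\<^sup>+y. ennreal (?K y) * g y \<partial>lborel)" .
    qed
    finally show ?thesis by (simp add: G.emeasure_space_1)
  qed
  note avg = integral_haar_average[OF sf mW mL mK h W0 riesz_kernel_nonneg[OF pos] C0 riesz_kernel_norm_cong R fin]
  have int: "integrable (H \<Otimes>\<^sub>M (?GS \<Otimes>\<^sub>M ?LL)) (\<lambda>z. W' (snd z) * h (x + fst z *v L' (snd z)))"
    by (rule avg(1))
  have "AE Q in H. mixed_radon j (fibre_riesz_potential j \<alpha> f) ((+) x ` (*v) Q ` \<eta>) =
    (\<integral>p. W' p * h (x + Q *v L' p) \<partial>(?GS \<Otimes>\<^sub>M ?LL))"
    using HGSLL.AE_integrable_fst'[OF int] AE_rotated AE_space
  proof eventually_elim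
    fix Q
    assume "integrable (?GS \<Otimes>\<^sub>M ?LL) (\<lambda>p. W' (snd (Q, p)) * h (x + fst (Q, p) *v L' (snd (Q, p))))" and Q: "Q \<in> space H"
      and aeQ: "AE \<xi> in G. AE z in lborel. (+) z ` (*v) Q ` \<xi> \<notin> E"
    then have iQ: "integrable (?GS \<Otimes>\<^sub>M ?LL) (\<lambda>p. W' p * h (x + Q *v L' p))" by simp
    note Q' = orthogonal_H[OF Q]
    define D where "D \<xi> u = (\<integral>q. W' ((\<xi>, u), q) * h (x + Q *v L' ((\<xi>, u), q)) \<partial>?LL)" for \<xi> u
    have "AE q in ?GS. integrable ?LL (\<lambda>z. W' (q, z) * h (x + Q *v L' (q, z)))"
      by (rule GSLL.AE_integrable_fst'[OF iQ])
    then have "AE \<xi> in G. AE u in subspace_measure \<eta>. integrable ?LL (\<lambda>z. W' ((\<xi>, u), z) * h (x + Q *v L' ((\<xi>, u), z)))"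
      by (rule GS.AE_pair)
    then have "AE \<xi> in G. AE u in subspace_measure \<eta>. fibre_riesz_potential j \<alpha> f ((+) (x + Q *v u) ` (*v) Q ` \<xi>) = D \<xi> u"
      using aeQ AE_space
    proof eventually_elim
      fix \<xi> assume aez: "AE z in lborel. (+) z ` (*v) Q ` \<xi> \<notin> E" and \<xi>: "\<xi> \<in> space G"
        and "AE u in subspace_measure \<eta>. integrable ?LL (\<lambda>z. W' ((\<xi>, u), z) * h (x + Q *v L' ((\<xi>, u), z)))"
      note \<xi>' = space_GD[OF \<xi>] and perp = subspace_orthogonal_comp[of \<xi>]
      have Q\<xi>: "subspace ((*v) Q ` \<xi>)" by (rule linear_subspace_image[OF matrix_vector_mul_linear \<xi>'(1)])
      have cm: "closest_point \<xi> \<in> borel \<rightarrow>\<^sub>M borel" by (rule closest_point_borel_measurable[OF \<xi>'(1)])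
      have cm': "closest_point (\<xi>\<^sup>\<bottom>) \<in> borel \<rightarrow>\<^sub>M borel" by (rule closest_point_borel_measurable[OF perp])
      have wm: "subspace_weight \<xi> \<in> borel_measurable borel" "subspace_weight (\<xi>\<^sup>\<bottom>) \<in> borel_measurable borel"
        using \<xi>'(1) perp by simp_all
      assume "AE u in subspace_measure \<eta>. integrable ?LL (\<lambda>z. W' ((\<xi>, u), z) * h (x + Q *v L' ((\<xi>, u), z)))"
      then show "AE u in subspace_measure \<eta>. fibre_riesz_potential j \<alpha> f ((+) (x + Q *v u) ` (*v) Q ` \<xi>) = D \<xi> u"
      proof eventually_elim
        fix u assume iu: "integrable ?LL (\<lambda>z. W' ((\<xi>, u), z) * h (x + Q *v L' ((\<xi>, u), z)))"
        define g where "g w = (\<integral>y. subspace_weight \<xi> y * h (x + Q *v u + Q *v w + Q *v closest_point \<xi> y) \<partial>lborel)" for w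
        have gm [measurable]: "g \<in> borel_measurable borel"
          unfolding g_def[abs_def] using cm wm by measurable
        \<comment> \<open>The plane depends on the translation only through its component orthogonal
          to \<xi>. A statement for Lebesgue almost every vector thus passes to the projected,
          weighted measure.\<close>
        have aew: "AE w in subspace_measure (\<xi>\<^sup>\<bottom>). (+) (x + Q *v u + Q *v w) ` (*v) Q ` \<xi> \<notin> E"
        proof -
          have "Measurable.pred borel (\<lambda>w. (+) (x + Q *v u + Q *v w) ` (*v) Q ` \<xi> \<notin> E)"
            by (rule pred_E) (use Q \<xi> in auto)
          then have S: "{w \<in> space borel. (+) (x + Q *v u + Q *v w) ` (*v) Q ` \<xi> \<notin> E} \<in> sets borel" by (simp add: pred_def)
          have "AE z in lborel. (+) (x + Q *v u + Q *v z) ` (*v) Q ` \<xi> \<notin> E"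
            by (rule AE_lborel_orthogonal[OF Q' AE_lborel_translate[OF aez]])
          then have "AE z in lborel. (+) (x + Q *v u + Q *v closest_point (\<xi>\<^sup>\<bottom>) z) ` (*v) Q ` \<xi> \<notin> E"
          proof eventually_elim
            fix z assume "(+) (x + Q *v u + Q *v z) ` (*v) Q ` \<xi> \<notin> E"
            moreover have "(+) (x + Q *v u + Q *v z) ` (*v) Q ` \<xi> = (+) (x + Q *v u + Q *v closest_point (\<xi>\<^sup>\<bottom>) z) ` (*v) Q ` \<xi>"
            proof (rule translate_subspace_cong[OF Q\<xi>])
              have "x + Q *v u + Q *v z - (x + Q *v u + Q *v closest_point (\<xi>\<^sup>\<bottom>) z) = Q *v closest_point \<xi> z"
                by (simp add: closest_point_orthogonal_comp[OF \<xi>'(1)] matrix_vector_mult_diff_distrib)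
              then show "x + Q *v u + Q *v z - (x + Q *v u + Q *v closest_point (\<xi>\<^sup>\<bottom>) z) \<in> (*v) Q ` \<xi>"
                using closest_point_subspace_in[OF \<xi>'(1)] by simp
            qed
            ultimately show "(+) (x + Q *v u + Q *v closest_point (\<xi>\<^sup>\<bottom>) z) ` (*v) Q ` \<xi> \<notin> E" by simp
          qed
          then have "AE z in density lborel (subspace_weight (\<xi>\<^sup>\<bottom>)). (+) (x + Q *v u + Q *v closest_point (\<xi>\<^sup>\<bottom>) z) ` (*v) Q ` \<xi> \<notin> E"
            using wm(2) by (subst AE_density) auto
          then show ?thesis unfolding subspace_measure_def
            by (subst AE_distr_iff[OF _ S]) (use cm' in simp_all)
        qed
        have "AE w in subspace_measure (\<xi>\<^sup>\<bottom>). f ((+) (x + Q *v u + Q *v w) ` (*v) Q ` \<xi>) = g w"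
          using aew by eventually_elim (unfold g_def, rule f_rotated[OF Q \<xi>])
        then have "fibre_riesz_potential j \<alpha> f ((+) (x + Q *v u) ` (*v) Q ` \<xi>) = (\<integral>w. ?\<kappa> w * g w \<partial>subspace_measure (\<xi>\<^sup>\<bottom>))"
          by (rule fibre_riesz_potential_rotated[OF \<xi>'(1) Q' \<xi>'(2) gm])
        also have "\<dots> = (\<integral>w. subspace_weight (\<xi>\<^sup>\<bottom>) w * (?\<kappa> (closest_point (\<xi>\<^sup>\<bottom>) w) * g (closest_point (\<xi>\<^sup>\<bottom>) w)) \<partial>lborel)"
          by (rule integral_subspace_measure[OF perp]) measurable
        also have "\<dots> = (\<integral>w. (\<integral>y. W' ((\<xi>, u), (w, y)) * h (x + Q *v L' ((\<xi>, u), (w, y))) \<partial>lborel) \<partial>lborel)"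
        proof (rule Bochner_Integration.integral_cong[OF refl])
          fix w :: "real^'n"
          have "W' ((\<xi>, u), (w, y)) * h (x + Q *v L' ((\<xi>, u), (w, y))) =
            subspace_weight (\<xi>\<^sup>\<bottom>) w * (?\<kappa> (closest_point (\<xi>\<^sup>\<bottom>) w) *
              (subspace_weight \<xi> y * h (x + Q *v u + Q *v closest_point (\<xi>\<^sup>\<bottom>) w + Q *v closest_point \<xi> y)))" for y
            by (simp add: W'_def L'_def closest_point_orthogonal_comp[OF \<xi>'(1)] matrix_vector_right_distrib mult.assoc add.assoc)
          then show "subspace_weight (\<xi>\<^sup>\<bottom>) w * (?\<kappa> (closest_point (\<xi>\<^sup>\<bottom>) w) * g (closest_point (\<xi>\<^sup>\<bottom>) w)) =
            (\<integral>y. W' ((\<xi>, u), (w, y)) * h (x + Q *v L' ((\<xi>, u), (w, y))) \<partial>lborel)"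
            by (simp only: g_def integral_mult_right_zero)
        qed
        also have "\<dots> = D \<xi> u" unfolding D_def by (rule lborel_pair.integral_fst'[OF iu])
        finally show "fibre_riesz_potential j \<alpha> f ((+) (x + Q *v u) ` (*v) Q ` \<xi>) = D \<xi> u" .
      qed
    qed
    moreover have iD: "integrable ?GS (\<lambda>p. D (fst p) (snd p))"
      using GSLL.integrable_fst'[OF iQ] by (simp add: D_def)
    ultimately have "mixed_radon j (fibre_riesz_potential j \<alpha> f) ((+) x ` (*v) Q ` \<eta>) = (\<integral>p. D (fst p) (snd p) \<partial>?GS)"
      by (intro mixed_radon_rotated[OF sub\<eta> j_le Q'])
    also have "\<dots> = (\<integral>p. W' p * h (x + Q *v L' p) \<partial>(?GS \<Otimes>\<^sub>M ?LL))"
      using GSLL.integral_fst'[OF iQ] by (simp add: D_def)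
    finally show "mixed_radon j (fibre_riesz_potential j \<alpha> f) ((+) x ` (*v) Q ` \<eta>) =
      (\<integral>p. W' p * h (x + Q *v L' p) \<partial>(?GS \<Otimes>\<^sub>M ?LL))" .
  qed
  then have "dual_plane_transform \<eta> (mixed_radon j (fibre_riesz_potential j \<alpha> f)) x =
    (\<integral>Q. (\<integral>p. W' p * h (x + Q *v L' p) \<partial>(?GS \<Otimes>\<^sub>M ?LL)) \<partial>H)"
    unfolding dual_plane_transform_def orthogonal_haar_eq
    using borel_measurable_integrable[OF HGSLL.integrable_fst'[OF int]] by (intro integral_completion_AE) simp_all
  also have "\<dots> = (\<integral>z. W' (snd z) * h (x + fst z *v L' (snd z)) \<partial>(H \<Otimes>\<^sub>M (?GS \<Otimes>\<^sub>M ?LL)))"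
    using HGSLL.integral_fst'[OF int] by simp
  also have "\<dots> = ?C * (\<integral>y. ?K y * h (x + y) \<partial>lborel)" by (rule avg(2))
  finally show ?thesis by (simp add: riesz_potential_borel)
qed

end

section \<open>The Riesz derivative as a left inverse, and the inversion formulas\<close>

lemma riesz_potential_cong_AE:
  fixes h h' :: "real^'n \<Rightarrow> real"
  assumes [measurable]: "h' \<in> borel_measurable borel" and ae: "AE x in lborel. h x = h' x"
  shows "riesz_potential \<beta> h x = (1 / riesz_gamma CARD('n) \<beta>) * (\<integral>y. h' y * norm (x - y) powr (\<beta> - real CARD('n)) \<partial>lborel)"
proof -
  have "(\<integral>y. h y / norm (x - y) powr (real CARD('n) - \<beta>) \<partial>lebesgue) = (\<integral>y. h' y * norm (x - y) powr (\<beta> - real CARD('n)) \<partial>lborel)"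
  proof (rule integral_completion_AE)
    show "AE y in lborel. h y / norm (x - y) powr (real CARD('n) - \<beta>) = h' y * norm (x - y) powr (\<beta> - real CARD('n))"
      using ae
    proof eventually_elim
      fix y assume "h y = h' y"
      moreover have "norm (x - y) powr (\<beta> - real CARD('n)) = inverse (norm (x - y) powr (real CARD('n) - \<beta>))"
        by (simp flip: powr_minus)
      ultimately show "h y / norm (x - y) powr (real CARD('n) - \<beta>) = h' y * norm (x - y) powr (\<beta> - real CARD('n))"
        by (simp add: divide_inverse)
    qed
  qed measurable
  then show ?thesis by (simp only: riesz_potential_def)
qed

text \<open>Elements of \<open>Lp\<close> are Lebesgue measurable only; a Borel representative can
  be composed with the maps on product spaces.\<close>

lemma Lp_borel_representative:
  fixes h :: "real^'n \<Rightarrow> real"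
  assumes "h \<in> Lp p"
  obtains h' where "h' \<in> borel_measurable borel" "AE x in lborel. h x = h' x" "integrable lborel (\<lambda>x. \<bar>h' x\<bar> powr p)"
proof -
  have h: "h \<in> borel_measurable lebesgue" "integrable lebesgue (\<lambda>x. \<bar>h x\<bar> powr p)"
    using assms by (auto simp: Lp_def)
  obtain h' where h': "h' \<in> borel_measurable borel" "AE x in lborel. h x = h' x"
    using completion_ex_borel_measurable_real[OF h(1)] by auto
  have [measurable]: "h' \<in> borel_measurable borel" by fact
  have "integrable lebesgue (\<lambda>x. \<bar>h' x\<bar> powr p)"
  proof (rule integrable_cong_AE_imp[OF h(2)])
    show "(\<lambda>x. \<bar>h' x\<bar> powr p) \<in> borel_measurable lebesgue" by (rule measurable_completion) measurable
    show "AE x in lebesgue. \<bar>h x\<bar> powr p = \<bar>h' x\<bar> powr p" using AE_completion[OF h'(2)] by eventually_elim simp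
  qed
  then have "integrable lborel (\<lambda>x. \<bar>h' x\<bar> powr p)" by (subst (asm) integrable_completion) measurable
  then show thesis using that h' by blast
qed

text \<open>The function \<open>c * h\<close> is a candidate, but \<open>SOME\<close> may return an
  element of a different \<open>Lp r\<close>. Both are integrable against the same inverse quadratic
  weight, so the injectivity result applies to their difference although the difference need not lie
  in a single space.\<close>

lemma riesz_derivative_AE:
  fixes h :: "real^'n \<Rightarrow> real"
  assumes h [measurable]: "h \<in> borel_measurable borel" and hp: "integrable lborel (\<lambda>x. \<bar>h x\<bar> powr p)"
    and p: "1 \<le> p" "p < real CARD('n) / \<beta>" and \<beta>: "0 < \<beta>"
    and \<phi>: "AE x in lborel. \<phi> x = c * riesz_potential \<beta> h x"
  shows "AE x in lborel. riesz_derivative \<beta> \<phi> x = c * h x"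
proof -
  let ?n = "real CARD('n)"
  let ?P = "\<lambda>g. \<exists>p. 1 \<le> p \<and> p < ?n / \<beta> \<and> g \<in> Lp p \<and> (AE x in lebesgue. \<phi> x = riesz_potential \<beta> g x)"
  have less: "s * \<beta> < ?n" if "s < ?n / \<beta>" for s using that \<beta> by (simp add: pos_less_divide_eq)
  have "\<beta> \<le> p * \<beta>" using p \<beta> by simp
  then have \<beta>n: "\<beta> < ?n" using less[OF p(2)] by linarith
  have g: "riesz_gamma CARD('n) \<beta> \<noteq> 0" using riesz_gamma_pos[OF \<beta> \<beta>n] by simp
  have chp: "integrable lborel (\<lambda>x. \<bar>c * h x\<bar> powr p)"
    using integrable_mult_right[OF hp, of "\<bar>c\<bar> powr p"] by (simp add: abs_mult powr_mult)
  have "(\<lambda>x. c * h x) \<in> Lp p"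
    unfolding Lp_def using chp by (auto intro!: measurable_completion simp: integrable_completion)
  moreover have "AE x in lebesgue. \<phi> x = riesz_potential \<beta> (\<lambda>x. c * h x) x"
    using AE_completion[OF \<phi>]
  proof eventually_elim
    fix x assume "\<phi> x = c * riesz_potential \<beta> h x"
    then show "\<phi> x = riesz_potential \<beta> (\<lambda>x. c * h x) x"
      by (simp add: riesz_potential_cong_AE[of h h] riesz_potential_cong_AE[of "\<lambda>x. c * h x" "\<lambda>x. c * h x"] mult.assoc)
  qed
  ultimately have "?P (\<lambda>x. c * h x)" using p by blast
  then have "?P (riesz_derivative \<beta> \<phi>)" unfolding riesz_derivative_def by (rule someI[where P="?P"])
  then obtain r where r: "1 \<le> r" "r < ?n / \<beta>" "riesz_derivative \<beta> \<phi> \<in> Lp r"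
    and \<phi>': "AE x in lborel. \<phi> x = riesz_potential \<beta> (riesz_derivative \<beta> \<phi>) x"
    by (auto simp: AE_completion_iff)
  obtain D where D [measurable]: "D \<in> borel_measurable borel" and DD: "AE x in lborel. riesz_derivative \<beta> \<phi> x = D x"
    and Dr: "integrable lborel (\<lambda>x. \<bar>D x\<bar> powr r)"
    using Lp_borel_representative[OF r(3)] by blast
  have ch [measurable]: "(\<lambda>x. c * h x) \<in> borel_measurable borel" by measurable
  have \<beta>': "\<beta> < real DIM(real^'n)" using \<beta>n by simp
  have wD: "integrable lborel (\<lambda>y. D y * (1 + (norm y)\<^sup>2) powr (- (real DIM(real^'n) - \<beta>) / 2))"
    by (rule integrable_inverse_quadratic_weight[OF D Dr r(1) \<beta>]) (use less[OF r(2)] in simp)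
  have wh: "integrable lborel (\<lambda>y. (c * h y) * (1 + (norm y)\<^sup>2) powr (- (real DIM(real^'n) - \<beta>) / 2))"
    by (rule integrable_inverse_quadratic_weight[OF ch chp p(1) \<beta>]) (use less[OF p(2)] in simp)
  have "AE x in lborel. D x - c * h x = 0"
  proof (rule riesz_potential_zero_AE[OF _ \<beta> \<beta>'])
    show "integrable lborel (\<lambda>y. (D y - c * h y) * (1 + (norm y)\<^sup>2) powr (- (real DIM(real^'n) - \<beta>) / 2))"
      using Bochner_Integration.integrable_diff[OF wD wh] by (simp only: left_diff_distrib)
    show "AE x in lborel. (\<integral>y. (D y - c * h y) * norm (x - y) powr (\<beta> - real DIM(real^'n)) \<partial>lborel) = 0"
      using AE_integrable_riesz[OF D \<beta> \<beta>' wD] AE_integrable_riesz[OF ch \<beta> \<beta>' wh] \<phi> \<phi>'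
    proof eventually_elim
      fix x
      assume i: "integrable lborel (\<lambda>y. D y * norm (x - y) powr (\<beta> - real DIM(real^'n)))"
        "integrable lborel (\<lambda>y. c * h y * norm (x - y) powr (\<beta> - real DIM(real^'n)))"
        and e: "\<phi> x = c * riesz_potential \<beta> h x" "\<phi> x = riesz_potential \<beta> (riesz_derivative \<beta> \<phi>) x"
      have "(\<integral>y. (D y - c * h y) * norm (x - y) powr (\<beta> - real DIM(real^'n)) \<partial>lborel) =
        (\<integral>y. D y * norm (x - y) powr (\<beta> - real DIM(real^'n)) \<partial>lborel) - (\<integral>y. c * h y * norm (x - y) powr (\<beta> - real DIM(real^'n)) \<partial>lborel)"
        unfolding left_diff_distrib using i by (rule Bochner_Integration.integral_diff)
      also have "\<dots> = 0"
        using e g unfolding riesz_potential_cong_AE[OF D DD] riesz_potential_cong_AE[OF h AE_I2[OF refl]]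
        by (simp add: mult.assoc)
      finally show "(\<integral>y. (D y - c * h y) * norm (x - y) powr (\<beta> - real DIM(real^'n)) \<partial>lborel) = 0" .
    qed
  qed measurable
  with DD show ?thesis by eventually_elim simp
qed

text \<open>Common end of the three formulas, with \<open>\<phi>\<close> the respective transform of
  \<open>f\<close>. Its value is known at those \<open>x\<close> where the potential converges
  absolutely and the rotated planes avoid \<open>E\<close>, and almost every \<open>x\<close> is of
  this kind.\<close>

lemma (in plane_transform_AE) inversion_AE:
  assumes hp: "integrable lborel (\<lambda>x. \<bar>h x\<bar> powr p)" and p: "1 \<le> p" "p < real CARD('n) / \<beta>" and \<beta>: "0 < \<beta>"
    and c: "c = radon_constant CARD('n) (j + k)"
    and \<phi>: "\<And>x. AE Q in H. AE \<xi> in G. AE u in subspace_measure \<eta>. (+) (x + Q *v u) ` (*v) Q ` \<xi> \<notin> E \<Longrightarrow>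
      (\<integral>\<^sup>+y. ennreal (riesz_kernel CARD('n) \<beta> y) * ennreal \<bar>h (x + y)\<bar> \<partial>lborel) < \<infinity> \<Longrightarrow>
      \<phi> x = c * riesz_potential \<beta> h x"
    and f: "AE \<tau> in affine_grassmannian_measure j. f \<tau> = plane_transform h \<tau>"
  shows "AE \<tau> in affine_grassmannian_measure j. f \<tau> = inverse c * plane_transform (riesz_derivative \<beta> \<phi>) \<tau>"
proof -
  have c0: "c \<noteq> 0" using radon_constant_pos[OF jk] c by simp
  have "\<beta> \<le> p * \<beta>" "p * \<beta> < real CARD('n)" using p \<beta> by (simp_all add: pos_less_divide_eq)
  then have \<beta>n: "\<beta> < real CARD('n)" and \<beta>': "\<beta> < real DIM(real^'n)" by simp_all
  have w: "integrable lborel (\<lambda>y. h y * (1 + (norm y)\<^sup>2) powr (- (real DIM(real^'n) - \<beta>) / 2))"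
    by (rule integrable_inverse_quadratic_weight[OF h hp p(1) \<beta>]) (use \<open>p * \<beta> < real CARD('n)\<close> in simp)
  have "AE x in lborel. \<phi> x = c * riesz_potential \<beta> h x"
    using AE_integrable_riesz[OF h \<beta> \<beta>' w] AE_rotated_point
  proof eventually_elim
    fix x assume i: "integrable lborel (\<lambda>y. h y * norm (x - y) powr (\<beta> - real DIM(real^'n)))"
      and ae: "AE Q in H. AE \<xi> in G. AE u in subspace_measure \<eta>. (+) (x + Q *v u) ` (*v) Q ` \<xi> \<notin> E"
    show "\<phi> x = c * riesz_potential \<beta> h x"
      using ae by (rule \<phi>) (rule riesz_kernel_finite[OF \<beta> \<beta>n h], use i in simp)
  qed
  then have D: "AE x in lborel. riesz_derivative \<beta> \<phi> x = c * h x"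
    by (rule riesz_derivative_AE[OF h hp p \<beta>])
  have "AE \<tau> in affine_grassmannian_measure j. plane_transform (riesz_derivative \<beta> \<phi>) \<tau> = plane_transform (\<lambda>x. c * h x) \<tau>"
    by (rule AE_plane_transform_cong[OF _ _ D]) (use jk in \<open>simp, measurable\<close>)
  with f show ?thesis
  proof eventually_elim
    fix \<tau> assume "f \<tau> = plane_transform h \<tau>" "plane_transform (riesz_derivative \<beta> \<phi>) \<tau> = plane_transform (\<lambda>x. c * h x) \<tau>"
    then show "f \<tau> = inverse c * plane_transform (riesz_derivative \<beta> \<phi>) \<tau>"
      using c0 by (simp add: plane_transform_def)
  qed
qed

theorem theorem7p5:
  fixes h :: "real^'n \<Rightarrow> real" and f :: "(real^'n) set \<Rightarrow> real"
    and \<eta>\<^sub>0 :: "(real^'n) set" and j k :: nat and p c :: real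
  assumes "j > 0" and "k > 0" and "j + k < CARD('n)"
    and "\<eta>\<^sub>0 \<in> grassmannian UNIV k"
    and "1 \<le> p" and "h \<in> Lp p"
    and "AE \<tau> in affine_grassmannian_measure j. f \<tau> = plane_transform h \<tau>"
    and "c = 2 ^ (j + k) * pi powr (real (j + k) / 2) * Gamma (real CARD('n) / 2)
             / Gamma ((real CARD('n) - real j - real k) / 2)"
  shows "(p < real CARD('n) / real (j + k) \<longrightarrow>
           (AE \<tau> in affine_grassmannian_measure j.
              f \<tau> = inverse c * plane_transform
                (riesz_derivative (real (j + k))
                  (dual_plane_transform \<eta>\<^sub>0 (mixed_radon j f))) \<tau>))
       \<and> (\<forall>\<alpha>. 0 < \<alpha> \<and> \<alpha> < real CARD('n) - real j - real k
              \<and> p < real CARD('n) / (real j + real k + \<alpha>) \<longrightarrow>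
           (AE \<tau> in affine_grassmannian_measure j.
              f \<tau> = inverse c * plane_transform
                (riesz_derivative (real j + real k + \<alpha>)
                  (dual_plane_transform \<eta>\<^sub>0
                    (fibre_riesz_potential k \<alpha> (mixed_radon j f)))) \<tau>)
         \<and> (AE \<tau> in affine_grassmannian_measure j.
              f \<tau> = inverse c * plane_transform
                (riesz_derivative (real j + real k + \<alpha>)
                  (dual_plane_transform \<eta>\<^sub>0
                    (mixed_radon j (fibre_riesz_potential j \<alpha> f)))) \<tau>))"
proof -
  obtain h' where h': "h' \<in> borel_measurable borel" and hh': "AE x in lborel. h x = h' x"
    and hp: "integrable lborel (\<lambda>x. \<bar>h' x\<bar> powr p)"
    using Lp_borel_representative[OF \<open>h \<in> Lp p\<close>] by blast
  have j: "j \<le> CARD('n)" using \<open>j + k < CARD('n)\<close> by simp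
  have f: "AE \<tau> in affine_grassmannian_measure j. f \<tau> = plane_transform h' \<tau>"
    using assms(7) AE_plane_transform_cong[OF j h' hh'] by eventually_elim simp
  obtain E where E: "E \<in> sets (affine_grassmannian_borel j)"
    "\<And>\<tau>. \<tau> \<in> affine_grassmannian j \<Longrightarrow> \<tau> \<notin> E \<Longrightarrow> f \<tau> = plane_transform h' \<tau>"
    "\<And>\<xi>. \<xi> \<in> grassmannian UNIV j \<Longrightarrow> AE Q in haar. AE z in lborel. (+) z ` (*v) Q ` \<xi> \<notin> E"
    using AE_affine_grassmannianE[OF j f] by blast
  interpret plane_transform_AE \<eta>\<^sub>0 j k E h' f
    using assms(1-4) h' E by unfold_locales
  have c: "c = radon_constant CARD('n) (j + k)"
    by (simp add: assms(8) radon_constant_def diff_diff_eq)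
  have \<beta>: "0 < real (j + k)" using jk0 by simp
  have eq: "real j + real k + \<alpha> = real (j + k) + \<alpha>" for \<alpha> by simp
  note inv = inversion_AE[OF hp \<open>1 \<le> p\<close> _ _ c _ f]
  show ?thesis
  proof (intro conjI impI allI)
    assume p: "p < real CARD('n) / real (j + k)"
    show "AE \<tau> in affine_grassmannian_measure j. f \<tau> = inverse c * plane_transform
        (riesz_derivative (real (j + k)) (dual_plane_transform \<eta>\<^sub>0 (mixed_radon j f))) \<tau>"
      by (rule inv[OF p \<beta>]) (unfold c, rule dual_mixed_radon)
  next
    fix \<alpha> :: real
    assume \<alpha>: "0 < \<alpha> \<and> \<alpha> < real CARD('n) - real j - real k \<and> p < real CARD('n) / (real j + real k + \<alpha>)"
    then have p: "p < real CARD('n) / (real (j + k) + \<alpha>)" and \<alpha>1: "0 < \<alpha>" and \<alpha>2: "\<alpha> < real CARD('n) - real j - real k"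
      by simp_all
    have \<beta>\<alpha>: "0 < real (j + k) + \<alpha>" using \<beta> \<alpha>1 by linarith
    show "AE \<tau> in affine_grassmannian_measure j. f \<tau> = inverse c * plane_transform
        (riesz_derivative (real j + real k + \<alpha>) (dual_plane_transform \<eta>\<^sub>0 (fibre_riesz_potential k \<alpha> (mixed_radon j f)))) \<tau>"
      unfolding eq by (rule inv[OF p \<beta>\<alpha>]) (unfold c, rule dual_fibre_mixed_radon[OF \<alpha>1 \<alpha>2])
    show "AE \<tau> in affine_grassmannian_measure j. f \<tau> = inverse c * plane_transform
        (riesz_derivative (real j + real k + \<alpha>) (dual_plane_transform \<eta>\<^sub>0 (mixed_radon j (fibre_riesz_potential j \<alpha> f)))) \<tau>"
      unfolding eq by (rule inv[OF p \<beta>\<alpha>]) (unfold c, rule dual_mixed_radon_fibre[OF \<alpha>1 \<alpha>2])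
  qed
qed

end
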